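(* Let $\sigma$ be a functional signature, $\mathcal C\subseteq\mathrm{Fun}(\sigma)$ a class with bounded expansion and $\varepsilon>0$. One can compute for every quantifier-free formula $\phi(y\bar x)$ with signature $\sigma$ a set $\Omega$ of conjunctive clauses with free variables $\bar x$ and signature $\rho\supseteq\sigma$ such that: there exists a class $\mathcal C'\subseteq\mathrm{Fun}(\rho)$ with bounded expansion such that for every $\vec G\in\mathcal C$ one can compute in time $O(\|\vec G\|)$ an expansion $\vec G'\in\mathcal C'$ of $\vec G$ and functions $c_{\omega,i}\colon V(\vec G)\to\mathbb N$ for $\omega\in\Omega$ and $i\in\{1,\dots,|\bar x|\}$ such that for every $\bar u\in V(\vec G)^{|\bar x|}$ there exists exactly one $\omega\in\Omega$ with $\vec G'\models\omega(\bar u)$, and for this $\omega$ $$[[\#y\,\phi(y\bar u)]]^{\vec G}\le\sum_{i=1}^{|\bar x|}c_{\omega,i}(u_i)\le(1+\varepsilon)[[\#y\,\phi(y\bar u)]]^{\vec G}.$$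
   Context: A functional signature $\sigma$ is a finite signature of unary function symbols and unary predicate symbols; $\mathrm{fsig}(\sigma)$ denotes its function symbols, including a special symbol $f_{\mathrm{id}}$ interpreted as identity. A functional representation with signature $\sigma$ is a finite $\sigma$-structure $\vec G$ with universe $V(\vec G)$; its underlying directed graph has an arc $uv$ iff $f^{\vec G}(v)=u$ for some $f\in\mathrm{fsig}(\sigma)$. $\mathrm{Fun}(\sigma)$ is the class of all such structures; a class $\mathcal C\subseteq\mathrm{Fun}(\sigma)$ has bounded expansion if the underlying undirected graphs form a class of bounded expansion (Nešetřil–Ossona de Mendez). $\|\vec G\|=|V(\vec G)|\cdot|\sigma|$. An expansion of $\vec G$ is a structure over a larger (functional) signature with the same universe and the same interpretation of the symbols of $\sigma$. Formulas may contain nested function terms. $\bar x=x_1\dots x_k$ is a nonempty tuple of variables, $\bar u=u_1\dots u_k$; $[[\#y\,\phi(y\bar u)]]^{\vec G}$ is the number of $v\in V(\vec G)$ with $\vec G\models\phi(v\bar u)$.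
   Formalization: Ω and ρ are computed from φ with access to an arbitrary function g bounding the expansion of the class at every depth (plain computability when g is computable); for some classes with no computable bound, Ω cannot be computed uniformly in φ. *)

theory Defs
  imports Complex_Main
begin

section \<open>Functional signatures and functional representations\<close>

text \<open>Function and predicate symbols are natural numbers, drawn from two separate name spaces.\<close>

record signature =
  fsig :: "nat set"
  psig :: "nat set"

abbreviation (input) f_id :: nat where "f_id \<equiv> 0"

definition functional_signature :: "signature \<Rightarrow> bool" where
  "functional_signature \<sigma> \<longleftrightarrow> finite (fsig \<sigma>) \<and> finite (psig \<sigma>) \<and> f_id \<in> fsig \<sigma>"

definition sig_size :: "signature \<Rightarrow> nat" where
  "sig_size \<sigma> = card (fsig \<sigma>) + card (psig \<sigma>)"

definition sig_le :: "signature \<Rightarrow> signature \<Rightarrow> bool" where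
  "sig_le \<sigma> \<rho> \<longleftrightarrow> fsig \<sigma> \<subseteq> fsig \<rho> \<and> psig \<sigma> \<subseteq> psig \<rho>"

text \<open>The interpretations are total HOL functions; their values at symbols outside the signature
  or at points outside the universe carry no meaning.\<close>

record 'v fstruct =
  univ :: "'v set"
  fint :: "nat \<Rightarrow> 'v \<Rightarrow> 'v"
  pint :: "nat \<Rightarrow> 'v \<Rightarrow> bool"

definition Fun :: "signature \<Rightarrow> 'v fstruct set" where
  "Fun \<sigma> = {G. finite (univ G) \<and>
     (\<forall>f\<in>fsig \<sigma>. \<forall>v\<in>univ G. fint G f v \<in> univ G) \<and>
     (\<forall>v\<in>univ G. fint G f_id v = v)}"

definition struct_size :: "signature \<Rightarrow> 'v fstruct \<Rightarrow> nat" where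
  "struct_size \<sigma> G = card (univ G) * sig_size \<sigma>"

definition is_expansion :: "signature \<Rightarrow> 'v fstruct \<Rightarrow> 'v fstruct \<Rightarrow> bool" where
  "is_expansion \<sigma> G G' \<longleftrightarrow> univ G' = univ G \<and>
     (\<forall>f\<in>fsig \<sigma>. \<forall>v\<in>univ G. fint G' f v = fint G f v) \<and>
     (\<forall>p\<in>psig \<sigma>. \<forall>v\<in>univ G. pint G' p v = pint G p v)"


section \<open>Bounded expansion\<close>

text \<open>A simple graph is a pair of a vertex set and a set of two-element edges.\<close>

type_synonym 'v graph = "'v set \<times> 'v set set"

definition arcs :: "signature \<Rightarrow> 'v fstruct \<Rightarrow> ('v \<times> 'v) set" where
  "arcs \<sigma> G = {(u, v). u \<in> univ G \<and> v \<in> univ G \<and> (\<exists>f\<in>fsig \<sigma>. fint G f v = u)}"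

text \<open>The loops, which the identity symbol produces at every vertex, are dropped here.\<close>

definition underlying :: "signature \<Rightarrow> 'v fstruct \<Rightarrow> 'v graph" where
  "underlying \<sigma> G = (univ G, {{u, v} | u v. (u, v) \<in> arcs \<sigma> G \<and> u \<noteq> v})"

text \<open>A branch set is connected and of radius at most \<open>r\<close> in the subgraph that it induces.\<close>

definition branch_set :: "nat \<Rightarrow> 'v graph \<Rightarrow> 'v set \<Rightarrow> bool" where
  "branch_set r G B \<longleftrightarrow> B \<subseteq> fst G \<and>
     (\<exists>c\<in>B. \<forall>v\<in>B. \<exists>d\<le>r. (c, v) \<in> {(a, b). a \<in> B \<and> b \<in> B \<and> {a, b} \<in> snd G} ^^ d)"

text \<open>The vertices of a depth-\<open>r\<close> shallow minor are the branch sets themselves; each edge joins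
  two branch sets between which \<open>G\<close> has an edge.\<close>

definition shallow_minor :: "nat \<Rightarrow> 'v graph \<Rightarrow> 'v set graph \<Rightarrow> bool" where
  "shallow_minor r G H \<longleftrightarrow>
     (\<forall>B\<in>fst H. branch_set r G B) \<and>
     (\<forall>A\<in>fst H. \<forall>B\<in>fst H. A \<noteq> B \<longrightarrow> A \<inter> B = {}) \<and>
     snd H \<subseteq> {{A, B} | A B. A \<in> fst H \<and> B \<in> fst H \<and> A \<noteq> B \<and> (\<exists>a\<in>A. \<exists>b\<in>B. {a, b} \<in> snd G)}"

text \<open>The greatest reduced average density of rank \<open>r\<close>. The empty minor contributes \<open>0 / 0 = 0\<close>.\<close>

definition grad :: "nat \<Rightarrow> 'v graph \<Rightarrow> real" where
  "grad r G = Max {real (card (snd H)) / real (card (fst H)) | H. shallow_minor r G H}"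

text \<open>A class may have bounded expansion without a computable bound, so computability statements
  that are uniform over formulas are taken relative to an arbitrary bounding function \<open>g\<close>.\<close>

definition expansion_bound :: "signature \<Rightarrow> 'v fstruct set \<Rightarrow> (nat \<Rightarrow> nat) \<Rightarrow> bool" where
  "expansion_bound \<sigma> C g \<longleftrightarrow> (\<forall>r. \<forall>G\<in>C. grad r (underlying \<sigma> G) \<le> real (g r))"

definition bounded_expansion :: "signature \<Rightarrow> 'v fstruct set \<Rightarrow> bool" where
  "bounded_expansion \<sigma> C \<longleftrightarrow> (\<exists>g. expansion_bound \<sigma> C g)"


section \<open>Quantifier-free formulas\<close>

datatype tm = Var nat | App nat tm

datatype fm = Eq tm tm | Pred nat tm | Neg fm | Conj fm fm | Disj fm fm

fun tm_over :: "signature \<Rightarrow> nat set \<Rightarrow> tm \<Rightarrow> bool" where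
  "tm_over \<sigma> X (Var i) \<longleftrightarrow> i \<in> X"
| "tm_over \<sigma> X (App f t) \<longleftrightarrow> f \<in> fsig \<sigma> \<and> tm_over \<sigma> X t"

text \<open>The formula has signature \<open>\<sigma>\<close> and its free variables are among \<open>X\<close>.\<close>

fun fm_over :: "signature \<Rightarrow> nat set \<Rightarrow> fm \<Rightarrow> bool" where
  "fm_over \<sigma> X (Eq s t) \<longleftrightarrow> tm_over \<sigma> X s \<and> tm_over \<sigma> X t"
| "fm_over \<sigma> X (Pred p t) \<longleftrightarrow> p \<in> psig \<sigma> \<and> tm_over \<sigma> X t"
| "fm_over \<sigma> X (Neg \<phi>) \<longleftrightarrow> fm_over \<sigma> X \<phi>"
| "fm_over \<sigma> X (Conj \<phi> \<psi>) \<longleftrightarrow> fm_over \<sigma> X \<phi> \<and> fm_over \<sigma> X \<psi>"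
| "fm_over \<sigma> X (Disj \<phi> \<psi>) \<longleftrightarrow> fm_over \<sigma> X \<phi> \<and> fm_over \<sigma> X \<psi>"

fun tm_val :: "'v fstruct \<Rightarrow> (nat \<Rightarrow> 'v) \<Rightarrow> tm \<Rightarrow> 'v" where
  "tm_val G a (Var i) = a i"
| "tm_val G a (App f t) = fint G f (tm_val G a t)"

fun sat :: "'v fstruct \<Rightarrow> (nat \<Rightarrow> 'v) \<Rightarrow> fm \<Rightarrow> bool" where
  "sat G a (Eq s t) \<longleftrightarrow> tm_val G a s = tm_val G a t"
| "sat G a (Pred p t) \<longleftrightarrow> pint G p (tm_val G a t)"
| "sat G a (Neg \<phi>) \<longleftrightarrow> \<not> sat G a \<phi>"
| "sat G a (Conj \<phi> \<psi>) \<longleftrightarrow> sat G a \<phi> \<and> sat G a \<psi>"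
| "sat G a (Disj \<phi> \<psi>) \<longleftrightarrow> sat G a \<phi> \<or> sat G a \<psi>"

fun atomic :: "fm \<Rightarrow> bool" where
  "atomic (Eq s t) \<longleftrightarrow> True"
| "atomic (Pred p t) \<longleftrightarrow> True"
| "atomic _ \<longleftrightarrow> False"

fun conj_clause :: "fm \<Rightarrow> bool" where
  "conj_clause (Conj \<phi> \<psi>) \<longleftrightarrow> conj_clause \<phi> \<and> conj_clause \<psi>"
| "conj_clause (Neg \<phi>) \<longleftrightarrow> atomic \<phi>"
| "conj_clause \<phi> \<longleftrightarrow> atomic \<phi>"

text \<open>In \<open>\<phi>(y x\<^sub>1 \<dots> x\<^sub>k)\<close> the counted variable \<open>y\<close> is variable \<open>0\<close> and \<open>x\<^sub>i\<close> is variable \<open>i\<close>.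
  A tuple \<open>u\<^sub>1 \<dots> u\<^sub>k\<close> is given by the values of \<open>u\<close> on \<open>{1..k}\<close>.\<close>

definition count_sat :: "'v fstruct \<Rightarrow> fm \<Rightarrow> (nat \<Rightarrow> 'v) \<Rightarrow> nat" where
  "count_sat G \<phi> u = card {v \<in> univ G. sat G (u(0 := v)) \<phi>}"


section \<open>Random access machines\<close>

text \<open>A machine has registers and a random access memory, both holding natural numbers, and a
  fixed oracle \<open>nat \<Rightarrow> nat\<close>. It halts when the program counter leaves the program. Each
  instruction costs one time unit; bounding the numbers that occur polynomially in the input
  size (see \<open>computes_within\<close>) gives the word RAM with words of logarithmic length.\<close>

datatype instr =
    Const nat nat
  | Add nat nat nat
  | Sub nat nat nat
  | Mult nat nat nat
  | Div nat nat nat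
  | Load nat nat
  | Store nat nat
  | Jump_Zero nat nat
  | Oracle nat nat

type_synonym config = "nat \<times> (nat \<Rightarrow> nat) \<times> (nat \<Rightarrow> nat)"

fun exec :: "(nat \<Rightarrow> nat) \<Rightarrow> instr \<Rightarrow> config \<Rightarrow> config" where
  "exec g (Const i n) (pc, r, m) = (Suc pc, r(i := n), m)"
| "exec g (Add i j l) (pc, r, m) = (Suc pc, r(i := r j + r l), m)"
| "exec g (Sub i j l) (pc, r, m) = (Suc pc, r(i := r j - r l), m)"
| "exec g (Mult i j l) (pc, r, m) = (Suc pc, r(i := r j * r l), m)"
| "exec g (Div i j l) (pc, r, m) = (Suc pc, r(i := r j div r l), m)"
| "exec g (Load i j) (pc, r, m) = (Suc pc, r(i := m (r j)), m)"
| "exec g (Store i j) (pc, r, m) = (Suc pc, r, m(r i := r j))"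
| "exec g (Jump_Zero i n) (pc, r, m) = (if r i = 0 then n else Suc pc, r, m)"
| "exec g (Oracle i j) (pc, r, m) = (Suc pc, r(i := g (r j)), m)"

definition step :: "(nat \<Rightarrow> nat) \<Rightarrow> instr list \<Rightarrow> config \<Rightarrow> config" where
  "step g P c = (if fst c < length P then exec g (P ! fst c) c else c)"

definition halted :: "instr list \<Rightarrow> config \<Rightarrow> bool" where
  "halted P c \<longleftrightarrow> length P \<le> fst c"

text \<open>Input and output are words of numbers, stored from memory address 0 on, with their length
  in register 0.\<close>

definition init_config :: "nat list \<Rightarrow> config" where
  "init_config xs = (0, (\<lambda>_. 0)(0 := length xs), \<lambda>i. if i < length xs then xs ! i else 0)"

fun result :: "config \<Rightarrow> nat list" where
  "result (pc, r, m) = map m [0..<r 0]"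

fun word_bounded :: "nat \<Rightarrow> config \<Rightarrow> bool" where
  "word_bounded W (pc, r, m) \<longleftrightarrow> (\<forall>i. r i \<le> W \<and> m i \<le> W)"

definition computes :: "(nat \<Rightarrow> nat) \<Rightarrow> instr list \<Rightarrow> nat list \<Rightarrow> nat list \<Rightarrow> bool" where
  "computes g P xs ys \<longleftrightarrow>
     (\<exists>t. halted P ((step g P ^^ t) (init_config xs)) \<and>
          result ((step g P ^^ t) (init_config xs)) = ys)"

text \<open>Here the machine runs without oracle (the constant function \<open>0\<close>) and halts after at most
  \<open>T\<close> steps, and all numbers that occur are at most \<open>W\<close>.\<close>

definition computes_within :: "nat \<Rightarrow> nat \<Rightarrow> instr list \<Rightarrow> nat list \<Rightarrow> nat list \<Rightarrow> bool" where
  "computes_within T W P xs ys \<longleftrightarrow>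
     (\<exists>t\<le>T. halted P ((step (\<lambda>_. 0) P ^^ t) (init_config xs)) \<and>
            result ((step (\<lambda>_. 0) P ^^ t) (init_config xs)) = ys \<and>
            (\<forall>s\<le>t. word_bounded W ((step (\<lambda>_. 0) P ^^ s) (init_config xs))))"


section \<open>Encodings\<close>

fun enc_tm :: "tm \<Rightarrow> nat list" where
  "enc_tm (Var i) = [0, i]"
| "enc_tm (App f t) = 1 # f # enc_tm t"

fun enc_fm :: "fm \<Rightarrow> nat list" where
  "enc_fm (Eq s t) = 0 # enc_tm s @ enc_tm t"
| "enc_fm (Pred p t) = 1 # p # enc_tm t"
| "enc_fm (Neg \<phi>) = 2 # enc_fm \<phi>"
| "enc_fm (Conj \<phi> \<psi>) = 3 # enc_fm \<phi> @ enc_fm \<psi>"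
| "enc_fm (Disj \<phi> \<psi>) = 4 # enc_fm \<phi> @ enc_fm \<psi>"

definition enc_fms :: "fm list \<Rightarrow> nat list" where
  "enc_fms \<phi>s = length \<phi>s # concat (map enc_fm \<phi>s)"

definition enc_sig :: "signature \<Rightarrow> nat list" where
  "enc_sig \<sigma> = card (fsig \<sigma>) # card (psig \<sigma>) #
     sorted_list_of_set (fsig \<sigma>) @ sorted_list_of_set (psig \<sigma>)"

text \<open>A structure is presented to a machine through a listing \<open>vs\<close> of its universe, by the value
  tables of all its symbols. The length of the encoding is \<open>struct_size \<sigma> G + 1\<close>.\<close>

definition index_of :: "'v list \<Rightarrow> 'v \<Rightarrow> nat" where
  "index_of vs v = (LEAST i. i < length vs \<and> vs ! i = v)"

definition enc_struct :: "signature \<Rightarrow> 'v list \<Rightarrow> 'v fstruct \<Rightarrow> nat list" where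
  "enc_struct \<sigma> vs G = length vs #
     concat (map (\<lambda>f. map (\<lambda>v. index_of vs (fint G f v)) vs) (sorted_list_of_set (fsig \<sigma>))) @
     concat (map (\<lambda>p. map (\<lambda>v. of_bool (pint G p v)) vs) (sorted_list_of_set (psig \<sigma>)))"

text \<open>The value tables of the functions \<open>c \<omega> i\<close> for \<open>\<omega>\<close> in the list \<open>\<omega>s\<close> and \<open>i\<close> in \<open>{1..k}\<close>.\<close>

definition enc_weights :: "fm list \<Rightarrow> nat \<Rightarrow> 'v list \<Rightarrow> (fm \<Rightarrow> nat \<Rightarrow> 'v \<Rightarrow> nat) \<Rightarrow> nat list" where
  "enc_weights \<omega>s k vs c = concat (map (\<lambda>\<omega>. concat (map (\<lambda>i. map (c \<omega> i) vs) [1..<Suc k])) \<omega>s)"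

end

theory Submission
  imports Defs "HOL-Library.FuncSet"
begin

text \<open>
  Let \<open>T\<close> be the set of all words of a fixed length over the function symbols and one additional
  constant function, long enough to express all terms of \<open>\<phi>\<close>. The graph in which any two values
  \<open>t(y)\<close>, \<open>t'(y)\<close> with \<open>t, t' \<in> T\<close> are adjacent is a shallow minor of a lexicographic product of the
  underlying graph (plus an apex), so these graphs have bounded expansion and are degenerate. Each
  vertex \<open>w\<close> is given function symbols for its boundedly many later neighbours in a degeneracy order.

  For a tuple \<open>u\<close> let \<open>W\<close> be the set of all \<open>t(u\<^sub>i)\<close>. Every \<open>y\<close> is counted at the first element \<open>w\<close> of \<open>W\<close>
  among its values; then all its other values in \<open>W\<close> are later neighbours of \<open>w\<close>, and \<open>\<phi>(y u)\<close> is decided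
  by \<open>y\<close>, \<open>w\<close> and the equality type of the later neighbours of \<open>w\<close> with \<open>W\<close>. So one has to count the \<open>y\<close> at \<open>w\<close>
  that satisfy a condition depending on \<open>w\<close> only, but that have no value in a bounded set \<open>U\<close>. Up to a
  factor \<open>1 + \<epsilon>\<close> only those elements of \<open>U\<close> matter that are values of a constant fraction of the
  remaining \<open>y\<close>. There are boundedly many such heavy values, and they get function symbols of
  their own. Walking along heavy values in \<open>U\<close>, and counting the \<open>y\<close> that avoid all the values passed,
  one stops after at most \<open>|U|\<close> steps at a count that only depends on \<open>w\<close> and the path. Which path this is
  can be read off the quantifier-free type of \<open>u\<close> in the expansion, and every complete
  type is one conjunctive clause.
\<close>

subsection \<open>Shallow minors and trace graphs\<close>

text \<open>The error must be relative, so the excluded set \<open>U\<close> cannot be dealt with by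
  subtracting approximate counts. The walk along frequent values uses exact counts only and stops
  once what it neglects is a small fraction. Since \<open>card U <= k * q\<close> and each
  infrequent value concerns at most the fraction \<open>1 / K\<close>, the choice
  \<open>K = k * q * E\<close> makes the neglected part at most \<open>1 / E\<close>, and
  \<open>E >= (1 + eps) / eps\<close> turns this into the factor \<open>1 + eps\<close>. As a vertex
  has at most \<open>q\<close> values, a family has at most \<open>J = q * K\<close> frequent ones.
  One machine has to produce the clauses for all formulas, while the degeneracy depends on the bound
  \<open>g\<close> at a depth that grows with the formula; this is what the oracle is for. The
  machine never parses the formula: \<open>D\<close>, and with it signature and clauses, depends
  only on the length of its encoding and on \<open>k\<close>. The number of new symbols is
  over-estimated by an arithmetic expression; surplus functions denote the identity and surplus
  predicates are false. The counting program has to keep its numbers small, so its additions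
  saturate.\<close>

lemma relpow_subset:
 fixes R S :: "('a \<times> 'a) set"
 shows "R <= S ==> R ^^ d <= S ^^ d" by (induction d) (simp_all add: relcomp_mono)

text \<open>\<open>grad\<close> is defined by \<open>Max\<close>, which says nothing about infinite
  sets; all estimates of it rest on this finiteness.\<close>

lemma finite_shallow_minors:
 assumes "finite (fst G)"
 shows "finite {H. shallow_minor r G H}"
proof -
 have "{H. shallow_minor r G H} <= Pow (Pow (fst G)) \<times> Pow (Pow (Pow (fst G)))"
 proof
  fix H assume "H : {H. shallow_minor r G H}"
  then have m: "shallow_minor r G H" by simp
  have 1: "fst H <= Pow (fst G)" using m by (auto simp: shallow_minor_def branch_set_def)
  have "snd H <= Pow (Pow (fst G))"
  proof
   fix e assume "e : snd H"
   then obtain A B where "e = {A, B}" "A : fst H" "B : fst H" using m unfolding shallow_minor_def by blast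
   then show "e : Pow (Pow (fst G))" using 1 by blast
  qed
  then show "H : Pow (Pow (fst G)) \<times> Pow (Pow (Pow (fst G)))" using 1 by (metis Pow_iff mem_Times_iff)
 qed
 then show ?thesis by (rule finite_subset) (use assms in simp)
qed

lemma minor_finite:
 assumes "finite (fst G)" "shallow_minor r G H"
 shows "finite (fst H)" "finite (snd H)"
proof -
 show f: "finite (fst H)" by (rule finite_subset[of _ "Pow (fst G)"])
    (use assms in "auto simp: shallow_minor_def branch_set_def")
 have "snd H <= Pow (fst H)" using assms(2) by (auto simp: shallow_minor_def)
 then show "finite (snd H)" using f by (meson finite_Pow_iff finite_subset)
qed

text \<open>Clears the denominator in \<open>grad\<close>. A minor without vertices has no edges
  either, so the convention \<open>0 / 0 = 0\<close> does no harm. From here on densities are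
  compared as natural numbers.\<close>

lemma shallow_minor_card_edges:
 assumes "finite (fst G)" "grad r G <= real b" "shallow_minor r G H"
 shows "card (snd H) <= b * card (fst H)"
proof (cases "card (fst H) = 0")
 case True
 then have "fst H = {}" using minor_finite[OF assms(1,3)] by simp
 then have "snd H = {}" using assms(3) by (auto simp: shallow_minor_def)
 then show ?thesis by simp
next
 case False
 let ?D = "{real (card (snd H)) / real (card (fst H)) | H. shallow_minor r G H}"
 have "?D = (%H. real (card (snd H)) / real (card (fst H))) ` {H. shallow_minor r G H}" by blast
 then have "finite ?D" using finite_shallow_minors[OF assms(1)] by simp
 then have "real (card (snd H)) / real (card (fst H)) <= grad r G" unfolding grad_def by (rule Max_ge) (use assms(3) in blast)
 then have "real (card (snd H)) / real (card (fst H)) <= real b" using assms(2) by simp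
 then have "real (card (snd H)) <= real b * real (card (fst H))" using False by (simp add: field_simps)
 then show ?thesis by (metis of_nat_le_iff of_nat_mult)
qed

lemma grad_leI:
 assumes "finite (fst G)" "!!H. shallow_minor r G H ==> card (snd H) <= b * card (fst H)"
 shows "grad r G <= real b"
proof -
 let ?D = "{real (card (snd H)) / real (card (fst H)) | H. shallow_minor r G H}"
 have "?D = (%H. real (card (snd H)) / real (card (fst H))) ` {H. shallow_minor r G H}" by blast
 then have fin: "finite ?D" using finite_shallow_minors[OF assms(1)] by simp
 have "shallow_minor r G ({}, {})" by (simp add: shallow_minor_def)
 then have ne: "?D ~= {}" by blast
 have "x <= real b" if x: "x : ?D" for x
 proof -
  obtain H where H: "shallow_minor r G H" "x = real (card (snd H)) / real (card (fst H))" using x by blast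
  have "real (card (snd H)) <= real b * real (card (fst H))" using assms(2)[OF H(1)] by (metis of_nat_le_iff of_nat_mult)
  then show ?thesis using H(2) by (cases "card (fst H) = 0") (simp_all add: divide_le_eq)
 qed
 then show ?thesis unfolding grad_def using Max_le_iff[OF fin ne] by blast
qed

lemma branch_set_mono:
 assumes "branch_set r G B" "B <= fst G'"
  "!!x y. x : B ==> y : B ==> {x, y} : snd G ==> {x, y} : snd G'"
 shows "branch_set r G' B"
proof -
 obtain c where c: "c : B"
  "ALL v:B. EX d<=r. (c, v) : {(a, b). a : B & b : B & {a, b} : snd G} ^^ d" using assms(1) unfolding branch_set_def by blast
 have sub: "{(a, b). a : B & b : B & {a, b} : snd G} ^^ d
   <= {(a, b). a : B & b : B & {a, b} : snd G'} ^^ d" for d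
  by (rule relpow_subset) (use assms(3) in auto)
 have "ALL v:B. EX d<=r. (c, v) : {(a, b). a : B & b : B & {a, b} : snd G'} ^^ d"
 proof
  fix v assume "v : B"
  then obtain d where "d <= r" "(c, v) : {(a, b). a : B & b : B & {a, b} : snd G} ^^ d" using c(2) by blast
  then show "EX d<=r. (c, v) : {(a, b). a : B & b : B & {a, b} : snd G'} ^^ d" using sub[of d] by (intro exI[of _ d]) auto
 qed
 then show ?thesis using c(1) assms(2) unfolding branch_set_def by blast
qed

lemma shallow_minorI:
 assumes "!!B. B : fst H ==> branch_set r G B"
  and "!!A B. A : fst H ==> B : fst H ==> A ~= B ==> A Int B = {}"
  and "!!e. e : snd H ==> EX A B a b. e = {A, B} & A : fst H & B : fst H & A ~= B &
   a : A & b : B & {a, b} : snd G"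
 shows "shallow_minor r G H" unfolding shallow_minor_def
proof (intro conjI ballI impI subsetI)
 fix e assume "e : snd H"
 from assms(3)[OF this] obtain A B a b where e: "e = {A, B}" "A : fst H" "B : fst H" "A ~= B"
  "a : A" "b : B" "{a, b} : snd G" by (elim exE conjE) (rule that)
 then show "e : {{A, B} |A B. A : fst H & B : fst H & A ~= B & (EX a:A. EX b:B. {a, b} : snd G)}"
  by - (rule CollectI, rule exI[of _ A], rule exI[of _ B], blast)
qed (use assms in blast)+

lemma minor_edgeE:
 assumes "shallow_minor r G H" "e : snd H"
 obtains A B a b where "e = {A, B}" "A : fst H" "B : fst H" "A ~= B"
  "a : A" "b : B" "{a, b} : snd G"
proof -
 have "e : {{A, B} |A B. A : fst H & B : fst H & A ~= B & (EX a:A. EX b:B. {a, b} : snd G)}" using assms unfolding shallow_minor_def by blast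
 then show ?thesis by (elim CollectE exE conjE bexE) (rule that)
qed

lemma minor_branch_set: "shallow_minor r G H ==> B : fst H ==> branch_set r G B" unfolding shallow_minor_def by blast

lemma shallow_minor_disjoint:
 "shallow_minor r G H ==> A : fst H ==> B : fst H ==> A ~= B ==> A Int B = {}" unfolding shallow_minor_def by blast

lemma minor_subset: "shallow_minor r G H ==> B : fst H ==> B <= fst G" using minor_branch_set unfolding branch_set_def by blast

lemma branch_set_centre:
 assumes "branch_set r G B"
 shows "EX c. c : B & (ALL x:B. EX d<=r. (c, x) : {(a, b). a : B & b : B & {a, b} : snd G} ^^ d)" using assms unfolding branch_set_def by blast

lemma shallow_minor_edge_subset: "shallow_minor r G H ==> snd H <= Pow (fst H)" by (rule subsetI, erule minor_edgeE, assumption) blast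

text \<open>Additional edges on the same vertices destroy no branch set. This lets the expansion
  inherit density bounds from a trace graph that contains it.\<close>

lemma shallow_minor_mono:
 assumes "shallow_minor r G H" "fst G = fst G'" "snd G <= snd G'"
 shows "shallow_minor r G' H"
proof (rule shallow_minorI)
 show "branch_set r G' B" if "B : fst H" for B
 proof (rule branch_set_mono)
  show "branch_set r G B" using assms(1) that unfolding shallow_minor_def by blast
  then show "B <= fst G'" unfolding branch_set_def assms(2) by blast
 qed (use assms(3) in blast)
 show "A Int B = {}" if "A : fst H" "B : fst H" "A ~= B" for A B using assms(1) that unfolding shallow_minor_def by blast
 show "EX A B a b. e = {A, B} & A : fst H & B : fst H & A ~= B & a : A & b : B & {a, b} : snd G'"
  if e: "e : snd H" for e
 proof -
  obtain A B a b where "e = {A, B}" "A : fst H" "B : fst H" "A ~= B"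
   "a : A" "b : B" "{a, b} : snd G" by (rule minor_edgeE[OF assms(1) e])
  then show ?thesis using assms(3) by - (rule exI[of _ A], rule exI[of _ B], rule exI[of _ a], rule exI[of _ b], blast)
 qed
qed

text \<open>Branch sets are disjoint, so at most one of them contains the apex \<open>a\<close>. The
  rest of the minor lives in \<open>G\<close>, and the special branch set has at most one further
  edge to each branch set, whence \<open>b + 1\<close>.\<close>

lemma apex_shallow_minor_edges:
 assumes fin: "finite (fst G)" and G': "fst G' = fst G" "!!e. e : snd G' ==> a : e \<or> e : snd G"
  and dens: "!!H. shallow_minor r G H ==> card (snd H) <= b * card (fst H)"
  and M: "shallow_minor r G' M"
 shows "card (snd M) <= (b + 1) * card (fst M)"
proof -
 define M1 where "M1 = ({B : fst M. a ~: B}, {e : snd M. ALL B:e. a ~: B})"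
 have finM: "finite (fst M)" "finite (snd M)" using minor_finite[OF _ M] fin G'(1) by simp_all
 have "shallow_minor r G M1"
 proof (rule shallow_minorI)
  show "branch_set r G B" if "B : fst M1" for B
  proof (rule branch_set_mono)
   show "branch_set r G' B" using that M unfolding shallow_minor_def M1_def by simp
   then show "B <= fst G" unfolding branch_set_def G'(1) by blast
   show "{x, y} : snd G" if "x : B" "y : B" "{x, y} : snd G'" for x y using G'(2)[OF that(3)] that \<open>B : fst M1\<close> unfolding M1_def by auto
  qed
  show "A Int B = {}" if "A : fst M1" "B : fst M1" "A ~= B" for A B using M that unfolding shallow_minor_def M1_def by simp
  show "EX A B a b. e = {A, B} & A : fst M1 & B : fst M1 & A ~= B & a : A & b : B & {a, b} : snd G"
   if "e : snd M1" for e
  proof -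
   have e: "e : snd M" "ALL B:e. a ~: B" using that by (auto simp: M1_def)
   obtain A B x y where *: "e = {A, B}" "A : fst M" "B : fst M" "A ~= B" "x : A" "y : B" "{x, y} : snd G'" by (rule minor_edgeE[OF M e(1)])
   have "{x, y} : snd G" using G'(2)[OF *(7)] * e(2) by auto
   moreover have "A : fst M1" "B : fst M1" using * e(2) by (auto simp: M1_def)
   ultimately show ?thesis using * by - (rule exI[of _ A], rule exI[of _ B], rule exI[of _ x], rule exI[of _ y], auto)
  qed
 qed
 then have "card (snd M1) <= b * card (fst M1)" by (rule dens)
 also have "... <= b * card (fst M)" using finM by (intro mult_le_mono2 card_mono) (auto simp: M1_def)
 finally have 1: "card (snd M1) <= b * card (fst M)" .
 \<comment> \<open>If no branch set contains \<open>a\<close>, this choice is arbitrary, but then no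
   edge has been removed.\<close>
 define A0 where "A0 = (SOME A. A : fst M & a : A)"
 have A0: "A = A0" if "A : fst M" "a : A" for A
 proof -
  have "A0 : fst M & a : A0" unfolding A0_def by (rule someI) (use that in blast)
  then show ?thesis using that M unfolding shallow_minor_def by blast
 qed
 have "snd M - snd M1 <= (%B. {A0, B}) ` fst M"
 proof
  fix e assume e: "e : snd M - snd M1"
  then obtain A where A: "A : e" "a : A" by (auto simp: M1_def)
  obtain B C where BC: "e = {B, C}" "B : fst M" "C : fst M" using e by (meson DiffD1 minor_edgeE[OF M])
  then have "A = A0" using A A0 by blast
  then have "e = {A0, B} \<or> e = {A0, C}" using A BC by blast
  then show "e : (%B. {A0, B}) ` fst M" using BC by blast
 qed
 then have "card (snd M - snd M1) <= card (fst M)" using finM by (meson card_image_le card_mono finite_imageI le_trans)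
 moreover have "card (snd M) <= card (snd M1) + card (snd M - snd M1)"
 proof -
  have "snd M = snd M1 Un (snd M - snd M1)" by (auto simp: M1_def)
  then show ?thesis by (metis card_Un_le)
 qed
 ultimately show ?thesis using 1 by simp
qed

text \<open>Singletons are branch sets of radius 0, so subgraphs are minors of depth 0. If all
  degrees inside \<open>S\<close> exceeded \<open>2 * b\<close>, the degree sum would exceed
  \<open>2 * b * card S\<close>, whereas every edge is counted at most twice in it.\<close>

lemma degenerate_of_shallow_minor_edges:
 assumes fin: "finite (fst G)"
  and dens: "!!H. shallow_minor 0 G H ==> card (snd H) <= b * card (fst H)"
  and S: "S <= fst G" "S ~= {}"
 shows "EX v:S. card {w : S. w ~= v & {v, w} : snd G} <= 2 * b"
proof (rule ccontr)
 assume neg: "~ ?thesis"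
 define N where "N v = {w : S. w ~= v & {v, w} : snd G}" for v
 define P where "P = Sigma S N"
 define psi where "psi = (%(v, w). {{v}, {w}} :: 'a set set)"
 have finS: "finite S" using fin S finite_subset by blast
 have finP: "finite P" unfolding P_def N_def using finS by auto
 have "shallow_minor 0 G ((%v. {v}) ` S, psi ` P)"
 proof (rule shallow_minorI)
  show "branch_set 0 G B" if "B : fst ((%v. {v}) ` S, psi ` P)" for B using S(1) that by (auto simp: branch_set_def)
  show "EX A B a b. e = {A, B} & A : fst ((%v. {v}) ` S, psi ` P) & B : fst ((%v. {v}) ` S, psi ` P) &
   A ~= B & a : A & b : B & {a, b} : snd G" if e: "e : snd ((%v. {v}) ` S, psi ` P)" for e
  proof -
   obtain v w where "e = {{v}, {w}}" "v : S" "w : S" "w ~= v" "{v, w} : snd G" using e by (auto simp: P_def N_def psi_def)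
   then show ?thesis by - (rule exI[of _ "{v}"], rule exI[of _ "{w}"], rule exI[of _ v], rule exI[of _ w], auto)
  qed
 qed auto
 then have "card (psi ` P) <= b * card ((%v. {v}) ` S)" using dens by fastforce
 also have "card ((%v. {v}) ` S) = card S" by (simp add: card_image)
 finally have up: "card (psi ` P) <= b * card S" .
 have "card P = (\<Sum>e\<in>psi ` P. card {p : P. psi p = e})" using sum.image_gen[OF finP, of "%_. 1::nat" psi] by simp
 also have "... <= (\<Sum>e\<in>psi ` P. 2)"
 proof (rule sum_mono)
  fix e assume "e : psi ` P"
  then obtain v w where vw: "e = psi (v, w)" by auto
  have "{p : P. psi p = e} <= {(v, w), (w, v)}" by (auto simp: vw psi_def doubleton_eq_iff)
  then have "card {p : P. psi p = e} <= card {(v, w), (w, v)}" by (rule card_mono[rotated]) simp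
  also have "... <= 2" by (cases "v = w") simp_all
  finally show "card {p : P. psi p = e} <= 2" .
 qed
 finally have "card P <= 2 * (b * card S)" using up by simp
 moreover have "card P = (\<Sum>v\<in>S. card (N v))" unfolding P_def by (rule card_SigmaI) (use finS in "auto simp: N_def")
 moreover have "(\<Sum>v\<in>S. card (N v)) >= (\<Sum>v\<in>S. 2 * b + 1)" by (rule sum_mono) (use neg in "force simp: N_def")
 moreover have "card S > 0" using S finS by (simp add: card_gt_0_iff)
 ultimately show False by (simp add: algebra_simps)
qed

section \<open>Shallow minors of a lexicographic product with a complete graph\<close>

definition lexprod :: "'v graph => 'x set => ('v \<times> 'x) graph" where
 "lexprod G X = (fst G \<times> X,
   {{(v, x), (w, y)} | v x w y. v : fst G & w : fst G & x : X & y : X & (v = w \<or> {v, w} : snd G)})"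

text \<open>\<open>nr\<close> stands for equal or adjacent and looks only at first components: a
  step may change the colour while staying at a vertex of \<open>G\<close>.\<close>

definition walk :: "('v => 'v => bool) => ('v \<times> 'x) set => 'v \<times> 'x => ('v \<times> 'x) list => bool" where
 "walk nr B c xs = (xs ~= [] & hd xs = c & set xs <= B & successively (%a b. nr (fst a) (fst b)) xs)"

lemma walk_take: "walk nr B c xs ==> 0 < m ==> walk nr B c (take m xs)"
proof -
 assume w: "walk nr B c xs" and m: "0 < m"
 have "successively (%a b. nr (fst a) (fst b)) (take m xs @ drop m xs)" using w by (simp add: walk_def)
 then have "successively (%a b. nr (fst a) (fst b)) (take m xs)" unfolding successively_append_iff by blast
 moreover have "set (take m xs) <= B" using w set_take_subset[of m xs] by (auto simp: walk_def)
 ultimately show ?thesis using w m by (auto simp: walk_def)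
qed

lemma last_take_Suc: "i < length xs ==> last (take (Suc i) xs) = xs ! i" by (simp add: take_Suc_conv_app_nth)

text \<open>Whether a step is allowed depends only on the vertices of \<open>G\<close>, so the walk
  may leave its first visit to a vertex by the exit of the second visit, even if the colours
  differ.\<close>

lemma walk_shortcut:
 assumes "walk nr B c xs" "i < j" "Suc j < length xs" "fst (xs ! i) = fst (xs ! j)"
 shows "walk nr B c (take (Suc i) xs @ drop (Suc j) xs)"
proof -
 have "nr (fst (xs ! j)) (fst (xs ! Suc j))" using assms unfolding walk_def successively_conv_nth by simp
 moreover have "last (take (Suc i) xs) = xs ! i" "hd (drop (Suc j) xs) = xs ! Suc j" using assms by (simp_all add: last_take_Suc hd_drop_conv_nth)
 moreover have "walk nr B c (take (Suc i) xs)" using walk_take assms(1) by blast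
 moreover have "successively (%a b. nr (fst a) (fst b)) (drop (Suc j) xs)"
 proof -
  have "successively (%a b. nr (fst a) (fst b)) (take (Suc j) xs @ drop (Suc j) xs)" using assms(1) by (simp add: walk_def)
  then show ?thesis unfolding successively_append_iff by blast
 qed
 moreover have "set (drop (Suc j) xs) <= B" using assms(1) unfolding walk_def by (meson order.trans set_drop_subset)
 ultimately show ?thesis using assms(4) unfolding walk_def by (auto simp: successively_append_iff)
qed

text \<open>Any repetition yields a smaller pair. Inside one walk, cut out the loop. If the walks
  meet, truncate both at the meeting point; by minimality they meet in their ends. Then one of them
  can drop its last vertex, unless both consist of their starting vertex alone, which
  \<open>ne\<close> excludes. Distinctness makes the colour conditions along the two walks
  independent of each other.\<close>

lemma minimal_walks_disjoint:
 assumes refl: "!!v. nr v v" and sym: "!!v w. nr v w ==> nr w v" and wx: "walk nr A c xs" and wy: "walk nr B c' ys"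
  and near: "nr (fst (last xs)) (fst (last ys))"
  and min: "!!xs' ys'. walk nr A c xs' ==> walk nr B c' ys' ==> nr (fst (last xs')) (fst (last ys'))
    ==> length xs' <= length xs ==> length ys' <= length ys ==> length xs + length ys <= length xs' + length ys'"
  and ne: "fst c ~= fst c'"
 shows "distinct (map fst (xs @ ys))"
proof -
 have nx: "xs ~= []" and ny: "ys ~= []" using wx wy by (auto simp: walk_def)
 have False if ij: "i < j" "j < length xs" "fst (xs ! i) = fst (xs ! j)" for i j
 proof (cases "Suc j = length xs")
  case True
  have "last xs = xs ! j" using True by (metis Suc_diff_1 diff_Suc_1 last_conv_nth nx)
  moreover have "last (take (Suc i) xs) = xs ! i" using ij by (simp add: last_take_Suc)
  ultimately have "nr (fst (last (take (Suc i) xs))) (fst (last ys))" using near ij(3) by metis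
  then have "length xs + length ys <= length (take (Suc i) xs) + length ys" by (intro min[OF walk_take[OF wx] wy]) simp_all
  then show ?thesis using ij True by simp
 next
  case False
  then have "last (take (Suc i) xs @ drop (Suc j) xs) = last xs" using ij by simp
  then have "length xs + length ys <= length (take (Suc i) xs @ drop (Suc j) xs) + length ys"
   using near ij False by (intro min[OF walk_shortcut[OF wx ij(1) _ ij(3)] wy]) simp_all
  then show ?thesis using ij False by simp
 qed
 then have dx: "distinct (map fst xs)" by (auto simp: distinct_conv_nth) (metis linorder_neqE_nat)
 have False if ij: "i < j" "j < length ys" "fst (ys ! i) = fst (ys ! j)" for i j
 proof (cases "Suc j = length ys")
  case True
  have "last ys = ys ! j" using True by (metis Suc_diff_1 diff_Suc_1 last_conv_nth ny)
  moreover have "last (take (Suc i) ys) = ys ! i" using ij by (simp add: last_take_Suc)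
  ultimately have "nr (fst (last xs)) (fst (last (take (Suc i) ys)))" using near ij(3) by metis
  then have "length xs + length ys <= length xs + length (take (Suc i) ys)" by (intro min[OF wx walk_take[OF wy]]) simp_all
  then show ?thesis using ij True by simp
 next
  case False
  then have "last (take (Suc i) ys @ drop (Suc j) ys) = last ys" using ij by simp
  then have "length xs + length ys <= length xs + length (take (Suc i) ys @ drop (Suc j) ys)"
   using near ij False by (intro min[OF wx walk_shortcut[OF wy ij(1) _ ij(3)]]) simp_all
  then show ?thesis using ij False by simp
 qed
 then have dy: "distinct (map fst ys)" by (auto simp: distinct_conv_nth) (metis linorder_neqE_nat)
 have False if ij: "i < length xs" "j < length ys" "fst (xs ! i) = fst (ys ! j)" for i j
 proof -
  have lx: "last (take (Suc i) xs) = xs ! i" and ly: "last (take (Suc j) ys) = ys ! j" using ij by (simp_all add: last_take_Suc)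
  have "nr (fst (last (take (Suc i) xs))) (fst (last (take (Suc j) ys)))" unfolding lx ly ij(3) by (rule refl)
  then have "length xs + length ys <= length (take (Suc i) xs) + length (take (Suc j) ys)"
   by (intro min[OF walk_take[OF wx] walk_take[OF wy]]) simp_all
  then have e: "Suc i = length xs" "Suc j = length ys" using ij by auto
  consider "i > 0" | "j > 0" | "i = 0" "j = 0" by linarith
  then show ?thesis
  proof cases
   case 1
   have "nr (fst (xs ! (i - 1))) (fst (xs ! i))" using wx 1 ij unfolding walk_def successively_conv_nth by (metis Suc_diff_1)
   moreover have "last (take i xs) = xs ! (i - 1)" using 1 ij last_take_Suc[of "i - 1" xs] by simp
   moreover have "last ys = ys ! j" using e(2) ny by (metis diff_Suc_1 last_conv_nth)
   ultimately have "nr (fst (last (take i xs))) (fst (last ys))" using ij(3) by metis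
   then have "length xs + length ys <= length (take i xs) + length ys" by (intro min[OF walk_take[OF wx 1] wy]) simp_all
   then show ?thesis using ij by simp
  next
   case 2
   have "nr (fst (ys ! (j - 1))) (fst (ys ! j))" using wy 2 ij unfolding walk_def successively_conv_nth by (metis Suc_diff_1)
   then have "nr (fst (ys ! j)) (fst (ys ! (j - 1)))" by (rule sym)
   moreover have "last (take j ys) = ys ! (j - 1)" using 2 ij last_take_Suc[of "j - 1" ys] by simp
   moreover have "last xs = xs ! i" using e(1) nx by (metis diff_Suc_1 last_conv_nth)
   ultimately have "nr (fst (last xs)) (fst (last (take j ys)))" using ij(3) by metis
   then have "length xs + length ys <= length xs + length (take j ys)" by (intro min[OF wx walk_take[OF wy 2]]) simp_all
   then show ?thesis using ij by simp
  next
   case 3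
   then have "c = xs ! 0" "c' = ys ! 0" using wx wy nx ny by (auto simp: walk_def hd_conv_nth)
   then show ?thesis using 3 ij ne by simp
  qed
 qed
 then have "fst x ~= fst y" if "x : set xs" "y : set ys" for x y using that unfolding in_set_conv_nth by blast
 then have "fst ` set xs Int fst ` set ys = {}" by auto
 then show ?thesis using dx dy unfolding map_append distinct_append set_map by blast
qed

text \<open>Prescribed colours at \<open>card Z\<close> different vertices leave a free choice at
  all others. This is the probability that a random colouring agrees with \<open>Z\<close>, written
  without division.\<close>

lemma card_restricted_colourings:
 assumes fin: "finite V" "finite X" and Z: "Z <= V \<times> X" "inj_on fst Z"
 shows "card X ^ card V = card X ^ card Z * card {ch : V \<rightarrow>\<^sub>E X. ALL z:Z. ch (fst z) = snd z}"
proof -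
 have eq: "{ch : V \<rightarrow>\<^sub>E X. ALL z:Z. ch (fst z) = snd z}
   = (\<Pi>\<^sub>E v\<in>V. if v : fst ` Z then {x. (v, x) : Z} else X)" (is "?L = ?R")
 proof (intro set_eqI iffI)
  fix ch assume c: "ch : ?L"
  have "ch v : (if v : fst ` Z then {x. (v, x) : Z} else X)" if "v : V" for v using c that by (auto simp: PiE_def Pi_def)
  then show "ch : ?R" using c by (auto simp: PiE_def)
 next
  fix ch assume c: "ch : ?R"
  have m: "ch v : (if v : fst ` Z then {x. (v, x) : Z} else X)" if "v : V" for v using c that by (rule PiE_mem)
  have "ch v : X" if "v : V" for v using m[OF that] Z(1) by (auto split: if_splits)
  then have "ch : V \<rightarrow>\<^sub>E X" using c by (auto simp: PiE_def)
  moreover have "ch (fst z) = snd z" if "z : Z" for z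
  proof -
   have "fst z : V" using that Z(1) by auto
   from m[OF this] have "(fst z, ch (fst z)) : Z" using that by auto
   then show ?thesis using Z(2) that by (metis fst_conv inj_onD snd_conv)
  qed
  ultimately show "ch : ?L" by simp
 qed
 have "card ?L = (\<Prod>v\<in>V. card (if v : fst ` Z then {x. (v, x) : Z} else X))" unfolding eq by (rule card_PiE[OF fin(1)])
 also have "... = (\<Prod>v\<in>V. if v : fst ` Z then 1 else card X)"
 proof (rule prod.cong[OF refl])
  fix v assume "v : V"
  have "card {x. (v, x) : Z} = 1" if v: "v : fst ` Z"
  proof -
   obtain x where x: "(v, x) : Z" using v by auto
   have "x' = x" if "(v, x') : Z" for x' using inj_onD[OF Z(2) _ that x] by simp
   then have "{x. (v, x) : Z} = {x}" using x by blast
   then show ?thesis by simp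
  qed
  then show "card (if v : fst ` Z then {x. (v, x) : Z} else X) = (if v : fst ` Z then 1 else card X)" by simp
 qed
 also have "... = card X ^ card (V Int - fst ` Z)" by (simp only: prod.If_cases[OF fin(1)] prod_constant Collect_mem_eq power_one mult_1)
 finally have 1: "card ?L = card X ^ card (V Int - fst ` Z)" .
 have "card V = card (V Int fst ` Z) + card (V Int - fst ` Z)" by (metis fin(1) card_Int_Diff Diff_eq)
 moreover have "V Int fst ` Z = fst ` Z" using Z(1) by auto
 ultimately have "card V = card Z + card (V Int - fst ` Z)" using Z(2) by (simp add: card_image)
 then show ?thesis using 1 by (simp add: power_add)
qed

text \<open>Steps that stay at a vertex of \<open>G\<close> are dropped, so the length of the walk
  is only an upper bound for the distance.\<close>

lemma walk_relpow:
 assumes "walk nr B c xs" "ALL x:set xs. fst x : S" "!!v w. nr v w ==> v ~= w ==> {v, w} : E"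
 shows "EX d<length xs. (fst c, fst (last xs)) : {(a, b). a : S & b : S & {a, b} : E} ^^ d" using assms(1,2)
proof (induction xs rule: rev_induct)
 case Nil
 then show ?case by (simp add: walk_def)
next
 case (snoc x xs)
 show ?case
 proof (cases "xs = []")
  case True
  then have "x = c" using snoc.prems by (simp add: walk_def)
  then show ?thesis using True by auto
 next
  case False
  then have w: "walk nr B c xs" and n: "nr (fst (last xs)) (fst x)" using snoc.prems by (auto simp: walk_def successively_append_iff)
  obtain d where d: "d < length xs"
    "(fst c, fst (last xs)) : {(a, b). a : S & b : S & {a, b} : E} ^^ d" using snoc.IH[OF w] snoc.prems(2) by auto
  show ?thesis
  proof (cases "fst (last xs) = fst x")
   case True
   then show ?thesis using d by (intro exI[of _ d]) auto
  next
   case neq: False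
   have "(fst (last xs), fst x) : {(a, b). a : S & b : S & {a, b} : E}" using assms(3)[OF n neq] snoc.prems(2) False by auto
   then have "(fst c, fst x) : {(a, b). a : S & b : S & {a, b} : E} ^^ Suc d" using d(2) by (rule relpow_Suc_I[rotated])
   then show ?thesis using d(1) by (intro exI[of _ "Suc d"]) simp
  qed
 qed
qed

lemma lexprod_edgeI:
 "[|v : fst G; w : fst G; x : X; y : X; v = w \<or> {v, w} : snd G|]
  ==> {(v, x), (w, y)} : snd (lexprod G X)"
 unfolding lexprod_def snd_conv by (rule CollectI, rule exI[of _ v], rule exI[of _ x], rule exI[of _ w], rule exI[of _ y]) simp

lemma lexprod_edgeD:
 assumes "{a, b} : snd (lexprod G X)"
 shows "fst a = fst b \<or> {fst a, fst b} : snd G"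
proof -
 obtain v x w y where *: "{a, b} = {(v, x), (w, y)}" "v = w \<or> {v, w} : snd G" using assms unfolding lexprod_def by auto
 then have "a = (v, x) & b = (w, y) \<or> a = (w, y) & b = (v, x)" by (auto simp: doubleton_eq_iff)
 then show ?thesis using *(2) by (auto simp: insert_commute)
qed

lemma relpow_walk:
 assumes "(c, x) : {(a, b). a : B & b : B & {a, b} : snd (lexprod G X)} ^^ d" "c : B"
 shows "EX xs. walk (%v w. v = w \<or> {v, w} : snd G) B c xs & last xs = x & length xs = Suc d" using assms(1)
proof (induction d arbitrary: x)
 case 0
 then show ?case using assms(2) by (intro exI[of _ "[c]"]) (auto simp: walk_def)
next
 case (Suc d)
 from Suc.prems obtain y where y: "(c, y) : {(a, b). a : B & b : B & {a, b} : snd (lexprod G X)} ^^ d"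
  "y : B" "x : B" "{y, x} : snd (lexprod G X)" by (auto elim!: relpow_Suc_E)
 obtain xs where xs: "walk (%v w. v = w \<or> {v, w} : snd G) B c xs" "last xs = y" "length xs = Suc d" using Suc.IH[OF y(1)] by auto
 have "fst y = fst x \<or> {fst y, fst x} : snd G" using y(4) by (rule lexprod_edgeD)
 then have "walk (%v w. v = w \<or> {v, w} : snd G) B c (xs @ [x])" using xs y(3) by (auto simp: walk_def successively_append_iff)
 then show ?case using xs by (intro exI[of _ "xs @ [x]"]) simp
qed

text \<open>Double counting; it takes the place of the expectation over random colourings.\<close>

lemma card_filter_swap:
 assumes "finite A" "finite B"
 shows "(\<Sum>a\<in>A. card {b : B. P a b}) = (\<Sum>b\<in>B. card {a : A. P a b})"
proof -
 have "(\<Sum>a\<in>A. card {b : B. P a b}) = (\<Sum>a\<in>A. \<Sum>b\<in>B. if P a b then 1 else 0)"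
  using assms(2) by (simp only: card_eq_sum sum.inter_filter)
 also have "... = (\<Sum>b\<in>B. \<Sum>a\<in>A. if P a b then 1 else 0)" by (rule sum.swap)
 also have "... = (\<Sum>b\<in>B. card {a : A. P a b})" using assms(1) by (simp only: card_eq_sum sum.inter_filter)
 finally show ?thesis .
qed

text \<open>A branch set of a minor of the lexicographic product is a walk-connected set of coloured
  vertices. Colour the vertices of \<open>G\<close> at random and keep of each branch set what is reachable from
 its centre along correctly coloured vertices: the remaining sets are disjoint in \<open>G\<close>, and an edge
 survives with probability at least \<open>card X\<close> to the power \<open>-(2 s + 2)\<close>, because it is realised by
 two vertex-disjoint walks. Edges between branch sets over the same centre are counted
 separately.\<close>

lemma lexprod_shallow_minor_edges:
 fixes G :: "'v graph" and X :: "'x set"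
 assumes fin: "finite (fst G)" "finite X"
  and dens: "!!H. shallow_minor s G H ==> card (snd H) <= b * card (fst H)"
  and M: "shallow_minor s (lexprod G X) M"
 shows "card (snd M) <= (card X + card X ^ (2 * s + 2) * b) * card (fst M)"
proof (cases "X = {}")
 case True
 have "B : fst M ==> False" for B using minor_subset[OF M] branch_set_centre[OF minor_branch_set[OF M]] True
  unfolding lexprod_def by fastforce
 then have "fst M = {}" by blast
 then have "snd M = {}" using minor_edgeE[OF M] by (metis all_not_in_conv)
 then show ?thesis by simp
next
 case False
 define nr where "nr = (%v w. v = w \<or> {v, w} : snd G)"
 have nr_refl: "nr v v" for v by (simp add: nr_def)
 have nr_sym: "nr v w ==> nr w v" for v w by (auto simp: nr_def insert_commute)
 have finM: "finite (fst M)" "finite (snd M)" using minor_finite[OF _ M] fin by (simp_all add: lexprod_def)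
 have disj: "A Int B = {}" if "A : fst M" "B : fst M" "A ~= B" for A B using shallow_minor_disjoint[OF M that] .
 have sub: "B <= fst G \<times> X" if "B : fst M" for B using minor_subset[OF M that] unfolding lexprod_def by simp
 have "ALL B:fst M. EX c. c : B & (ALL x:B. EX d<=s. (c, x) :
   {(a, b). a : B & b : B & {a, b} : snd (lexprod G X)} ^^ d)"
  using branch_set_centre[OF minor_branch_set[OF M]] by blast
 from bchoice[OF this] obtain cen where cen_all: "ALL B:fst M. cen B : B & (ALL x:B. EX d<=s. (cen B, x) :
   {(a, b). a : B & b : B & {a, b} : snd (lexprod G X)} ^^ d)" by (rule exE)
 have cen: "cen B : B" if "B : fst M" for B using bspec[OF cen_all that] by (rule conjunct1)
 have cen_reach: "EX d<=s. (cen B, x) : {(a, b). a : B & b : B & {a, b} : snd (lexprod G X)} ^^ d"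
  if "B : fst M" "x : B" for B x using bspec[OF conjunct2[OF bspec[OF cen_all that(1)]] that(2)] .
 have reach: "EX xs. walk nr B (cen B) xs & last xs = x & length xs <= Suc s"
  if B: "B : fst M" and x: "x : B" for B x
 proof -
  obtain d where d: "d <= s" "(cen B, x) : {(a, b). a : B & b : B & {a, b} : snd (lexprod G X)} ^^ d" using cen_reach[OF B x] by (elim exE conjE)
  obtain xs where "walk nr B (cen B) xs" "last xs = x" "length xs = Suc d" using relpow_walk[OF d(2) cen[OF B]] unfolding nr_def by (elim exE conjE)
  then show ?thesis using d(1) by (intro exI[of _ xs]) simp
 qed
 \<comment> \<open>What the colouring \<open>ch\<close> leaves of \<open>B\<close>: the ends of
   walks with at most \<open>s\<close> steps from the centre on which every colour agrees with
   \<open>ch\<close>. A vertex of \<open>G\<close> has only one colour under \<open>ch\<close>,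
   which makes these sets disjoint for different \<open>B\<close>.\<close>
 define S where "S ch B = {v. EX xs. walk nr B (cen B) xs & length xs <= Suc s & fst (last xs) = v &
   (ALL z:set xs. ch (fst z) = snd z)}" for ch B
 have S_mem: "(v, ch v) : B" if "v : S ch B" for v ch B
 proof -
  obtain xs where xs: "walk nr B (cen B) xs" "fst (last xs) = v" "ALL z:set xs. ch (fst z) = snd z"
   using \<open>v : S ch B\<close> unfolding S_def by auto
  then have "last xs : set xs" "set xs <= B" by (auto simp: walk_def)
  moreover from this have "last xs = (v, ch v)" using xs by (metis prod.collapse)
  ultimately show ?thesis by auto
 qed
 have S_prefix: "ALL z:set xs. fst z : S ch B"
  if xs: "walk nr B (cen B) xs" "length xs <= Suc s" "ALL z:set xs. ch (fst z) = snd z" for xs ch B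
 proof
  fix z assume "z : set xs"
  then obtain i where i: "i < length xs" "z = xs ! i" by (auto simp: in_set_conv_nth)
  have "walk nr B (cen B) (take (Suc i) xs)" by (rule walk_take[OF xs(1)]) simp
  moreover have "last (take (Suc i) xs) = z" using i by (simp add: last_take_Suc)
  moreover have "ALL z:set (take (Suc i) xs). ch (fst z) = snd z" using xs(3) by (meson in_set_takeD)
  moreover have "length (take (Suc i) xs) <= Suc s" using xs(2) by simp
  ultimately show "fst z : S ch B" unfolding S_def by blast
 qed
 have S_disj: "S ch A Int S ch B = {}" if "A : fst M" "B : fst M" "A ~= B" for A B ch using disj[OF that] S_mem by blast
 have S_branch: "branch_set s G (S ch B)" if B: "B : fst M" and ne: "S ch B ~= {}" for ch B unfolding branch_set_def
 proof (intro conjI bexI[of _ "fst (cen B)"] ballI)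
  show "S ch B <= fst G" using S_mem sub[OF B] by blast
  fix v assume "v : S ch B"
  then obtain xs where xs: "walk nr B (cen B) xs" "length xs <= Suc s" "fst (last xs) = v"
    "ALL z:set xs. ch (fst z) = snd z" unfolding S_def by auto
  obtain d where d: "d < length xs" "(fst (cen B), fst (last xs)) :
    {(a, b). a : S ch B & b : S ch B & {a, b} : snd G} ^^ d"
   using walk_relpow[OF xs(1) S_prefix[OF xs(1,2,4)], of "snd G"] unfolding nr_def by blast
  then show "EX d<=s. (fst (cen B), v) : {(a, b). a : S ch B & b : S ch B & {a, b} : snd G} ^^ d" using xs(2,3) by (intro exI[of _ d]) auto
 next
  obtain v where "v : S ch B" using ne by auto
  then obtain xs where xs: "walk nr B (cen B) xs" "length xs <= Suc s"
    "ALL z:set xs. ch (fst z) = snd z" unfolding S_def by auto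
  moreover have "cen B : set xs" using xs(1) unfolding walk_def by (metis hd_in_set)
  ultimately show "fst (cen B) : S ch B" using S_prefix by blast
 qed
 \<comment> \<open>Walks that start over the same vertex of \<open>G\<close> cannot be disjoint
   there. Such edges are few: given \<open>A\<close>, the other branch set is determined by the
   colour of its centre.\<close>
 define E1 where "E1 = {e : snd M. EX A B. e = {A, B} & A : fst M & B : fst M & fst (cen A) = fst (cen B)}"
 have E1: "card E1 <= card X * card (fst M)"
 proof -
  define bc where "bc z = (SOME B. B : fst M & cen B = z)" for z
  have bc: "bc (cen B) = B" if "B : fst M" for B
  proof -
   have "bc (cen B) : fst M & cen (bc (cen B)) = cen B" unfolding bc_def by (rule someI[of _ B]) (use that in simp)
   then show ?thesis using disj that cen by (metis disjoint_iff)
  qed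
  have "E1 <= (%(A, x). {A, bc (fst (cen A), x)}) ` (fst M \<times> X)"
  proof
   fix e assume "e : E1"
   then obtain A B where AB: "e = {A, B}" "A : fst M" "B : fst M" "fst (cen A) = fst (cen B)" unfolding E1_def by blast
   have "bc (fst (cen A), snd (cen B)) = B" using bc[OF AB(3)] AB(4) by simp
   moreover have "snd (cen B) : X" using sub[OF AB(3)] cen[OF AB(3)] by auto
   ultimately show "e : (%(A, x). {A, bc (fst (cen A), x)}) ` (fst M \<times> X)" using AB by (intro image_eqI[of _ _ "(A, snd (cen B))"]) auto
  qed
  then have "card E1 <= card (fst M \<times> X)" using finM fin by (meson card_image_le card_mono finite_SigmaI finite_imageI le_trans)
  then show ?thesis by (simp add: card_cartesian_product mult.commute)
 qed
 \<comment> \<open>\<open>Z\<close> collects the coloured vertices of a pair of walks of least total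
   length that realises \<open>e\<close>. A colouring that agrees with \<open>Z\<close> keeps both
   walks, and hence the edge.\<close>
 have "ALL e:snd M - E1. EX Z. Z <= fst G \<times> X & inj_on fst Z & card Z <= 2 * s + 2 &
   (ALL ch. (ALL z:Z. ch (fst z) = snd z) --> (EX A B a b. e = {A, B} & A : fst M & B : fst M & A ~= B &
    a : S ch A & b : S ch B & {a, b} : snd G))"
 proof
  fix e assume e: "e : snd M - E1"
  then have eM: "e : snd M" by simp
  obtain A B a b where AB: "e = {A, B}" "A : fst M" "B : fst M" "A ~= B"
   and ab: "a : A" "b : B" "{a, b} : snd (lexprod G X)" by (rule minor_edgeE[OF M eM])
  have ne: "fst (cen A) ~= fst (cen B)" using e AB unfolding E1_def by blast
  define Q where "Q p = (walk nr A (cen A) (fst p) & walk nr B (cen B) (snd p) &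
    nr (fst (last (fst p))) (fst (last (snd p))) & length (fst p) <= Suc s & length (snd p) <= Suc s)" for p
  obtain xs0 ys0 where "walk nr A (cen A) xs0" "last xs0 = a" "length xs0 <= Suc s"
    "walk nr B (cen B) ys0" "last ys0 = b" "length ys0 <= Suc s" using reach[OF AB(2) ab(1)] reach[OF AB(3) ab(2)] by auto
  moreover have "nr (fst a) (fst b)" using lexprod_edgeD[OF ab(3)] by (simp add: nr_def)
  ultimately have "Q (xs0, ys0)" by (simp add: Q_def)
  from ex_has_least_nat[of Q, OF this, of "%p. length (fst p) + length (snd p)"]
  obtain xs ys where Qxy: "Q (xs, ys)"
   and min: "!!xs' ys'. Q (xs', ys') ==> length xs + length ys <= length xs' + length ys'" by force
  have w: "walk nr A (cen A) xs" "walk nr B (cen B) ys" "nr (fst (last xs)) (fst (last ys))"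
    "length xs <= Suc s" "length ys <= Suc s" using Qxy by (auto simp: Q_def)
  have dist: "distinct (map fst (xs @ ys))" by (rule minimal_walks_disjoint[where nr = nr, OF nr_refl nr_sym w(1,2,3) _ ne])
    (use min w in "auto simp: Q_def")
  let ?Z = "set (xs @ ys)"
  have "?Z <= fst G \<times> X" using w sub[OF AB(2)] sub[OF AB(3)] by (auto simp: walk_def)
  moreover have "inj_on fst ?Z" using dist distinct_map by blast
  moreover have "card ?Z <= 2 * s + 2" using card_length[of "xs @ ys"] w by simp
  moreover have "EX A B a b. e = {A, B} & A : fst M & B : fst M & A ~= B &
    a : S ch A & b : S ch B & {a, b} : snd G" if chi: "ALL z:?Z. ch (fst z) = snd z" for ch
  proof -
   have "fst (last xs) : S ch A" "fst (last ys) : S ch B"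
    using S_prefix[OF w(1,4), of ch] S_prefix[OF w(2,5), of ch] chi w(1,2) by (auto simp: walk_def)
   moreover from this have "fst (last xs) ~= fst (last ys)" using S_disj[OF AB(2,3,4)] by (metis disjoint_iff)
   ultimately show ?thesis using AB w(3) by - (rule exI[of _ A], rule exI[of _ B], rule exI[of _ "fst (last xs)"],
    rule exI[of _ "fst (last ys)"], auto simp: nr_def)
  qed
  ultimately show "EX Z. Z <= fst G \<times> X & inj_on fst Z & card Z <= 2 * s + 2 &
   (ALL ch. (ALL z:Z. ch (fst z) = snd z) --> (EX A B a b. e = {A, B} & A : fst M & B : fst M & A ~= B &
    a : S ch A & b : S ch B & {a, b} : snd G))"
   by (intro exI[of _ ?Z]) blast
 qed
 from bchoice[OF this] obtain Z where Z_all: "ALL e:snd M - E1. Z e <= fst G \<times> X & inj_on fst (Z e) & card (Z e) <= 2 * s + 2 &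
   (ALL ch. (ALL z:Z e. ch (fst z) = snd z) --> (EX A B a b. e = {A, B} & A : fst M & B : fst M & A ~= B &
    a : S ch A & b : S ch B & {a, b} : snd G))" by (rule exE)
 have Z: "!!e. e : snd M - E1 ==> Z e <= fst G \<times> X"
  "!!e. e : snd M - E1 ==> inj_on fst (Z e)" "!!e. e : snd M - E1 ==> card (Z e) <= 2 * s + 2" using Z_all by (meson bspec)+
 have Zedge: "EX A B a b. e = {A, B} & A : fst M & B : fst M & A ~= B & a : S ch A & b : S ch B & {a, b} : snd G"
  if "e : snd M - E1" "ALL z:Z e. ch (fst z) = snd z" for e ch
  by (rule mp[OF spec[OF conjunct2[OF conjunct2[OF conjunct2[OF bspec[OF Z_all that(1)]]]]] that(2)])
 \<comment> \<open>For a fixed colouring the surviving edges form a minor of \<open>G\<close>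
   itself, to which \<open>dens\<close> applies.\<close>
 have good: "card {e : snd M - E1. ALL z:Z e. ch (fst z) = snd z} <= b * card (fst M)" for ch
 proof -
  let ?F = "{e : snd M - E1. ALL z:Z e. ch (fst z) = snd z}" and ?V = "{B : fst M. S ch B ~= {}}"
  have inj: "inj_on (S ch) ?V"
  proof (rule inj_onI)
   fix A B assume "A : ?V" "B : ?V" "S ch A = S ch B"
   then show "A = B" using S_disj[of A B ch] by auto
  qed
  have FV: "?F <= Pow ?V"
  proof
   fix e assume "e : ?F"
   then have "EX A B a b. e = {A, B} & A : fst M & B : fst M & A ~= B & a : S ch A & b : S ch B & {a, b} : snd G" by (intro Zedge) auto
   then show "e : Pow ?V" by auto
  qed
  have "shallow_minor s G (S ch ` ?V, (%e. S ch ` e) ` ?F)"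
  proof (rule shallow_minorI)
   show "branch_set s G B" if "B : fst (S ch ` ?V, (%e. S ch ` e) ` ?F)" for B using that S_branch by auto
   show "A Int B = {}" if "A : fst (S ch ` ?V, (%e. S ch ` e) ` ?F)" "B : fst (S ch ` ?V, (%e. S ch ` e) ` ?F)" "A ~= B" for A B
   proof -
    obtain A' B' where "A = S ch A'" "B = S ch B'" "A' : fst M" "B' : fst M" using \<open>A : _\<close> \<open>B : _\<close> by auto
    then show ?thesis using S_disj \<open>A ~= B\<close> by metis
   qed
   fix e' assume "e' : snd (S ch ` ?V, (%e. S ch ` e) ` ?F)"
   then obtain e where e: "e' = S ch ` e" "e : snd M - E1" "ALL z:Z e. ch (fst z) = snd z" by auto
   obtain A B a b where AB: "e = {A, B}" "A : fst M" "B : fst M" "A ~= B" "a : S ch A" "b : S ch B"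
    "{a, b} : snd G" using Zedge[OF e(2,3)] by (elim exE conjE)
   moreover have "S ch A ~= S ch B" using S_disj[OF AB(2,3,4), of ch] AB(5) by auto
   moreover have "S ch A : S ch ` ?V" "S ch B : S ch ` ?V" using AB by auto
   ultimately show "EX A B a b. e' = {A, B} & A : fst (S ch ` ?V, (%e. S ch ` e) ` ?F) &
    B : fst (S ch ` ?V, (%e. S ch ` e) ` ?F) & A ~= B & a : A & b : B & {a, b} : snd G"
    using e(1) by - (rule exI[of _ "S ch A"], rule exI[of _ "S ch B"], rule exI[of _ a], rule exI[of _ b], simp)
  qed
  then have "card ((%e. S ch ` e) ` ?F) <= b * card (S ch ` ?V)" using dens by fastforce
  moreover have "inj_on (%e. S ch ` e) ?F" using inj_on_subset[OF inj_on_image_Pow[OF inj] FV] .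
  ultimately have "card ?F <= b * card (S ch ` ?V)" by (simp add: card_image)
  also have "card (S ch ` ?V) <= card ?V" using finM by (intro card_image_le) simp
  also have "card ?V <= card (fst M)" using finM by (intro card_mono) auto
  finally show ?thesis by simp
 qed
 let ?q = "card X" and ?n = "card (fst G)" and ?P = "fst G \<rightarrow>\<^sub>E X" and ?E = "snd M - E1"
 have finP: "finite ?P" using fin by (intro finite_PiE) auto
 have q: "?q > 0" using False fin by (simp add: card_gt_0_iff)
 have low: "?q ^ ?n <= ?q ^ (2 * s + 2) * card {ch : ?P. ALL z:Z e. ch (fst z) = snd z}" if e: "e : ?E" for e
 proof -
  have "?q ^ card (Z e) <= ?q ^ (2 * s + 2)" using Z(3)[OF e] q by (intro power_increasing) auto
  then show ?thesis unfolding card_restricted_colourings[OF fin Z(1)[OF e] Z(2)[OF e]] by (rule mult_le_mono1)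
 qed
 \<comment> \<open>Pairs of an edge and a colouring that keeps it are counted in both
   orders.\<close>
 have "card ?E * ?q ^ ?n = (\<Sum>e\<in>?E. ?q ^ ?n)" by simp
 also have "... <= (\<Sum>e\<in>?E. ?q ^ (2 * s + 2) * card {ch : ?P. ALL z:Z e. ch (fst z) = snd z})" by (rule sum_mono) (rule low)
 also have "... = ?q ^ (2 * s + 2) * (\<Sum>ch\<in>?P. card {e : ?E. ALL z:Z e. ch (fst z) = snd z})"
  using card_filter_swap[OF _ finP, of ?E] finM by (simp add: sum_distrib_left[symmetric])
 also have "... <= ?q ^ (2 * s + 2) * (\<Sum>ch\<in>?P. b * card (fst M))" using good by (intro mult_le_mono2 sum_mono) blast
 also have "... = (?q ^ (2 * s + 2) * b * card (fst M)) * ?q ^ ?n" using fin by (simp add: card_PiE)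
 finally have "card ?E <= ?q ^ (2 * s + 2) * b * card (fst M)" using q by simp
 moreover have "card (snd M) <= card E1 + card ?E"
 proof -
  have "snd M = E1 Un ?E" unfolding E1_def by auto
  then show ?thesis by (metis card_Un_le)
 qed
 ultimately show ?thesis using E1 by (simp add: algebra_simps)
qed

section \<open>Trace graphs as shallow minors\<close>

definition apply_word :: "(nat => 'v => 'v) => nat list => 'v => 'v" where
 "apply_word fn ws = foldr fn ws"

text \<open>Fixing the length loses nothing: the letter \<open>0\<close> acts as the identity, so
  shorter words can be padded.\<close>

definition words :: "nat set => nat => nat list set" where
 "words L D = {ws. set ws <= L & length ws = D}"

definition trace_graph :: "'v set => (nat => 'v => 'v) => nat set => nat => 'v graph" where
 "trace_graph V fn L D = (V, {{a, b} | a b. a ~= b &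
   (EX y:V. EX s:words L D. EX t:words L D. a = apply_word fn s y & b = apply_word fn t y)})"

lemma apply_word_append: "apply_word fn (xs @ ys) v = apply_word fn xs (apply_word fn ys v)" by (simp add: apply_word_def)

lemma apply_word_mem:
 assumes "!!f v. f : L ==> v : V ==> fn f v : V" "set ws <= L" "v : V"
 shows "apply_word fn ws v : V" using assms(2) by (induction ws) (auto simp: apply_word_def assms(1,3))

lemma apply_word_replicate:
 assumes "fn 0 v = v"
 shows "apply_word fn (replicate n 0) v = v" by (induction n) (auto simp: apply_word_def assms)

lemma relpow_sym:
 fixes R :: "('a \<times> 'a) set"
 assumes "sym R" "(a, b) : R ^^ n"
 shows "(b, a) : R ^^ n" using assms(2)
proof (induction n arbitrary: b)
 case (Suc n)
 then obtain c where "(a, c) : R ^^ n" "(c, b) : R" by (auto elim: relpow_Suc_E)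
 then show ?case using Suc.IH assms(1) by (meson relpow_Suc_I2 symD)
qed auto

text \<open>The copy \<open>(v, t)\<close> of \<open>v\<close> in the lexicographic product is contracted to the vertex that the
 word \<open>t\<close> reaches from \<open>v\<close>.\<close>

lemma trace_graph_minor:
 fixes fn :: "nat => 'v => 'v"
 assumes fn: "!!f v. f : L ==> v : V ==> fn f v : V" and id: "!!v. v : V ==> fn 0 v = v" "0 : L"
  and G: "fst G = V" "!!f v. f : L ==> v : V ==> fn f v ~= v ==> {fn f v, v} : snd G"
  and H: "shallow_minor r (trace_graph V fn L D) H"
 shows "EX H'. shallow_minor ((2 * D + 1) * r + D) (lexprod G (words L D)) H' &
  card (fst H') = card (fst H) & card (snd H') = card (snd H)"
proof -
 let ?T = "words L D" and ?z = "replicate D 0" and ?e = "apply_word fn"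
 define hat where "hat B = {(v, t). v : V & t : ?T & ?e t v : B}" for B
 define R where "R B = {(a, b). a : hat B & b : hat B & {a, b} : snd (lexprod G ?T)}" for B
 have z: "?z : ?T" using id(2) by (auto simp: words_def)
 have ez: "?e ?z v = v" if "v : V" for v using apply_word_replicate id(1)[OF that] by metis
 have BV: "B <= V" if "B : fst H" for B using minor_subset[OF H that] unfolding trace_graph_def by simp
 have hat_z: "(v, ?z) : hat B \<longleftrightarrow> v : B" if "v : V" for v B using ez[OF that] z that by (simp add: hat_def)
 have symR: "sym (R B)" for B by (auto simp: R_def sym_def insert_commute)
 have down: "((v, t), (?e t v, ?z)) : R B ^^ D" if vt: "(v, t) : hat B" for v t B
 proof -
  have v: "v : V" and t: "t : ?T" "set t <= L" "length t = D" and tB: "?e t v : B" using vt by (auto simp: hat_def words_def)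
  \<comment> \<open>In each step the last letter is applied to the vertex and a letter
    \<open>0\<close> is put in front of the rest. The pair denotes the vertex \<open>?e t v\<close>
    all the time, so the path never leaves \<open>hat B\<close>.\<close>
  define p where "p i = (?e (drop (D - i) t) v, replicate i 0 @ take (D - i) t)" for i
  have fp: "fst (p i) : V" for i
  proof -
   have "set (drop (D - i) t) <= L" using t(2) set_drop_subset by fastforce
   then show ?thesis unfolding p_def using apply_word_mem[OF fn _ v] by simp
  qed
  have ph: "p i : hat B" if "i <= D" for i
  proof -
   have "set (snd (p i)) <= L" unfolding p_def using id(2) t(2) by (auto dest: in_set_takeD)
   moreover have "length (snd (p i)) = D" unfolding p_def using that t(3) by simp
   moreover have "?e (snd (p i)) (fst (p i)) = ?e t v"
   proof -
    have "?e (take (D - i) t) (?e (drop (D - i) t) v) = ?e t v" by (metis append_take_drop_id apply_word_append)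
    then show ?thesis unfolding p_def using apply_word_mem[OF fn t(2) v] id(1) by (simp add: apply_word_append apply_word_replicate)
   qed
   ultimately show ?thesis using fp[of i] tB by (cases "p i") (auto simp: hat_def words_def)
  qed
  have step: "(p i, p (Suc i)) : R B" if i: "i < D" for i
  proof -
   have "drop (D - Suc i) t = t ! (D - Suc i) # drop (D - i) t"
    using i t(3) by (metis Cons_nth_drop_Suc Suc_diff_Suc diff_less zero_less_Suc not_less0 gr0I)
   then have "fst (p (Suc i)) = fn (t ! (D - Suc i)) (fst (p i))" by (simp add: p_def apply_word_def)
   moreover have "t ! (D - Suc i) : L" using t i by (auto dest: nth_mem)
   ultimately have adj: "fst (p i) = fst (p (Suc i)) \<or> {fst (p i), fst (p (Suc i))} : snd G" using G(2) fp[of i] by (metis insert_commute)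
   have h: "p i : hat B" "p (Suc i) : hat B" using ph i by auto
   then have "{p i, p (Suc i)} : snd (lexprod G ?T)" using lexprod_edgeI[of "fst (p i)" G "fst (p (Suc i))" "snd (p i)" ?T "snd (p (Suc i))"] adj G(1)
    by (auto simp: hat_def)
   then show ?thesis using h by (simp add: R_def)
  qed
  have "p 0 = (v, t)" "p D = (?e t v, ?z)" using t(3) by (simp_all add: p_def apply_word_def)
  then show ?thesis using step unfolding relpow_fun_conv by blast
 qed
 have same: "((y, s), (y, t)) : R B" if "(y, s) : hat B" "(y, t) : hat B" for y s t B
 proof -
  have "{(y, s), (y, t)} : snd (lexprod G ?T)" using that G(1) by (intro lexprod_edgeI) (auto simp: hat_def)
  then show ?thesis using that by (simp add: R_def)
 qed
 have edge: "EX y s t. y : V & s : ?T & t : ?T & a = ?e s y & b = ?e t y"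
  if ab: "{a, b} : snd (trace_graph V fn L D)" for a b
 proof -
  obtain a' b' y s t where *: "{a, b} = {a', b'}" "y : V" "s : ?T" "t : ?T" "a' = ?e s y" "b' = ?e t y" using ab unfolding trace_graph_def by auto
  then have "a = a' & b = b' \<or> a = b' & b = a'" by (auto simp: doubleton_eq_iff)
  then show ?thesis using * by blast
 qed
 \<comment> \<open>An edge of the trace graph comes from a common \<open>y\<close>: \<open>D\<close>
   steps lead from \<open>u\<close> back to \<open>(y, s)\<close>, one to \<open>(y, t)\<close>, and
   \<open>D\<close> on to \<open>w\<close>. This gives the factor \<open>2 * D + 1\<close>; the
   extra \<open>D\<close> in the final radius leads from \<open>(x, ?z)\<close> to the other copies
   in \<open>hat B\<close>.\<close>
 have reach: "((c, ?z), (w, ?z)) : R B ^^ ((2 * D + 1) * d)"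
  if "(c, w) : {(a, b). a : B & b : B & {a, b} : snd (trace_graph V fn L D)} ^^ d" for c w d B using that
 proof (induction d arbitrary: w)
  case (Suc d)
  then obtain u where u: "(c, u) : {(a, b). a : B & b : B & {a, b} : snd (trace_graph V fn L D)} ^^ d"
   "u : B" "w : B" "{u, w} : snd (trace_graph V fn L D)" by (auto elim!: relpow_Suc_E)
  obtain y s t where y: "y : V" "s : ?T" "t : ?T" "u = ?e s y" "w = ?e t y" using edge[OF u(4)] by blast
  then have h: "(y, s) : hat B" "(y, t) : hat B" using u by (auto simp: hat_def)
  have "((u, ?z), (y, s)) : R B ^^ D" using relpow_sym[OF symR down[OF h(1)]] y by simp
  then have "((u, ?z), (y, t)) : R B ^^ Suc D" using same[OF h] by (rule relpow_Suc_I)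
  then have "((u, ?z), (w, ?z)) : R B ^^ (Suc D + D)" using down[OF h(2)] y unfolding relpow_add by auto
  then have "((c, ?z), (w, ?z)) : R B ^^ ((2 * D + 1) * d + (Suc D + D))" using Suc.IH[OF u(1)] unfolding relpow_add by blast
  moreover have "(2 * D + 1) * d + (Suc D + D) = (2 * D + 1) * Suc d" by simp
  ultimately show ?case by metis
 qed simp
 have branch: "branch_set ((2 * D + 1) * r + D) (lexprod G ?T) (hat B)" if B: "B : fst H" for B
 proof -
  obtain c where c: "c : B" "ALL v:B. EX d<=r. (c, v) :
    {(a, b). a : B & b : B & {a, b} : snd (trace_graph V fn L D)} ^^ d"
   using branch_set_centre[OF minor_branch_set[OF H B]] by blast
  have "EX d<=(2 * D + 1) * r + D. ((c, ?z), x) : R B ^^ d" if x: "x : hat B" for x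
  proof -
   obtain v t where vt: "x = (v, t)" by (cases x)
   have "?e t v : B" using x vt by (simp add: hat_def)
   then obtain d where d: "d <= r" "(c, ?e t v) :
    {(a, b). a : B & b : B & {a, b} : snd (trace_graph V fn L D)} ^^ d" using c(2) by blast
   have "((?e t v, ?z), x) : R B ^^ D" using relpow_sym[OF symR down] x vt by blast
   then have "((c, ?z), x) : R B ^^ ((2 * D + 1) * d + D)" using reach[OF d(2)] unfolding relpow_add by blast
   moreover have "(2 * D + 1) * d + D <= (2 * D + 1) * r + D" using d(1) by (intro add_mono mult_le_mono) auto
   ultimately show ?thesis by blast
  qed
  moreover have "(c, ?z) : hat B" using c(1) BV[OF B] hat_z by blast
  moreover have "hat B <= fst (lexprod G ?T)" by (auto simp: hat_def lexprod_def G(1))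
  ultimately show ?thesis unfolding branch_set_def R_def by blast
 qed
 have inj: "inj_on hat (fst H)"
 proof (rule inj_onI)
  fix A B assume "A : fst H" "B : fst H" "hat A = hat B"
  then show "A = B" using BV hat_z by (metis subsetD subsetI subset_antisym)
 qed
 have HP: "snd H <= Pow (fst H)" using H by (rule shallow_minor_edge_subset)
 have "shallow_minor ((2 * D + 1) * r + D) (lexprod G ?T) (hat ` fst H, (%e. hat ` e) ` snd H)"
 proof (rule shallow_minorI)
  show "branch_set ((2 * D + 1) * r + D) (lexprod G ?T) B"
   if "B : fst (hat ` fst H, (%e. hat ` e) ` snd H)" for B using that branch by auto
  show "A Int B = {}" if "A : fst (hat ` fst H, (%e. hat ` e) ` snd H)"
   "B : fst (hat ` fst H, (%e. hat ` e) ` snd H)" "A ~= B" for A B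
  proof -
   obtain A' B' where *: "A = hat A'" "B = hat B'" "A' : fst H" "B' : fst H" using \<open>A : _\<close> \<open>B : _\<close> by auto
   then have "A' Int B' = {}" using shallow_minor_disjoint[OF H] \<open>A ~= B\<close> by blast
   then show ?thesis using * by (auto simp: hat_def)
  qed
  fix e' assume "e' : snd (hat ` fst H, (%e. hat ` e) ` snd H)"
  then obtain e where e: "e' = hat ` e" "e : snd H" by auto
  obtain A B a b where AB: "e = {A, B}" "A : fst H" "B : fst H" "A ~= B"
   and ab: "a : A" "b : B" "{a, b} : snd (trace_graph V fn L D)" by (rule minor_edgeE[OF H e(2)])
  obtain y s t where y: "y : V" "s : ?T" "t : ?T" "a = ?e s y" "b = ?e t y" using edge[OF ab(3)] by blast
  have "hat A ~= hat B" using inj AB by (meson inj_onD)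
  moreover have "(y, s) : hat A" "(y, t) : hat B" using y ab by (auto simp: hat_def)
  moreover have "{(y, s), (y, t)} : snd (lexprod G ?T)" using y G(1) by (intro lexprod_edgeI) auto
  ultimately show "EX A B a b. e' = {A, B} & A : fst (hat ` fst H, (%e. hat ` e) ` snd H) &
   B : fst (hat ` fst H, (%e. hat ` e) ` snd H) & A ~= B & a : A & b : B & {a, b} : snd (lexprod G ?T)"
   using e(1) AB by - (rule exI[of _ "hat A"], rule exI[of _ "hat B"], rule exI[of _ "(y, s)"],
    rule exI[of _ "(y, t)"], simp)
 qed
 moreover have "inj_on (%e. hat ` e) (snd H)" using inj_on_subset[OF inj_on_image_Pow[OF inj] HP] .
 ultimately show ?thesis by (intro exI[of _ "(hat ` fst H, (%e. hat ` e) ` snd H)"]) (simp add: card_image inj)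
qed

subsection \<open>A structured language for random access machines\<close>

text \<open>\<open>Rep\<close> reads its bound once, on entry. So every program terminates, and
  \<open>sem\<close> and \<open>cost\<close> are defined by structural recursion without side
  conditions.\<close>

datatype 'p com = Skip | Prm 'p | Seq "'p com" "'p com" (infixr ";;" 60)
 | IfNZ nat "'p com" | Rep nat "'p com"

type_synonym 'm state = "(nat => nat) \<times> 'm"

fun sem :: "('p => 'm state => 'm state) => 'p com => 'm state => 'm state" where
 "sem e Skip s = s"
| "sem e (Prm p) s = e p s"
| "sem e (c ;; d) s = sem e d (sem e c s)"
| "sem e (IfNZ x c) s = (if fst s x = 0 then s else sem e c s)"
| "sem e (Rep x c) s = (sem e c ^^ fst s x) s"

text \<open>The constants are those of the compilation \<open>code\<close> below, so that \<open>cost\<close> is the exact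
 running time of the machine program.\<close>

fun cost :: "('p => 'm state => 'm state) => 'p com => 'm state => nat" where
 "cost e Skip s = 0"
| "cost e (Prm p) s = 1"
| "cost e (c ;; d) s = cost e c s + cost e d (sem e c s)"
| "cost e (IfNZ x c) s = 1 + (if fst s x = 0 then 0 else cost e c s)"
| "cost e (Rep x c) s = 2 + (\<Sum>j<fst s x. 3 + cost e c ((sem e c ^^ j) s))"

primrec seqs :: "'p com list => 'p com" where
 "seqs [] = Skip"
| "seqs (c # cs) = c ;; seqs cs"

definition ram :: "(nat => nat) => instr => (nat => nat) state => (nat => nat) state" where
 "ram g i s = snd (exec g i (0, s))"

abbreviation "exr g == sem (ram g)"

text \<open>\<open>ok\<close> stands for any bound on numbers. Only the state after a primitive is
  inspected; loop counters and the initial state are treated separately when the code is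
  verified.\<close>

fun safe :: "(nat => bool) => (nat => nat) => instr com => (nat => nat) state => bool" where
 "safe ok g Skip s = (True)"
| "safe ok g (Prm p) s = ((ALL x. ok (fst (ram g p s) x) & ok (snd (ram g p s) x)))"
| "safe ok g (c ;; d) s = (safe ok g c s & safe ok g d (exr g c s))"
| "safe ok g (IfNZ x c) s = ((fst s x ~= 0 --> safe ok g c s))"
| "safe ok g (Rep x c) s = ((ALL j<fst s x. safe ok g c ((exr g c ^^ j) s)))"

fun clen :: "instr com => nat" where
 "clen Skip = 0"
| "clen (Prm p) = 1"
| "clen (c ;; d) = clen c + clen d"
| "clen (IfNZ x c) = Suc (clen c)"
| "clen (Rep x c) = clen c + 4"

text \<open>Register \<open>z\<close> holds \<open>0\<close>, register \<open>Suc z\<close> holds \<open>1\<close>, and the registers from \<open>k\<close> on serve as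
 loop counters; \<open>a\<close> is the address of the code.\<close>

fun code :: "nat => nat => nat => instr com => instr list" where
 "code z k a Skip = []"
| "code z k a (Prm p) = [p]"
| "code z k a (c ;; d) = code z k a c @ code z k (a + clen c) d"
| "code z k a (IfNZ x c) = Jump_Zero x (Suc (a + clen c)) # code z k (Suc a) c"
| "code z k a (Rep x c) = Add k x z # Jump_Zero k (a + 4 + clen c) # Sub k k (Suc z) #
   code z (Suc k) (a + 3) c @ [Jump_Zero z (Suc a)]"

fun instr_ok :: "nat => instr => bool" where
 "instr_ok z (Const i n) = (i < z)"
| "instr_ok z (Add i j l) = (i < z & j < z & l < z)"
| "instr_ok z (Sub i j l) = (i < z & j < z & l < z)"
| "instr_ok z (Mult i j l) = (i < z & j < z & l < z)"
| "instr_ok z (Div i j l) = (i < z & j < z & l < z)"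
| "instr_ok z (Load i j) = (i < z & j < z)"
| "instr_ok z (Store i j) = (i < z & j < z)"
| "instr_ok z (Jump_Zero i n) = (False)"
| "instr_ok z (Oracle i j) = (i < z & j < z)"

fun com_ok :: "('p => bool) => nat => 'p com => bool" where
 "com_ok p z Skip = (True)"
| "com_ok p z (Prm i) = (p i)"
| "com_ok p z (c ;; d) = (com_ok p z c & com_ok p z d)"
| "com_ok p z (IfNZ x c) = (x < z & com_ok p z c)"
| "com_ok p z (Rep x c) = (x < z & com_ok p z c)"

lemma com_ok_seqs [simp]: "com_ok p z (seqs cs) = ((ALL c:set cs. com_ok p z c))" by (induction cs) auto

lemma length_code [simp]: "length (code z k a c) = clen c" by (induction c arbitrary: k a) auto

fun okc :: "(nat => bool) => config => bool" where
 "okc ok (pc, r, m) = ((ALL x. ok (r x) & ok (m x)))"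

definition reach :: "(nat => bool) => (nat => nat) => instr list => config => nat => config => bool" where
 "reach ok g P c t c' = ((step g P ^^ t) c = c' & (ALL s<=t. okc ok ((step g P ^^ s) c)))"

lemma reach_refl: "okc ok c ==> reach ok g P c 0 c" by (simp add: reach_def)

lemma reach_trans:
 assumes "reach ok g P c t c'" "reach ok g P c' t' c''"
 shows "reach ok g P c (t + t') c''"
proof -
 have 1: "(step g P ^^ (t + s)) c = (step g P ^^ s) c'" for s
 proof -
  have "(step g P ^^ t) c = c'" using assms(1) by (simp add: reach_def)
  then show ?thesis unfolding add.commute[of t s] funpow_add comp_apply by simp
 qed
 have "okc ok ((step g P ^^ s) c)" if "s <= t + t'" for s
 proof (cases "s <= t")
  case True
  then show ?thesis using assms(1) by (simp add: reach_def)
 next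
  case False
  then have "(step g P ^^ s) c = (step g P ^^ (s - t)) c'" using 1[of "s - t"] by simp
  then show ?thesis using assms(2) that by (simp add: reach_def)
 qed
 then show ?thesis using 1[of t'] assms(2) by (simp add: reach_def)
qed

lemma reach_step:
 assumes "okc ok c" "okc ok c'" "fst c < length P" "exec g (P ! fst c) c = c'"
 shows "reach ok g P c 1 c'" using assms by (auto simp: reach_def step_def le_Suc_eq)

lemma reach_final: "reach ok g P c t c' ==> okc ok c'" by (auto simp: reach_def)

definition emb :: "instr list => nat => instr list => bool" where
 "emb P a xs = ((EX pre post. P = pre @ xs @ post & length pre = a))"

lemma emb_append: "emb P a (xs @ ys) ==> emb P a xs & emb P (a + length xs) ys" unfolding emb_def by (metis append.assoc length_append)

lemma emb_Cons: "emb P a (x # xs) ==> a < length P & P ! a = x & emb P (Suc a) xs"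
proof -
 assume "emb P a (x # xs)"
 then obtain pre post where "P = pre @ (x # xs) @ post" "length pre = a" unfolding emb_def by blast
 then have *: "P = (pre @ [x]) @ xs @ post" "length (pre @ [x]) = Suc a" "a < length P" "P ! a = x" by auto
 have "emb P (Suc a) xs" unfolding emb_def using *(1,2) by blast
 then show ?thesis using *(3,4) by blast
qed

definition agree :: "nat => (nat => nat) => (nat => nat) state => bool" where
 "agree z r s = ((ALL x<z. r x = fst s x) & r z = 0 & r (Suc z) = 1)"

lemma prim_reach:
 assumes "instr_ok z p" "a < length P" "P ! a = p" "agree z r s" "z <= k"
  "ALL x. ok (r x)" "ALL x. ok (snd s x)" "safe ok g (Prm p) s"
 shows "EX r'. reach ok g P (a, r, snd s) 1 (Suc a, r', snd (ram g p s)) & agree z r' (ram g p s) &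
  (ALL x>=z. r' x = r x)"
proof -
 define r' where "r' = (%x. if x < z then fst (ram g p s) x else r x)"
 obtain rs m where s: "s = (rs, m)" by (cases s)
 have ex: "exec g (P ! a) (a, r, snd s) = (Suc a, r', snd (ram g p s))"
  using assms(1,3,4) by (cases p) (auto simp: r'_def ram_def s agree_def fun_eq_iff)
 have "okc ok (Suc a, r', snd (ram g p s))" using assms(6,8) by (auto simp: r'_def)
 then have "reach ok g P (a, r, snd s) 1 (Suc a, r', snd (ram g p s))" using ex assms(2,6,7) by (intro reach_step) auto
 moreover have "agree z r' (ram g p s)" using assms(4) by (auto simp: agree_def r'_def)
 ultimately show ?thesis by (auto simp: r'_def)
qed

text \<open>Code compiled with \<open>k\<close> returns all registers from \<open>z\<close> up to
  but excluding \<open>k\<close> unchanged, so an inner loop never disturbs an outer counter.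
  Counters run downwards from a value that was \<open>ok\<close>, and \<open>ok\<close> is downward
  closed, so they need no bound of their own.\<close>

lemma code_correct:
 assumes dc: "ALL x y. ok y --> x <= y --> ok x" and one: "ok 1"
 shows "com_ok (instr_ok z) z c ==> emb P a (code z k a c) ==> Suc z < k ==> agree z r s ==>
  ALL x. ok (r x) ==> ALL x. ok (snd s x) ==> safe ok g c s ==>
  EX r'. reach ok g P (a, r, snd s) (cost (ram g) c s) (a + clen c, r', snd (exr g c s)) &
   agree z r' (exr g c s) & (ALL x. z <= x --> x < k --> r' x = r x)"
proof (induction c arbitrary: k a r s)
 case Skip
 then show ?case by (intro exI[of _ r]) (auto intro: reach_refl)
next
 case (Prm p)
 have "a < length P" "P ! a = p" using emb_Cons[of P a p "[]"] Prm.prems(2) by auto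
 from prim_reach[OF _ this Prm.prems(4), of k ok g] Prm.prems show ?case by auto
next
 case (Seq c d)
 have em: "emb P a (code z k a c)" "emb P (a + clen c) (code z k (a + clen c) d)" using emb_append Seq.prems(2) by fastforce+
 obtain r1 where r1: "reach ok g P (a, r, snd s) (cost (ram g) c s) (a + clen c, r1, snd (exr g c s))"
  "agree z r1 (exr g c s)" "ALL x. z <= x --> x < k --> r1 x = r x" using Seq.IH(1)[OF _ em(1) Seq.prems(3,4,5,6)] Seq.prems(1,7) by auto
 have "ALL x. ok (r1 x)" "ALL x. ok (snd (exr g c s) x)" using reach_final[OF r1(1)] by auto
 then obtain r2 where r2: "reach ok g P (a + clen c, r1, snd (exr g c s)) (cost (ram g) d (exr g c s))
   (a + clen c + clen d, r2, snd (exr g d (exr g c s)))"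
  "agree z r2 (exr g d (exr g c s))" "ALL x. z <= x --> x < k --> r2 x = r1 x" using Seq.IH(2)[OF _ em(2) Seq.prems(3) r1(2)] Seq.prems(1,7) by auto
 show ?case using reach_trans[OF r1(1) r2(1)] r1 r2 by (intro exI[of _ r2]) (auto simp: add.assoc)
next
 case (IfNZ x c)
 have em: "a < length P" "P ! a = Jump_Zero x (Suc (a + clen c))" "emb P (Suc a) (code z k (Suc a) c)" using emb_Cons IfNZ.prems(2) by fastforce+
 have rx: "r x = fst s x" using IfNZ.prems by (auto simp: agree_def)
 show ?case
 proof (cases "fst s x = 0")
  case True
  have "reach ok g P (a, r, snd s) 1 (Suc (a + clen c), r, snd s)" using em True rx IfNZ.prems by (intro reach_step) auto
  then show ?thesis using True IfNZ.prems by (intro exI[of _ r]) auto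
 next
  case False
  have j: "reach ok g P (a, r, snd s) 1 (Suc a, r, snd s)" using em False rx IfNZ.prems by (intro reach_step) auto
  obtain r1 where r1: "reach ok g P (Suc a, r, snd s) (cost (ram g) c s) (Suc a + clen c, r1, snd (exr g c s))"
   "agree z r1 (exr g c s)" "ALL x. z <= x --> x < k --> r1 x = r x" using IfNZ.IH[OF _ em(3) IfNZ.prems(3,4,5,6)] IfNZ.prems(1,7) False by auto
  show ?thesis using reach_trans[OF j r1(1)] r1 False by (intro exI[of _ r1]) auto
 qed
next
 case (Rep x c)
 let ?f = "exr g c"
 have em: "a < length P" "P ! a = Add k x z" "Suc a < length P" "P ! Suc a = Jump_Zero k (a + 4 + clen c)"
  "Suc (Suc a) < length P" "P ! Suc (Suc a) = Sub k k (Suc z)"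
  "emb P (a + 3) (code z (Suc k) (a + 3) c @ [Jump_Zero z (Suc a)])" using Rep.prems(2) by (auto dest!: emb_Cons simp: numeral_3_eq_3)
 have em2: "emb P (a + 3) (code z (Suc k) (a + 3) c)" "a + 3 + clen c < length P"
  "P ! (a + 3 + clen c) = Jump_Zero z (Suc a)" using emb_append[OF em(7)] emb_Cons by fastforce+
 have zk: "z < k" "Suc z < k" using Rep.prems by auto
 \<comment> \<open>Entered at the test behind the initialisation of the counter, so that an
   induction on the counter value \<open>n\<close> is possible. The jump back tests register
   \<open>z\<close>, which is 0, and is therefore unconditional.\<close>
 have loop: "EX r'. reach ok g P (Suc a, r, snd s) (1 + (\<Sum>j<n. 3 + cost (ram g) c ((?f ^^ j) s)))
    (a + clen (Rep x c), r', snd ((?f ^^ n) s)) & agree z r' ((?f ^^ n) s) &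
    (ALL x. z <= x --> x < k --> r' x = r x)"
  if "agree z r s" "r k = n" "ALL x. ok (r x)" "ALL x. ok (snd s x)" "ALL j<n. safe ok g c ((?f ^^ j) s)" for n r s using that
 proof (induction n arbitrary: r s)
  case 0
  have "reach ok g P (Suc a, r, snd s) 1 (a + 4 + clen c, r, snd s)" using em 0 by (intro reach_step) auto
  then show ?case using 0 by (intro exI[of _ r]) (auto simp: algebra_simps)
 next
  case (Suc n)
  let ?r1 = "r(k := n)"
  have a1: "agree z ?r1 s" using Suc.prems(1) zk by (auto simp: agree_def)
  have "ok (Suc n)" using Suc.prems(2,3) by metis
  then have "ok n" using dc le_add2 plus_1_eq_Suc by metis
  then have okn: "ALL x. ok (?r1 x)" using Suc.prems(3) by simp
  have s1: "reach ok g P (Suc a, r, snd s) 1 (Suc (Suc a), r, snd s)" using em Suc.prems by (intro reach_step) auto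
  have s2: "reach ok g P (Suc (Suc a), r, snd s) 1 (a + 3, ?r1, snd s)" using em Suc.prems okn by (intro reach_step) (auto simp: agree_def)
  have sc: "safe ok g c s" using Suc.prems(5) by force
  have cc: "com_ok (instr_ok z) z c" "Suc z < Suc k" using Rep.prems zk by auto
  obtain r2 where r2: "reach ok g P (a + 3, ?r1, snd s) (cost (ram g) c s) (a + 3 + clen c, r2, snd (?f s))"
   "agree z r2 (?f s)" "ALL x. z <= x --> x < Suc k --> r2 x = ?r1 x" using Rep.IH[OF cc(1) em2(1) cc(2) a1 okn Suc.prems(4) sc] by (elim exE conjE)
  have ok2: "ALL x. ok (r2 x)" "ALL x. ok (snd (?f s) x)" using reach_final[OF r2(1)] by auto
  have s3: "reach ok g P (a + 3 + clen c, r2, snd (?f s)) 1 (Suc a, r2, snd (?f s))" using em2 ok2 r2(2) by (intro reach_step) (auto simp: agree_def)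
  have "r2 k = n" using r2(3) zk by auto
  moreover have "ALL j<n. safe ok g c ((?f ^^ j) (?f s))" using Suc.prems(5) by (metis Suc_less_eq comp_apply funpow_Suc_right)
  ultimately obtain r3 where r3: "reach ok g P (Suc a, r2, snd (?f s)) (1 + (\<Sum>j<n. 3 + cost (ram g) c ((?f ^^ j) (?f s))))
    (a + clen (Rep x c), r3, snd ((?f ^^ n) (?f s)))" "agree z r3 ((?f ^^ n) (?f s))"
    "ALL x. z <= x --> x < k --> r3 x = r2 x" using Suc.IH[OF r2(2) _ ok2] by blast
  have t: "1 + (\<Sum>j<Suc n. 3 + cost (ram g) c ((?f ^^ j) s)) =
   1 + (1 + (cost (ram g) c s + (1 + (1 + (\<Sum>j<n. 3 + cost (ram g) c ((?f ^^ j) (?f s)))))))"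
   by (simp only: sum.lessThan_Suc_shift funpow_0 funpow_Suc_right comp_apply)
  have f: "(?f ^^ n) (?f s) = (?f ^^ Suc n) s" by (simp only: funpow_Suc_right comp_apply)
  show ?case using reach_trans[OF s1 reach_trans[OF s2 reach_trans[OF r2(1) reach_trans[OF s3 r3(1)]]]] r3(2,3) r2(3) zk
   unfolding t f by (intro exI[of _ r3]) auto
 qed
 let ?r0 = "r(k := fst s x)"
 have x: "x < z" "r x = fst s x" using Rep.prems by (auto simp: agree_def)
 have ok0: "ALL x. ok (?r0 x)" using Rep.prems(5) x by (metis fun_upd_apply)
 have h1: "reach ok g P (a, r, snd s) 1 (Suc a, ?r0, snd s)" using em ok0 x Rep.prems by (intro reach_step) (auto simp: agree_def)
 obtain r' where r': "reach ok g P (Suc a, ?r0, snd s) (1 + (\<Sum>j<fst s x. 3 + cost (ram g) c ((?f ^^ j) s)))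
    (a + clen (Rep x c), r', snd ((?f ^^ fst s x) s))" "agree z r' ((?f ^^ fst s x) s)"
    "ALL x. z <= x --> x < k --> r' x = ?r0 x" using loop[of ?r0 s "fst s x"] Rep.prems ok0 zk by (auto simp: agree_def)
 show ?case using reach_trans[OF h1 r'(1)] r'(2,3) zk by (intro exI[of _ r']) auto
qed

definition machine :: "nat => instr com => instr list" where
 "machine z c = Const (Suc z) 1 # code z (z + 2) 1 c"

lemma machine_reach:
 assumes dc: "ALL x y. ok y --> x <= y --> ok x" and one: "ok 1"
  and c: "com_ok (instr_ok z) z c" "0 < z"
  and ok: "ok (length xs)" "ALL i<length xs. ok (xs ! i)"
  and safe: "safe ok g c (snd (init_config xs))"
 shows "EX r. reach ok g (machine z c) (init_config xs) (Suc (cost (ram g) c (snd (init_config xs))))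
   (length (machine z c), r, snd (exr g c (snd (init_config xs)))) &
   r 0 = fst (exr g c (snd (init_config xs))) 0"
proof -
 let ?P = "machine z c" and ?s = "snd (init_config xs)"
 let ?r = "(fst ?s)(Suc z := 1)"
 have ok0: "ok 0" using dc one by blast
 have i: "init_config xs = (0, fst ?s, snd ?s)" by (simp add: init_config_def)
 have okr: "ALL x. ok (?r x)" using ok ok0 one by (auto simp: init_config_def)
 have okm: "ALL x. ok (snd ?s x)" using ok ok0 by (auto simp: init_config_def)
 have 1: "reach ok g ?P (init_config xs) 1 (1, ?r, snd ?s)"
 proof (rule reach_step)
  show "okc ok (1, ?r, snd ?s)" using okr okm unfolding okc.simps by blast
  have "ok (fst ?s x)" for x using ok ok0 by (simp add: init_config_def)
  then have "okc ok (0, fst ?s, snd ?s)" unfolding okc.simps using okm by blast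
  then show "okc ok (init_config xs)" by (subst i)
  show "fst (init_config xs) < length ?P" by (simp add: init_config_def machine_def)
  have "?P ! fst (init_config xs) = Const (Suc z) 1" by (simp add: init_config_def machine_def)
  then show "exec g (?P ! fst (init_config xs)) (init_config xs) = (1, ?r, snd ?s)" by (simp add: init_config_def)
 qed
 have em: "emb ?P 1 (code z (z + 2) 1 c)" unfolding emb_def by (intro exI[of _ "[Const (Suc z) 1]"] exI[of _ "[]"]) (simp add: machine_def)
 have ag: "agree z ?r ?s" using c(2) by (auto simp: agree_def init_config_def)
 obtain r' where r': "reach ok g ?P (1, ?r, snd ?s) (cost (ram g) c ?s) (1 + clen c, r', snd (exr g c ?s))"
  "agree z r' (exr g c ?s)"
 proof -
  have "Suc z < z + 2" by simp
  from code_correct[OF dc one c(1) em this ag okr okm safe] show ?thesis using that by (elim exE conjE)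
 qed
 have "reach ok g ?P (init_config xs) (Suc (cost (ram g) c ?s)) (length ?P, r', snd (exr g c ?s))"
  using reach_trans[OF 1 r'(1)] by (simp add: machine_def)
 then show ?thesis using r'(2) c(2) by (auto simp: agree_def)
qed

text \<open>With \<open>ok\<close> constantly true, safety is void. The version with resource bounds
  takes the word bound for \<open>ok\<close> instead.\<close>

lemma machine_computes:
 assumes c: "com_ok (instr_ok z) z c" "0 < z"
  and res: "exr g c (snd (init_config xs)) = (r, m)" "map m [0..<r 0] = ys"
 shows "computes g (machine z c) xs ys"
proof -
 have safe: "safe (%_. True) g c s" for s by (induction c arbitrary: s) auto
 obtain r' where "reach (%_. True) g (machine z c) (init_config xs) (Suc (cost (ram g) c (snd (init_config xs))))
   (length (machine z c), r', m)" "r' 0 = r 0"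
  using machine_reach[where ok = "%_. True" and xs = xs and g = g, OF _ _ c _ _ safe] unfolding res(1) by auto
 then show ?thesis using res(2) unfolding computes_def
  by (intro exI[of _ "Suc (cost (ram g) c (snd (init_config xs)))"]) (simp add: reach_def halted_def)
qed

lemma machine_computes_within:
 assumes c: "com_ok (instr_ok z) z c" "0 < z"
  and W: "1 <= W" "length xs <= W" "ALL i<length xs. xs ! i <= W"
  and safe: "safe (%x. x <= W) (%_. 0) c (snd (init_config xs))"
  and T: "cost (ram (%_. 0)) c (snd (init_config xs)) < T"
  and res: "sem (ram (%_. 0)) c (snd (init_config xs)) = (r, m)" "map m [0..<r 0] = ys"
 shows "computes_within T W (machine z c) xs ys"
proof -
 let ?t = "Suc (cost (ram (%_. 0)) c (snd (init_config xs)))"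
 obtain r' where r': "reach (%x. x <= W) (%_. 0) (machine z c) (init_config xs) ?t
   (length (machine z c), r', m)" "r' 0 = r 0"
  using machine_reach[where ok = "%x. x <= W", OF _ W(1) c W(2,3) safe] unfolding res(1) by auto
 have wb: "okc (%x. x <= W) c = (word_bounded W c)" for c by (cases c) auto
 show ?thesis unfolding computes_within_def by (rule exI[of _ ?t]) (use r' res(2) T in "auto simp: reach_def halted_def wb")
qed

lemma ram_simps [simp]:
 "ram g (Const i n) s = ((fst s)(i := n), snd s)"
 "ram g (Add i j l) s = ((fst s)(i := fst s j + fst s l), snd s)"
 "ram g (Sub i j l) s = ((fst s)(i := fst s j - fst s l), snd s)"
 "ram g (Mult i j l) s = ((fst s)(i := fst s j * fst s l), snd s)"
 "ram g (Div i j l) s = ((fst s)(i := fst s j div fst s l), snd s)"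
 "ram g (Load i j) s = ((fst s)(i := snd s (fst s j)), snd s)"
 "ram g (Store i j) s = (fst s, (snd s)(fst s i := fst s j))"
 "ram g (Oracle i j) s = ((fst s)(i := g (fst s j)), snd s)" by (cases s; simp add: ram_def)+

section \<open>Programs on named arrays and their layout in memory\<close>

datatype 'a prim = SetC nat nat | Inc nat | Mov nat nat | Sb nat nat nat | AddC nat nat nat
 | Rd nat 'a nat | Wr 'a nat nat

text \<open>Apart from constants and the saturated sum, a primitive exceeds the numbers at hand by
  at most one. So all numbers are bounded by the initial ones, the constants and \<open>cap\<close>,
  plus the running time; plain addition could double them in every step.\<close>

fun aram :: "nat => 'a prim => ('a => nat => nat) state => ('a => nat => nat) state" where
 "aram cap (SetC x c) s = ((fst s)(x := c), snd s)"
| "aram cap (Inc x) s = ((fst s)(x := Suc (fst s x)), snd s)"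
| "aram cap (Mov x y) s = ((fst s)(x := fst s y), snd s)"
| "aram cap (Sb x y z) s = ((fst s)(x := fst s y - fst s z), snd s)"
| "aram cap (AddC x y z) s = ((fst s)(x := min cap (fst s y + fst s z)), snd s)"
| "aram cap (Rd x a y) s = ((fst s)(x := snd s a (fst s y)), snd s)"
| "aram cap (Wr a x y) s = (fst s, (snd s)(a := (snd s a)(fst s x := fst s y)))"

abbreviation "exa cap == sem (aram cap)"
abbreviation "tim cap == cost (aram cap)"
definition below :: "nat => (nat => nat) state => bool" where
 "below W s = ((ALL x. fst s x <= W & snd s x <= W))"

abbreviation "safeW W g c s \<equiv> safe (%x. x <= W) g c s"

lemma safe_Prm: "safeW W g (Prm p) s = (below W (ram g p s))" by (simp add: below_def)

lemma below_reg: "below W s ==> n <= W ==> below W ((fst s)(x := n), snd s)" by (simp add: below_def)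

lemma below_mem: "below W s ==> n <= W ==> below W (fst s, (snd s)(x := n))" by (simp add: below_def)

lemma seqs_inv:
 assumes "I 0 s" "!!i s. i < length cs ==> I i s ==> I (Suc i) (exr g (cs ! i) s) &
   safeW W g (cs ! i) s & cost (ram g) (cs ! i) s <= C"
 shows "I (length cs) (exr g (seqs cs) s) & safeW W g (seqs cs) s &
  cost (ram g) (seqs cs) s <= length cs * C"
 using assms
proof (induction cs arbitrary: I s)
 case (Cons c cs)
 have 1: "I (Suc 0) (exr g c s) & safeW W g c s & cost (ram g) c s <= C" using Cons.prems(2)[of 0] Cons.prems(1) by simp
 have "I (Suc (length cs)) (exr g (seqs cs) (exr g c s)) &
   safeW W g (seqs cs) (exr g c s) & cost (ram g) (seqs cs) (exr g c s) <= length cs * C"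
 proof (rule Cons.IH[of "%i. I (Suc i)"])
  show "I (Suc 0) (exr g c s)" using 1 by simp
  fix i s assume "i < length cs" "I (Suc i) s"
  then show "I (Suc (Suc i)) (exr g (cs ! i) s) & safeW W g (cs ! i) s & cost (ram g) (cs ! i) s <= C" using Cons.prems(2)[of "Suc i"] by simp
 qed
 then show ?case using 1 by simp
qed simp

lemma rep_inv:
 assumes "I 0 s" "fst s x = n" "!!i s. i < n ==> I i s ==> I (Suc i) (exr g c s) &
   safeW W g c s & cost (ram g) c s <= C"
 shows "I n (exr g (Rep x c) s) & safeW W g (Rep x c) s &
  cost (ram g) (Rep x c) s <= 2 + n * (3 + C)"
proof -
 let ?f = "exr g c"
 have I: "I j ((?f ^^ j) s)" if "j <= n" for j using that by (induction j) (use assms in auto)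
 have "safeW W g c ((?f ^^ j) s)" "cost (ram g) c ((?f ^^ j) s) <= C" if "j < n" for j using I[of j] assms(3)[OF that] that by auto
 moreover from this have "(\<Sum>j<n. 3 + cost (ram g) c ((?f ^^ j) s)) <= (\<Sum>j<n. 3 + C)" by (intro sum_mono) auto
 ultimately show ?thesis using I[of n] assms(2) by simp
qed

text \<open>Uniqueness of division with remainder; it keeps interleaved arrays apart.\<close>

lemma div_add_inj:
 fixes K :: nat
 assumes "i < K" "j < K"
 shows "v * K + i = w * K + j = (v = w & i = j)"
proof
 assume e: "v * K + i = w * K + j"
 have "(v * K + i) div K = v" "(w * K + j) div K = w" using assms by simp_all
 then have "v = w" using e by metis
 then show "v = w & i = j" using e by simp
qed simp

lemma concat_map_upt:
 "concat (map (%j. map (f j) [0..<n]) [0..<m]) = map (%i. f (i div n) (i mod n)) [0..<m * n]"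
proof (induction m)
 case (Suc m)
 have "[0..<Suc m * n] = [0..<m * n] @ map (%i. i + m * n) [0..<n]" using upt_add_eq_append[of 0 "m * n" n] by (simp add: map_add_upt add.commute)
 then show ?case using Suc by simp
qed simp

text \<open>The number \<open>K\<close> of arrays is fixed, but their length is known only at run
  time. So the arrays are interleaved, with entry \<open>v\<close> of \<open>a\<close> at address
  \<open>base + v * K + ix a\<close>. Registers below \<open>R\<close> belong to the program; those
  from \<open>R\<close> to \<open>R + 7\<close> hold temporaries and the constants of
  \<open>cregs\<close>.\<close>

locale layout =
 fixes R K :: nat and ix :: "'a => nat" and N :: "'a set" and cm :: nat
 assumes inj: "inj_on ix N" and ixK: "!!a. a : N ==> ix a < K" and R0: "0 < R"
begin

definition addr :: "'a => nat => instr com" where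
 "addr a y = Prm (Mult R y (R+2)) ;; Prm (Const (R+1) (ix a)) ;; Prm (Add R R (R+1)) ;; Prm (Add R R (R+3))"

text \<open>The saturated sum is obtained as \<open>s - (s - cap)\<close> with truncated
  subtraction.\<close>

fun trp :: "'a prim => instr com" where
 "trp (SetC x c) = Prm (Const x c)"
| "trp (Inc x) = Prm (Add x x (R+4))"
| "trp (Mov x y) = Prm (Const R 0) ;; Prm (Add x y R)"
| "trp (Sb x y z) = Prm (Sub x y z)"
| "trp (AddC x y z) = Prm (Add R y z) ;; Prm (Sub (R+1) R (R+5)) ;; Prm (Sub x R (R+1))"
| "trp (Rd x a y) = addr a y ;; Prm (Load x R)"
| "trp (Wr a x y) = addr a x ;; Prm (Store R y)"

fun tr :: "'a prim com => instr com" where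
 "tr Skip = Skip"
| "tr (Prm p) = trp p"
| "tr (c ;; d) = tr c ;; tr d"
| "tr (IfNZ x c) = IfNZ x (tr c)"
| "tr (Rep x c) = Rep x (tr c)"

fun pok :: "'a prim => bool" where
 "pok (SetC x c) = (x < R & c <= cm)"
| "pok (Inc x) = (x < R)"
| "pok (Mov x y) = (x < R & y < R)"
| "pok (Sb x y z) = (x < R & y < R & z < R)"
| "pok (AddC x y z) = (x < R & y < R & z < R)"
| "pok (Rd x a y) = (x < R & y < R & a : N)"
| "pok (Wr a x y) = (x < R & y < R & a : N)"

lemma com_ok_tr: "com_ok pok R c ==> R + 8 <= z ==> com_ok (instr_ok z) z (tr c)"
proof (induction c)
 case (Prm p)
 then show ?case by (cases p) (auto simp: addr_def)
qed auto

definition cregs :: "nat => nat => (nat => nat) state => bool" where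
 "cregs base cap s = (fst s (R+2) = K & fst s (R+3) = base & fst s (R+4) = 1 & fst s (R+5) = cap)"

text \<open>Memory below \<open>base\<close> is reserved for input and output and keeps its contents
  \<open>m0\<close> while the array program runs.\<close>

definition rel :: "nat => nat => (nat => nat) => (nat => nat) state => ('a => nat => nat) state => bool" where
 "rel base cap m0 s1 s2 = ((ALL x<R. fst s1 x = fst s2 x) & cregs base cap s1 &
   (ALL a:N. ALL v. snd s1 (base + v * K + ix a) = snd s2 a v) & (ALL i<base. snd s1 i = m0 i))"

definition vb :: "nat => ('a => nat => nat) state => bool" where
 "vb V s = ((ALL x<R. fst s x <= V) & (ALL a:N. ALL v. snd s a v <= V))"

lemma vb_mono: "vb V s ==> V <= V' ==> vb V' s" unfolding vb_def by (meson order.trans)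

text \<open>Room for the addresses of all entries with index up to \<open>V\<close>, and for a sum
  of two numbers before it is cut off at \<open>cap\<close>.\<close>

definition fits :: "nat => nat => nat => bool" where
 "fits W base V = (base + V * K + K + 2 * V + 1 <= W)"

lemma fits_mono:
 assumes "fits W base V" "V' <= V"
 shows "fits W base V'"
proof -
 have "V' * K <= V * K" using assms(2) by simp
 then show ?thesis using assms unfolding fits_def by linarith
qed

lemma addr_sem:
 assumes "a : N" "y < R" "cregs base cap s" "below W s" "fst s y <= V" "fits W base V"
 shows "fst (exr g (addr a y) s) R = base + fst s y * K + ix a"
  and "!!x. x ~= R ==> x ~= R + 1 ==> fst (exr g (addr a y) s) x = fst s x"
  and "snd (exr g (addr a y) s) = snd s"
  and "safeW W g (addr a y) s" and "below W (exr g (addr a y) s)"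
  and "cost (ram g) (addr a y) s = 4"
proof -
 have 1: "fst s y * K <= V * K" using assms(5) by simp
 have b: "base + fst s y * K + ix a <= W" "fst s y * K <= W" "ix a <= W" "fst s y * K + ix a <= W"
  using 1 ixK[OF assms(1)] assms(6) unfolding fits_def by linarith+
 have c: "fst s (R+2) = K" "fst s (R+3) = base" using assms(3) by (auto simp: cregs_def)
 show "fst (exr g (addr a y) s) R = base + fst s y * K + ix a"
  "!!x. x ~= R ==> x ~= R + 1 ==> fst (exr g (addr a y) s) x = fst s x"
  "snd (exr g (addr a y) s) = snd s" "cost (ram g) (addr a y) s = 4" using assms(2) c by (auto simp: addr_def)
 show "safeW W g (addr a y) s" "below W (exr g (addr a y) s)" using assms(2,4) b c unfolding addr_def sem.simps safe.simps(3) safe_Prm ram_simps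
  by (auto simp: below_def add.commute add.left_commute)
qed

lemma trp_correct:
 assumes p: "pok p" and rel: "rel base cap m0 s1 s2" and W: "below W s1" and V: "vb V s2"
  and le: "cm <= V" "cap <= V" "fits W base V"
 shows "rel base cap m0 (exr g (trp p) s1) (aram cap p s2) & safeW W g (trp p) s1 &
  below W (exr g (trp p) s1) & cost (ram g) (trp p) s1 <= 5 & vb (Suc V) (aram cap p s2)"
proof -
 have cs: "cregs base cap s1" using rel by (simp add: rel_def)
 have c: "fst s1 (R+2) = K" "fst s1 (R+3) = base" "fst s1 (R+4) = 1" "fst s1 (R+5) = cap" using cs by (auto simp: cregs_def)
 have eq: "fst s1 x = fst s2 x" if "x < R" for x using rel that by (simp add: rel_def)
 have mem: "snd s1 (base + v * K + ix a) = snd s2 a v" if "a : N" for a v using rel that by (simp add: rel_def)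
 have low: "snd s1 i = m0 i" if "i < base" for i using rel that by (simp add: rel_def)
 have Vx: "fst s2 x <= V" if "x < R" for x using V that by (simp add: vb_def)
 have Va: "snd s2 a v <= V" if "a : N" for a v using V that by (simp add: vb_def)
 have VW: "2 * V + 1 <= W" using le(3) unfolding fits_def by linarith
 have reg: "rel base cap m0 s1' (aram cap p s2) & vb (Suc V) (aram cap p s2)"
  if s1': "!!y. y < R ==> fst s1' y = ((fst s2)(x := n)) y" "!!y. R + 2 <= y ==> fst s1' y = fst s1 y"
   "snd s1' = snd s1" and s2': "aram cap p s2 = ((fst s2)(x := n), snd s2)" and n: "n <= Suc V" for s1' x n
 proof -
  have "cregs base cap s1'" using c s1'(2) by (simp add: cregs_def)
  moreover have "vb (Suc V) (aram cap p s2)" unfolding s2' vb_def using n le_SucI[OF Vx] le_SucI[OF Va] by auto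
  ultimately show ?thesis using s1' mem low unfolding rel_def s2' by simp
 qed
 show ?thesis
 proof (cases p)
  case (SetC x n)
  have "rel base cap m0 (exr g (trp p) s1) (aram cap p s2) & vb (Suc V) (aram cap p s2)" by (rule reg[of _ x n]) (use p eq le(1) in "auto simp: SetC")
  moreover have "n <= W" using p le(1) VW by (simp add: SetC)
  ultimately show ?thesis unfolding SetC trp.simps safe_Prm using below_reg[OF W] by simp
 next
  case (Inc x)
  have x: "x < R" using p by (simp add: Inc)
  have "rel base cap m0 (exr g (trp p) s1) (aram cap p s2) & vb (Suc V) (aram cap p s2)"
   by (rule reg[of _ x "Suc (fst s2 x)"]) (use x eq c Vx[OF x] in "auto simp: Inc")
  moreover have "Suc (fst s2 x) <= W" using Vx[OF x] VW by simp
  ultimately show ?thesis unfolding Inc trp.simps safe_Prm using below_reg[OF W] eq[OF x] c by simp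
 next
  case (Mov x y)
  have x: "x < R" "y < R" using p by (auto simp: Mov)
  have "rel base cap m0 (exr g (trp p) s1) (aram cap p s2) & vb (Suc V) (aram cap p s2)"
   by (rule reg[of _ x "fst s2 y"]) (use x eq c Vx[OF x(2)] in "auto simp: Mov")
  moreover have "fst s2 y <= W" using Vx[OF x(2)] VW by simp
  ultimately show ?thesis unfolding Mov trp.simps safe.simps(3) safe_Prm using W x eq[OF x(2)] by (auto simp: below_def)
 next
  case (Sb x y z)
  have x: "x < R" "y < R" "z < R" using p by (auto simp: Sb)
  have b: "fst s2 y - fst s2 z <= V" using Vx[OF x(2)] by simp
  have "rel base cap m0 (exr g (trp p) s1) (aram cap p s2) & vb (Suc V) (aram cap p s2)"
   by (rule reg[of _ x "fst s2 y - fst s2 z"]) (use x eq c b in "auto simp: Sb")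
  moreover have "fst s2 y - fst s2 z <= W" using b VW by simp
  ultimately show ?thesis unfolding Sb trp.simps safe_Prm using below_reg[OF W] x eq by simp
 next
  case (AddC x y z)
  have x: "x < R" "y < R" "z < R" using p by (auto simp: AddC)
  have m: "fst s2 y + fst s2 z - (fst s2 y + fst s2 z - cap) = min cap (fst s2 y + fst s2 z)" by simp
  have "rel base cap m0 (exr g (trp p) s1) (aram cap p s2) & vb (Suc V) (aram cap p s2)"
   by (rule reg[of _ x "min cap (fst s2 y + fst s2 z)"]) (use x eq c m le(2) in "auto simp: AddC")
  moreover have "fst s2 y + fst s2 z <= W" using Vx[OF x(2)] Vx[OF x(3)] VW by simp
  ultimately show ?thesis unfolding AddC trp.simps safe.simps(3) safe_Prm using W x eq[OF x(2)] eq[OF x(3)] c by (auto simp: below_def)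
 next
  case (Rd x a y)
  have x: "x < R" "y < R" "a : N" using p by (auto simp: Rd)
  note ad = addr_sem[where g = g, OF x(3,2) cs W, unfolded eq[OF x(2)], OF Vx[OF x(2)] le(3)]
  have "rel base cap m0 (exr g (trp p) s1) (aram cap p s2) & vb (Suc V) (aram cap p s2)" by (rule reg[of _ x "snd s2 a (fst s2 y)"])
    (use x eq ad mem[OF x(3)] le_SucI[OF Va[OF x(3)]] in "auto simp: Rd")
  moreover have "snd s2 a (fst s2 y) <= W" using Va[OF x(3), of "fst s2 y"] VW by linarith
  ultimately show ?thesis unfolding Rd trp.simps safe.simps(3) safe_Prm using below_reg[OF ad(5)] ad mem[OF x(3)] by simp
 next
  case (Wr a x y)
  have x: "x < R" "y < R" "a : N" using p by (auto simp: Wr)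
  note ad = addr_sem[where g = g, OF x(3,1) cs W, unfolded eq[OF x(1)], OF Vx[OF x(1)] le(3)]
  let ?s = "exr g (trp p) s1"
  have s: "fst ?s = fst (exr g (addr a x) s1)"
   "snd ?s = (snd s1)(base + fst s2 x * K + ix a := fst s2 y)" using ad eq x by (auto simp: Wr)
  have "snd ?s (base + v * K + ix b) = snd (aram cap p s2) b v" if b: "b : N" for b v
  proof -
   have "base + v * K + ix b = base + fst s2 x * K + ix a = (v = fst s2 x & b = a)"
    using div_add_inj[OF ixK[OF b] ixK[OF x(3)], of v "fst s2 x"] inj_onD[OF inj _ b x(3)] by auto
   then show ?thesis unfolding s(2) using mem[OF b] by (auto simp: Wr)
  qed
  moreover have "ALL y<R. fst ?s y = fst (aram cap p s2) y" using s(1) ad(2) eq by (simp add: Wr)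
  moreover have "cregs base cap ?s" using c ad(2) unfolding cregs_def s(1) by simp
  moreover have "ALL i<base. snd ?s i = m0 i" unfolding s(2) using low by simp
  ultimately have "rel base cap m0 ?s (aram cap p s2)" unfolding rel_def by blast
  moreover have "vb (Suc V) (aram cap p s2)" unfolding vb_def using le_SucI[OF Vx] le_SucI[OF Va] x by (auto simp: Wr)
  moreover have "fst s2 y <= W" using Vx[OF x(2)] VW by simp
  ultimately show ?thesis unfolding Wr trp.simps safe.simps(3) safe_Prm using below_mem[OF ad(5)] ad x eq by simp
 qed
qed

text \<open>The bound on the numbers grows with the time spent so far, so it is enough that
  \<open>W\<close> has room for \<open>V\<close> plus the total time. The factor 5 belongs to an
  array access: four instructions for the address and one for the transfer.\<close>

lemma tr_correct:
 assumes "com_ok pok R c" "rel base cap m0 s1 s2" "below W s1" "vb V s2"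
  "cm <= V" "cap <= V" "fits W base (V + tim cap c s2)"
 shows "rel base cap m0 (exr g (tr c) s1) (exa cap c s2) & safeW W g (tr c) s1 &
  below W (exr g (tr c) s1) & cost (ram g) (tr c) s1 <= 5 * tim cap c s2 &
  vb (V + tim cap c s2) (exa cap c s2)"
 using assms
proof (induction c arbitrary: s1 s2 V)
 case (Prm p)
 have "fits W base V" using Prm.prems(7) by (rule fits_mono) simp
 then show ?case using trp_correct[of p base cap m0 s1 s2 W V g] Prm.prems by simp
next
 case (Seq c d)
 let ?V = "V + tim cap c s2" and ?t1 = "exr g (tr c) s1" and ?t2 = "exa cap c s2"
 have f: "fits W base ?V" using Seq.prems(7) by (rule fits_mono) simp
 have 1: "rel base cap m0 ?t1 ?t2 & safeW W g (tr c) s1 & below W ?t1 &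
   cost (ram g) (tr c) s1 <= 5 * tim cap c s2 & vb ?V ?t2"
  using Seq.IH(1)[OF _ Seq.prems(2-6) f] Seq.prems(1) by simp
 have "rel base cap m0 (exr g (tr d) ?t1) (exa cap d ?t2) & safeW W g (tr d) ?t1 &
   below W (exr g (tr d) ?t1) & cost (ram g) (tr d) ?t1 <= 5 * tim cap d ?t2 &
   vb (?V + tim cap d ?t2) (exa cap d ?t2)"
  by (rule Seq.IH(2)) (use 1 Seq.prems in "auto simp: add.assoc")
 then show ?case using 1 by (simp add: add.assoc)
next
 case (IfNZ x c)
 have x: "fst s1 x = fst s2 x" using IfNZ.prems(1,2) by (simp add: rel_def)
 show ?case
 proof (cases "fst s2 x = 0")
  case True
  then show ?thesis using IfNZ.prems x vb_mono[OF IfNZ.prems(4)] by simp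
 next
  case False
  let ?V = "V + tim cap c s2"
  have f: "fits W base ?V" using IfNZ.prems(7) False by (auto intro: fits_mono)
  have 1: "rel base cap m0 (exr g (tr c) s1) (exa cap c s2) & safeW W g (tr c) s1 &
    below W (exr g (tr c) s1) & cost (ram g) (tr c) s1 <= 5 * tim cap c s2 &
    vb ?V (exa cap c s2)"
   using IfNZ.IH[OF _ IfNZ.prems(2-6) f] IfNZ.prems(1) by simp
  then show ?thesis using False x vb_mono[of ?V _ "Suc ?V"] by simp
 qed
next
 case (Rep x c)
 let ?f1 = "exr g (tr c)" and ?f2 = "exa cap c" and ?n = "fst s2 x"
 let ?S = "%j. \<Sum>i<j. 3 + tim cap c ((?f2 ^^ i) s2)"
 have x: "fst s1 x = ?n" and okc: "com_ok pok R c" using Rep.prems(1,2) by (auto simp: rel_def)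
 have P: "rel base cap m0 ((?f1 ^^ j) s1) ((?f2 ^^ j) s2) & below W ((?f1 ^^ j) s1) &
   vb (V + ?S j) ((?f2 ^^ j) s2) & (ALL i<j. safeW W g (tr c) ((?f1 ^^ i) s1) &
    cost (ram g) (tr c) ((?f1 ^^ i) s1) <= 5 * tim cap c ((?f2 ^^ i) s2))" if "j <= ?n" for j
  using that
 proof (induction j)
  case 0
  then show ?case using Rep.prems by simp
 next
  case (Suc j)
  let ?V = "V + ?S j" and ?t1 = "(?f1 ^^ j) s1" and ?t2 = "(?f2 ^^ j) s2"
  have IH: "rel base cap m0 ?t1 ?t2" "below W ?t1" "vb ?V ?t2"
   "ALL i<j. safeW W g (tr c) ((?f1 ^^ i) s1) &
    cost (ram g) (tr c) ((?f1 ^^ i) s1) <= 5 * tim cap c ((?f2 ^^ i) s2)"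
   using Suc by auto
  have "?S (Suc j) <= ?S ?n" using Suc.prems by (intro sum_mono2) auto
  then have "fits W base (?V + tim cap c ?t2)" using Rep.prems(7) by (elim fits_mono) simp
  then have "rel base cap m0 (?f1 ?t1) (?f2 ?t2) & safeW W g (tr c) ?t1 & below W (?f1 ?t1) &
    cost (ram g) (tr c) ?t1 <= 5 * tim cap c ?t2 & vb (?V + tim cap c ?t2) (?f2 ?t2)"
   using Rep.prems(5,6) by (intro Rep.IH[OF okc IH(1-3)]) auto
  then show ?case using IH(4) vb_mono[of "?V + tim cap c ?t2" _ "V + ?S (Suc j)"] by (auto simp: less_Suc_eq)
 qed
 have "(\<Sum>j<?n. 3 + cost (ram g) (tr c) ((?f1 ^^ j) s1)) <= (\<Sum>j<?n. 5 * (3 + tim cap c ((?f2 ^^ j) s2)))"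
 proof (rule sum_mono)
  fix j assume "j : {..<?n}"
  then have "cost (ram g) (tr c) ((?f1 ^^ j) s1) <= 5 * tim cap c ((?f2 ^^ j) s2)" using P[of ?n] by simp
  then show "3 + cost (ram g) (tr c) ((?f1 ^^ j) s1) <= 5 * (3 + tim cap c ((?f2 ^^ j) s2))" by simp
 qed
 also have "... = 5 * ?S ?n" by (rule sum_distrib_left[symmetric])
 finally have "cost (ram g) (tr (Rep x c)) s1 <= 5 * tim cap (Rep x c) s2" using x by simp
 moreover have "vb (V + tim cap (Rep x c) s2) ((?f2 ^^ ?n) s2)" using P[of ?n] by (auto intro: vb_mono)
 ultimately show ?case using P[of ?n] x by simp
qed (simp add: vb_def)

end

section \<open>Copying between the tables in memory and the arrays\<close>

context layout
begin

text \<open>Tables start at address 1, behind the size \<open>n\<close>. With \<open>mo\<close> the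
  number of input and output tables together, \<open>base\<close> lies behind both areas, although
  they overlap.\<close>

definition setup_regs :: "nat => nat => instr com" where
 "setup_regs mo cc = Prm (Const 0 0) ;; Prm (Load 0 0) ;; Prm (Const (R+2) K) ;; Prm (Const (R+4) 1) ;;
   Prm (Const (R+3) mo) ;; Prm (Mult (R+3) (R+3) 0) ;; Prm (Add (R+3) (R+3) (R+4)) ;;
   Prm (Const (R+5) cc) ;; Prm (Mult (R+5) (R+5) 0)"

definition cell :: "nat => instr com" where
 "cell j = Prm (Const R j) ;; Prm (Mult R R 0) ;; Prm (Add R R (R+6)) ;; Prm (Add R R (R+4))"

definition saddr :: "'a => instr com" where
 "saddr a = Prm (Mult (R+7) (R+6) (R+2)) ;; Prm (Const R (ix a)) ;; Prm (Add (R+7) (R+7) R) ;;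
   Prm (Add (R+7) (R+7) (R+3))"

definition cin :: "nat => 'a => instr com" where
 "cin j a = cell j ;; Prm (Load (R+1) R) ;; saddr a ;; Prm (Store (R+7) (R+1))"

definition cout :: "nat => 'a => instr com" where
 "cout j a = saddr a ;; Prm (Load (R+7) (R+7)) ;; cell j ;; Prm (Store R (R+7))"

text \<open>The loop runs over the \<open>n\<close> rows, while the fixed number of tables is
  unrolled.\<close>

definition copy_loop :: "(nat => 'a => instr com) => 'a list => instr com" where
 "copy_loop f as = Prm (Const (R+6) 0) ;;
   Rep 0 (seqs (map (%j. f j (as ! j)) [0..<length as]) ;; Prm (Add (R+6) (R+6) (R+4)))"

definition driver :: "nat => nat => 'a list => 'a list => 'a prim com => instr com" where
 "driver mo cc ins outs c = setup_regs mo cc ;; copy_loop cin ins ;; tr c ;;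
   copy_loop cout outs ;; Prm (Const R (length outs)) ;; Prm (Mult 0 R 0) ;; Prm (Add 0 0 (R+4))"

definition frm :: "nat => nat => nat => nat => nat => (nat => nat) state => bool" where
 "frm W n i base cap s = (fst s 0 = n & fst s (R+6) = i & cregs base cap s & below W s)"

lemma cell_sem:
 assumes "frm W n i base cap s" "Suc (j * n + i) <= W" "j <= W"
 shows "fst (exr g (cell j) s) R = Suc (j * n + i)"
  and "!!x. x ~= R ==> fst (exr g (cell j) s) x = fst s x"
  and "snd (exr g (cell j) s) = snd s"
  and "safeW W g (cell j) s" and "below W (exr g (cell j) s)"
  and "cost (ram g) (cell j) s = 4"
proof -
 have c: "fst s 0 = n" "fst s (R+6) = i" "fst s (R+4) = 1" "below W s" using assms(1) by (auto simp: frm_def cregs_def)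
 show "fst (exr g (cell j) s) R = Suc (j * n + i)"
  "!!x. x ~= R ==> fst (exr g (cell j) s) x = fst s x"
  "snd (exr g (cell j) s) = snd s" "cost (ram g) (cell j) s = 4" using c R0 by (simp_all add: cell_def)
 have b: "j * n <= W" "j * n + i <= W" using assms(2) by auto
 show "safeW W g (cell j) s" "below W (exr g (cell j) s)" using R0 c b assms(2,3) unfolding cell_def sem.simps safe.simps(3) safe_Prm ram_simps
  by (auto simp: below_def)
qed

lemma saddr_sem:
 assumes "frm W n i base cap s" "base + i * K + ix a <= W"
 shows "fst (exr g (saddr a) s) (R+7) = base + i * K + ix a"
  and "!!x. x ~= R ==> x ~= R + 7 ==> fst (exr g (saddr a) s) x = fst s x"
  and "snd (exr g (saddr a) s) = snd s"
  and "safeW W g (saddr a) s" and "below W (exr g (saddr a) s)"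
  and "cost (ram g) (saddr a) s = 4"
proof -
 have c: "fst s (R+6) = i" "fst s (R+2) = K" "fst s (R+3) = base" "below W s" using assms(1) by (auto simp: frm_def cregs_def)
 show "fst (exr g (saddr a) s) (R+7) = base + i * K + ix a"
  "!!x. x ~= R ==> x ~= R + 7 ==> fst (exr g (saddr a) s) x = fst s x"
  "snd (exr g (saddr a) s) = snd s" "cost (ram g) (saddr a) s = 4" using c R0 by (simp_all add: saddr_def)
 have b: "i * K <= W" "i * K + ix a <= W" "ix a <= W" using assms(2) by auto
 show "safeW W g (saddr a) s" "below W (exr g (saddr a) s)"
  using R0 c b assms(2) unfolding saddr_def sem.simps safe.simps(3) safe_Prm ram_simps by (auto simp: below_def add.commute add.left_commute)
qed

lemma cin_sem:
 assumes f: "frm W n i base cap s" and b: "Suc (j * n + i) <= W" "j <= W" "base + i * K + ix a <= W"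
 shows "!!x. x < R \<or> R + 2 <= x & x ~= R + 7 ==> fst (exr g (cin j a) s) x = fst s x"
  and "snd (exr g (cin j a) s) = (snd s)(base + i * K + ix a := snd s (Suc (j * n + i)))"
  and "safeW W g (cin j a) s" and "frm W n i base cap (exr g (cin j a) s)"
  and "cost (ram g) (cin j a) s = 10"
proof -
 note c = cell_sem[where g = g, OF f b(1,2)]
 let ?s1 = "ram g (Load (R+1) R) (exr g (cell j) s)"
 have v: "snd s (Suc (j * n + i)) <= W" using f by (simp add: frm_def below_def)
 have f1: "frm W n i base cap ?s1" using f c below_reg[OF c(5) v, of "R+1"] R0 by (simp add: frm_def cregs_def)
 note a = saddr_sem[where g = g, OF f1 b(3)]
 let ?s2 = "exr g (saddr a) ?s1"
 have r: "exr g (cin j a) s = ram g (Store (R+7) (R+1)) ?s2" by (simp add: cin_def)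
 have w: "fst ?s2 (R+1) = snd s (Suc (j * n + i))" using a(2)[of "R+1"] c by simp
 have bl: "below W (ram g (Store (R+7) (R+1)) ?s2)" using below_mem[OF a(5) v, of "fst ?s2 (R+7)"] by (simp only: ram_simps(7) w)
 show regs: "!!x. x < R \<or> R + 2 <= x & x ~= R + 7 ==> fst (exr g (cin j a) s) x = fst s x"
 proof -
  fix x assume x: "x < R \<or> R + 2 <= x & x ~= R + 7"
  have "fst ?s2 x = fst ?s1 x" by (rule a(2)) (use x in auto)
  then show "fst (exr g (cin j a) s) x = fst s x" unfolding r using c(2)[of x] x by auto
 qed
 show "snd (exr g (cin j a) s) = (snd s)(base + i * K + ix a := snd s (Suc (j * n + i)))"
 proof -
  have "snd ?s1 = snd s" by (simp add: c(3))
  then show ?thesis unfolding r ram_simps(7) snd_conv a(1) w a(3) by simp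
 qed
 show "safeW W g (cin j a) s" unfolding cin_def safe.simps(3) safe_Prm sem.simps using c(4) a(4) bl f1 by (auto simp: frm_def)
 show "frm W n i base cap (exr g (cin j a) s)" using regs f bl R0 unfolding frm_def r[symmetric] by (simp add: cregs_def)
 show "cost (ram g) (cin j a) s = 10" using c(6) a(6) by (simp add: cin_def)
qed

lemma cout_sem:
 assumes f: "frm W n i base cap s" and b: "Suc (j * n + i) <= W" "j <= W" "base + i * K + ix a <= W"
 shows "snd (exr g (cout j a) s) = (snd s)(Suc (j * n + i) := snd s (base + i * K + ix a))"
  and "safeW W g (cout j a) s" and "frm W n i base cap (exr g (cout j a) s)"
  and "cost (ram g) (cout j a) s = 10"
proof -
 note a = saddr_sem[where g = g, OF f b(3)]
 let ?s1 = "ram g (Load (R+7) (R+7)) (exr g (saddr a) s)"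
 have v: "snd s (base + i * K + ix a) <= W" using f by (simp add: frm_def below_def)
 have bl1: "below W ?s1" unfolding ram_simps a(1) by (rule below_reg[OF a(5)]) (simp only: a(3) v)
 have f1: "frm W n i base cap ?s1" using f a bl1 R0 by (simp add: frm_def cregs_def)
 note c = cell_sem[where g = g, OF f1 b(1,2)]
 let ?s2 = "exr g (cell j) ?s1"
 have r: "exr g (cout j a) s = ram g (Store R (R+7)) ?s2" by (simp add: cout_def)
 have w: "fst ?s2 (R+7) = snd s (base + i * K + ix a)" using c(2)[of "R+7"] a by simp
 have bl: "below W (ram g (Store R (R+7)) ?s2)" using below_mem[OF c(5) v, of "fst ?s2 R"] by (simp only: ram_simps(7) w)
 show "snd (exr g (cout j a) s) = (snd s)(Suc (j * n + i) := snd s (base + i * K + ix a))"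
 proof -
  have "snd ?s1 = snd s" by (simp add: a(3))
  then show ?thesis unfolding r ram_simps(7) snd_conv c(1) w c(3) by simp
 qed
 show "safeW W g (cout j a) s" unfolding cout_def safe.simps(3) safe_Prm sem.simps using c(4) a(4) bl bl1 by auto
 show "frm W n i base cap (exr g (cout j a) s)" using f1 bl c(2) R0 unfolding frm_def r by (simp add: cregs_def)
 show "cost (ram g) (cout j a) s = 10" using c(6) a(6) by (simp add: cout_def)
qed

lemma copy_loop_sem:
 assumes I: "I 0 0 ((fst s)(R+6 := 0), snd s)" and n: "fst s 0 = n" and W: "below W s" "Suc n <= W"
  and step: "!!i j s. i < n ==> j < length as ==> I i j s ==>
   I i (Suc j) (exr g (f j (as ! j)) s) & safeW W g (f j (as ! j)) s & cost (ram g) (f j (as ! j)) s <= C"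
  and nxt: "!!i s. i < n ==> I i (length as) s ==> I (Suc i) 0 ((fst s)(R+6 := Suc i), snd s)"
  and fr: "!!i j s. I i j s ==> frm W n i base cap s"
 shows "I n 0 (exr g (copy_loop f as) s) & safeW W g (copy_loop f as) s &
  cost (ram g) (copy_loop f as) s <= 3 + n * (4 + length as * C)"
proof -
 let ?cs = "map (%j. f j (as ! j)) [0..<length as]"
 let ?b = "seqs ?cs ;; Prm (Add (R+6) (R+6) (R+4))" and ?s0 = "((fst s)(R+6 := 0), snd s)"
 have row: "I (Suc i) 0 (exr g ?b s) & safeW W g ?b s & cost (ram g) ?b s <= length as * C + 1"
  if i: "i < n" and Ii: "I i 0 s" for i s
 proof -
  have 1: "I i (length ?cs) (exr g (seqs ?cs) s) & safeW W g (seqs ?cs) s &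
    cost (ram g) (seqs ?cs) s <= length ?cs * C"
   by (rule seqs_inv) (use step i Ii in auto)
  let ?t = "exr g (seqs ?cs) s"
  have It: "I i (length as) ?t" using 1 by simp
  have ft: "frm W n i base cap ?t" using fr[OF It] .
  have e: "ram g (Add (R+6) (R+6) (R+4)) ?t = ((fst ?t)(R+6 := Suc i), snd ?t)" using ft by (simp add: frm_def cregs_def)
  have "below W ((fst ?t)(R+6 := Suc i), snd ?t)" by (rule below_reg) (use ft i W(2) in "auto simp: frm_def")
  then show ?thesis using 1 nxt[OF i It] unfolding sem.simps safe.simps(3) safe_Prm cost.simps e by simp
 qed
 have "I n 0 (exr g (Rep 0 ?b) ?s0) & safeW W g (Rep 0 ?b) ?s0 &
  cost (ram g) (Rep 0 ?b) ?s0 <= 2 + n * (3 + (length as * C + 1))"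
  by (rule rep_inv[where I = "%i. I i 0"]) (use I n row in auto)
 moreover have "below W ?s0" by (rule below_reg[OF W(1)]) simp
 ultimately show ?thesis unfolding copy_loop_def sem.simps safe.simps(3) safe_Prm cost.simps ram_simps by (simp add: add.commute)
qed

lemma driver_correct:
 assumes c: "com_ok pok R c" and ins: "set ins <= N" and outs: "set outs <= N"
  and len: "length xs = Suc (length ins * n)" and x0: "xs ! 0 = n"
  and xs': "ALL j<length ins. ALL v<n. xs ! Suc (j * n + v) = A0 (ins ! j) v"
  and A0': "ALL a v. a ~: set ins \<or> n <= v --> A0 a v = 0" "ALL a v. A0 a v <= n"
  and mo: "mo = length ins + length outs"
  and r0: "fst (sem (aram (cc * n)) c ((%x. 0)(0 := n), A0)) 0 = n"
  and t: "t = cost (aram (cc * n)) c ((%x. 0)(0 := n), A0)"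
  and V: "V = n + cm + cc * n" and W: "fits W (mo * n + 1) (V + t)" "cc <= W" "mo <= W"
 shows "EX r m. exr g (driver mo cc ins outs c) (snd (init_config xs)) = (r, m) &
  map m [0..<r 0] = n # concat (map (%a. map (snd (sem (aram (cc * n)) c ((%x. 0)(0 := n), A0)) a) [0..<n]) outs) &
  safeW W g (driver mo cc ins outs c) (snd (init_config xs)) &
  cost (ram g) (driver mo cc ins outs c) (snd (init_config xs)) <=
   18 + n * (8 + length ins * 10 + length outs * 10) + 5 * t &
  length xs <= W & (ALL i<length xs. xs ! i <= W)"
proof -
 note xs = xs'[rule_format] and A0 = A0'[rule_format]
 define base where "base = mo * n + 1"
 define cap where "cap = cc * n"
 define m0 where "m0 = (%i. if i < length xs then xs ! i else 0)"
 let ?st = "(%x. 0)(0 := n)"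
 let ?s0 = "snd (init_config xs)"
 have s0: "?s0 = ((%_. 0)(0 := length xs), m0)" by (simp add: init_config_def m0_def)
 define P where "P = (V + t) * K"
 have Wb: "base + P + K + 2 * V + 2 * t + 1 <= W" using W(1) by (simp add: fits_def base_def P_def)
 have nV: "n <= V" "cap <= V" "cm <= V" by (auto simp: V cap_def)
 have VK: "v * K <= P" if "v <= V" for v unfolding P_def using that by (intro mult_le_mono1) simp
 have b1: "base + v * K + ix a <= W" if "a : N" "v <= V" for a v using VK[OF that(2)] ixK[OF that(1)] Wb by linarith
 have b2: "Suc (j * n + i) < base" if "j < mo" "i < n" for i j
 proof -
  have "Suc j * n <= mo * n" using that(1) by (intro mult_le_mono1) simp
  then show ?thesis using that(2) by (simp add: base_def)
 qed
 have baseW: "base <= W" "Suc n <= W" "K <= W" "1 <= W" "cap <= W" "V <= W" using Wb nV by linarith+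
 have inmo: "length ins * n <= mo * n" "length outs * n <= mo * n" unfolding mo by (simp_all add: add_mult_distrib)
 have lenW: "length xs <= base" using inmo by (simp add: len base_def)
 have m0n: "m0 i <= n" for i
 proof (cases "i < length xs & i > 0")
  case True
  then have n: "n > 0" using len by (cases n) auto
  define j v where "j = (i - 1) div n" and "v = (i - 1) mod n"
  have i: "i = Suc (j * n + v)" using True by (simp add: j_def v_def)
  have "i - 1 < length ins * n" using True len by linarith
  then have "j < length ins" "v < n" using n by (auto simp: j_def v_def less_mult_imp_div_less)
  then show ?thesis using xs[of j v] A0(2) True i by (simp add: m0_def)
 next
  case False
  then show ?thesis using x0 by (auto simp: m0_def)
 qed
 have m0W: "m0 i <= W" for i using m0n[of i] baseW by linarith
 have below0: "below W ?s0" using lenW baseW m0W by (auto simp: below_def s0)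
 define s1 where "s1 = ((%_. 0)(0 := n, R+2 := K, R+4 := 1, R+3 := base, R+5 := cap), m0)"
 have m00: "m0 0 = n" using x0 len by (simp add: m0_def)
 have stp: "exr g (setup_regs mo cc) ?s0 = s1" "cost (ram g) (setup_regs mo cc) ?s0 = 9"
  using R0 m00 by (auto simp: setup_regs_def s0 s1_def base_def cap_def fun_eq_iff)
 have stp_safe: "safeW W g (setup_regs mo cc) ?s0" unfolding setup_regs_def sem.simps safe.simps(3) safe_Prm ram_simps
  using below0 R0 m00 m0W baseW W(2,3) by (auto simp: below_def s0 base_def cap_def)
 have below1: "below W s1" using baseW m0W by (auto simp: below_def s1_def)
 \<comment> \<open>Entries not yet copied are 0, since memory behind the input is 0 at the
   beginning. \<open>A0\<close> vanishes outside \<open>ins\<close>, so a completed row agrees with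
   it for every array.\<close>
 define CI where "CI i j s = (frm W n i base cap s & (ALL x. 0 < x & x < R --> fst s x = 0) &
   (ALL k<base. snd s k = m0 k) & (ALL a:N. ALL v. snd s (base + v * K + ix a) =
    (if v < i \<or> v = i & a : set (take j ins) then A0 a v else 0)))" for i j s
 let ?ci = "copy_loop cin ins"
 have ci: "CI n 0 (exr g ?ci s1) & safeW W g ?ci s1 & cost (ram g) ?ci s1 <= 3 + n * (4 + length ins * 10)"
 proof (rule copy_loop_sem[where base = base and cap = cap])
  have "frm W n 0 base cap ((fst s1)(R + 6 := 0), snd s1)" using below_reg[OF below1, of 0 "R+6"] R0 by (simp add: frm_def cregs_def s1_def)
  moreover have "m0 (base + v * K + ix a) = 0" for v a using lenW by (simp add: m0_def)
  ultimately show "CI 0 0 ((fst s1)(R + 6 := 0), snd s1)" by (simp add: CI_def s1_def)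
  show "fst s1 0 = n" by (simp add: s1_def)
  show "below W s1" by (rule below1)
  show "Suc n <= W" by (rule baseW)
  show "frm W n i base cap s" if "CI i j s" for i j s using that by (simp add: CI_def)
 next
  fix i j s assume i: "i < n" and j: "j < length ins" and C: "CI i j s"
  have a: "ins ! j : N" using ins j by auto
  have jm: "j < mo" using j by (simp add: mo)
  have f: "frm W n i base cap s" using C by (simp add: CI_def)
  have iV: "i <= V" using i nV by simp
  have lb: "Suc (j * n + i) < base" by (rule b2[OF jm i])
  have cW: "Suc (j * n + i) <= W" "j <= W" using lb baseW jm W(3) by auto
  note h = cin_sem[where g = g, OF f cW b1[OF a iV]]
  let ?s = "exr g (cin j (ins ! j)) s"
  have val: "snd s (Suc (j * n + i)) = A0 (ins ! j) i"
  proof -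
   have "Suc j * n <= length ins * n" using j by (intro mult_le_mono1) simp
   then have "Suc (j * n + i) < length xs" using i by (simp add: len)
   then show ?thesis using C lb xs[OF j i] by (simp add: CI_def m0_def)
  qed
  have "snd ?s (base + v * K + ix b) = (if v < i \<or> v = i & b : set (take (Suc j) ins) then A0 b v else 0)"
   if b: "b : N" for b v
  proof -
   have "base + v * K + ix b = base + i * K + ix (ins ! j) = (v = i & b = ins ! j)"
    using div_add_inj[OF ixK[OF b] ixK[OF a], of v i] inj_onD[OF inj _ b a] by auto
   then show ?thesis unfolding h(2) using C b val j by (auto simp: CI_def take_Suc_conv_app_nth)
  qed
  moreover have "ALL k<base. snd ?s k = m0 k" unfolding h(2) using C by (simp add: CI_def)
  moreover have "ALL x. 0 < x & x < R --> fst ?s x = 0" using h(1) C by (simp add: CI_def)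
  ultimately have "CI i (Suc j) ?s" unfolding CI_def using h(4) by blast
  then show "CI i (Suc j) ?s & safeW W g (cin j (ins ! j)) s & cost (ram g) (cin j (ins ! j)) s <= 10" using h by simp
 next
  fix i s assume i: "i < n" and C: "CI i (length ins) s"
  have "frm W n (Suc i) base cap ((fst s)(R + 6 := Suc i), snd s)"
   using C below_reg[of W s "Suc i" "R+6"] i baseW R0 by (simp add: CI_def frm_def cregs_def)
  moreover have "(if v < i \<or> v = i & a : set ins then A0 a v else 0) = (if v < Suc i then A0 a v else 0)" for a v using A0(1) by auto
  ultimately show "CI (Suc i) 0 ((fst s)(R + 6 := Suc i), snd s)" using C by (simp add: CI_def)
 qed
 let ?s2 = "exr g ?ci s1" and ?t2 = "(?st, A0)"
 have f2: "frm W n n base cap ?s2" using ci by (simp add: CI_def)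
 have rel2: "rel base cap m0 ?s2 ?t2"
 proof -
  have "fst ?s2 x = ?st x" if "x < R" for x using ci that by (cases "x = 0") (auto simp: CI_def frm_def)
  moreover have "snd ?s2 (base + v * K + ix a) = A0 a v" if "a : N" for a v using ci that A0(1)[of a v] by (auto simp: CI_def)
  ultimately show ?thesis using ci f2 by (auto simp: rel_def CI_def frm_def)
 qed
 have vb2: "vb V ?t2" using A0(2) nV by (auto simp: vb_def intro: order.trans)
 have fit: "fits W base (V + tim cap c ?t2)" using W(1) t by (simp add: base_def cap_def)
 let ?s3 = "exr g (tr c) ?s2" and ?t3 = "exa cap c ?t2"
 have main: "rel base cap m0 ?s3 ?t3 & safeW W g (tr c) ?s2 & below W ?s3 &
   cost (ram g) (tr c) ?s2 <= 5 * tim cap c ?t2 & vb (V + tim cap c ?t2) ?t3"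
  using f2 by (intro tr_correct[OF c rel2 _ vb2 nV(3,2) fit]) (simp add: frm_def)
 have r3: "fst ?s3 0 = n" using main R0 r0 by (simp add: rel_def cap_def)
 have c3: "cregs base cap ?s3" using main by (simp add: rel_def)
 define A' where "A' = snd ?t3"
 \<comment> \<open>The output overwrites addresses below \<open>base\<close> only, so the arrays
   stay readable while they are copied.\<close>
 define CO where "CO i j s = (frm W n i base cap s & (ALL k>=base. snd s k = snd ?s3 k) & snd s 0 = n &
   (ALL l<length outs. ALL v<n. v < i \<or> v = i & l < j --> snd s (Suc (l * n + v)) = A' (outs ! l) v))" for i j s
 let ?co = "copy_loop cout outs"
 have co: "CO n 0 (exr g ?co ?s3) & safeW W g ?co ?s3 & cost (ram g) ?co ?s3 <= 3 + n * (4 + length outs * 10)"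
 proof (rule copy_loop_sem[where base = base and cap = cap])
  have "frm W n 0 base cap ((fst ?s3)(R + 6 := 0), snd ?s3)" using below_reg[of W ?s3 0 "R+6"] main r3 c3 R0 by (simp add: frm_def cregs_def)
  moreover have "snd ?s3 0 = n" using main m00 by (simp add: rel_def base_def)
  ultimately show "CO 0 0 ((fst ?s3)(R + 6 := 0), snd ?s3)" by (simp add: CO_def)
  show "fst ?s3 0 = n" by (rule r3)
  show "below W ?s3" using main by blast
  show "Suc n <= W" by (rule baseW)
  show "frm W n i base cap s" if "CO i j s" for i j s using that by (simp add: CO_def)
 next
  fix i j s assume i: "i < n" and j: "j < length outs" and C: "CO i j s"
  have a: "outs ! j : N" using outs j by auto
  have jm: "j < mo" using j by (simp add: mo)
  have f: "frm W n i base cap s" using C by (simp add: CO_def)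
  have iV: "i <= V" using i nV by simp
  have lb: "Suc (j * n + i) < base" by (rule b2[OF jm i])
  have cW: "Suc (j * n + i) <= W" "j <= W" using lb baseW jm W(3) by auto
  note h = cout_sem[where g = g, OF f cW b1[OF a iV]]
  let ?s = "exr g (cout j (outs ! j)) s"
  have val: "snd s (base + i * K + ix (outs ! j)) = A' (outs ! j) i" using C main a by (simp add: CO_def rel_def A'_def)
  have "snd ?s (Suc (l * n + v)) = A' (outs ! l) v"
   if l: "l < length outs" "v < n" "v < i \<or> v = i & l < Suc j" for l v
  proof (cases "l = j & v = i")
   case True
   then show ?thesis unfolding h(1) using val by simp
  next
   case False
   then have "Suc (l * n + v) ~= Suc (j * n + i)" using div_add_inj[OF l(2) i, of l j] by auto
   then have "snd ?s (Suc (l * n + v)) = snd s (Suc (l * n + v))" unfolding h(1) by simp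
   moreover have "v < i \<or> v = i & l < j" using l(3) False by auto
   ultimately show ?thesis using C l(1,2) unfolding CO_def by metis
  qed
  moreover have "ALL k>=base. snd ?s k = snd ?s3 k" unfolding h(1) using C lb by (simp add: CO_def)
  moreover have "snd ?s 0 = n" unfolding h(1) using C by (simp add: CO_def)
  ultimately have "CO i (Suc j) ?s" unfolding CO_def using h(3) by blast
  then show "CO i (Suc j) ?s & safeW W g (cout j (outs ! j)) s & cost (ram g) (cout j (outs ! j)) s <= 10" using h by simp
 next
  fix i s assume i: "i < n" and C: "CO i (length outs) s"
  have "frm W n (Suc i) base cap ((fst s)(R + 6 := Suc i), snd s)"
   using C below_reg[of W s "Suc i" "R+6"] i baseW R0 by (simp add: CO_def frm_def cregs_def)
  then show "CO (Suc i) 0 ((fst s)(R + 6 := Suc i), snd s)" using C by (auto simp: CO_def less_Suc_eq)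
 qed
 let ?s4 = "exr g ?co ?s3"
 have f4: "frm W n n base cap ?s4" using co by (simp add: CO_def)
 let ?fin = "Prm (Const R (length outs)) ;; Prm (Mult 0 R 0) ;; Prm (Add 0 0 (R+4))"
 have fin: "fst (exr g ?fin ?s4) 0 = Suc (length outs * n)" "snd (exr g ?fin ?s4) = snd ?s4"
  "cost (ram g) ?fin ?s4 = 3" using f4 R0 by (simp_all add: frm_def cregs_def)
 have noW: "length outs <= W" "length outs * n <= W" "Suc (length outs * n) <= W"
 proof -
  have "length outs <= mo" by (simp add: mo)
  then show "length outs <= W" using W(3) by simp
  show "length outs * n <= W" "Suc (length outs * n) <= W" using inmo(2) baseW(1) unfolding base_def by linarith+
 qed
 have fin_safe: "safeW W g ?fin ?s4" unfolding sem.simps safe.simps(3) safe_Prm ram_simps using f4 R0 noW by (auto simp: frm_def cregs_def below_def)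
 have out: "map (snd ?s4) [0..<Suc (length outs * n)] = n # concat (map (%a. map (A' a) [0..<n]) outs)"
 proof -
  have "map (snd ?s4) [0..<Suc (length outs * n)] = snd ?s4 0 # map (%i. snd ?s4 (Suc i)) [0..<length outs * n]" by (simp only: map_upt_Suc)
  also have "map (%i. snd ?s4 (Suc i)) [0..<length outs * n] =
    map (%i. A' (outs ! (i div n)) (i mod n)) [0..<length outs * n]"
  proof (rule map_cong[OF refl])
   fix i assume "i : set [0..<length outs * n]"
   then have i: "i < length outs * n" by simp
   then have "n > 0" by (cases n) auto
   then have "i div n < length outs" "i mod n < n" using i by (auto simp: less_mult_imp_div_less)
   moreover have "i = i div n * n + i mod n" by simp
   ultimately show "snd ?s4 (Suc i) = A' (outs ! (i div n)) (i mod n)" using co unfolding CO_def by metis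
  qed
  also have "... = concat (map (%j. map (%v. A' (outs ! j) v) [0..<n]) [0..<length outs])" by (rule concat_map_upt[symmetric])
  also have "map (%j. map (%v. A' (outs ! j) v) [0..<n]) [0..<length outs] = map (%a. map (A' a) [0..<n]) (map ((!) outs) [0..<length outs])" by simp
  also have "map ((!) outs) [0..<length outs] = outs" by (rule map_nth)
  finally show ?thesis using co by (simp add: CO_def)
 qed
 let ?d = "driver mo cc ins outs c"
 have d: "exr g ?d ?s0 = exr g ?fin ?s4" unfolding driver_def sem.simps stp(1) ..
 have "safeW W g ?d ?s0" unfolding driver_def using stp_safe ci main co fin_safe unfolding safe.simps(3) sem.simps stp(1) by blast
 moreover have "cost (ram g) ?d ?s0 <= 18 + n * (8 + length ins * 10 + length outs * 10) + 5 * t"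
 proof -
  have "cost (ram g) ?d ?s0 = 9 + (cost (ram g) ?ci s1 + (cost (ram g) (tr c) ?s2 + (cost (ram g) ?co ?s3 + 3)))"
   unfolding driver_def using fin(3) stp(2) unfolding cost.simps(3) sem.simps stp(1) by simp
  moreover have "cost (ram g) (tr c) ?s2 <= 5 * t" using main t by (simp add: cap_def)
  ultimately show ?thesis using ci co by (simp add: algebra_simps)
 qed
 moreover have "ALL i<length xs. xs ! i <= W" using m0W by (auto simp: m0_def split: if_splits) (metis m0W m0_def)
 moreover have "map (snd (exr g ?d ?s0)) [0..<fst (exr g ?d ?s0) 0] =
   n # concat (map (%a. map (snd (sem (aram (cc * n)) c (?st, A0)) a) [0..<n]) outs)"
  unfolding d fin out A'_def cap_def ..
 ultimately show ?thesis using lenW baseW(1) by (intro exI[of _ "fst (exr g ?d ?s0)"] exI[of _ "snd (exr g ?d ?s0)"]) simp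
qed

lemma com_ok_driver:
 assumes "com_ok pok R c"
 shows "com_ok (instr_ok (R+8)) (R+8) (driver mo cc ins outs c)" using com_ok_tr[OF assms, of "R+8"] R0
 by (auto simp: driver_def setup_regs_def copy_loop_def cin_def cout_def cell_def saddr_def)

end

fun prim_ok :: "nat => nat => 'a set => 'a prim => bool" where
 "prim_ok R cm N (SetC x c) = (x < R & c <= cm)"
| "prim_ok R cm N (Inc x) = (x < R)"
| "prim_ok R cm N (Mov x y) = (x < R & y < R)"
| "prim_ok R cm N (Sb x y z) = (x < R & y < R & z < R)"
| "prim_ok R cm N (AddC x y z) = (x < R & y < R & z < R)"
| "prim_ok R cm N (Rd x a y) = (x < R & y < R & a : N)"
| "prim_ok R cm N (Wr a x y) = (x < R & y < R & a : N)"

text \<open>Everything is linear in \<open>n + 1\<close>: the time by assumption, hence the numbers,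
  hence the addresses. The constant \<open>b\<close> adds up the summands of \<open>fits\<close> and
  those of the running time of \<open>driver\<close>.\<close>

theorem array_program_computable:
 fixes c :: "'a prim com"
 assumes N: "finite N" and R: "0 < R" and c: "com_ok (prim_ok R cm N) R c"
  and ins: "set ins <= N" and outs: "set outs <= N"
 shows "EX Q b. 0 < b & (ALL n A0 xs. length xs = Suc (length ins * n) --> xs ! 0 = n -->
  (ALL j<length ins. ALL v<n. xs ! Suc (j * n + v) = A0 (ins ! j) v) -->
  (ALL a v. a ~: set ins \<or> n <= v --> A0 a v = 0) --> (ALL a v. A0 a v <= n) -->
  fst (sem (aram (cc * n)) c ((%x. 0)(0 := n), A0)) 0 = n -->
  cost (aram (cc * n)) c ((%x. 0)(0 := n), A0) <= c1 * (n + 1) -->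
  computes_within (b * (n + 1)) (b * (n + 1)) Q xs
   (n # concat (map (%a. map (snd (sem (aram (cc * n)) c ((%x. 0)(0 := n), A0)) a) [0..<n]) outs)))"
proof -
 obtain ix :: "'a => nat" and K where ix: "inj_on ix N" "ix ` N = {i. i < K}" using finite_imp_inj_to_nat_seg[OF N] by metis
 interpret layout R K ix N cm by unfold_locales (use ix R in auto)
 have "pok = prim_ok R cm N"
 proof
  show "pok p = prim_ok R cm N p" for p by (cases p) auto
 qed
 with c have c': "com_ok pok R c" by simp
 define mo where "mo = length ins + length outs"
 define v where "v = 1 + cm + cc + c1"
 define b where "b = (mo + 1) + v * K + K + 2 * v + 1 + cc + (19 + 10 * mo + 5 * c1)"
 let ?Q = "machine (R+8) (driver mo cc ins outs c)"
 show ?thesis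
 proof (intro exI[of _ ?Q] exI[of _ b] conjI allI impI)
  show "0 < b" by (simp add: b_def)
  fix n A0 xs
  assume H: "length xs = Suc (length ins * n)" "xs ! 0 = n"
   "ALL j<length ins. ALL v<n. xs ! Suc (j * n + v) = A0 (ins ! j) v"
   "ALL a v. a ~: set ins \<or> n <= v --> A0 a v = 0" "ALL a v. A0 a v <= n"
   "fst (sem (aram (cc * n)) c ((%x. 0)(0 := n), A0)) 0 = n"
   "cost (aram (cc * n)) c ((%x. 0)(0 := n), A0) <= c1 * (n + 1)"
  let ?t = "cost (aram (cc * n)) c ((%x. 0)(0 := n), A0)" and ?W = "b * (n + 1)" and ?m = "n + 1"
  have Vt: "n + cm + cc * n + ?t <= v * ?m" using H(7) by (simp add: v_def algebra_simps)
  have W: "?W = (mo + 1) * ?m + v * ?m * K + K * ?m + 2 * (v * ?m) + ?m + cc * ?m + (19 + 10 * mo + 5 * c1) * ?m" by (simp add: b_def algebra_simps)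
  have f: "fits ?W (mo * n + 1) (v * ?m)" unfolding fits_def W by (simp add: algebra_simps)
  have W2: "cc <= ?W" "mo <= ?W" "1 <= ?W" unfolding W by (simp_all add: algebra_simps)
  obtain r m where d: "sem (ram (%_. 0)) (driver mo cc ins outs c) (snd (init_config xs)) = (r, m)"
   "map m [0..<r 0] = n # concat (map (%a. map (snd (sem (aram (cc * n)) c ((%x. 0)(0 := n), A0)) a) [0..<n]) outs)"
   "safeW ?W (%_. 0) (driver mo cc ins outs c) (snd (init_config xs))"
   "cost (ram (%_. 0)) (driver mo cc ins outs c) (snd (init_config xs)) <=
    18 + n * (8 + length ins * 10 + length outs * 10) + 5 * ?t"
   "length xs <= ?W" "ALL i<length xs. xs ! i <= ?W"
   using driver_correct[where g = "%_. 0", OF c' ins outs H(1-5) mo_def H(6) refl refl fits_mono[OF f Vt] W2(1,2)] by (elim exE conjE)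
  have "cost (ram (%_. 0)) (driver mo cc ins outs c) (snd (init_config xs)) < ?W"
  proof -
   have "n * (8 + length ins * 10 + length outs * 10) = 8 * n + 10 * mo * n" by (simp add: mo_def algebra_simps)
   then have "cost (ram (%_. 0)) (driver mo cc ins outs c) (snd (init_config xs)) <=
    18 + (8 * n + 10 * mo * n) + 5 * (c1 * ?m)" using d(4) H(7) by linarith
   also have "... < (19 + 10 * mo + 5 * c1) * ?m" by (simp add: algebra_simps)
   also have "... <= ?W" unfolding W by simp
   finally show ?thesis .
  qed
  then show "computes_within ?W ?W ?Q xs
   (n # concat (map (%a. map (snd (sem (aram (cc * n)) c ((%x. 0)(0 := n), A0)) a) [0..<n]) outs))"
   using machine_computes_within[OF com_ok_driver[OF c'] _ W2(3) d(5,6,3) _ d(1,2)] by simp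
 qed
qed

subsection \<open>Computing the vertex order\<close>

fun wreg :: "'a prim => nat set" where
 "wreg (SetC x c) = {x}" | "wreg (Inc x) = {x}" | "wreg (Mov x y) = {x}" | "wreg (Sb x y z) = {x}"
| "wreg (AddC x y z) = {x}" | "wreg (Rd x a y) = {x}" | "wreg (Wr a x y) = {}"

fun warr :: "'a prim => 'a set" where
 "warr (Wr a x y) = {a}" | "warr _ = {}"

fun wregs :: "'a prim com => nat set" where
 "wregs Skip = {}" | "wregs (Prm p) = wreg p" | "wregs (c ;; d) = wregs c Un wregs d"
| "wregs (IfNZ x c) = wregs c" | "wregs (Rep x c) = wregs c"

fun warrs :: "'a prim com => 'a set" where
 "warrs Skip = {}" | "warrs (Prm p) = warr p" | "warrs (c ;; d) = warrs c Un warrs d"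
| "warrs (IfNZ x c) = warrs c" | "warrs (Rep x c) = warrs c"

lemma wregs_seqs [simp]: "wregs (seqs cs) = (\<Union>c\<in>set cs. wregs c)" by (induction cs) auto

lemma warrs_seqs [simp]: "warrs (seqs cs) = (\<Union>c\<in>set cs. warrs c)" by (induction cs) auto

definition same :: "nat set => 'a set => ('a => nat => nat) state => ('a => nat => nat) state => bool" where
 "same X A s s' = ((ALL x. x ~: X --> fst s' x = fst s x) & (ALL a. a ~: A --> snd s' a = snd s a))"

lemma same_refl: "same X A s s" by (simp add: same_def)

lemma same_trans: "same X A s s' ==> same X A s' s'' ==> same X A s s''" by (auto simp: same_def)

lemma same_mono: "same X A s s' ==> X <= X' ==> A <= A' ==> same X' A' s s'" by (auto simp: same_def)

lemma same_reg: "same X A s s' ==> x ~: X ==> fst s' x = fst s x" by (simp add: same_def)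
lemma same_arr: "same X A s s' ==> a ~: A ==> snd s' a = snd s a" by (simp add: same_def)

text \<open>Frame rule: the write sets are computed from the program text, so what a piece of code
  preserves is found by simplification and need not be carried along in invariants.\<close>

lemma same_sem: "same (wregs c) (warrs c) s (exa cap c s)"
proof (induction c arbitrary: s)
 case (Prm p)
 show ?case by (cases p) (auto simp: same_def)
next
 case (Seq c d)
 show ?case using same_trans[OF same_mono[OF Seq.IH(1)] same_mono[OF Seq.IH(2)]] by simp
next
 case (Rep x c)
 have "same (wregs c) (warrs c) s ((exa cap c ^^ j) s)" for j by (induction j) (auto intro: same_trans[OF _ Rep.IH] same_refl)
 then show ?case by simp
qed (auto simp: same_refl)

lemmas sem_reg = same_reg[OF same_sem] and sem_arr = same_arr[OF same_sem]

fun norep :: "'p com => bool" where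
 "norep Skip = (True)" | "norep (Prm p) = (True)" | "norep (c ;; d) = (norep c & norep d)"
| "norep (IfNZ x c) = (norep c)" | "norep (Rep x c) = (False)"

text \<open>Bounds the cost of loop-free programs only; the value for \<open>Rep\<close> is a
  placeholder that \<open>norep\<close> excludes.\<close>

fun csz :: "'p com => nat" where
 "csz Skip = 0" | "csz (Prm p) = 1" | "csz (c ;; d) = csz c + csz d"
| "csz (IfNZ x c) = Suc (csz c)" | "csz (Rep x c) = 0"

lemma norep_seqs [simp]: "norep (seqs cs) = ((ALL c:set cs. norep c))" by (induction cs) auto

lemma cost_norep: "norep c ==> cost e c s <= csz c"
proof (induction c arbitrary: s)
 case (Seq c d)
 then have "cost e c s <= csz c" "cost e d (sem e c s) <= csz d" by auto
 then show ?case by (simp add: add_mono)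
qed auto

lemma seqs_rule:
 assumes "I 0 s" "!!i s'. i < length cs ==> I i s' ==> same (wregs (seqs cs)) (warrs (seqs cs)) s s' ==>
  I (Suc i) (exa cap (cs ! i) s') & tim cap (cs ! i) s' <= C i"
 shows "I (length cs) (exa cap (seqs cs) s) & tim cap (seqs cs) s <= (\<Sum>i<length cs. C i)" using assms
proof (induction cs arbitrary: I s C)
 case (Cons c cs)
 let ?s1 = "exa cap c s"
 have 1: "I (Suc 0) ?s1 & tim cap c s <= C 0" using Cons.prems(2)[of 0 s] Cons.prems(1) by (simp add: same_refl)
 have "I (Suc (length cs)) (exa cap (seqs cs) ?s1) &
   tim cap (seqs cs) ?s1 <= (\<Sum>i<length cs. C (Suc i))"
 proof (rule Cons.IH[of "%i. I (Suc i)"])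
  show "I (Suc 0) ?s1" using 1 by simp
  fix i s' assume i: "i < length cs" "I (Suc i) s'" "same (wregs (seqs cs)) (warrs (seqs cs)) ?s1 s'"
  have "same (wregs (seqs (c # cs))) (warrs (seqs (c # cs))) s s'" by (rule same_trans[OF same_mono[OF same_sem] same_mono[OF i(3)]]) auto
  then show "I (Suc (Suc i)) (exa cap (cs ! i) s') & tim cap (cs ! i) s' <= C (Suc i)" using Cons.prems(2)[of "Suc i"] i by simp
 qed
 then show ?case using 1 by (simp add: sum.lessThan_Suc_shift del: sum.lessThan_Suc)
qed simp

lemma Rep_rule:
 assumes "fst s x = n" "I 0 s"
  "!!j t. j < n ==> I j t ==> I (Suc j) (sem e b t) & cost e b t <= C j"
 shows "I n (sem e (Rep x b) s) & cost e (Rep x b) s <= 2 + (\<Sum>j<n. 3 + C j)"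
proof -
 have I: "I j ((sem e b ^^ j) s)" if "j <= n" for j using that by (induction j) (use assms in auto)
 have "(\<Sum>j<n. 3 + cost e b ((sem e b ^^ j) s)) <= (\<Sum>j<n. 3 + C j)"
 proof (rule sum_mono)
  fix j assume "j : {..<n}"
  then show "3 + cost e b ((sem e b ^^ j) s) <= 3 + C j" using assms(3)[of j] I[of j] by simp
 qed
 then show ?thesis using I[of n] assms(1) by simp
qed

text \<open>Register 0 holds the size of the universe throughout, so this loop runs over all
  vertices.\<close>

definition For :: "nat => 'a prim com => 'a prim com" where
 "For x c = Prm (SetC x 0) ;; Rep 0 (c ;; Prm (Inc x))"

lemma wregs_For [simp]: "wregs (For x c) = insert x (wregs c)" by (auto simp: For_def)
lemma warrs_For [simp]: "warrs (For x c) = warrs c" by (auto simp: For_def)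

text \<open>\<open>I\<close> must tolerate changes of the loop register (\<open>ins\<close>);
  \<open>step\<close> gets its value separately, together with everything the frame rule has
  preserved since the start of the loop.\<close>

lemma For_rule:
 assumes n: "fst s 0 = n" and x: "x ~= 0" "x ~: wregs c" and I0: "I 0 s"
  and ins: "!!i s v. I i s ==> I i ((fst s)(x := v), snd s)"
  and step: "!!i s'. i < n ==> I i s' ==> fst s' x = i ==> same (insert x (wregs c)) (warrs c) s s' ==>
   I (Suc i) (exa cap c s') & tim cap c s' <= C i"
 shows "I n (exa cap (For x c) s) & tim cap (For x c) s <= 3 + (\<Sum>i<n. C i + 4)"
proof -
 define s0 where "s0 = ((fst s)(x := 0), snd s)"
 define P where "P j t = (I j t & fst t x = j & same (insert x (wregs c)) (warrs c) s t)" for j t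
 have "P n (exa cap (Rep 0 (c ;; Prm (Inc x))) s0) &
   tim cap (Rep 0 (c ;; Prm (Inc x))) s0 <= 2 + (\<Sum>j<n. 3 + (C j + 1))"
 proof (rule Rep_rule)
  show "fst s0 0 = n" using n x by (simp add: s0_def)
  show "P 0 s0" using ins[OF I0, of 0] by (simp add: P_def s0_def same_def)
  fix j t assume j: "j < n" and t: "P j t"
  let ?u = "exa cap c t"
  have st: "I (Suc j) ?u & tim cap c t <= C j" using step[OF j] t by (auto simp: P_def)
  have ux: "fst ?u x = j" using sem_reg[OF x(2)] t by (simp add: P_def)
  have su: "same (insert x (wregs c)) (warrs c) s ?u" by (rule same_trans[of _ _ _ t]) (use t in "auto simp: P_def intro: same_mono[OF same_sem]")
  have e: "exa cap (c ;; Prm (Inc x)) t = ((fst ?u)(x := Suc j), snd ?u)" using ux by simp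
  have "same (insert x (wregs c)) (warrs c) s ((fst ?u)(x := Suc j), snd ?u)" using su by (simp add: same_def)
  then have "P (Suc j) (exa cap (c ;; Prm (Inc x)) t)" unfolding e P_def using ins[of "Suc j" ?u "Suc j"] st by simp
  then show "P (Suc j) (exa cap (c ;; Prm (Inc x)) t) & tim cap (c ;; Prm (Inc x)) t <= C j + 1" using st by simp
 qed
 moreover have "(\<Sum>j<n. 3 + (C j + 1)) = (\<Sum>j<n. C j + 4)" by (rule sum.cong) auto
 ultimately show ?thesis by (simp add: For_def s0_def P_def)
qed

text \<open>A linked list without end marker; its length is stored apart.\<close>

definition lst :: "(nat => nat) => nat => nat => nat list" where
 "lst nx p l = map (%j. (nx ^^ j) p) [0..<l]"

lemma lst_Suc: "lst nx p (Suc l) = p # lst nx (nx p) l" unfolding lst_def map_upt_Suc by (simp add: funpow_swap1)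

lemma lst_0 [simp]: "lst nx p 0 = []" by (simp add: lst_def)

lemma length_lst [simp]: "length (lst nx p l) = l" by (simp add: lst_def)

lemma lst_upd: "m ~: set (lst nx p l) ==> lst (nx(m := y)) p l = lst nx p l" by (induction l arbitrary: p) (auto simp: lst_Suc)

text \<open>\<open>In\<close>, \<open>Pr\<close>: input tables. \<open>Tau i\<close>: values of word
  \<open>i\<close>. \<open>Hd\<close>, \<open>Nx\<close>, \<open>Len\<close>: for each word, the
  lists of vertices with equal value. \<open>Mk\<close>, \<open>Mk2\<close>: time stamps.
  \<open>Deg\<close>, \<open>Que\<close>, \<open>Inq\<close>, \<open>Rm\<close>: remaining degrees,
  queue, flags for queued and removed vertices. \<open>Hn\<close>: later neighbours.
  \<open>Cnt\<close>: how often a value occurs. \<open>Num\<close>, \<open>Slot\<close>: counts and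
  frequent values for a context and a path. \<open>Wt\<close>: the resulting weights.\<close>

datatype aname = In nat | Pr nat | Tau nat | Hd nat | Nx nat | Len nat | Mk | Mk2 | Deg | Que | Inq | Rm
 | Hn nat | Cnt | Num "nat \<times> (nat \<times> nat \<times> nat) list \<times> fm list" "nat list"
 | Slot "nat \<times> (nat \<times> nat \<times> nat) list \<times> fm list" "nat list" | Wt fm nat

type_synonym ast = "(aname => nat => nat) state"
type_synonym prog = "aname prim com"

text \<open>Register 1 holds the vertex whose list is traversed, register 3 the current member of
  the list.\<close>

definition Trav :: "nat => prog => prog" where
 "Trav i c = Prm (Rd 3 (Hd i) 1) ;; Prm (Rd 4 (Len i) 1) ;; Rep 4 (c ;; Prm (Rd 3 (Nx i) 3))"

lemma wregs_Trav [simp]: "wregs (Trav i c) = {3, 4} Un wregs c" by (auto simp: Trav_def)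
lemma warrs_Trav [simp]: "warrs (Trav i c) = warrs c" by (auto simp: Trav_def)

lemma Trav_rule:
 fixes s :: ast
 assumes ys: "ys = lst (snd s (Nx i)) (snd s (Hd i) (fst s 1)) (snd s (Len i) (fst s 1))"
  and x: "3 ~: wregs c" "Nx i ~: warrs c" and I0: "I 0 s"
  and ins: "!!j s v w. I j s ==> I j ((fst s)(3 := v, 4 := w), snd s)"
  and step: "!!j s'. j < length ys ==> I j s' ==> fst s' 3 = ys ! j ==>
   same ({3, 4} Un wregs c) (warrs c) s s' ==>
   I (Suc j) (exa cap c s') & tim cap c s' <= C"
 shows "I (length ys) (exa cap (Trav i c) s) & tim cap (Trav i c) s <= 4 + length ys * (C + 4)"
proof -
 define s0 where "s0 = ((fst s)(3 := snd s (Hd i) (fst s 1), 4 := length ys), snd s)"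
 let ?p = "snd s (Hd i) (fst s 1)" and ?b = "c ;; Prm (Rd 3 (Nx i) 3)"
 define P where "P j t = (I j t & fst t 3 = (snd s (Nx i) ^^ j) ?p & same ({3, 4} Un wregs c) (warrs c) s t)" for j t
 have l: "length ys = snd s (Len i) (fst s 1)" by (simp add: ys)
 have nth: "ys ! j = (snd s (Nx i) ^^ j) ?p" if "j < length ys" for j using that unfolding ys by (simp add: lst_def)
 have "P (length ys) (exa cap (Rep 4 ?b) s0) &
   tim cap (Rep 4 ?b) s0 <= 2 + (\<Sum>j<length ys. 3 + (C + 1))"
 proof (rule Rep_rule)
  show "fst s0 4 = length ys" by (simp add: s0_def)
  show "P 0 s0" using ins[OF I0, of ?p "length ys"] by (simp add: P_def s0_def same_def)
  fix j t assume j: "j < length ys" and t: "P j t"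
  let ?u = "exa cap c t"
  have st: "I (Suc j) ?u & tim cap c t <= C" using step[OF j] t nth[OF j] by (auto simp: P_def)
  have u3: "fst ?u 3 = (snd s (Nx i) ^^ j) ?p" using sem_reg[OF x(1)] t by (simp add: P_def)
  have su: "same ({3, 4} Un wregs c) (warrs c) s ?u" by (rule same_trans[of _ _ _ t]) (use t in "auto simp: P_def intro: same_mono[OF same_sem]")
  have un: "snd ?u (Nx i) = snd s (Nx i)" using same_arr[OF su x(2)] .
  let ?q = "(snd s (Nx i) ^^ Suc j) ?p"
  have e: "exa cap ?b t = ((fst ?u)(3 := ?q), snd ?u)" using u3 un by simp
  have "same ({3, 4} Un wregs c) (warrs c) s ((fst ?u)(3 := ?q), snd ?u)" using su by (simp add: same_def)
  moreover have "I (Suc j) ((fst ?u)(3 := ?q), snd ?u)"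
  proof -
   have "(fst ?u)(3 := ?q, 4 := fst ?u 4) = (fst ?u)(3 := ?q)" by (simp add: fun_eq_iff)
   then show ?thesis using ins[of "Suc j" ?u ?q "fst ?u 4"] st by metis
  qed
  ultimately have "P (Suc j) (exa cap ?b t)" unfolding e P_def by simp
  then show "P (Suc j) (exa cap ?b t) & tim cap ?b t <= C + 1" using st by simp
 qed
 moreover have "exa cap (Trav i c) s = exa cap (Rep 4 ?b) s0"
  "tim cap (Trav i c) s = 2 + tim cap (Rep 4 ?b) s0" using l by (simp_all add: Trav_def s0_def)
 ultimately show ?thesis by (simp add: P_def algebra_simps)
qed

text \<open>Truncated subtraction in both directions is the only comparison that the primitives
  offer.\<close>

definition eqT :: "nat => nat => nat => prog" where
 "eqT x y z = Prm (SetC x 1) ;; Prm (Sb 19 y z) ;; IfNZ 19 (Prm (SetC x 0)) ;; Prm (Sb 19 z y) ;;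
   IfNZ 19 (Prm (SetC x 0))"

definition neT :: "nat => nat => nat => prog" where
 "neT x y z = Prm (SetC x 0) ;; Prm (Sb 19 y z) ;; IfNZ 19 (Prm (SetC x 1)) ;; Prm (Sb 19 z y) ;;
   IfNZ 19 (Prm (SetC x 1))"

lemma eqT_simps [simp]: "wregs (eqT x y z) = {x, 19}" "warrs (eqT x y z) = {}" "norep (eqT x y z)" by (auto simp: eqT_def)

lemma neT_simps [simp]: "wregs (neT x y z) = {x, 19}" "warrs (neT x y z) = {}" "norep (neT x y z)" by (auto simp: neT_def)

lemma sem_eqT:
 assumes "x ~= y" "x ~= z" "x ~= 19" "y ~= 19" "z ~= 19"
 shows "exa cap (eqT x y z) s =
  ((fst s)(x := of_bool (fst s y = fst s z), 19 := fst s z - fst s y), snd s)"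
 by (cases "fst s y" "fst s z" rule: linorder_cases) (use assms in "simp_all add: eqT_def fun_eq_iff")

lemma sem_neT:
 assumes "x ~= y" "x ~= z" "x ~= 19" "y ~= 19" "z ~= 19"
 shows "exa cap (neT x y z) s =
  ((fst s)(x := of_bool (fst s y ~= fst s z), 19 := fst s z - fst s y), snd s)"
 by (cases "fst s y" "fst s z" rule: linorder_cases) (use assms in "simp_all add: neT_def fun_eq_iff")

text \<open>\<open>rev\<close>, because a word applies its last letter first.\<close>

definition tau_code :: "nat => nat list => prog" where
 "tau_code i ws = For 1 (Prm (Mov 2 1) ;; seqs (map (%a. Prm (Rd 2 (In a) 2)) (rev ws)) ;; Prm (Wr (Tau i) 1 2))"

definition apply_tab :: "(aname => nat => nat) => nat list => nat => nat" where
 "apply_tab A ws v = foldr (%a. A (In a)) ws v"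

lemma sem_read_chain:
 "exa cap (seqs (map (%a. Prm (Rd 2 (In a) 2)) as)) s =
  ((fst s)(2 := foldl (%v a. snd s (In a) v) (fst s 2) as), snd s)"
 by (induction as arbitrary: s) auto

lemma tau_code_simps [simp]: "wregs (tau_code i ws) <= {1, 2}" "warrs (tau_code i ws) = {Tau i}" by (auto simp: tau_code_def)

lemma tau_code_sem:
 fixes s :: ast
 assumes n: "fst s 0 = n"
 shows "(ALL v<n. snd (exa cap (tau_code i ws) s) (Tau i) v = apply_tab (snd s) ws v) &
  tim cap (tau_code i ws) s <= (length ws + 9) * (n + 1)"
proof -
 let ?c = "Prm (Mov 2 1) ;; seqs (map (%a. Prm (Rd 2 (In a) 2)) (rev ws)) ;; Prm (Wr (Tau i) 1 2)"
 have cz: "csz (seqs (map (%a. Prm (Rd 2 (In a) 2)) as)) = length as" for as :: "nat list" by (induction as) auto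
 have c: "norep ?c" "csz ?c = length ws + 2" by (auto simp: cz)
 have "(ALL v<n. snd (exa cap (For 1 ?c) s) (Tau i) v = apply_tab (snd s) ws v) &
   tim cap (For 1 ?c) s <= 3 + (\<Sum>i<n. (length ws + 2) + 4)"
 proof (rule For_rule[OF n, where I = "%j s'. ALL v<j. snd s' (Tau i) v = apply_tab (snd s) ws v"])
  fix j and s' :: ast assume j: "ALL v<j. snd s' (Tau i) v = apply_tab (snd s) ws v" "fst s' 1 = j"
   and sm: "same (insert 1 (wregs ?c)) (warrs ?c) s s'"
  have "snd s' (In a) = snd s (In a)" for a by (rule same_arr[OF sm]) auto
  then have "foldl (%v a. snd s' (In a) v) (fst s' 1) (rev ws) = apply_tab (snd s) ws j" using j(2) by (simp add: apply_tab_def foldl_conv_foldr)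
  then show "(ALL v<Suc j. snd (exa cap ?c s') (Tau i) v = apply_tab (snd s) ws v) &
    tim cap ?c s' <= length ws + 2"
   using j cost_norep[OF c(1), of "aram cap" s'] c(2) by (auto simp: sem_read_chain less_Suc_eq)
 qed auto
 then show ?thesis unfolding tau_code_def by (simp add: algebra_simps)
qed

definition tau_prog :: "nat list list => prog" where
 "tau_prog Tw = seqs (map (%i. tau_code i (Tw ! i)) [0..<length Tw])"

lemma tau_prog_simps: "wregs (tau_prog Tw) <= {1, 2}" "warrs (tau_prog Tw) <= range Tau"
 by (auto simp: tau_prog_def dest: subsetD[OF tau_code_simps(1)])

lemma tau_prog_sem:
 fixes s :: ast
 assumes n: "fst s 0 = n" and D: "ALL ws:set Tw. length ws <= D"
 shows "(ALL i<length Tw. ALL v<n. snd (exa cap (tau_prog Tw) s) (Tau i) v = apply_tab (snd s) (Tw ! i) v) &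
  tim cap (tau_prog Tw) s <= length Tw * (D + 9) * (n + 1)"
proof -
 let ?cs = "map (%i. tau_code i (Tw ! i)) [0..<length Tw]"
 have "(ALL i<length ?cs. ALL v<n. snd (exa cap (seqs ?cs) s) (Tau i) v = apply_tab (snd s) (Tw ! i) v) &
  tim cap (seqs ?cs) s <= (\<Sum>i<length ?cs. (D + 9) * (n + 1))"
 proof (rule seqs_rule[where I = "%j s'. ALL i<j. ALL v<n. snd s' (Tau i) v = apply_tab (snd s) (Tw ! i) v"])
  fix j and s' :: ast
  assume j: "j < length ?cs" and I: "ALL i<j. ALL v<n. snd s' (Tau i) v = apply_tab (snd s) (Tw ! i) v"
   and sm: "same (wregs (seqs ?cs)) (warrs (seqs ?cs)) s s'"
  have sub: "wregs (seqs ?cs) <= {1, 2}" using tau_prog_simps(1)[of Tw] unfolding tau_prog_def .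
  have n': "fst s' 0 = n" using same_reg[OF same_mono[OF sm sub subset_refl]] n by simp
  have "snd s' (In a) = snd s (In a)" for a by (rule same_arr[OF sm]) auto
  then have ap: "apply_tab (snd s') ws = apply_tab (snd s) ws" for ws by (intro ext) (simp add: apply_tab_def)
  have cj: "?cs ! j = tau_code j (Tw ! j)" using j by simp
  have "length (Tw ! j) <= D" using D j by simp
  then have "(length (Tw ! j) + 9) * (n + 1) <= (D + 9) * (n + 1)" by (intro mult_le_mono1) simp
  moreover have "snd (exa cap (tau_code j (Tw ! j)) s') (Tau i) = snd s' (Tau i)" if "i ~= j" for i by (rule sem_arr) (use that in simp)
  ultimately show "(ALL i<Suc j. ALL v<n. snd (exa cap (?cs ! j) s') (Tau i) v = apply_tab (snd s) (Tw ! i) v) &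
   tim cap (?cs ! j) s' <= (D + 9) * (n + 1)"
   unfolding cj using tau_code_sem[OF n', of cap j "Tw ! j"] I ap le_trans by (auto simp: less_Suc_eq)
 qed simp
 then show ?thesis unfolding tau_prog_def by (simp add: algebra_simps)
qed

text \<open>For a fixed word every vertex is in exactly one list, so one successor array serves all
  lists.\<close>

definition list_code :: "nat => prog" where
 "list_code i = For 1 (Prm (Rd 2 (Tau i) 1) ;; Prm (Rd 3 (Hd i) 2) ;; Prm (Wr (Nx i) 1 3) ;; Prm (Wr (Hd i) 2 1) ;;
   Prm (Rd 3 (Len i) 2) ;; Prm (Inc 3) ;; Prm (Wr (Len i) 2 3))"

definition list_prog :: "nat => prog" where
 "list_prog q = seqs (map list_code [0..<q])"

text \<open>\<open>rev\<close>, because vertices are put in front of their list in increasing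
  order.\<close>

definition members :: "nat => (nat => nat => nat) => nat => nat => nat list" where
 "members n tv i w = rev (filter (%y. tv i y = w) [0..<n])"

definition env :: "nat => nat => (nat => nat => nat) => ast => bool" where
 "env n q tv s = (fst s 0 = n & (ALL i<q. ALL y<n. snd s (Tau i) y = tv i y))"

definition lists_ok :: "nat => nat => (nat => nat => nat) => ast => bool" where
 "lists_ok n q tv s = ((ALL i<q. ALL w. lst (snd s (Nx i)) (snd s (Hd i) w) (snd s (Len i) w) = members n tv i w))"

lemma list_code_simps [simp]: "wregs (list_code i) = {1, 2, 3}" "warrs (list_code i) = {Nx i, Hd i, Len i}" by (auto simp: list_code_def)

lemma list_prog_simps: "wregs (list_prog q) <= {1, 2, 3}" "warrs (list_prog q) <= range Nx Un range Hd Un range Len" by (auto simp: list_prog_def)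

lemma list_code_sem:
 fixes s :: ast
 assumes e: "env n q tv s" and i: "i < q" and z: "ALL w. snd s (Len i) w = 0"
 shows "(ALL w. let s' = exa cap (list_code i) s in
   lst (snd s' (Nx i)) (snd s' (Hd i) w) (snd s' (Len i) w) = members n tv i w) &
  tim cap (list_code i) s <= 14 * (n + 1)"
proof -
 let ?c = "Prm (Rd 2 (Tau i) 1) ;; Prm (Rd 3 (Hd i) 2) ;; Prm (Wr (Nx i) 1 3) ;; Prm (Wr (Hd i) 2 1) ;;
   Prm (Rd 3 (Len i) 2) ;; Prm (Inc 3) ;; Prm (Wr (Len i) 2 3) :: prog"
 have n: "fst s 0 = n" using e by (simp add: env_def)
 let ?I = "%m s'. ALL w. lst (snd s' (Nx i)) (snd s' (Hd i) w) (snd s' (Len i) w) = members m tv i w"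
 have "?I n (exa cap (For 1 ?c) s) & tim cap (For 1 ?c) s <= 3 + (\<Sum>i<n. 7 + 4)"
 proof (rule For_rule[OF n, where I = ?I])
  show "?I 0 s" using z by (simp add: members_def)
  fix m and s' :: ast assume m: "m < n" and I: "?I m s'" and x: "fst s' 1 = m"
   and sm: "same (insert 1 (wregs ?c)) (warrs ?c) s s'"
  have "snd s' (Tau i) = snd s (Tau i)" by (rule same_arr[OF sm]) auto
  then have t: "snd s' (Tau i) m = tv i m" using e i m by (simp add: env_def)
  let ?w = "tv i m" and ?s = "exa cap ?c s'"
  have s1: "snd ?s (Nx i) = (snd s' (Nx i))(m := snd s' (Hd i) ?w)"
   "snd ?s (Hd i) = (snd s' (Hd i))(?w := m)"
   "snd ?s (Len i) = (snd s' (Len i))(?w := Suc (snd s' (Len i) ?w))" using t x by (auto simp: fun_eq_iff)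
  have fresh: "m ~: set (lst (snd s' (Nx i)) (snd s' (Hd i) w) (snd s' (Len i) w))" for w using I by (simp add: members_def)
  have "lst (snd ?s (Nx i)) (snd ?s (Hd i) w) (snd ?s (Len i) w) = members (Suc m) tv i w" for w
  proof (cases "w = ?w")
   case True
   then have "lst (snd ?s (Nx i)) (snd ?s (Hd i) w) (snd ?s (Len i) w) =
    m # lst ((snd s' (Nx i))(m := snd s' (Hd i) ?w)) (snd s' (Hd i) ?w) (snd s' (Len i) ?w)"
    unfolding s1 by (simp add: lst_Suc)
   then show ?thesis using True I lst_upd[OF fresh[of ?w]] by (simp add: members_def)
  next
   case False
   then show ?thesis unfolding s1 using I lst_upd[OF fresh[of w]] by (simp add: members_def)
  qed
  then show "?I (Suc m) ?s & tim cap ?c s' <= 7" by simp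
 qed auto
 then show ?thesis unfolding list_code_def Let_def by simp
qed

lemma list_prog_sem:
 fixes s :: ast
 assumes e: "env n q tv s" and z: "ALL i<q. ALL w. snd s (Len i) w = 0"
 shows "env n q tv (exa cap (list_prog q) s) & lists_ok n q tv (exa cap (list_prog q) s) &
  tim cap (list_prog q) s <= q * 14 * (n + 1)"
proof -
 let ?cs = "map list_code [0..<q]"
 let ?I = "%j s'. ALL i<j. ALL w. lst (snd s' (Nx i)) (snd s' (Hd i) w) (snd s' (Len i) w) = members n tv i w"
 have sub: "wregs (seqs ?cs) <= {1, 2, 3}" by auto
 let ?J = "%j s'. ?I j s' & (ALL i. j <= i --> i < q --> (ALL w. snd s' (Len i) w = 0))"
 have "?J (length ?cs) (exa cap (seqs ?cs) s) & tim cap (seqs ?cs) s <= (\<Sum>i<length ?cs. 14 * (n + 1))"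
 proof (rule seqs_rule[where I = ?J])
  show "?J 0 s" using z by simp
  fix j and s' :: ast
  assume j: "j < length ?cs" and I: "?J j s'" and sm: "same (wregs (seqs ?cs)) (warrs (seqs ?cs)) s s'"
  have "fst s' 0 = n" using same_reg[OF same_mono[OF sm sub subset_refl]] e by (simp add: env_def)
  moreover have "snd s' (Tau i) = snd s (Tau i)" for i by (rule same_arr[OF sm]) auto
  ultimately have e': "env n q tv s'" using e by (simp add: env_def)
  have cj: "?cs ! j = list_code j" using j by simp
  have "snd (exa cap (list_code j) s') a = snd s' a" if "a ~= Nx j" "a ~= Hd j" "a ~= Len j" for a by (rule sem_arr) (use that in simp)
  then show "?J (Suc j) (exa cap (?cs ! j) s') & tim cap (?cs ! j) s' <= 14 * (n + 1)"
   unfolding cj using list_code_sem[OF e', of j cap] I j by (auto simp: less_Suc_eq Let_def)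
 qed
 moreover have "env n q tv (exa cap (list_prog q) s)"
 proof -
  have "0 ~: wregs (list_prog q)" "Tau i ~: warrs (list_prog q)" for i using list_prog_simps[of q] by auto
  then show ?thesis using e by (simp add: env_def sem_reg sem_arr)
 qed
 ultimately show ?thesis unfolding list_prog_def lists_ok_def by (simp add: algebra_simps)
qed

lemma set_members: "set (members n tv i w) = {y. y < n & tv i y = w}" by (auto simp: members_def)

text \<open>The lists of one word partition the vertices. This is why a loop over all vertices and
  their lists takes linear time in total.\<close>

lemma sum_length_members:
 assumes "!!y. y < n ==> tv i y < n"
 shows "(\<Sum>w<n. length (members n tv i w)) = n"
proof -
 have "length (members n tv i w) = card {y : {..<n}. tv i y = w}" for w
 proof -
  have "length (members n tv i w) = card (set (members n tv i w))" by (rule distinct_card[symmetric]) (simp add: members_def)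
  then show ?thesis by (simp add: set_members)
 qed
 then have "(\<Sum>w<n. length (members n tv i w)) = (\<Sum>w<n. card {y : {..<n}. tv i y = w})" by simp
 also have "... = (\<Sum>w<n. \<Sum>y\<in>{y : {..<n}. tv i y = w}. 1)" by simp
 also have "... = (\<Sum>y<n. 1)" by (rule sum.group) (use assms in auto)
 finally show ?thesis by simp
qed

text \<open>The stamp \<open>Suc a\<close> on \<open>b\<close> records that \<open>b\<close> was
  already met from \<open>a\<close>. As the stamp depends on \<open>a\<close>, the array is never
  cleared, and \<open>Suc\<close> keeps stamps apart from the initial 0.\<close>

definition visit :: "aname => prog => nat => prog" where
 "visit mk body j = Prm (Rd 5 (Tau j) 3) ;; neT 6 5 1 ;; IfNZ 6 (Prm (Rd 7 mk 5) ;; Prm (Mov 8 1) ;; Prm (Inc 8) ;;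
   neT 6 7 8 ;; IfNZ 6 (Prm (Wr mk 5 8) ;; body))"

definition nbrs :: "nat => aname => prog => prog" where
 "nbrs q mk body = seqs (map (%i. Trav i (seqs (map (visit mk body) [0..<q]))) [0..<q])"

text \<open>The neighbourhoods of the trace graph, for vertex numbers instead of vertices.\<close>

definition Nb :: "nat => nat => (nat => nat => nat) => nat => nat set" where
 "Nb n q tv a = {b. b ~= a & (EX i<q. EX j<q. EX y<n. tv i y = a & tv j y = b)}"

lemma Nb_sym: "b : Nb n q tv a \<longleftrightarrow> a : Nb n q tv b" by (auto simp: Nb_def)

lemma Nb_subset: "(!!i y. i < q ==> y < n ==> tv i y < n) ==> Nb n q tv a <= {..<n}" by (auto simp: Nb_def)

abbreviation "garrs \<equiv> range Tau Un range Hd Un range Nx Un range Len"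

lemma visit_simps: "wregs (visit mk body j) <= {5, 6, 7, 8, 19} Un wregs body"
 "warrs (visit mk body j) <= insert mk (warrs body)" "norep body ==> norep (visit mk body j)"
 "csz (visit mk body j) = 21 + csz body" by (auto simp: visit_def) (simp add: neT_def)

lemma csz_seqs_visit: "csz (seqs (map (visit mk body) js)) = length js * (21 + csz body)" by (induction js) (auto simp: visit_simps)

lemma nbrs_simps: "wregs (nbrs q mk body) <= {3, 4, 5, 6, 7, 8, 19} Un wregs body"
 "warrs (nbrs q mk body) <= insert mk (warrs body)" using visit_simps(1,2)[of mk body] by (auto simp: nbrs_def)

text \<open>The invariant is indexed by the set \<open>X\<close> of neighbours already treated, as
  their order is immaterial. The same neighbour may arise from many \<open>i\<close>,
  \<open>y\<close> and \<open>j\<close>; the stamps ensure that \<open>body\<close> runs just once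
  for it.\<close>

lemma nbrs_rule:
 fixes s :: ast
 assumes e: "env n q tv s" and l: "lists_ok n q tv s" and a: "fst s 1 = a" and fresh: "ALL b. snd s mk b ~= Suc a"
  and body: "norep body" "wregs body Int {0, 1, 3, 4} = {}" "warrs body Int garrs = {}" "mk ~: warrs body"
   "mk ~: garrs"
  and I0: "I {} s"
  and ins: "!!X s s'. I X s ==> same {3, 4, 5, 6, 7, 8, 19} {mk} s s' ==> I X s'"
  and step: "!!X b s'. I X s' ==> X <= Nb n q tv a ==> b : Nb n q tv a ==> b ~: X ==> fst s' 5 = b ==> fst s' 1 = a ==>
    same ({3, 4, 5, 6, 7, 8, 19} Un wregs body) (insert mk (warrs body)) s s' ==> I (insert b X) (exa cap body s')"
 shows "I (Nb n q tv a) (exa cap (nbrs q mk body) s) &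
  (ALL b. snd (exa cap (nbrs q mk body) s) mk b = (if b : Nb n q tv a then Suc a else snd s mk b)) &
  tim cap (nbrs q mk body) s <= (\<Sum>i<q. 4 + length (members n tv i a) * (q * (21 + csz body) + 4))"
proof -
 let ?R = "{3, 4, 5, 6, 7, 8, 19} Un wregs body" and ?A = "insert mk (warrs body)" and ?N = "Nb n q tv a"
 define J where "J X s' = (I X s' & X <= ?N & (ALL b. snd s' mk b = (if b : X then Suc a else snd s mk b)) &
   same ?R ?A s s')" for X s'
 have J1: "fst s' 1 = a" if "J X s'" for X s' using same_reg[of ?R ?A s s' 1] that a body(2) by (auto simp: J_def)
 have Jarr: "snd s' b = snd s b" if "J X s'" "b : garrs" for X s' b
 proof -
  have "b ~: ?A" using that(2) body(3,5) by blast
  then show ?thesis using same_arr[of ?R ?A s s' b] that(1) by (simp add: J_def)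
 qed
 have Jins: "J X s''" if "J X s'" "same {3, 4, 5, 6, 7, 8, 19} {} s' s''" for X s' s''
 proof -
  have "same {3, 4, 5, 6, 7, 8, 19} {mk} s' s''" using that(2) by (rule same_mono) auto
  then have "I X s''" by (rule ins[rotated]) (use that(1) in "simp add: J_def")
  moreover have "same ?R ?A s s''" using that by (intro same_trans[of ?R ?A s s' s'']) (auto simp: J_def intro: same_mono)
  moreover have "snd s'' mk = snd s' mk" using that(2) by (simp add: same_def)
  ultimately show ?thesis using that(1) by (simp add: J_def)
 qed
 have visit: "J (X Un ({tv j y} - {a})) (exa cap (visit mk body j) s')"
  if J: "J X s'" and y: "fst s' 3 = y" "y < n" and j: "j < q" and i: "i < q" "tv i y = a" for X s' y i j
 proof -
  let ?b = "tv j y"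
  have b: "snd s' (Tau j) y = ?b" using Jarr[OF J, of "Tau j"] e j y by (simp add: env_def)
  define s1 where "s1 = exa cap (Prm (Rd 5 (Tau j) 3) ;; neT 6 5 1) s'"
  have s1: "s1 = ((fst s')(5 := ?b, 6 := of_bool (?b ~= a), 19 := a - ?b), snd s')" using b y J1[OF J] by (simp add: s1_def sem_neT fun_eq_iff)
  have J1': "J X s1" by (rule Jins[OF J]) (simp add: s1 same_def)
  define chk where "chk = Prm (Rd 7 mk 5) ;; Prm (Mov 8 1) ;; Prm (Inc 8) ;; neT 6 7 8"
  have vs: "exa cap (visit mk body j) s' = exa cap
    (IfNZ 6 (chk ;; IfNZ 6 (Prm (Wr mk 5 8) ;; body))) s1"
   by (simp add: visit_def s1_def chk_def)
  show ?thesis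
  proof (cases "?b = a")
   case True
   then have "exa cap (visit mk body j) s' = s1" unfolding vs by (simp add: s1)
   then show ?thesis using J1' True by simp
  next
   case False
   have bN: "?b : ?N" using False i j y by (auto simp: Nb_def)
   define s2 where "s2 = exa cap chk s1"
   have s2: "s2 = ((fst s1)(7 := snd s1 mk ?b, 8 := Suc a, 6 := of_bool (snd s1 mk ?b ~= Suc a),
    19 := Suc a - snd s1 mk ?b), snd s1)"
    using J1[OF J1'] s1 by (simp add: s2_def chk_def sem_neT fun_eq_iff)
   have J2: "J X s2" by (rule Jins[OF J1']) (simp add: s2 same_def)
   have vs2: "exa cap (visit mk body j) s' = exa cap (IfNZ 6 (Prm (Wr mk 5 8) ;; body)) s2" unfolding vs s2_def using False by (simp add: s1)
   have bX: "snd s1 mk ?b = Suc a \<longleftrightarrow> ?b : X" using J1' fresh by (simp add: J_def)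
   show ?thesis
   proof (cases "?b : X")
    case True
    then have "exa cap (visit mk body j) s' = s2" unfolding vs2 using bX by (simp add: s2)
    moreover have "X Un ({?b} - {a}) = X" using True by auto
    ultimately show ?thesis using J2 by simp
   next
    case nX: False
    define s3 where "s3 = exa cap (Prm (Wr mk 5 8)) s2"
    have s3: "s3 = (fst s2, (snd s2)(mk := (snd s2 mk)(?b := Suc a)))" by (simp add: s3_def s2 s1)
    have vs3: "exa cap (visit mk body j) s' = exa cap body s3" unfolding vs2 s3_def using nX bX by (simp add: s2)
    have sm: "same {3, 4, 5, 6, 7, 8, 19} {mk} s2 s3" by (simp add: s3 same_def)
    have I3: "I X s3" using ins[OF _ sm] J2 by (simp add: J_def)
    have same3: "same ?R ?A s s3" by (rule same_trans[of _ _ _ s2]) (use J2 sm in "auto simp: J_def intro: same_mono")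
    have r3: "fst s3 5 = ?b" "fst s3 1 = a" using s3 s2 s1 J1[OF J2] by simp_all
    have I4: "I (insert ?b X) (exa cap body s3)" by (rule step[OF I3 _ bN nX r3 same3]) (use J2 in "simp add: J_def")
    have same4: "same ?R ?A s (exa cap body s3)" by (rule same_trans[OF same3]) (auto intro: same_mono[OF same_sem])
    have "snd (exa cap body s3) mk b' = (if b' : insert ?b X then Suc a else snd s mk b')" for b' using J2 sem_arr[OF body(4)] by (simp add: s3 J_def)
    then have "J (insert ?b X) (exa cap body s3)" unfolding J_def using I4 same4 bN J2 by (simp add: J_def)
    moreover have "X Un ({?b} - {a}) = insert ?b X" using False by auto
    ultimately show ?thesis unfolding vs3 by simp
   qed
  qed
 qed
 let ?vs = "map (visit mk body) [0..<q]"
 have r3: "3 ~: wregs (visit mk body j)" for j using visit_simps(1)[of mk body j] body(2) by auto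
 have row: "J (X Un ((%j. tv j y) ` {..<q} - {a})) (exa cap (seqs ?vs) s')"
  if J: "J X s'" and y: "fst s' 3 = y" "y < n" and i: "i < q" "tv i y = a" for X s' y i
 proof -
  let ?I = "%m s'. J (X Un ((%j. tv j y) ` {..<m} - {a})) s' & fst s' 3 = y"
  have "?I (length ?vs) (exa cap (seqs ?vs) s') &
   tim cap (seqs ?vs) s' <= (\<Sum>i<length ?vs. 21 + csz body)"
  proof (rule seqs_rule[where I = ?I])
   show "?I 0 s'" using J y by simp
   fix m and t :: ast assume m: "m < length ?vs" and It: "?I m t"
   have "X Un ((%j. tv j y) ` {..<Suc m} - {a}) = (X Un ((%j. tv j y) ` {..<m} - {a})) Un ({tv m y} - {a})" by (auto simp: lessThan_Suc)
   moreover have "J ((X Un ((%j. tv j y) ` {..<m} - {a})) Un ({tv m y} - {a})) (exa cap (visit mk body m) t)" by (rule visit) (use It m y i in auto)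
   moreover have "fst (exa cap (visit mk body m) t) 3 = y" using It sem_reg[OF r3] by simp
   moreover have "tim cap (visit mk body m) t <= 21 + csz body" using cost_norep[OF visit_simps(3)[OF body(1)]] visit_simps(4)[of mk body m] by metis
   ultimately show "?I (Suc m) (exa cap (?vs ! m) t) & tim cap (?vs ! m) t <= 21 + csz body" using m by simp
  qed
  then show ?thesis by simp
 qed
 have nr: "norep (seqs ?vs)" "csz (seqs ?vs) = q * (21 + csz body)" using visit_simps(3)[OF body(1)] by (auto simp: csz_seqs_visit)
 have wr: "3 ~: wregs (seqs ?vs)" "Nx i ~: warrs (seqs ?vs)" for i
 proof -
  have "Nx i ~: insert mk (warrs body)" using body(3,5) by blast
  then have "Nx i ~: warrs (visit mk body j)" for j using visit_simps(2)[of mk body j] by blast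
  then show "3 ~: wregs (seqs ?vs)" "Nx i ~: warrs (seqs ?vs)" using r3 by auto
 qed
 let ?U = "%m. {b. b ~= a & (EX i<m. EX j<q. EX y<n. tv i y = a & tv j y = b)}"
 let ?ts = "map (%i. Trav i (seqs ?vs)) [0..<q]"
 have "J (?U (length ?ts)) (exa cap (seqs ?ts) s) & tim cap (seqs ?ts) s <=
   (\<Sum>i<length ?ts. 4 + length (members n tv i a) * (q * (21 + csz body) + 4))"
 proof (rule seqs_rule[where I = "%m. J (?U m)"])
  show "J (?U 0) s" using I0 by (simp add: J_def same_refl)
  fix i and t :: ast assume i: "i < length ?ts" and Jt: "J (?U i) t"
  let ?ys = "members n tv i a"
  have iq: "i < q" using i by simp
  have ys: "?ys = lst (snd t (Nx i)) (snd t (Hd i) (fst t 1)) (snd t (Len i) (fst t 1))" using l iq Jarr[OF Jt] J1[OF Jt] by (simp add: lists_ok_def)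
  let ?I = "%m s'. J (?U i Un ((\<Union>y\<in>set (take m ?ys). (%j. tv j y) ` {..<q}) - {a})) s'"
  have 1: "?I (length ?ys) (exa cap (Trav i (seqs ?vs)) t) &
    tim cap (Trav i (seqs ?vs)) t <= 4 + length ?ys * (q * (21 + csz body) + 4)"
  proof (rule Trav_rule[OF ys wr, where I = ?I])
   show "?I 0 t" using Jt by simp
   fix j s' v w assume "?I j s'"
   then show "?I j ((fst s')(3 := v, 4 := w), snd s')" by (rule Jins) (simp add: same_def)
  next
   fix m and s' :: ast assume m: "m < length ?ys" and Im: "?I m s'" and y: "fst s' 3 = ?ys ! m"
   have "?ys ! m : set ?ys" using m by simp
   then have ym: "?ys ! m < n" "tv i (?ys ! m) = a" by (auto simp: set_members)
   have "?I (Suc m) (exa cap (seqs ?vs) s')"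
   proof -
    have "?U i Un ((\<Union>y\<in>set (take (Suc m) ?ys). (%j. tv j y) ` {..<q}) - {a}) =
    (?U i Un ((\<Union>y\<in>set (take m ?ys). (%j. tv j y) ` {..<q}) - {a})) Un ((%j. tv j (?ys ! m)) ` {..<q} - {a})"
    using m by (auto simp: take_Suc_conv_app_nth)
    then show ?thesis using row[OF Im y ym(1) iq ym(2)] by simp
   qed
   then show "?I (Suc m) (exa cap (seqs ?vs) s') & tim cap (seqs ?vs) s' <= q * (21 + csz body)"
    using cost_norep[OF nr(1), of "aram cap" s'] nr(2) by simp
  qed
  have "?U (Suc i) = ?U i Un ((\<Union>y\<in>set (take (length ?ys) ?ys). (%j. tv j y) ` {..<q}) - {a})"
   by (auto simp: set_members less_Suc_eq image_iff)
  then show "J (?U (Suc i)) (exa cap (?ts ! i) t) & tim cap (?ts ! i) t <=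
    4 + length (members n tv i a) * (q * (21 + csz body) + 4)"
   using 1 iq by simp
 qed
 then show ?thesis unfolding nbrs_def J_def by (simp add: Nb_def)
qed

text \<open>Exchanging the sums charges every \<open>y\<close> once per word, so visiting all
  neighbourhoods takes linear time even if single ones are large.\<close>

lemma nbrs_cost_sum:
 assumes "!!i y. i < q ==> y < n ==> tv i y < n"
 shows "(\<Sum>a<n. \<Sum>i<q. 4 + length (members n tv i a) * c) = q * (4 + c) * n"
proof -
 have "(\<Sum>a<n. \<Sum>i<q. 4 + length (members n tv i a) * c) = (\<Sum>i<q. \<Sum>a<n. 4 + length (members n tv i a) * c)" by (rule sum.swap)
 also have "... = (\<Sum>i<q. (4 + c) * n)"
 proof (rule sum.cong[OF refl])
  fix i assume "i : {..<q}"
  then have "(\<Sum>w<n. length (members n tv i w)) = n" using assms by (intro sum_length_members) auto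
  then show "(\<Sum>a<n. 4 + length (members n tv i a) * c) = (4 + c) * n"
  proof -
   assume *: "(\<Sum>w<n. length (members n tv i w)) = n"
   have "(\<Sum>a<n. 4 + length (members n tv i a) * c) = n * 4 + (\<Sum>w<n. length (members n tv i w)) * c"
    by (simp add: sum.distrib sum_distrib_right)
   then show ?thesis unfolding * by (simp add: algebra_simps)
  qed
 qed
 finally show ?thesis by simp
qed

definition deg_prog :: "nat => prog" where
 "deg_prog q = For 1 (nbrs q Mk (Prm (Rd 9 Deg 1) ;; Prm (Inc 9) ;; Prm (Wr Deg 1 9)))"

lemma deg_prog_simps: "wregs (deg_prog q) <= {1, 3, 4, 5, 6, 7, 8, 9, 19}" "warrs (deg_prog q) <= {Mk, Deg}"
 using nbrs_simps[of q Mk "Prm (Rd 9 Deg 1) ;; Prm (Inc 9) ;; Prm (Wr Deg 1 9)"] by (auto simp: deg_prog_def)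

lemma deg_prog_sem:
 fixes s :: ast
 assumes e: "env n q tv s" and l: "lists_ok n q tv s" and z: "ALL v. snd s Deg v = 0" "ALL v. snd s Mk v = 0"
  and tv: "!!i y. i < q ==> y < n ==> tv i y < n"
 shows "(ALL v<n. snd (exa cap (deg_prog q) s) Deg v = card (Nb n q tv v)) &
  tim cap (deg_prog q) s <= (7 + q * (8 + q * 24)) * (n + 1)"
proof -
 let ?b = "Prm (Rd 9 Deg 1) ;; Prm (Inc 9) ;; Prm (Wr Deg 1 9) :: prog" and ?c = "nbrs q Mk (Prm (Rd 9 Deg 1) ;; Prm (Inc 9) ;; Prm (Wr Deg 1 9))"
 note w = nbrs_simps[of q Mk ?b]
 let ?C = "%a. \<Sum>i<q. 4 + length (members n tv i a) * (q * 24 + 4)"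
 have n: "fst s 0 = n" using e by (simp add: env_def)
 let ?I = "%m s'. (ALL v. snd s' Deg v = (if v < m then card (Nb n q tv v) else 0)) &
   (ALL b. snd s' Mk b <= m)"
 have "?I n (exa cap (For 1 ?c) s) & tim cap (For 1 ?c) s <= 3 + (\<Sum>a<n. ?C a + 4)"
 proof (rule For_rule[OF n, where I = ?I])
  show "1 ~: wregs ?c" using w by auto
  show "?I 0 s" using z by simp
  fix a and s' :: ast assume a: "a < n" and I: "?I a s'" and x: "fst s' 1 = a"
   and sm: "same (insert 1 (wregs ?c)) (warrs ?c) s s'"
  have sm': "same {1, 3, 4, 5, 6, 7, 8, 9, 19} {Mk, Deg} s s'" by (rule same_mono[OF sm]) (use w in auto)
  have e': "env n q tv s'" using e sm' by (simp add: env_def same_def)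
  have l': "lists_ok n q tv s'" using l sm' by (simp add: lists_ok_def same_def)
  let ?J = "%X t. snd t Deg = (snd s' Deg)(a := card X)"
  have fin: "finite (Nb n q tv a)" by (rule finite_subset[OF Nb_subset[OF tv]]) auto
  have "?J (Nb n q tv a) (exa cap ?c s') & (ALL b. snd (exa cap ?c s') Mk b = (if b : Nb n q tv a then Suc a else snd s' Mk b)) &
    tim cap ?c s' <= (\<Sum>i<q. 4 + length (members n tv i a) * (q * (21 + csz ?b) + 4))"
  proof (rule nbrs_rule[OF e' l' x, where I = ?J])
   show "ALL b. snd s' Mk b ~= Suc a" using I by (metis Suc_n_not_le_n)
   show "?J {} s'" using I by (simp add: fun_eq_iff)
   fix X b and t :: ast
   assume J: "?J X t" "X <= Nb n q tv a" "b ~: X" "fst t 1 = a"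
   then have "card (insert b X) = Suc (card X)" using finite_subset[OF J(2) fin] by simp
   then show "?J (insert b X) (exa cap ?b t)" using J by (simp add: fun_eq_iff)
  qed (auto simp: same_def)
  moreover have "csz ?b = 3" by simp
  ultimately show "?I (Suc a) (exa cap ?c s') & tim cap ?c s' <= ?C a" using I by (simp add: less_Suc_eq le_SucI)
 qed auto
 moreover have "3 + (\<Sum>a<n. ?C a + 4) <= (7 + q * (8 + q * 24)) * (n + 1)"
  using nbrs_cost_sum[of q n tv "q * 24 + 4"] tv by (simp add: sum.distrib algebra_simps)
 ultimately show ?thesis unfolding deg_prog_def by simp
qed

section \<open>Greedy elimination of vertices of small degree\<close>

definition push :: "aname list => prog" where
 "push hs = seqs (map (%h. Prm (Rd 15 h 1) ;; Prm (Wr h 1 14) ;; Prm (Mov 14 15)) hs)"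

lemma push_simps: "wregs (push hs) <= {14, 15}" "warrs (push hs) = set hs" "norep (push hs)" "csz (push hs) = 3 * length hs"
 by (auto simp: push_def) (induction hs, auto)

text \<open>At one vertex the arrays \<open>hs\<close> act as a stack of fixed height: the new value
  enters in front, all others move on by one, and the last is lost.\<close>

lemma push_sem:
 fixes s :: ast
 assumes "distinct hs"
 shows "map (%h. snd (exa cap (push hs) s) h (fst s 1)) hs =
   take (length hs) (fst s 14 # map (%h. snd s h (fst s 1)) hs) &
  (ALL h v. v ~= fst s 1 --> snd (exa cap (push hs) s) h v = snd s h v)"
 using assms
proof (induction hs arbitrary: s)
 case (Cons h hs)
 let ?s1 = "((fst s)(15 := snd s h (fst s 1), 14 := snd s h (fst s 1)), (snd s)(h := (snd s h)(fst s 1 := fst s 14)))"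
 have e: "exa cap (push (h # hs)) s = exa cap (push hs) ?s1" by (simp add: push_def)
 have h: "snd (exa cap (push hs) ?s1) h = snd ?s1 h" by (rule sem_arr) (use Cons.prems in "simp add: push_simps")
 have m: "map (%h. snd ?s1 h (fst ?s1 1)) hs = map (%h. snd s h (fst s 1)) hs" using Cons.prems by auto
 have IH: "map (%h. snd (exa cap (push hs) ?s1) h (fst ?s1 1)) hs =
   take (length hs) (fst ?s1 14 # map (%h. snd ?s1 h (fst ?s1 1)) hs)"
  "ALL h v. v ~= fst ?s1 1 --> snd (exa cap (push hs) ?s1) h v = snd ?s1 h v"
 proof -
  have "distinct hs" using Cons.prems by simp
  note IH = Cons.IH[OF this, of ?s1]
  show "map (%h. snd (exa cap (push hs) ?s1) h (fst ?s1 1)) hs =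
    take (length hs) (fst ?s1 14 # map (%h. snd ?s1 h (fst ?s1 1)) hs)" by (rule IH[THEN conjunct1])
  show "ALL h v. v ~= fst ?s1 1 --> snd (exa cap (push hs) ?s1) h v = snd ?s1 h v" by (rule IH[THEN conjunct2])
 qed
 show ?case unfolding e using IH(1)[unfolded m] IH(2) h by simp
qed (simp add: push_def)

definition enq :: "nat => nat => prog" where
 "enq x d = Prm (Rd 6 Deg x) ;; Prm (SetC 7 d) ;; Prm (Sb 6 6 7) ;; Prm (SetC 7 1) ;; IfNZ 6 (Prm (SetC 7 0)) ;;
   Prm (Rd 8 Inq x) ;; IfNZ 8 (Prm (SetC 7 0)) ;; IfNZ 7 (Prm (Wr Que 13 x) ;; Prm (Inc 13) ;; Prm (Wr Inq x 7))"

lemma enq_simps: "wregs (enq x d) = {6, 7, 8, 13}" "warrs (enq x d) = {Que, Inq}" "norep (enq x d)" "csz (enq x d) = 13" by (auto simp: enq_def)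

text \<open>Nothing is ever taken out of the queue; its processed prefix is the elimination
  order.\<close>

definition qlist :: "ast => nat list" where
 "qlist s = map (snd s Que) [0..<fst s 13]"

definition qinv :: "nat => ast => bool" where
 "qinv n s = (distinct (qlist s) & set (qlist s) = {v. snd s Inq v ~= 0} & set (qlist s) <= {..<n})"

lemma qlist_cong: "fst s' 13 = fst s 13 ==> snd s' Que = snd s Que ==> qlist s' = qlist s" by (simp add: qlist_def)

lemma qinv_cong:
 assumes "fst s' 13 = fst s 13" "snd s' Que = snd s Que" "snd s' Inq = snd s Inq"
 shows "qlist s' = qlist s" "qinv n s' = qinv n s" unfolding qinv_def qlist_def assms by (rule refl)+

lemma enq_sem:
 fixes s :: ast
 assumes x: "x ~= 6" "x ~= 7" "x ~= 8" "x ~= 13" and v: "fst s x = v" "v < n" and q: "qinv n s"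
 shows "qlist (exa cap (enq x d) s) = (if snd s Deg v <= d & v ~: set (qlist s) then qlist s @ [v] else qlist s) &
  qinv n (exa cap (enq x d) s)"
proof (cases "snd s Deg v <= d & snd s Inq v = 0")
 case True
 let ?s = "exa cap (enq x d) s"
 have s: "fst ?s 13 = Suc (fst s 13)" "snd ?s Que = (snd s Que)(fst s 13 := v)" "snd ?s Inq = (snd s Inq)(v := 1)"
  using True x v by (simp_all add: enq_def)
 have ql: "qlist ?s = qlist s @ [v]" using s by (simp add: qlist_def)
 have nv: "v ~: set (qlist s)" using True q by (simp add: qinv_def)
 show ?thesis using ql nv True q v by (auto simp: qinv_def s)
next
 case False
 let ?s = "exa cap (enq x d) s"
 have s: "fst ?s 13 = fst s 13" "snd ?s = snd s" using False x v by (auto simp: enq_def)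
 have ql: "qlist ?s = qlist s" using s by (simp add: qlist_def)
 show ?thesis using ql False q by (auto simp: qinv_def s)
qed

definition hs_of :: "nat => aname list" where
 "hs_of d = map Hn [1..<Suc d]"

definition init_prog :: "nat => prog" where
 "init_prog d = Prm (SetC 13 0) ;; For 1 (seqs (map (%l. Prm (Wr (Hn l) 1 1)) [0..<Suc d]) ;; enq 1 d)"

lemma sem_write_all:
 fixes s :: ast
 shows "exa cap (seqs (map (%l. Prm (Wr (f l) 1 1)) ls)) s =
  (fst s, %a. if a : f ` set ls then (snd s a)(fst s 1 := fst s 1) else snd s a)"
 by (induction ls arbitrary: s) (auto simp: fun_eq_iff)

lemma init_prog_simps: "wregs (init_prog d) = {1, 6, 7, 8, 13}" "warrs (init_prog d) = Hn ` {..d} Un {Que, Inq}"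
 by (auto simp: init_prog_def enq_simps)

lemma init_prog_sem:
 fixes s :: ast
 assumes n: "fst s 0 = n" and z: "ALL v. snd s Inq v = 0"
 shows "let s' = exa cap (init_prog d) s in qinv n s' &
   (ALL v<n. v : set (qlist s') \<longleftrightarrow> snd s Deg v <= d) & (ALL l<=d. ALL v<n. snd s' (Hn l) v = v) &
   tim cap (init_prog d) s <= (d + 22) * (n + 1)"
proof -
 let ?c = "seqs (map (%l. Prm (Wr (Hn l) 1 1)) [0..<Suc d]) ;; enq 1 d :: prog"
 let ?s0 = "((fst s)(13 := 0), snd s)"
 have cz: "csz (seqs (map (%l. Prm (Wr (Hn l) 1 1)) ls)) = length ls" for ls by (induction ls) auto
 have nr: "norep ?c" "csz ?c = d + 14" using cz[of "[0..<Suc d]"] by (auto simp: enq_simps)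
 let ?I = "%m s'. qinv n s' & (ALL v. v : set (qlist s') \<longleftrightarrow> v < m & snd s Deg v <= d) & (ALL l<=d. ALL v<m. snd s' (Hn l) v = v)"
 have "?I n (exa cap (For 1 ?c) ?s0) & tim cap (For 1 ?c) ?s0 <= 3 + (\<Sum>a<n. (d + 14) + 4)"
 proof (rule For_rule[where I = ?I])
  show "fst ?s0 0 = n" using n by simp
  show "?I 0 ?s0" using z by (simp add: qinv_def qlist_def)
  show "1 ~: wregs ?c" by (auto simp: enq_simps)
  fix i s v assume "?I i s"
  moreover have "qlist ((fst s)(1 := v), snd s) = qlist s" "qinv n ((fst s)(1 := v), snd s) = qinv n s" by (rule qinv_cong; simp)+
  ultimately show "?I i ((fst s)(1 := v), snd s)" by simp
 next
  fix m and s' :: ast assume m: "m < n" and I: "?I m s'" and x: "fst s' 1 = m"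
   and sm: "same (insert 1 (wregs ?c)) (warrs ?c) ?s0 s'"
  define t where "t = exa cap (seqs (map (%l. Prm (Wr (Hn l) 1 1)) [0..<Suc d]) :: prog) s'"
  have t: "fst t = fst s'" "snd t a = (if a : Hn ` {..d} then (snd s' a)(m := m) else snd s' a)" for a
  proof -
   have "set [0..<Suc d] = {..d}" by auto
   then show "fst t = fst s'" "snd t a = (if a : Hn ` {..d} then (snd s' a)(m := m) else snd s' a)"
    unfolding t_def sem_write_all using x by (simp_all del: upt_Suc)
  qed
  have ql: "qlist t = qlist s'" "qinv n t"
  proof -
   have "fst t 13 = fst s' 13" "snd t Que = snd s' Que" "snd t Inq = snd s' Inq" using t by auto
   from qinv_cong[OF this] show "qlist t = qlist s'" "qinv n t" using I by auto
  qed
  have dg: "snd t Deg = snd s Deg"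
  proof -
   have "snd s' Deg = snd ?s0 Deg" by (rule same_arr[OF sm]) (auto simp: enq_simps)
   then show ?thesis using t(2)[of Deg] by auto
  qed
  have E: "qlist (exa cap (enq 1 d) t) = (if snd s Deg m <= d & m ~: set (qlist t) then qlist t @ [m] else qlist t) &
    qinv n (exa cap (enq 1 d) t)"
   using enq_sem[of 1 t m n cap d] t x m ql dg by simp
  have h: "snd (exa cap (enq 1 d) t) (Hn l) = snd t (Hn l)" for l by (rule sem_arr) (simp add: enq_simps)
  have e: "exa cap ?c s' = exa cap (enq 1 d) t" by (simp add: t_def)
  show "?I (Suc m) (exa cap ?c s') & tim cap ?c s' <= d + 14" unfolding e using E I ql h t(2) cost_norep[OF nr(1), of "aram cap" s'] nr(2)
   by (auto simp: less_Suc_eq)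
 qed auto
 then show ?thesis unfolding init_prog_def Let_def by (simp add: algebra_simps)
qed

text \<open>Register 1 holds the vertex \<open>a\<close> that is being removed, register 5 one of
  its neighbours. Only a neighbour not yet removed is recorded as later than \<open>a\<close>, and
  its degree drops by one.\<close>

definition gbody :: "nat => prog" where
 "gbody d = Prm (Rd 9 Rm 5) ;; Prm (SetC 10 1) ;; IfNZ 9 (Prm (SetC 10 0)) ;; IfNZ 10 (Prm (Mov 14 5) ;; push (hs_of d) ;;
   Prm (Rd 9 Deg 5) ;; Prm (SetC 10 1) ;; Prm (Sb 9 9 10) ;; Prm (Wr Deg 5 9) ;; enq 5 d)"

definition greedy :: "nat => nat => prog" where
 "greedy q d = For 2 (Prm (Rd 1 Que 2) ;; Prm (SetC 6 1) ;; Prm (Wr Rm 1 6) ;; nbrs q Mk2 (gbody d))"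

lemma set_hs_of: "set (hs_of d) = Hn ` {1..d}" "distinct (hs_of d)" "length (hs_of d) = d" by (auto simp: hs_of_def distinct_map inj_on_def)

lemma gbody_simps: "wregs (gbody d) <= {6, 7, 8, 9, 10, 13, 14, 15}" "warrs (gbody d) = Hn ` {1..d} Un {Deg, Que, Inq}"
 "norep (gbody d)" "csz (gbody d) = 23 + 3 * d" using push_simps[of "hs_of d"] by (auto simp: gbody_def enq_simps set_hs_of)

lemma greedy_simps: "wregs (greedy q d) <= {1, 2, 3, 4, 5, 6, 7, 8, 9, 10, 13, 14, 15, 19}"
 "warrs (greedy q d) <= Hn ` {1..d} Un {Deg, Que, Inq, Rm, Mk2}"
proof -
 have "wregs (nbrs q Mk2 (gbody d)) <= {3, 4, 5, 6, 7, 8, 19} Un {6, 7, 8, 9, 10, 13, 14, 15}"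
  using nbrs_simps(1)[of q Mk2 "gbody d"] gbody_simps(1)[of d] by blast
 then have "wregs (nbrs q Mk2 (gbody d)) <= {1, 2, 3, 4, 5, 6, 7, 8, 9, 10, 13, 14, 15, 19}" by (rule order.trans) simp
 then show "wregs (greedy q d) <= {1, 2, 3, 4, 5, 6, 7, 8, 9, 10, 13, 14, 15, 19}" by (simp add: greedy_def)
 have "warrs (nbrs q Mk2 (gbody d)) <= Hn ` {1..d} Un {Deg, Que, Inq, Rm, Mk2}"
  using nbrs_simps(2)[of q Mk2 "gbody d"] unfolding gbody_simps(2)[of d] by (rule order.trans) auto
 then show "warrs (greedy q d) <= Hn ` {1..d} Un {Deg, Que, Inq, Rm, Mk2}" by (simp add: greedy_def)
qed

definition ginv :: "nat => nat => nat => (nat => nat => nat) => nat => ast => bool" where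
 "ginv n q d tv t s \<longleftrightarrow> (let L = qlist s; R = set (take t L) in qinv n s & t <= length L &
   (ALL v<n. snd s Rm v ~= 0 \<longleftrightarrow> v : R) &
   (ALL v<n. v ~: R --> snd s Deg v = card (Nb n q tv v - R)) &
   (ALL v<n. v : set L \<longleftrightarrow> v : R \<or> card (Nb n q tv v - R) <= d) &
   (ALL i<t. insert (L ! i) (set (map (%h. snd s h (L ! i)) (hs_of d))) =
    insert (L ! i) (Nb n q tv (L ! i) - set (take i L))) &
   (ALL v<n. v ~: R --> (ALL h:set (hs_of d). snd s h v = v)) &
   (ALL b. snd s Mk2 b = 0 \<or> (EX v:R. snd s Mk2 b = Suc v)))"

lemma take_Cons_take: "take d (x # take d ys) = take d (x # ys)" by (cases d) (simp_all add: min_def take_Suc_conv_app_nth take_take)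

lemma gbody_sem:
 fixes s :: ast
 assumes a: "fst s 1 = a" and b: "fst s 5 = b" "b < n" and q: "qinv n s"
 shows "let s' = exa cap (gbody d) s in
  (snd s Rm b ~= 0 --> snd s' = snd s & fst s' 13 = fst s 13) &
  (snd s Rm b = 0 --> qinv n s' &
   map (%h. snd s' h a) (hs_of d) = take d (b # map (%h. snd s h a) (hs_of d)) &
   (ALL h:set (hs_of d). ALL v. v ~= a --> snd s' h v = snd s h v) &
   snd s' Deg = (snd s Deg)(b := snd s Deg b - 1) &
   qlist s' = (if snd s Deg b - 1 <= d & b ~: set (qlist s) then qlist s @ [b] else qlist s))"
proof -
 let ?s' = "exa cap (gbody d) s"
 have 1: "snd ?s' = snd s & fst ?s' 13 = fst s 13" if "snd s Rm b ~= 0" using that b by (simp add: gbody_def)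
 have 2: "qinv n ?s' & map (%h. snd ?s' h a) (hs_of d) = take d (b # map (%h. snd s h a) (hs_of d)) &
   (ALL h:set (hs_of d). ALL v. v ~= a --> snd ?s' h v = snd s h v) &
   snd ?s' Deg = (snd s Deg)(b := snd s Deg b - 1) &
   qlist ?s' = (if snd s Deg b - 1 <= d & b ~: set (qlist s) then qlist s @ [b] else qlist s)" if r: "snd s Rm b = 0"
 proof -
  define s1 where "s1 = ((fst s)(9 := 0, 10 := 1, 14 := b), snd s)"
  define s2 where "s2 = exa cap (push (hs_of d)) s1"
  define s3 where "s3 = ((fst s2)(10 := 1, 9 := snd s2 Deg b - 1), (snd s2)(Deg := (snd s2 Deg)(b := snd s2 Deg b - 1)))"
  have p: "fst s2 x = fst s1 x" if "x ~: {14, 15}" for x unfolding s2_def by (rule sem_reg) (use that push_simps(1)[of "hs_of d"] in auto)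
  have pa: "snd s2 h = snd s h" if "h ~: set (hs_of d)" for h unfolding s2_def by (subst sem_arr) (use that in "auto simp: push_simps s1_def")
  have e: "?s' = exa cap (enq 5 d) s3"
  proof -
   have "?s' = exa cap (Prm (Rd 9 Deg 5) ;; Prm (SetC 10 1) ;; Prm (Sb 9 9 10) ;; Prm (Wr Deg 5 9) ;; enq 5 d) s2"
    using r b by (simp add: gbody_def s2_def s1_def)
   moreover have "exa cap (Prm (Rd 9 Deg 5) ;; Prm (SetC 10 1) ;; Prm (Sb 9 9 10) ;; Prm (Wr Deg 5 9)) s2 = s3"
    using p[of 5] b by (simp add: s3_def s1_def fun_eq_iff)
   ultimately show ?thesis by simp
  qed
  have hs: "h ~= Deg" "h ~= Que" "h ~= Inq" if "h : set (hs_of d)" for h using that by (auto simp: set_hs_of)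
  have nm: "Deg ~: set (hs_of d)" "Que ~: set (hs_of d)" "Inq ~: set (hs_of d)" using hs by auto
  have q3: "qinv n s3" "qlist s3 = qlist s"
  proof -
   have "fst s3 13 = fst s 13" "snd s3 Que = snd s Que" "snd s3 Inq = snd s Inq" using p[of 13] pa nm by (simp_all add: s3_def s1_def)
   from qinv_cong[OF this] show "qlist s3 = qlist s" "qinv n s3" using q by auto
  qed
  have b3: "fst s3 5 = b" using p[of 5] b by (simp add: s3_def s1_def)
  have d3: "snd s3 Deg = (snd s Deg)(b := snd s Deg b - 1)" using pa[OF nm(1)] by (simp add: s3_def)
  note E = enq_sem[of 5 s3 b n cap d, OF _ _ _ _ b3 b(2) q3(1), unfolded d3 q3(2)]
  have ar: "snd ?s' h = snd s3 h" if "h ~= Que" "h ~= Inq" for h unfolding e by (rule sem_arr) (use that in "simp add: enq_simps")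
  have ps: "map (%h. snd s2 h a) (hs_of d) = take d (b # map (%h. snd s h a) (hs_of d))"
   "ALL h v. v ~= a --> snd s2 h v = snd s h v"
   using push_sem[OF set_hs_of(2), where d1 = d and s = s1 and cap = cap] a by (simp_all add: s2_def[symmetric] set_hs_of) (simp_all add: s1_def)
  have m: "map (%h. snd ?s' h a) (hs_of d) = map (%h. snd s2 h a) (hs_of d)"
  proof (rule map_cong[OF refl])
   fix h assume h: "h : set (hs_of d)"
   show "snd ?s' h a = snd s2 h a" using ar[OF hs(2,3)[OF h]] hs(1)[OF h] by (simp add: s3_def)
  qed
  have o: "ALL h:set (hs_of d). ALL v. v ~= a --> snd ?s' h v = snd s h v"
  proof (intro ballI allI impI)
   fix h v assume h: "h : set (hs_of d)" "v ~= a"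
   show "snd ?s' h v = snd s h v" using ar[OF hs(2,3)[OF h(1)]] hs(1)[OF h(1)] ps(2) h(2) by (simp add: s3_def)
  qed
  have "snd ?s' Deg = (snd s Deg)(b := snd s Deg b - 1)" using ar[of Deg] d3 by simp
  then show ?thesis using E m ps(1) o unfolding e[symmetric] by simp
 qed
 show ?thesis unfolding Let_def using 1 2 by blast
qed

text \<open>The queue cannot run dry: by \<open>deg\<close> some remaining vertex has at most
  \<open>d\<close> remaining neighbours, and by the invariant it is queued. For the same reason the
  \<open>d\<close> entries of the removed vertex have room for all its remaining neighbours.\<close>

lemma greedy_step:
 fixes s :: ast
 assumes e: "env n q tv s" and l: "lists_ok n q tv s" and tv: "!!i y. i < q ==> y < n ==> tv i y < n"
  and deg: "!!S. S <= {..<n} ==> S ~= {} ==> EX v:S. card (Nb n q tv v Int S) <= d"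
  and t: "t < n" "fst s 2 = t" and G: "ginv n q d tv t s"
 shows "ginv n q d tv (Suc t) (exa cap (Prm (Rd 1 Que 2) ;; Prm (SetC 6 1) ;; Prm (Wr Rm 1 6) ;; nbrs q Mk2 (gbody d)) s) &
  tim cap (Prm (Rd 1 Que 2) ;; Prm (SetC 6 1) ;; Prm (Wr Rm 1 6) ;; nbrs q Mk2 (gbody d)) s <=
   3 + (\<Sum>i<q. 4 + length (members n tv i (qlist s ! t)) * (q * (44 + 3 * d) + 4)) & t < length (qlist s) &
  (EX ext. qlist (exa cap (Prm (Rd 1 Que 2) ;; Prm (SetC 6 1) ;; Prm (Wr Rm 1 6) ;; nbrs q Mk2 (gbody d)) s) = qlist s @ ext)"
proof -
 let ?N = "Nb n q tv" and ?L0 = "qlist s" and ?Hs = "hs_of d"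
 define R where "R = set (take t ?L0)"
 have g: "qinv n s" "t <= length ?L0" "!!v. v < n ==> snd s Rm v ~= 0 \<longleftrightarrow> v : R"
  "!!v. v < n ==> v ~: R ==> snd s Deg v = card (?N v - R)"
  "!!v. v < n ==> v : set ?L0 \<longleftrightarrow> v : R \<or> card (?N v - R) <= d"
  "!!i. i < t ==> insert (?L0 ! i) (set (map (%h. snd s h (?L0 ! i)) ?Hs)) = insert (?L0 ! i) (?N (?L0 ! i) - set (take i ?L0))"
  "!!v h. v < n ==> v ~: R ==> h : set ?Hs ==> snd s h v = v"
  "!!b. snd s Mk2 b = 0 \<or> (EX v:R. snd s Mk2 b = Suc v)" using G by (auto simp: ginv_def Let_def R_def)
 have dist: "distinct ?L0" and Ln: "set ?L0 <= {..<n}" using g(1) by (auto simp: qinv_def)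
 have NV: "?N v <= {..<n}" for v by (rule Nb_subset[OF tv])
 have finN: "finite (?N v)" for v by (rule finite_subset[OF NV]) simp
 have RL: "R <= set ?L0" by (auto simp: R_def dest: in_set_takeD)
 have cR: "card R = t" using dist g(2) by (simp add: R_def distinct_card)
 have tL: "t < length ?L0"
 proof -
  have "{..<n} - R ~= {}"
  proof
   assume "{..<n} - R = {}"
   then have "{..<n} <= R" by auto
   then have "card {..<n} <= card R" by (rule card_mono[rotated]) (simp add: R_def)
   then show False using cR t by simp
  qed
  then obtain v where v: "v < n" "v ~: R" "card (?N v Int ({..<n} - R)) <= d" using deg[of "{..<n} - R"] by auto
  have "?N v Int ({..<n} - R) = ?N v - R" using NV by auto
  then have "v : set ?L0" using g(5)[OF v(1)] v by simp
  then have "R ~= set ?L0" using v(2) by auto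
  then show ?thesis using g(2) by (cases "t = length ?L0") (auto simp: R_def)
 qed
 define a where "a = ?L0 ! t"
 have aL: "a : set ?L0" using tL by (simp add: a_def)
 have an: "a < n" using aL Ln by auto
 have aR: "a ~: R" using dist tL by (auto simp: R_def a_def in_set_conv_nth nth_eq_iff_index_eq)
 define R' where "R' = insert a R"
 have R't: "R' = set (take (Suc t) ?L0)" using tL by (simp add: R'_def R_def a_def take_Suc_conv_app_nth)
 have aN: "a ~: ?N a" by (simp add: Nb_def)
 define s1 where "s1 = exa cap (Prm (Rd 1 Que 2) ;; Prm (SetC 6 1) ;; Prm (Wr Rm 1 6)) s"
 have qa: "snd s Que t = a" using tL by (simp add: a_def qlist_def)
 have s1: "fst s1 1 = a" "fst s1 13 = fst s 13" "fst s1 0 = fst s 0" "snd s1 = (snd s)(Rm := (snd s Rm)(a := 1))" using t qa by (simp_all add: s1_def)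
 have ql1: "qlist s1 = ?L0" "qinv n s1"
 proof -
  have "fst s1 13 = fst s 13" "snd s1 Que = snd s Que" "snd s1 Inq = snd s Inq" using s1 by auto
  from qinv_cong[OF this] show "qlist s1 = ?L0" "qinv n s1" using g(1) by auto
 qed
 have e1: "env n q tv s1" using e s1 by (simp add: env_def)
 have l1: "lists_ok n q tv s1" using l s1 by (simp add: lists_ok_def)
 have Rm1: "snd s1 Rm v ~= 0 \<longleftrightarrow> v : R'" if "v < n" for v using g(3)[OF that] s1(4) by (simp add: R'_def)
 have hneq: "h ~= Rm" if "h : set ?Hs" for h using that by (auto simp: set_hs_of)
 \<comment> \<open>While \<open>a\<close> is being removed, the degrees of the neighbours in
   \<open>X\<close> already refer to \<open>R'\<close>, all other ones still to \<open>R\<close>.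
   \<open>pl\<close> lists the neighbours recorded so far, followed by the initial entries
   \<open>a\<close>.\<close>
 let ?I = "%X u. qinv n u & (EX ext. qlist u = ?L0 @ ext) &
   (ALL v<n. v ~: R' --> snd u Deg v = card (?N v - (if v : X then R' else R))) &
   (ALL v<n. v : set (qlist u) \<longleftrightarrow> v : R' \<or> snd u Deg v <= d) &
   (EX pl. distinct pl & set pl = X - R' & map (%h. snd u h a) ?Hs = take d (pl @ replicate d a)) &
   (ALL h:set ?Hs. ALL v. v ~= a --> snd u h v = snd s h v)"
 have bd: "wregs (gbody d) Int {0, 1, 3, 4} = {}" "warrs (gbody d) Int garrs = {}" "Mk2 ~: warrs (gbody d)"
  "Mk2 ~: garrs" using gbody_simps[of d] by auto
 let ?s' = "exa cap (nbrs q Mk2 (gbody d)) s1"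
 have main: "?I (?N a) ?s' & (ALL b. snd ?s' Mk2 b = (if b : ?N a then Suc a else snd s1 Mk2 b)) &
   tim cap (nbrs q Mk2 (gbody d)) s1 <= (\<Sum>i<q. 4 + length (members n tv i a) * (q * (21 + csz (gbody d)) + 4))"
 proof (rule nbrs_rule[OF e1 l1 s1(1) _ gbody_simps(3) bd, where I = ?I])
  show "ALL b. snd s1 Mk2 b ~= Suc a"
  proof
   fix b show "snd s1 Mk2 b ~= Suc a" using g(8)[of b] aR s1(4) by auto
  qed
  have "map (%h. snd s1 h a) ?Hs = replicate d a" using g(7)[OF an aR] s1(4) hneq set_hs_of(3)[of d] by (intro replicate_eqI) auto
  then have 1: "EX pl. distinct pl & set pl = {} - R' & map (%h. snd s1 h a) ?Hs = take d (pl @ replicate d a)" by (intro exI[of _ "[]"]) simp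
  have 2: "v : set ?L0 \<longleftrightarrow> v : R' \<or> snd s1 Deg v <= d" if v: "v < n" for v
  proof (cases "v : R'")
   case True
   then show ?thesis using RL aL by (auto simp: R'_def)
  next
   case False
   then show ?thesis using g(4)[OF v] g(5)[OF v] s1(4) by (simp add: R'_def)
  qed
  have 3: "snd s1 Deg v = card (?N v - R)" if "v < n" "v ~: R'" for v using g(4)[of v] that s1(4) by (simp add: R'_def)
  have 4: "ALL h:set ?Hs. ALL v. v ~= a --> snd s1 h v = snd s h v" using s1(4) hneq by auto
  show "?I {} s1" using ql1 1 2 3 4 by simp
 next
  fix X and u u' :: ast assume I: "?I X u" and sm: "same {3, 4, 5, 6, 7, 8, 19} {Mk2} u u'"
  have r13: "fst u' 13 = fst u 13" by (rule same_reg[OF sm]) simp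
  have ar: "snd u' x = snd u x" if "x ~= Mk2" for x by (rule same_arr[OF sm]) (use that in simp)
  have ql: "qlist u' = qlist u" "qinv n u' = qinv n u" by (rule qinv_cong; simp add: r13 ar)+
  have "h ~= Mk2" if "h : set ?Hs" for h using that by (auto simp: set_hs_of)
  then have hs: "ALL h:set ?Hs. snd u' h = snd u h" using ar by blast
  then have m: "map (%h. snd u' h a) ?Hs = map (%h. snd u h a) ?Hs" by auto
  have dg: "snd u' Deg = snd u Deg" by (rule ar) simp
  have "ALL h:set ?Hs. ALL v. v ~= a --> snd u' h v = snd s h v" using I hs by auto
  then show "?I X u'" unfolding ql m dg using I by blast
 next
  fix X b and u :: ast
  assume I: "?I X u" and X: "X <= ?N a" and b: "b : ?N a" "b ~: X" and r: "fst u 5 = b" "fst u 1 = a"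
   and sm: "same ({3, 4, 5, 6, 7, 8, 19} Un wregs (gbody d)) (insert Mk2 (warrs (gbody d))) s1 u"
  have bn: "b < n" using b NV by auto
  have ba: "b ~= a" using b aN by auto
  have rm: "snd u Rm = snd s1 Rm" by (rule same_arr[OF sm]) (auto simp: gbody_simps)
  have qu: "qinv n u" using I by blast
  note B = gbody_sem[OF r(2,1) bn qu, of cap d, unfolded Let_def]
  let ?u = "exa cap (gbody d) u"
  show "?I (insert b X) ?u"
  proof (cases "b : R'")
   case True
   then have "snd u Rm b ~= 0" using Rm1[OF bn] rm by simp
   then have su: "snd ?u = snd u" "fst ?u 13 = fst u 13" using B by auto
   have ql: "qlist ?u = qlist u" "qinv n ?u = qinv n u" by (rule qinv_cong; simp add: su)+
   have x: "insert b X - R' = X - R'" using True by auto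
   have "(v : insert b X) = (v : X)" if "v ~: R'" for v using True that by auto
   then show ?thesis using I unfolding ql su x by auto
  next
   case False
   then have "snd u Rm b = 0" using Rm1[OF bn] rm by auto
   then have B2: "qinv n ?u" "map (%h. snd ?u h a) ?Hs = take d (b # map (%h. snd u h a) ?Hs)"
    "ALL h:set ?Hs. ALL v. v ~= a --> snd ?u h v = snd u h v" "snd ?u Deg = (snd u Deg)(b := snd u Deg b - 1)"
    "qlist ?u = (if snd u Deg b - 1 <= d & b ~: set (qlist u) then qlist u @ [b] else qlist u)" using B by auto
   have db: "snd u Deg b = card (?N b - R)" using I bn False b(2) by auto
   have ab: "a : ?N b" using b(1) Nb_sym by metis
   have "?N b - R' = (?N b - R) - {a}" by (auto simp: R'_def)
   moreover have "a : ?N b - R" using ab aR by simp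
   ultimately have dd: "card (?N b - R') = snd u Deg b - 1" using db finN by simp
   have D: "snd ?u Deg v = card (?N v - (if v : insert b X then R' else R))" if "v < n" "v ~: R'" for v using I that dd B2(4) by auto
   have Q: "v : set (qlist ?u) \<longleftrightarrow> v : R' \<or> snd ?u Deg v <= d" if v: "v < n" for v
   proof (cases "v = b")
    case True
    have "b : set (qlist u) \<longleftrightarrow> snd u Deg b <= d" using I bn False by blast
    then show ?thesis using True B2(4,5) False by auto
   next
    case vb: False
    then have "v : set (qlist ?u) \<longleftrightarrow> v : set (qlist u)" using B2(5) by auto
    moreover have "snd ?u Deg v = snd u Deg v" using B2(4) vb by simp
    ultimately show ?thesis using I v by simp
   qed
   obtain pl where pl: "distinct pl" "set pl = X - R'" "map (%h. snd u h a) ?Hs = take d (pl @ replicate d a)" using I by blast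
   have "map (%h. snd ?u h a) ?Hs = take d ((b # pl) @ replicate d a)" unfolding B2(2) pl(3) by (simp only: take_Cons_take append_Cons)
   moreover have "distinct (b # pl)" using pl b by simp
   moreover have "set (b # pl) = insert b X - R'" using pl False by auto
   ultimately have P: "EX pl. distinct pl & set pl = insert b X - R' & map (%h. snd ?u h a) ?Hs = take d (pl @ replicate d a)" by blast
   have ext: "EX ext. qlist ?u = ?L0 @ ext" using I B2(5) by auto
   have H: "ALL h:set ?Hs. ALL v. v ~= a --> snd ?u h v = snd s h v" using I B2(3) by auto
   show ?thesis using B2(1) ext D Q P H by blast
  qed
 qed
 let ?c = "Prm (Rd 1 Que 2) ;; Prm (SetC 6 1) ;; Prm (Wr Rm 1 6) ;; nbrs q Mk2 (gbody d)"
 have sc: "exa cap ?c s = ?s'" by (simp add: s1_def)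
 have cc: "tim cap ?c s = 3 + tim cap (nbrs q Mk2 (gbody d)) s1" by (simp add: s1_def)
 obtain ext where ext: "qlist ?s' = ?L0 @ ext" using main by blast
 obtain pl where pl: "distinct pl" "set pl = ?N a - R'" "map (%h. snd ?s' h a) ?Hs = take d (pl @ replicate d a)" using main by blast
 have tk: "take i (qlist ?s') = take i ?L0" if "i <= Suc t" for i using that tL unfolding ext by simp
 have nth: "qlist ?s' ! i = ?L0 ! i" if "i <= t" for i using that tL unfolding ext by (simp add: nth_append)
 have R'2: "set (take (Suc t) (qlist ?s')) = R'" using tk[of "Suc t"] R't by simp
 have deg': "card (?N v - (if v : ?N a then R' else R)) = card (?N v - R')" for v
 proof (cases "v : ?N a")
  case False
  then have "a ~: ?N v" using Nb_sym by metis
  then have "?N v - R = ?N v - R'" by (auto simp: R'_def)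
  then show ?thesis using False by simp
 qed simp
 have G3: "snd ?s' Deg v = card (?N v - R')" if "v < n" "v ~: R'" for v using main that deg'[of v] by presburger
 have G4: "v : set (qlist ?s') \<longleftrightarrow> v : R' \<or> card (?N v - R') <= d" if "v < n" for v
  using main that G3[OF that] by (cases "v : R'") auto
 have G2: "snd ?s' Rm v ~= 0 \<longleftrightarrow> v : R'" if "v < n" for v
 proof -
  have "snd ?s' Rm = snd s1 Rm" by (rule sem_arr) (use nbrs_simps(2)[of q Mk2 "gbody d"] in "auto simp: gbody_simps")
  then show ?thesis using Rm1[OF that] by simp
 qed
 have G6: "insert (qlist ?s' ! i) (set (map (%h. snd ?s' h (qlist ?s' ! i)) ?Hs)) =
   insert (qlist ?s' ! i) (?N (qlist ?s' ! i) - set (take i (qlist ?s')))" if i: "i < Suc t" for i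
 proof (cases "i = t")
  case True
  have "card (?N a - R) <= d" using g(5)[OF an] aL aR by simp
  moreover have "?N a - R' = ?N a - R" using aN by (auto simp: R'_def)
  ultimately have "length pl <= d" using pl(1,2) distinct_card by fastforce
  then have "map (%h. snd ?s' h a) ?Hs = pl @ replicate (d - length pl) a" using pl(3) by simp
  then have "insert a (set (map (%h. snd ?s' h a) ?Hs)) = insert a (set pl)" by auto
  also have "... = insert a (?N a - R)" using pl(2) by (auto simp: R'_def)
  finally show ?thesis using True nth[of t] tk[of t] by (simp add: a_def R_def)
 next
  case False
  then have it: "i < t" using i by simp
  have "?L0 ! i ~= a" using dist it tL by (simp add: a_def nth_eq_iff_index_eq)
  then have "map (%h. snd ?s' h (?L0 ! i)) ?Hs = map (%h. snd s h (?L0 ! i)) ?Hs" using main by auto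
  then show ?thesis using g(6)[OF it] nth[of i] tk[of i] it by simp
 qed
 have G7: "snd ?s' h v = v" if "v < n" "v ~: R'" "h : set ?Hs" for v h using main that g(7)[of v h] by (auto simp: R'_def)
 have G8: "snd ?s' Mk2 b = 0 \<or> (EX v:R'. snd ?s' Mk2 b = Suc v)" for b
 proof -
  have "snd s1 Mk2 b = snd s Mk2 b" using s1(4) by simp
  then show ?thesis using main g(8)[of b] by (auto simp: R'_def)
 qed
 have G5: "Suc t <= length (qlist ?s')" using tL ext by simp
 have "ginv n q d tv (Suc t) ?s'" unfolding ginv_def Let_def R'2
  by (intro conjI allI impI ballI main[THEN conjunct1, THEN conjunct1] G2 G3 G4 G5 G6 G7 G8; assumption)
 moreover have "tim cap (nbrs q Mk2 (gbody d)) s1 <= (\<Sum>i<q. 4 + length (members n tv i (?L0 ! t)) * (q * (44 + 3 * d) + 4))"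
  using main unfolding gbody_simps(4) a_def[symmetric] by simp
 ultimately show ?thesis unfolding sc cc using tL ext by simp
qed

text \<open>The cost of a round depends on the vertex found in the queue and not on the number of
  the round, so it is accumulated in the invariant.\<close>

lemma For_rule_acc:
 assumes n: "fst s 0 = n" and x: "x ~= 0" "x ~: wregs c" and I0: "I 0 s 0"
  and ins: "!!i s v a. I i s a ==> I i ((fst s)(x := v), snd s) a"
  and step: "!!i s' a. i < n ==> I i s' a ==> fst s' x = i ==> same (insert x (wregs c)) (warrs c) s s' ==>
   I (Suc i) (exa cap c s') (a + tim cap c s')"
 shows "EX a. I n (exa cap (For x c) s) a & tim cap (For x c) s = 3 + a + 4 * n"
proof -
 define s0 where "s0 = ((fst s)(x := 0), snd s)"
 define b where "b = c ;; Prm (Inc x)"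
 define f where "f = exa cap b"
 have P: "EX a. I j ((f ^^ j) s0) a & (\<Sum>i<j. 3 + tim cap b ((f ^^ i) s0)) = a + 4 * j &
   fst ((f ^^ j) s0) x = j & same (insert x (wregs c)) (warrs c) s ((f ^^ j) s0)" if "j <= n" for j
  using that
 proof (induction j)
  case 0
  have "same (insert x (wregs c)) (warrs c) s s0" by (simp add: s0_def same_def)
  then show ?case using ins[OF I0, of 0] by (intro exI[of _ 0]) (simp add: s0_def[symmetric], simp add: s0_def)
 next
  case (Suc j)
  define t where "t = (f ^^ j) s0"
  obtain a where IH: "I j t a" "(\<Sum>i<j. 3 + tim cap b ((f ^^ i) s0)) = a + 4 * j" "fst t x = j"
   "same (insert x (wregs c)) (warrs c) s t" using Suc unfolding t_def by auto
  define u where "u = exa cap c t"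
  have st: "I (Suc j) u (a + tim cap c t)" unfolding u_def using step IH Suc.prems by simp
  have ux: "fst u x = j" unfolding u_def using sem_reg[OF x(2)] IH(3) by simp
  have su: "same (insert x (wregs c)) (warrs c) s u" unfolding u_def by (rule same_trans[OF IH(4)]) (rule same_mono[OF same_sem], auto)
  have e: "(f ^^ Suc j) s0 = ((fst u)(x := Suc j), snd u)"
  proof -
   have "(f ^^ Suc j) s0 = f t" by (simp add: t_def)
   then show ?thesis using ux by (simp add: f_def b_def u_def)
  qed
  have cb: "tim cap b t = tim cap c t + 1" by (simp add: b_def)
  have sm: "same (insert x (wregs c)) (warrs c) s ((fst u)(x := Suc j), snd u)" using su by (simp add: same_def)
  show ?case unfolding e by (rule exI[of _ "a + tim cap c t"]) (use ins[OF st] IH(2) cb sm in "simp add: t_def")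
 qed
 have s0: "fst s0 0 = n" using n x by (simp add: s0_def)
 have e: "exa cap (For x c) s = (f ^^ n) s0"
  "tim cap (For x c) s = 3 + (\<Sum>i<n. 3 + tim cap b ((f ^^ i) s0))" using s0 by (simp_all add: For_def f_def b_def s0_def)
 show ?thesis unfolding e using P[of n] by auto
qed

text \<open>The queue ends up as a list of all vertices without repetition, so the costs of the
  rounds add up to one visit to every neighbourhood.\<close>

lemma greedy_sem:
 fixes s :: ast
 assumes e: "env n q tv s" and l: "lists_ok n q tv s" and tv: "!!i y. i < q ==> y < n ==> tv i y < n"
  and deg: "!!S. S <= {..<n} ==> S ~= {} ==> EX v:S. card (Nb n q tv v Int S) <= d"
  and init: "qinv n s" "ALL v<n. v : set (qlist s) \<longleftrightarrow> snd s Deg v <= d" "ALL v<n. snd s Deg v = card (Nb n q tv v)"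
   "ALL l<=d. ALL v<n. snd s (Hn l) v = v" "ALL v. snd s Rm v = 0" "ALL v. snd s Mk2 v = 0"
 shows "(EX L. distinct L & set L = {..<n} & (ALL i<n. insert (L ! i) (set (map (%h. snd (exa cap (greedy q d) s) h (L ! i)) (hs_of d))) =
    insert (L ! i) (Nb n q tv (L ! i) - set (take i L)))) &
  tim cap (greedy q d) s <= (10 + q * (8 + q * (44 + 3 * d))) * (n + 1)"
proof -
 let ?c = "Prm (Rd 1 Que 2) ;; Prm (SetC 6 1) ;; Prm (Wr Rm 1 6) ;; nbrs q Mk2 (gbody d)"
 have n: "fst s 0 = n" using e by (simp add: env_def)
 let ?W = "%v. 3 + (\<Sum>i<q. 4 + length (members n tv i v) * (q * (44 + 3 * d) + 4))"
 let ?I = "%t s' a. ginv n q d tv t s' & a <= (\<Sum>v\<in>set (take t (qlist s')). ?W v)"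
 have wr: "2 ~: wregs ?c"   proof -
  have "2 ~: wregs (gbody d)" using gbody_simps(1)[of d] by auto
  then have "2 ~: wregs (nbrs q Mk2 (gbody d))" using nbrs_simps(1)[of q Mk2 "gbody d"] by auto
  then show ?thesis by simp
 qed
 have "EX a. ?I n (exa cap (For 2 ?c) s) a & tim cap (For 2 ?c) s = 3 + a + 4 * n"
 proof (rule For_rule_acc[OF n _ wr, where I = ?I])
  have "h : set (hs_of d) ==> v < n ==> snd s h v = v" for h v using init(4) by (auto simp: set_hs_of)
  then have "ginv n q d tv 0 s" unfolding ginv_def Let_def using init by simp
  then show "?I 0 s 0" by simp
  fix i a v and s' :: ast assume I: "?I i s' a"
  have ql: "qlist ((fst s')(2 := v), snd s') = qlist s'" "qinv n ((fst s')(2 := v), snd s') = qinv n s'" by (rule qinv_cong; simp)+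
  show "?I i ((fst s')(2 := v), snd s') a" using I unfolding ginv_def Let_def ql snd_conv .
 next
  fix t a and s' :: ast assume t: "t < n" and I: "?I t s' a" and x: "fst s' 2 = t"
   and sm: "same (insert 2 (wregs ?c)) (warrs ?c) s s'"
  have "same {1, 2, 3, 4, 5, 6, 7, 8, 9, 10, 13, 14, 15, 19} (Hn ` {1..d} Un {Deg, Que, Inq, Rm, Mk2}) s s'"
   by (rule same_mono[OF sm]) (use greedy_simps[of q d] in "simp_all add: greedy_def")
  then have a: "fst s' 0 = fst s 0" "x : garrs ==> snd s' x = snd s x" for x by (auto simp: same_def)
  have e': "env n q tv s'" using e a by (simp add: env_def)
  have l': "lists_ok n q tv s'" using l a by (simp add: lists_ok_def)
  let ?s = "exa cap ?c s'"
  have G: "ginv n q d tv t s'" using I by blast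
  have gs: "ginv n q d tv (Suc t) ?s & tim cap ?c s' <= ?W (qlist s' ! t) & t < length (qlist s') &
   (EX ext. qlist ?s = qlist s' @ ext)"
   by (rule greedy_step[OF e' l' tv deg t x G])
  have st: "ginv n q d tv (Suc t) ?s" "tim cap ?c s' <= ?W (qlist s' ! t)" "t < length (qlist s')" using gs by blast+
  have q1: "qinv n s'" "qinv n ?s" "Suc t <= length (qlist ?s)" using G st(1) by (auto simp: ginv_def Let_def)
  obtain ext where ext: "qlist ?s = qlist s' @ ext" using gs by blast
  have "set (take (Suc t) (qlist ?s)) = insert (qlist s' ! t) (set (take t (qlist s')))"
   using st(3) unfolding ext by (simp add: take_Suc_conv_app_nth)
  moreover have "qlist s' ! t ~: set (take t (qlist s'))"
  proof -
   have "distinct (take (Suc t) (qlist s'))" using q1(1) by (simp add: qinv_def)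
   then show ?thesis using st(3) by (simp add: take_Suc_conv_app_nth)
  qed
  ultimately show "?I (Suc t) ?s (a + tim cap ?c s')" using st(1,2) I by simp
 qed simp
 then obtain a where F: "ginv n q d tv n (exa cap (greedy q d) s)"
  "a <= (\<Sum>v\<in>set (take n (qlist (exa cap (greedy q d) s))). ?W v)"
  "tim cap (greedy q d) s = 3 + a + 4 * n" unfolding greedy_def by blast
 define L where "L = qlist (exa cap (greedy q d) s)"
 have L: "distinct L" "set L <= {..<n}" "n <= length L" using F(1) by (auto simp: ginv_def Let_def qinv_def L_def)
 have "card (set L) = length L" using L(1) by (rule distinct_card)
 moreover have "card (set L) <= n" using card_mono[OF _ L(2)] by simp
 ultimately have len: "length L = n" using L(3) by simp
 have setL: "set L = {..<n}" by (rule card_subset_eq) (use L len distinct_card[OF L(1)] in auto)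
 have "(\<Sum>v\<in>set (take n L). ?W v) = 3 * n + (\<Sum>v<n. \<Sum>i<q. 4 + length (members n tv i v) * (q * (44 + 3 * d) + 4))"
  using len setL by (simp add: sum.distrib)
 also have "... = 3 * n + q * (4 + (q * (44 + 3 * d) + 4)) * n" by (simp only: nbrs_cost_sum[OF tv])
 finally have "a <= 3 * n + q * (4 + (q * (44 + 3 * d) + 4)) * n" using F(2) unfolding L_def by linarith
 then have c: "tim cap (greedy q d) s <= (10 + q * (8 + q * (44 + 3 * d))) * (n + 1)" using F(3) by (simp add: algebra_simps)
 have "ALL i<n. insert (L ! i) (set (map (%h. snd (exa cap (greedy q d) s) h (L ! i)) (hs_of d))) =
    insert (L ! i) (Nb n q tv (L ! i) - set (take i L))"
  using F(1) unfolding ginv_def Let_def L_def[symmetric] by blast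
 then show ?thesis using L(1) setL c by blast
qed

subsection \<open>Counting in contexts\<close>

text \<open>All functions are unary, so a term contains exactly one variable.\<close>

fun tvar :: "tm => nat" where
 "tvar (Var i) = i"
| "tvar (App f t) = tvar t"

text \<open>A context \<open>(t, \<nu>, \<xi>)\<close> describes a vertex \<open>w\<close> relative to the tuple \<open>u\<close>: \<open>t\<close> is the first word taking the counted
 vertex to \<open>w\<close>, a triple \<open>(l, s, j)\<close> in \<open>nu\<close> says that the later neighbour \<open>Hn l\<close> of \<open>w\<close> is the word \<open>s\<close> applied to \<open>u\<^sub>j\<close>,
 and \<open>xi\<close> lists the true atoms without the counted variable. For a path \<open>p\<close> of slot numbers, \<open>Num kp p\<close> counts the
 vertices in context \<open>kp\<close> that avoid the values in the slots along \<open>p\<close>, and the slots \<open>p @ [j]\<close> hold the values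
 that are frequent among these vertices.\<close>

type_synonym links = "(nat \<times> nat \<times> nat) list"
type_synonym ctx = "nat \<times> links \<times> fm list"

text \<open>Tests whether word \<open>a\<close> of \<open>y\<close> is word \<open>b\<close> of the
  tuple element \<open>u j\<close> while only \<open>w\<close> is at hand: the common value is
  sought among the later neighbours of \<open>w\<close>, and \<open>nu\<close> tells which of them
  belong to the tuple.\<close>

definition lcode :: "links => nat => nat => nat => prog" where
 "lcode nu a b j = Prm (SetC 11 0) ;; Prm (Rd 5 (Tau a) 3) ;;
   seqs (map (%(l, b', j'). if b' = b & j' = j
    then Prm (Rd 7 (Hn l) 1) ;; eqT 6 5 7 ;; IfNZ 6 (Prm (SetC 11 1)) else Skip) nu)"

fun ev_code :: "(tm => nat) => links => fm list => fm => prog" where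
 "ev_code ix nu xi (Eq s t) =
   (if tvar s = 0 & tvar t = 0 then Prm (Rd 5 (Tau (ix s)) 3) ;; Prm (Rd 7 (Tau (ix t)) 3) ;; eqT 11 5 7
   else if tvar s = 0 then lcode nu (ix s) (ix t) (tvar t)
   else if tvar t = 0 then lcode nu (ix t) (ix s) (tvar s)
   else Prm (SetC 11 (of_bool (Eq s t : set xi))))"
| "ev_code ix nu xi (Pred p t) =
   (if tvar t = 0 then Prm (Rd 5 (Tau (ix t)) 3) ;; Prm (Rd 11 (Pr p) 5)
   else Prm (SetC 11 (of_bool (Pred p t : set xi))))"
| "ev_code ix nu xi (Neg ph) = ev_code ix nu xi ph ;; Prm (SetC 6 1) ;; Prm (Sb 11 6 11)"
| "ev_code ix nu xi (Conj ph psi) = ev_code ix nu xi ph ;; IfNZ 11 (ev_code ix nu xi psi)"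
| "ev_code ix nu xi (Disj ph psi) = ev_code ix nu xi ph ;; Prm (SetC 6 1) ;; Prm (Sb 6 6 11) ;; IfNZ 6 (ev_code ix nu xi psi)"

fun ptest :: "(tm => nat) => (aname => nat => nat) => links => fm list => nat => nat => fm => bool" where
 "ptest ix A nu xi w y (Eq s t) = ((if tvar s = 0 & tvar t = 0 then A (Tau (ix s)) y = A (Tau (ix t)) y
   else if tvar s = 0 then EX l. (l, ix t, tvar t) : set nu & A (Tau (ix s)) y = A (Hn l) w
   else if tvar t = 0 then EX l. (l, ix s, tvar s) : set nu & A (Tau (ix t)) y = A (Hn l) w
   else Eq s t : set xi))"
| "ptest ix A nu xi w y (Pred p t) = ((if tvar t = 0 then A (Pr p) (A (Tau (ix t)) y) ~= 0 else Pred p t : set xi))"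
| "ptest ix A nu xi w y (Neg ph) = (~ ptest ix A nu xi w y ph)"
| "ptest ix A nu xi w y (Conj ph psi) = (ptest ix A nu xi w y ph & ptest ix A nu xi w y psi)"
| "ptest ix A nu xi w y (Disj ph psi) = (ptest ix A nu xi w y ph \<or> ptest ix A nu xi w y psi)"

lemma lcode_simps: "wregs (lcode nu a b j) <= {5, 6, 7, 11, 19}" "warrs (lcode nu a b j) = {}" "norep (lcode nu a b j)"
 by (auto simp: lcode_def split: if_splits)

lemma ev_code_simps: "wregs (ev_code ix nu xi ph) <= {5, 6, 7, 11, 19}" "warrs (ev_code ix nu xi ph) = {}" "norep (ev_code ix nu xi ph)"
proof (induction ph)
 case (Eq s t)
 { case 1 then show ?case using lcode_simps(1) by simp }
 { case 2 then show ?case using lcode_simps(2) by simp }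
 { case 3 then show ?case using lcode_simps(3) by simp }
qed auto

lemma lcode_sem:
 fixes s :: ast
 assumes "fst s 1 = w" "fst s 3 = y"
 shows "fst (exa cap (lcode nu a b j) s) 11 =
  of_bool (EX l. (l, b, j) : set nu & snd s (Tau a) y = snd s (Hn l) w)"
proof -
 let ?c = "%(l, b', j'). if b' = b & j' = j
    then Prm (Rd 7 (Hn l) 1) ;; eqT 6 5 7 ;; IfNZ 6 (Prm (SetC 11 1)) else Skip :: prog"
 have "fst (exa cap (seqs (map ?c nu)) t) 11 =
   (if EX l. (l, b, j) : set nu & fst t 5 = snd t (Hn l) (fst t 1) then 1 else fst t 11)" for t
 proof (induction nu arbitrary: t)
  case (Cons x nu)
  obtain l b' j' where x: "x = (l, b', j')" by (cases x)
  show ?case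
  proof (cases "b' = b & j' = j")
   case True
   define u where "u = exa cap (Prm (Rd 7 (Hn l) 1) ;; eqT 6 5 7 ;; IfNZ 6 (Prm (SetC 11 1))) t"
   have u: "fst u 5 = fst t 5" "fst u 1 = fst t 1" "snd u = snd t"
    "fst u 11 = (if fst t 5 = snd t (Hn l) (fst t 1) then 1 else fst t 11)" by (auto simp: u_def sem_eqT)
   have "exa cap (seqs (map ?c (x # nu))) t = exa cap (seqs (map ?c nu)) u" using True by (simp add: x u_def)
   then show ?thesis using Cons.IH[of u] u True by (auto simp: x)
  next
   case False
   then have "exa cap (seqs (map ?c (x # nu))) t = exa cap (seqs (map ?c nu)) t" by (auto simp: x)
   then show ?thesis using Cons.IH[of t] False by (auto simp: x)
  qed
 qed simp
 then show ?thesis using assms by (simp add: lcode_def)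
qed

lemma ev_code_sem:
 fixes s :: ast
 assumes "fst s 1 = w" "fst s 3 = y" "ALL p v. snd s (Pr p) v <= 1"
 shows "fst (exa cap (ev_code ix nu xi ph) s) 11 = of_bool (ptest ix (snd s) nu xi w y ph)" using assms
proof (induction ph arbitrary: s)
 case (Eq t u)
 then show ?case using lcode_sem[OF Eq.prems(1,2)] by (simp add: sem_eqT)
next
 case (Pred p t)
 have "snd s (Pr p) v = of_bool (snd s (Pr p) v ~= 0)" for v using Pred.prems(3)[rule_format, of p v] by (cases "snd s (Pr p) v") auto
 then show ?case using Pred.prems by simp
next
 case (Neg ph)
 then show ?case by simp
next
 case (Conj ph psi)
 let ?s = "exa cap (ev_code ix nu xi ph) s"
 have "fst ?s 1 = fst s 1" "fst ?s 3 = fst s 3" by (rule sem_reg; use ev_code_simps(1)[of ix nu xi ph] in auto)+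
 moreover have "snd ?s = snd s" using sem_arr[of _ "ev_code ix nu xi ph"] ev_code_simps(2) by (intro ext) (simp add: ev_code_simps)
 ultimately show ?case using Conj.IH(1)[of s] Conj.IH(2)[of ?s] Conj.prems by auto
next
 case (Disj ph psi)
 let ?s = "exa cap (ev_code ix nu xi ph) s"
 let ?t = "((fst ?s)(6 := 1 - fst ?s 11), snd ?s)"
 have e: "exa cap (ev_code ix nu xi (Disj ph psi)) s = exa cap (IfNZ 6 (ev_code ix nu xi psi)) ?t" by simp
 have r: "fst ?s 1 = fst s 1" "fst ?s 3 = fst s 3" by (rule sem_reg; use ev_code_simps(1)[of ix nu xi ph] in auto)+
 moreover have "snd ?s = snd s" using sem_arr[of _ "ev_code ix nu xi ph"] ev_code_simps(2) by (intro ext) (simp add: ev_code_simps)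
 ultimately show ?case unfolding e using Disj.IH(1)[of s] Disj.IH(2)[of ?t] Disj.prems by auto
qed

section \<open>The vertices counted in a context along a path\<close>

definition avoid :: "nat => nat => prog" where
 "avoid r t = Prm (Rd 5 (Tau t) 3) ;; eqT 6 5 r ;; IfNZ 6 (Prm (SetC 10 0))"

lemma avoid_simps: "wregs (avoid r t) = {5, 6, 10, 19}" "warrs (avoid r t) = {}" "norep (avoid r t)" by (auto simp: avoid_def)

lemma avoid_seqs:
 fixes s :: ast
 assumes "r ~: {5, 6, 10, 19}"
 shows "fst (exa cap (seqs (map (avoid r) ts)) s) 10 =
   (if EX t:set ts. snd s (Tau t) (fst s 3) = fst s r then 0 else fst s 10)"
proof (induction ts arbitrary: s)
 case (Cons t ts)
 define u where "u = exa cap (avoid r t) s"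
 have u: "fst u r = fst s r" "fst u 3 = fst s 3" "snd u = snd s"
  "fst u 10 = (if snd s (Tau t) (fst s 3) = fst s r then 0 else fst s 10)" using assms by (auto simp: u_def avoid_def sem_eqT)
 show ?case using Cons.IH[of u] u by (auto simp: u_def[symmetric])
qed simp

text \<open>Register 10 is the verdict. Requiring that no word before \<open>fst kp\<close> takes
  \<open>y\<close> to \<open>w\<close> prevents counting \<open>y\<close> twice at
  \<open>w\<close>.\<close>

definition tst :: "(tm => nat) => fm => nat => ctx => nat list => prog" where
 "tst ix ph q kp p = Prm (SetC 10 1) ;; seqs (map (avoid 1) [0..<fst kp]) ;;
   ev_code ix (fst (snd kp)) (snd (snd kp)) ph ;; Prm (SetC 6 1) ;; Prm (Sb 6 6 11) ;; IfNZ 6 (Prm (SetC 10 0)) ;;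
   seqs (map (%j. Prm (Rd 7 (Slot kp (take j p)) 1) ;; seqs (map (avoid 7) [0..<q])) [1..<Suc (length p)])"

definition ytest :: "(tm => nat) => fm => nat => (aname => nat => nat) => ctx => nat list => nat => nat => bool" where
 "ytest ix ph q A kp p w y = ((ALL t<fst kp. A (Tau t) y ~= w) & ptest ix A (fst (snd kp)) (snd (snd kp)) w y ph &
   (ALL j:{1..length p}. ALL t<q. A (Tau t) y ~= A (Slot kp (take j p)) w))"

lemma tst_simps: "wregs (tst ix ph q kp p) <= {5, 6, 7, 10, 11, 19}" "warrs (tst ix ph q kp p) = {}" "norep (tst ix ph q kp p)"
 using ev_code_simps[of ix "fst (snd kp)" "snd (snd kp)" ph] by (auto simp: tst_def avoid_simps)

lemma slot_avoid_seqs: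
 fixes s :: ast
 shows "fst (exa cap (seqs (map (%j. Prm (Rd 7 (Slot kp (f j)) 1) ;; seqs (map (avoid 7) ts)) js)) s) 10 =
   (if EX j:set js. EX t:set ts. snd s (Tau t) (fst s 3) = snd s (Slot kp (f j)) (fst s 1) then 0 else fst s 10)"
proof (induction js arbitrary: s)
 case (Cons j js)
 define s1 where "s1 = ((fst s)(7 := snd s (Slot kp (f j)) (fst s 1)), snd s)"
 define u where "u = exa cap (seqs (map (avoid 7) ts)) s1"
 have "x ~: wregs (seqs (map (avoid 7) ts))" if "x ~: {5, 6, 10, 19}" for x using that by (auto simp: avoid_simps)
 from sem_reg[OF this] have "fst u 3 = fst s1 3" "fst u 1 = fst s1 1" unfolding u_def by auto
 moreover have "snd u = snd s1" unfolding u_def by (intro ext, subst sem_arr) (auto simp: avoid_simps)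
 moreover have "fst u 10 = (if EX t:set ts. snd s (Tau t) (fst s 3) = snd s (Slot kp (f j)) (fst s 1) then 0 else fst s 10)"
  using avoid_seqs[of 7 cap ts s1] by (simp add: u_def s1_def)
 moreover have "exa cap (seqs (map (%j. Prm (Rd 7 (Slot kp (f j)) 1) ;; seqs (map (avoid 7) ts)) (j # js))) s =
   exa cap (seqs (map (%j. Prm (Rd 7 (Slot kp (f j)) 1) ;; seqs (map (avoid 7) ts)) js)) u"
  by (simp add: u_def s1_def)
 ultimately show ?case using Cons.IH[of u] by (simp add: s1_def)
qed simp

lemma tst_sem:
 fixes s :: ast
 assumes a: "fst s 1 = w" "fst s 3 = y" "ALL p v. snd s (Pr p) v <= 1"
 shows "fst (exa cap (tst ix ph q kp p) s) 10 = of_bool (ytest ix ph q (snd s) kp p w y)"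
proof -
 define s1 where "s1 = exa cap (seqs (map (avoid 1) [0..<fst kp])) ((fst s)(10 := 1), snd s)"
 let ?ev = "ev_code ix (fst (snd kp)) (snd (snd kp)) ph"
 define s2 where "s2 = exa cap ?ev s1"
 define s3 where "s3 = exa cap (Prm (SetC 6 1) ;; Prm (Sb 6 6 11) ;; IfNZ 6 (Prm (SetC 10 0))) s2"
 have w1: "x ~: wregs (seqs (map (avoid 1) [0..<fst kp]))" if "x ~: {5, 6, 10, 19}" for x using that by (auto simp: avoid_simps)
 have s1: "fst s1 1 = w" "fst s1 3 = y" using sem_reg[OF w1] a unfolding s1_def by auto
 have s1a: "snd s1 = snd s" unfolding s1_def by (intro ext, subst sem_arr) (auto simp: avoid_simps)
 have s110: "fst s1 10 = of_bool (ALL t<fst kp. snd s (Tau t) y ~= w)"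
  using avoid_seqs[of 1 cap "[0..<fst kp]" "((fst s)(10 := 1), snd s)"] a by (auto simp: s1_def)
 have w2: "x ~: wregs ?ev" if "x ~: {5, 6, 7, 11, 19}" for x using that ev_code_simps(1)[of ix "fst (snd kp)" "snd (snd kp)" ph] by blast
 have s2: "fst s2 1 = w" "fst s2 3 = y" "fst s2 10 = fst s1 10" using sem_reg[OF w2] s1 unfolding s2_def by auto
 have s2a: "snd s2 = snd s" unfolding s2_def s1a[symmetric] by (intro ext, subst sem_arr) (auto simp: ev_code_simps)
 have s211: "fst s2 11 = of_bool (ptest ix (snd s) (fst (snd kp)) (snd (snd kp)) w y ph)"
  using ev_code_sem[OF s1, of cap ix] a(3) unfolding s2_def s1a by blast
 have s3: "fst s3 1 = w" "fst s3 3 = y" "snd s3 = snd s"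
  "fst s3 10 = of_bool ((ALL t<fst kp. snd s (Tau t) y ~= w) & ptest ix (snd s) (fst (snd kp)) (snd (snd kp)) w y ph)"
  using s2 s2a s211 s110 by (auto simp: s3_def)
 have e: "exa cap (tst ix ph q kp p) s = exa cap
   (seqs (map (%j. Prm (Rd 7 (Slot kp (take j p)) 1) ;; seqs (map (avoid 7) [0..<q])) [1..<Suc (length p)])) s3"
  by (simp add: tst_def s3_def s2_def s1_def del: upt_Suc)
 have st: "set [1..<Suc (length p)] = {1..length p}" "set [0..<q] = {..<q}" by auto
 show ?thesis unfolding e slot_avoid_seqs st s3 by (auto simp: ytest_def)
qed

text \<open>Pairs are counted, since the machine increases the counter of \<open>v\<close> once for
  each word with that value. This bounds the number of \<open>y\<close> with value \<open>v\<close>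
  from above, and over all \<open>v\<close> it still adds up to at most
  \<open>q * card S\<close>.\<close>

definition cntv :: "nat => (nat => nat => nat) => nat set => nat => nat" where
 "cntv q tv S v = card {(t, y). t < q & y : S & tv t y = v}"

lemma finite_cntv: "finite (S :: nat set) ==> finite {(t, y). t < (q :: nat) & y : S & P t y}" by (rule finite_subset[of _ "{..<q} \<times> S"]) auto

lemma cntv_insert:
 assumes "finite S" "y ~: S"
 shows "cntv q tv (insert y S) v = cntv q tv S v + card {t. t < q & tv t y = v}"
proof -
 have "{(t, z). t < q & z : insert y S & tv t z = v} =
   {(t, z). t < q & z : S & tv t z = v} Un (%t. (t, y)) ` {t. t < q & tv t y = v}" by auto
 moreover have "card ((%t. (t, y)) ` {t. t < q & tv t y = v}) = card {t. t < q & tv t y = v}" by (intro card_image) (simp add: inj_on_def)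
 ultimately show ?thesis unfolding cntv_def
  using assms(2) by (subst (1) \<open>_ = _ Un _\<close>) (subst card_Un_disjoint, auto intro: finite_cntv[OF assms(1)])
qed

lemma cntv_pos: "0 < cntv q tv S v ==> EX t<q. EX y:S. tv t y = v" unfolding cntv_def by (auto simp: card_gt_0_iff)

text \<open>Averaging: the counters add up to at most \<open>q * card Y\<close>, and every element
  of \<open>P\<close> takes at least \<open>card Y / K\<close> of this. Hence the number
  \<open>J = q * K\<close> of slots.\<close>

lemma heavy_values_card:
 assumes "finite Y" "finite P" "!!v. v : P ==> 0 < cntv q tv Y v & card Y <= K * cntv q tv Y v"
 shows "card P <= q * K"
proof (cases "P = {}")
 case False
 then obtain v where "v : P" by auto
 then have "Y ~= {}" using cntv_pos[of q tv Y v] assms(3)[of v] by auto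
 then have tot: "card Y > 0" using assms(1) by (simp add: card_gt_0_iff)
 have "(\<Sum>v\<in>P. cntv q tv Y v) = card (\<Union>v\<in>P. {(t, y). t < q & y : Y & tv t y = v})"
  unfolding cntv_def by (rule card_UN_disjoint[symmetric]) (use assms finite_cntv in auto)
 also have "... <= card ({..<q} \<times> Y)" using assms(1) by (intro card_mono) auto
 also have "... = q * card Y" by (simp add: card_cartesian_product)
 finally have 1: "(\<Sum>v\<in>P. cntv q tv Y v) <= q * card Y" .
 have "card P * card Y = (\<Sum>v\<in>P. card Y)" by simp
 also have "... <= (\<Sum>v\<in>P. K * cntv q tv Y v)" using assms(3) by (intro sum_mono) auto
 also have "... = K * (\<Sum>v\<in>P. cntv q tv Y v)" by (simp add: sum_distrib_left)
 also have "... <= K * (q * card Y)" using 1 by simp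
 also have "... = q * K * card Y" by simp
 finally show ?thesis using tot by simp
qed simp

lemma ptest_cong:
 assumes "!!i. A' (Tau i) = A (Tau i)" "!!p. A' (Pr p) = A (Pr p)" "!!l. A' (Hn l) w = A (Hn l) w"
 shows "ptest ix A' nu xi w y ph = ptest ix A nu xi w y ph" by (induction ph) (simp_all add: assms)

lemma ytest_cong:
 assumes "!!i. A' (Tau i) = A (Tau i)" "!!p. A' (Pr p) = A (Pr p)" "!!l. A' (Hn l) w = A (Hn l) w"
  "!!j. 1 <= j ==> j <= length p ==> A' (Slot kp (take j p)) w = A (Slot kp (take j p)) w"
 shows "ytest ix ph q A' kp p w y = ytest ix ph q A kp p w y" unfolding ytest_def ptest_cong[of A' A w, OF assms(1-3)] using assms(1,4) by auto

definition inc_item :: "nat => prog" where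
 "inc_item t = Prm (Rd 5 (Tau t) 3) ;; Prm (Rd 6 Cnt 5) ;; Prm (Inc 6) ;; Prm (Wr Cnt 5 6)"

definition clr_item :: "nat => prog" where
 "clr_item t = Prm (Rd 5 (Tau t) 3) ;; Prm (SetC 6 0) ;; Prm (Wr Cnt 5 6)"

text \<open>Whether the total in register 12 is at most \<open>K\<close> times the counter is
  decided by \<open>K\<close> truncated subtractions. The counter of a stored value is set to 0, so
  that no value is stored twice.\<close>

definition fill_item :: "nat => aname list => nat => prog" where
 "fill_item K sl t = Prm (Rd 5 (Tau t) 3) ;; Prm (Rd 6 Cnt 5) ;; IfNZ 6 (Prm (Mov 7 12) ;;
   seqs (replicate K (Prm (Sb 7 7 6))) ;; Prm (SetC 8 1) ;; IfNZ 7 (Prm (SetC 8 0)) ;;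
   IfNZ 8 (Prm (Mov 14 5) ;; push sl ;; Prm (SetC 8 0) ;; Prm (Wr Cnt 5 8)))"

lemma inc_seq_sem:
 fixes s :: ast
 assumes "!!t. t : set ts ==> snd s (Tau t) (fst s 3) = f t"
 shows "snd (exa cap (seqs (map inc_item ts)) s) Cnt v = snd s Cnt v + length (filter (%t. f t = v) ts)" using assms
proof (induction ts arbitrary: s)
 case (Cons t ts)
 define u where "u = exa cap (inc_item t) s"
 have u: "fst u 3 = fst s 3" "snd u (Tau i) = snd s (Tau i)" "snd u Cnt = (snd s Cnt)(f t := Suc (snd s Cnt (f t)))" for i
  using Cons.prems[of t] by (auto simp: u_def inc_item_def)
 show ?case using Cons.IH[of u] Cons.prems u by (auto simp: u_def[symmetric])
qed simp

lemma clr_seq_sem: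
 fixes s :: ast
 assumes "!!t. t : set ts ==> snd s (Tau t) (fst s 3) = f t"
 shows "snd (exa cap (seqs (map clr_item ts)) s) Cnt v = (if v : f ` set ts then 0 else snd s Cnt v)" using assms
proof (induction ts arbitrary: s)
 case (Cons t ts)
 define u where "u = exa cap (clr_item t) s"
 have u: "fst u 3 = fst s 3" "snd u (Tau i) = snd s (Tau i)" "snd u Cnt = (snd s Cnt)(f t := 0)" for i
  using Cons.prems[of t] by (auto simp: u_def clr_item_def)
 show ?case using Cons.IH[of u] Cons.prems u by (auto simp: u_def[symmetric])
qed simp

lemma item_simps:
 "wregs (inc_item t) = {5, 6}" "warrs (inc_item t) = {Cnt}" "norep (inc_item t)"
 "wregs (clr_item t) = {5, 6}" "warrs (clr_item t) = {Cnt}" "norep (clr_item t)"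
 "wregs (fill_item K sl t) <= {5, 6, 7, 8, 14, 15}" "warrs (fill_item K sl t) = insert Cnt (set sl)" "norep (fill_item K sl t)"
 using push_simps[of sl] by (auto simp: inc_item_def clr_item_def fill_item_def)

lemma sub_chain: "exa cap (seqs (replicate K (Prm (Sb 7 7 6)))) s = ((fst s)(7 := fst s 7 - K * fst s 6), snd s)"
 by (induction K arbitrary: s) (auto simp: fun_eq_iff)

lemma fill_item_sem:
 fixes s :: ast
 assumes w: "fst s 1 = w" and x: "snd s (Tau t) (fst s 3) = x" and sl: "distinct sl" "Cnt ~: set sl"
 shows "let s' = exa cap (fill_item K sl t) s; c = snd s Cnt x in
  (0 < c & fst s 12 <= K * c --> snd s' Cnt = (snd s Cnt)(x := 0) &
    map (%h. snd s' h w) sl = take (length sl) (x # map (%h. snd s h w) sl) &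
    (ALL h:set sl. ALL v. v ~= w --> snd s' h v = snd s h v)) &
  (~ (0 < c & fst s 12 <= K * c) --> snd s' = snd s)"
proof -
 let ?s' = "exa cap (fill_item K sl t) s" and ?c = "snd s Cnt x"
 show ?thesis
 proof (cases "0 < ?c & fst s 12 <= K * ?c")
  case True
  define s1 where "s1 = ((fst s)(5 := x, 6 := ?c, 7 := fst s 12 - K * ?c, 8 := 1, 14 := x), snd s)"
  define s2 where "s2 = exa cap (push sl) s1"
  have p: "fst s2 y = fst s1 y" if "y ~: {14, 15}" for y unfolding s2_def by (rule sem_reg) (use that push_simps(1)[of sl] in auto)
  have pc: "snd s2 Cnt = snd s Cnt" unfolding s2_def by (subst sem_arr) (use sl in "auto simp: push_simps s1_def")
  have e: "?s' = exa cap (Prm (SetC 8 0) ;; Prm (Wr Cnt 5 8)) s2" using True x by (simp add: fill_item_def sub_chain s2_def s1_def)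
  have s': "snd ?s' = (snd s2)(Cnt := (snd s Cnt)(x := 0))" unfolding e using p[of 5] pc by (simp add: s1_def)
  have ps: "map (%h. snd s2 h w) sl = take (length sl) (x # map (%h. snd s h w) sl)"
   "ALL h v. v ~= w --> snd s2 h v = snd s h v" using push_sem[OF sl(1), of cap s1] w by (simp_all add: s2_def[symmetric]) (simp_all add: s1_def)
  have ne: "h ~= Cnt" if "h : set sl" for h using sl(2) that by auto
  then have "map (%h. snd ?s' h w) sl = map (%h. snd s2 h w) sl" unfolding s' by auto
  then show ?thesis unfolding Let_def using True ps ne unfolding s' by auto
 next
  case False
  have "snd ?s' = snd s" using False x by (auto simp: fill_item_def sub_chain)
  then show ?thesis unfolding Let_def using False by blast
 qed
qed

definition slots :: "ctx => nat list => nat => aname list" where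
 "slots kp p J = map (%j. Slot kp (p @ [j])) [0..<J]"

lemma set_slots: "set (slots kp p J) = (%j. Slot kp (p @ [j])) ` {..<J}" "distinct (slots kp p J)" "length (slots kp p J) = J"
 by (auto simp: slots_def distinct_map inj_on_def)

definition cbody :: "(tm => nat) => fm => nat => ctx => nat list => prog" where
 "cbody ix ph q kp p = tst ix ph q kp p ;; IfNZ 10 (Prm (Inc 12) ;; seqs (map inc_item [0..<q]))"

definition count_pass :: "(tm => nat) => fm => nat => ctx => nat list => prog" where
 "count_pass ix ph q kp p = Prm (SetC 12 0) ;; Trav (fst kp) (cbody ix ph q kp p) ;; Prm (Wr (Num kp p) 1 12)"

text \<open>Slots start out as \<open>w\<close> itself, which stands for the absence of a value:
  \<open>w\<close> never belongs to the values to be avoided.\<close>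

definition fill_pass :: "nat => nat => nat => ctx => nat list => prog" where
 "fill_pass q K J kp p = seqs (map (%a. Prm (Wr a 1 1)) (slots kp p J)) ;;
   Trav (fst kp) (seqs (map (fill_item K (slots kp p J)) [0..<q]))"

text \<open>Resets only the counters that may have been touched, in time proportional to the list
  and not to the number of vertices.\<close>

definition clear_pass :: "nat => ctx => prog" where
 "clear_pass q kp = Trav (fst kp) (seqs (map clr_item [0..<q]))"

lemma cbody_simps: "wregs (cbody ix ph q kp p) <= {5, 6, 7, 10, 11, 12, 19}"
 "warrs (cbody ix ph q kp p) <= {Cnt}" "norep (cbody ix ph q kp p)"
 using tst_simps[of ix ph q kp p] by (auto simp: cbody_def item_simps)

lemma pass_simps:
 "wregs (count_pass ix ph q kp p) <= {3, 4, 5, 6, 7, 10, 11, 12, 19}" "warrs (count_pass ix ph q kp p) <= {Cnt, Num kp p}"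
 "wregs (fill_pass q K J kp p) <= {3, 4, 5, 6, 7, 8, 14, 15}" "warrs (fill_pass q K J kp p) <= insert Cnt (set (slots kp p J))"
 "wregs (clear_pass q kp) <= {3, 4, 5, 6}" "warrs (clear_pass q kp) <= {Cnt}"
proof -
 show "wregs (count_pass ix ph q kp p) <= {3, 4, 5, 6, 7, 10, 11, 12, 19}"
  using cbody_simps(1)[of ix ph q kp p] unfolding count_pass_def by (simp, blast)
 show "warrs (count_pass ix ph q kp p) <= {Cnt, Num kp p}" using cbody_simps(2)[of ix ph q kp p] unfolding count_pass_def by (simp, blast)
 show "wregs (fill_pass q K J kp p) <= {3, 4, 5, 6, 7, 8, 14, 15}" using item_simps(7)[of K "slots kp p J"] unfolding fill_pass_def by (simp, blast)
 show "warrs (fill_pass q K J kp p) <= insert Cnt (set (slots kp p J))" unfolding fill_pass_def by (auto simp: item_simps)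
 show "wregs (clear_pass q kp) <= {3, 4, 5, 6}" "warrs (clear_pass q kp) <= {Cnt}" unfolding clear_pass_def by (auto simp: item_simps)
qed

definition Yset :: "(tm => nat) => fm => nat => nat => (nat => nat => nat) => (aname => nat => nat) => ctx => nat list => nat => nat set" where
 "Yset ix ph n q tv A kp p w = {y. y < n & tv (fst kp) y = w & ytest ix ph q A kp p w y}"

definition cstate :: "nat => nat => (nat => nat => nat) => nat => ast => bool" where
 "cstate n q tv w s = (env n q tv s & lists_ok n q tv s & fst s 1 = w & (ALL p v. snd s (Pr p) v <= 1))"

lemma cstate_same:
 assumes "cstate n q tv w s" "same X A s s'" "0 ~: X" "1 ~: X" "A Int (garrs Un range Pr) = {}"
 shows "cstate n q tv w s'"
proof -
 have ar: "snd s' a = snd s a" if "a : garrs Un range Pr" for a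
 proof -
  have "a ~: A"
  proof
   assume "a : A"
   then have "a : A Int (garrs Un range Pr)" using that by (rule IntI)
   then show False unfolding assms(5) by (rule emptyE)
  qed
  then show ?thesis by (rule same_arr[OF assms(2)])
 qed
 have "snd s' (Tau i) = snd s (Tau i)" "snd s' (Hd i) = snd s (Hd i)" "snd s' (Nx i) = snd s (Nx i)"
  "snd s' (Len i) = snd s (Len i)" "snd s' (Pr i) = snd s (Pr i)" for i by (rule ar; simp)+
 moreover have "fst s' 0 = fst s 0" "fst s' 1 = fst s 1" by (rule same_reg[OF assms(2)]; fact)+
 ultimately show ?thesis using assms(1) by (simp add: cstate_def env_def lists_ok_def)
qed

lemma count_pass_sem:
 fixes s :: ast and p :: "nat list" and ix :: "tm => nat" and ph :: fm
 assumes c: "cstate n q tv w s" and ts: "fst kp < q" and z: "ALL v. snd s Cnt v = 0"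
 defines "Y \<equiv> Yset ix ph n q tv (snd s) kp p w"
 shows "let s' = exa cap (count_pass ix ph q kp p) s in
  snd s' (Num kp p) = (snd s (Num kp p))(w := card Y) & fst s' 12 = card Y & (ALL v. snd s' Cnt v = cntv q tv Y v) &
  tim cap (count_pass ix ph q kp p) s <= 6 + length (members n tv (fst kp) w) * (csz (cbody ix ph q kp p) + 4)"
proof -
 let ?c = "cbody ix ph q kp p" and ?ys = "members n tv (fst kp) w"
 let ?s0 = "((fst s)(12 := 0), snd s)"
 define Ym where "Ym m = {y : set (take m ?ys). ytest ix ph q (snd s) kp p w y}" for m
 let ?I = "%m s'. fst s' 12 = card (Ym m) & (ALL v. snd s' Cnt v = cntv q tv (Ym m) v)"
 have e: "env n q tv s" and l: "lists_ok n q tv s" and w: "fst s 1 = w" and pr: "ALL p v. snd s (Pr p) v <= 1" using c by (auto simp: cstate_def)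
 have dy: "distinct ?ys" by (simp add: members_def)
 have ys: "?ys = lst (snd ?s0 (Nx (fst kp))) (snd ?s0 (Hd (fst kp)) (fst ?s0 1)) (snd ?s0 (Len (fst kp)) (fst ?s0 1))"
  using l ts w by (simp add: lists_ok_def)
 have "?I (length ?ys) (exa cap (Trav (fst kp) ?c) ?s0) &
   tim cap (Trav (fst kp) ?c) ?s0 <= 4 + length ?ys * (csz ?c + 4)"
 proof (rule Trav_rule[OF ys, where I = ?I])
  show "3 ~: wregs ?c" using cbody_simps(1)[of ix ph q kp p] by auto
  show "Nx (fst kp) ~: warrs ?c" using cbody_simps(2)[of ix ph q kp p] by auto
  show "?I 0 ?s0" using z by (simp add: Ym_def cntv_def)
  fix m and s' :: ast assume m: "m < length ?ys" and I: "?I m s'" and x3: "fst s' 3 = ?ys ! m"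
   and sm0: "same ({3, 4} Un wregs ?c) (warrs ?c) ?s0 s'"
  let ?y = "?ys ! m"
  have sm: "same {3, 4, 5, 6, 7, 10, 11, 12, 19} {Cnt} s s'" by (rule same_trans[OF _ same_mono[OF sm0]])
    (use cbody_simps(1,2)[of ix ph q kp p] in "simp add: same_def, blast, blast")
  have "?y : set ?ys" using m by simp
  then have yn: "?y < n" by (simp add: set_members)
  have arr: "snd s' a = snd s a" if "a ~= Cnt" for a by (rule same_arr[OF sm]) (use that in simp)
  have r1: "fst s' 1 = w" using same_reg[OF sm] w by simp
  have yt: "ytest ix ph q (snd s') kp p w y = ytest ix ph q (snd s) kp p w y" for y by (rule ytest_cong) (simp_all add: arr)
  define u where "u = exa cap (tst ix ph q kp p) s'"
  have u10: "fst u 10 = of_bool (ytest ix ph q (snd s) kp p w ?y)" unfolding u_def yt[symmetric] by (rule tst_sem[OF r1 x3]) (use pr arr in simp)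
  have ur: "fst u x = fst s' x" if "x ~: {5, 6, 7, 10, 11, 19}" for x
   unfolding u_def by (rule sem_reg) (use that tst_simps(1)[of ix ph q kp p] in blast)
  have ua: "snd u = snd s'" unfolding u_def by (intro ext, subst sem_arr) (auto simp: tst_simps)
  have fin: "finite (Ym m)" by (simp add: Ym_def)
  have ny: "?y ~: set (take m ?ys)"
  proof -
   have "distinct (take (Suc m) ?ys)" using dy by simp
   then show ?thesis using m by (simp add: take_Suc_conv_app_nth)
  qed
  have "?I (Suc m) (exa cap ?c s')"
  proof (cases "ytest ix ph q (snd s) kp p w ?y")
   case False
   then have "exa cap ?c s' = u" using u10 by (simp add: cbody_def u_def[symmetric])
   moreover have "Ym (Suc m) = Ym m" using False m by (auto simp: Ym_def take_Suc_conv_app_nth)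
   ultimately show ?thesis using I ur[of 12] ua by simp
  next
   case True
   let ?u1 = "((fst u)(12 := Suc (fst u 12)), snd u)"
   have sc: "exa cap ?c s' = exa cap (seqs (map inc_item [0..<q])) ?u1" using True u10 by (simp add: cbody_def u_def[symmetric])
   have Y: "Ym (Suc m) = insert ?y (Ym m)" "?y ~: Ym m" using True m ny by (auto simp: Ym_def take_Suc_conv_app_nth)
   have "fst (exa cap (seqs (map inc_item [0..<q])) ?u1) 12 = fst ?u1 12" by (rule sem_reg) (auto simp: item_simps)
   moreover have "snd (exa cap (seqs (map inc_item [0..<q])) ?u1) Cnt v =
    snd ?u1 Cnt v + length (filter (%t. tv t ?y = v) [0..<q])" for v
    by (rule inc_seq_sem) (use e yn ur[of 3] x3 ua arr in "simp add: env_def")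
   moreover have "length (filter (%t. tv t ?y = v) [0..<q]) = card {t. t < q & tv t ?y = v}" for v
    by (subst distinct_length_filter) (auto intro!: arg_cong[of _ _ card])
   ultimately show ?thesis unfolding sc Y(1) using I ur[of 12] ua Y(2) fin by (simp add: cntv_insert)
  qed
  then show "?I (Suc m) (exa cap ?c s') & tim cap ?c s' <= csz ?c" using cost_norep[OF cbody_simps(3)] by blast
 qed simp
 moreover have "Ym (length ?ys) = Y" by (auto simp: Ym_def Y_def Yset_def set_members)
 moreover have "fst (exa cap (Trav (fst kp) ?c) ?s0) 1 = w"
 proof -
  have "1 ~: wregs (Trav (fst kp) ?c)" using cbody_simps(1)[of ix ph q kp p] by auto
  from sem_reg[OF this] show ?thesis using w by simp
 qed
 moreover have "snd (exa cap (Trav (fst kp) ?c) ?s0) (Num kp p) = snd s (Num kp p)"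
 proof -
  have "Num kp p ~: warrs (Trav (fst kp) ?c)" using cbody_simps(2)[of ix ph q kp p] by auto
  from sem_arr[OF this] show ?thesis by simp
 qed
 ultimately show ?thesis by (simp add: count_pass_def Let_def)
qed

lemma fill_pass_sem:
 fixes s :: ast
 assumes c: "cstate n q tv w s" and ts: "fst kp < q" and J: "J = q * K"
  and Y: "Y <= {y. y < n & tv (fst kp) y = w}" and cnt: "ALL v. snd s Cnt v = cntv q tv Y v" and tot: "fst s 12 = card Y"
 shows "let s' = exa cap (fill_pass q K J kp p) s in
  (ALL v. 0 < cntv q tv Y v & card Y <= K * cntv q tv Y v --> (EX j<J. snd s' (Slot kp (p @ [j])) w = v)) &
  (ALL j<J. snd s' (Slot kp (p @ [j])) w = w \<or> (EX y:Y. EX t<q. tv t y = snd s' (Slot kp (p @ [j])) w)) &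
  (ALL j. ALL v. v ~= w --> snd s' (Slot kp (p @ [j])) v = snd s (Slot kp (p @ [j])) v) &
  (ALL v. snd s' Cnt v <= cntv q tv Y v) &
  tim cap (fill_pass q K J kp p) s <= J + 4 + length (members n tv (fst kp) w) *
   (csz (seqs (map (fill_item K (slots kp p J)) [0..<q])) + 4)"
proof -
 let ?sl = "slots kp p J" and ?ys = "members n tv (fst kp) w"
 let ?c = "seqs (map (fill_item K ?sl) [0..<q])"
 let ?ini = "seqs (map (%a. Prm (Wr a 1 1)) ?sl) :: prog"
 have e: "env n q tv s" and l: "lists_ok n q tv s" and w: "fst s 1 = w" using c by (auto simp: cstate_def)
 have finY: "finite Y" by (rule finite_subset[OF Y]) simp
 define s0 where "s0 = exa cap ?ini s"
 have s0: "s0 = (fst s, %a. if a : set ?sl then (snd s a)(w := w) else snd s a)" using sem_write_all[of cap "%x. x" ?sl s] unfolding s0_def w by simp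
 have slne: "h ~: garrs" "h ~= Cnt" if "h : set ?sl" for h using that by (auto simp: set_slots)
 have cne: "Cnt ~: set ?sl" using slne by blast
 have ga: "a ~: set ?sl" if "a : garrs" for a using that slne by blast
 define hv where "hv v = (0 < cntv q tv Y v & card Y <= K * cntv q tv Y v)" for v
 \<comment> \<open>\<open>pl\<close> lists the frequent values found so far, the latest first;
   behind them the slots still hold \<open>w\<close>.\<close>
 define F where "F pl s' = (distinct pl & (ALL v:set pl. hv v) &
   (ALL v. snd s' Cnt v = (if v : set pl then 0 else cntv q tv Y v)) &
   map (%h. snd s' h w) ?sl = take J (pl @ replicate J w) &
   (ALL h:set ?sl. ALL v. v ~= w --> snd s' h v = snd s h v) & fst s' 12 = card Y)" for pl and s' :: ast
 have wc: "wregs ?c <= {5, 6, 7, 8, 14, 15}" "warrs ?c <= insert Cnt (set ?sl)" "norep ?c"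
  using item_simps(7)[of K ?sl] by (simp, blast) (auto simp: item_simps)
 have row: "EX pl'. F pl' (exa cap (seqs (map (fill_item K ?sl) ls)) s') & set pl <= set pl' &
   (ALL t:set ls. hv (tv t y) --> tv t y : set pl')"
  if F: "F pl s'" and r: "fst s' 1 = w" "fst s' 3 = y" and tau: "!!t. t : set ls ==> snd s' (Tau t) y = tv t y" for pl s' y ls using that
 proof (induction ls arbitrary: pl s')
  case (Cons t ls)
  let ?x = "tv t y"
  let ?u = "exa cap (fill_item K ?sl t) s'"
  have x: "snd s' (Tau t) (fst s' 3) = ?x" using Cons.prems by simp
  note U = fill_item_sem[OF Cons.prems(2) x set_slots(2)[of kp p J] cne, of cap K, unfolded Let_def]
  have ur: "fst ?u z = fst s' z" if "z ~: {5, 6, 7, 8, 14, 15}" for z by (rule sem_reg) (use that item_simps(7)[of K ?sl t] in blast)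
  have ut: "snd ?u (Tau i) = snd s' (Tau i)" for i by (rule sem_arr) (use ga[of "Tau i"] in "simp add: item_simps")
  have "EX pl'. F pl' ?u & set pl <= set pl' & (hv ?x --> ?x : set pl')"
  proof (cases "0 < snd s' Cnt ?x & fst s' 12 <= K * snd s' Cnt ?x")
   case True
   have nx: "?x ~: set pl" and cx: "snd s' Cnt ?x = cntv q tv Y ?x" using True Cons.prems(1) by (auto simp: F_def split: if_splits)
   have hx: "hv ?x" using True cx Cons.prems(1) by (simp add: hv_def F_def)
   have A: "snd ?u Cnt = (snd s' Cnt)(?x := 0)"
    "map (%h. snd ?u h w) ?sl = take (length ?sl) (?x # map (%h. snd s' h w) ?sl)"
    "ALL h:set ?sl. ALL v. v ~= w --> snd ?u h v = snd s' h v" using U True by auto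
   have "map (%h. snd s' h w) ?sl = take J (pl @ replicate J w)" using Cons.prems(1) by (simp add: F_def)
   then have "map (%h. snd ?u h w) ?sl = take J ((?x # pl) @ replicate J w)" unfolding A(2) set_slots(3) by (simp only: take_Cons_take append_Cons)
   then have "F (?x # pl) ?u" using Cons.prems(1) nx hx A(1,3) ur[of 12] unfolding F_def by (simp del: append_Cons take_append)
   then show ?thesis by (intro exI[of _ "?x # pl"]) auto
  next
   case False
   then have su: "snd ?u = snd s'" using U by blast
   have "F pl ?u" using Cons.prems(1) ur[of 12] unfolding F_def su by simp
   moreover have "hv ?x --> ?x : set pl" using False Cons.prems(1) unfolding F_def hv_def by (metis)
   ultimately show ?thesis by blast
  qed
  then obtain pl1 where pl1: "F pl1 ?u" "set pl <= set pl1" "hv ?x --> ?x : set pl1" by blast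
  have "fst ?u 1 = w" "fst ?u 3 = y" using ur Cons.prems(2,3) by auto
  from Cons.IH[OF pl1(1) this] Cons.prems(4) ut obtain pl2 where
   "F pl2 (exa cap (seqs (map (fill_item K ?sl) ls)) ?u)" "set pl1 <= set pl2"
   "ALL t:set ls. hv (tv t y) --> tv t y : set pl2" by auto
  then show ?case using pl1 by (intro exI[of _ pl2]) auto
 qed auto
 let ?I = "%m s'. EX pl. F pl s' & (ALL y:set (take m ?ys). ALL t<q. hv (tv t y) --> tv t y : set pl)"
 have ys: "?ys = lst (snd s0 (Nx (fst kp))) (snd s0 (Hd (fst kp)) (fst s0 1)) (snd s0 (Len (fst kp)) (fst s0 1))"
  using l ts w ga by (simp add: lists_ok_def s0)
 have T: "?I (length ?ys) (exa cap (Trav (fst kp) ?c) s0) &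
   tim cap (Trav (fst kp) ?c) s0 <= 4 + length ?ys * (csz ?c + 4)"
 proof (rule Trav_rule[OF ys, where I = ?I])
  show "3 ~: wregs ?c"
  proof
   assume "3 : wregs ?c"
   from subsetD[OF wc(1) this] show False by simp
  qed
  show "Nx (fst kp) ~: warrs ?c"
  proof
   assume "Nx (fst kp) : warrs ?c"
   from subsetD[OF wc(2) this] show False using ga[of "Nx (fst kp)"] by simp
  qed
  have "map (%h. snd s0 h w) ?sl = replicate J w" by (rule replicate_eqI) (auto simp: s0 set_slots(3))
  then have "F [] s0" using cnt tot cne by (simp add: F_def s0)
  then show "?I 0 s0" by auto
  fix j s v w' assume "?I j s"
  then show "?I j ((fst s)(3 := v, 4 := w'), snd s)" by (simp add: F_def)
 next
  fix m and s' :: ast assume m: "m < length ?ys" and I: "?I m s'" and x3: "fst s' 3 = ?ys ! m"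
   and sm: "same ({3, 4} Un wregs ?c) (warrs ?c) s0 s'"
  let ?y = "?ys ! m"
  have "?y : set ?ys" using m by simp
  then have yn: "?y < n" by (simp add: set_members)
  have r1: "fst s' 1 = w"
  proof -
   have "1 ~: {3, 4} Un wregs ?c"
   proof
    assume "1 : {3, 4} Un wregs ?c"
    then have "1 : wregs ?c" by simp
    from subsetD[OF wc(1) this] show False by simp
   qed
   from same_reg[OF sm this] show ?thesis using w by (simp add: s0)
  qed
  have tau: "snd s' (Tau t) ?y = tv t ?y" if "t < q" for t
  proof -
   have "snd s' (Tau t) = snd s0 (Tau t)" 
   proof (rule same_arr[OF sm], rule notI)
    assume "Tau t : warrs ?c"
    from subsetD[OF wc(2) this] show False using ga[of "Tau t"] by simp
   qed
   then show ?thesis using e yn that ga[of "Tau t"] by (simp add: s0 env_def)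
  qed
  obtain pl where pl: "F pl s'" "ALL y:set (take m ?ys). ALL t<q. hv (tv t y) --> tv t y : set pl" using I by blast
  obtain pl' where "F pl' (exa cap ?c s')" "set pl <= set pl'" "ALL t:set [0..<q]. hv (tv t ?y) --> tv t ?y : set pl'"
   using row[OF pl(1) r1 x3, of "[0..<q]"] tau by auto
  then have "?I (Suc m) (exa cap ?c s')" using pl(2) m by (intro exI[of _ pl']) (auto simp: take_Suc_conv_app_nth)
  then show "?I (Suc m) (exa cap ?c s') & tim cap ?c s' <= csz ?c" using cost_norep[OF wc(3)] by blast
 qed
 let ?s' = "exa cap (fill_pass q K J kp p) s"
 have s': "?s' = exa cap (Trav (fst kp) ?c) s0" by (simp add: fill_pass_def s0_def)
 obtain pl where pl: "F pl ?s'" "ALL y:set ?ys. ALL t<q. hv (tv t y) --> tv t y : set pl" using T unfolding s' by auto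
 have hpl: "v : set pl" if hvv: "hv v" for v
 proof -
  obtain t y where "t < q" "y : Y" "tv t y = v" using cntv_pos[of q tv Y v] hvv by (auto simp: hv_def)
  moreover from this have "y : set ?ys" using Y by (auto simp: set_members)
  ultimately show ?thesis using pl(2) hvv by blast
 qed
 \<comment> \<open>So no frequent value has been pushed out of the \<open>J\<close> slots.\<close>
 have "card (set pl) <= q * K" by (rule heavy_values_card[where tv = tv, OF finY]) (use pl(1) in "auto simp: F_def hv_def")
 then have "length pl <= J" using pl(1) J by (simp add: F_def distinct_card)
 then have m: "map (%h. snd ?s' h w) ?sl = pl @ replicate (J - length pl) w" using pl(1) by (simp add: F_def)
 have nth: "snd ?s' (Slot kp (p @ [j])) w = (pl @ replicate (J - length pl) w) ! j" if "j < J" for j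
  using that unfolding m[symmetric] by (simp add: slots_def)
 have 1: "EX j<J. snd ?s' (Slot kp (p @ [j])) w = v" if hvv: "hv v" for v
 proof -
  obtain j where "j < length pl" "pl ! j = v" using hpl[OF hvv] by (auto simp: in_set_conv_nth)
  then show ?thesis using nth[of j] \<open>length pl <= J\<close> by (intro exI[of _ j]) (auto simp: nth_append)
 qed
 have 2: "snd ?s' (Slot kp (p @ [j])) w = w \<or> (EX y:Y. EX t<q. tv t y = snd ?s' (Slot kp (p @ [j])) w)" if j: "j < J" for j
 proof (cases "j < length pl")
  case True
  then have "snd ?s' (Slot kp (p @ [j])) w : set pl" using nth[OF j] by (simp add: nth_append)
  then have "hv (snd ?s' (Slot kp (p @ [j])) w)" using pl(1) by (simp add: F_def)
  then show ?thesis using cntv_pos unfolding hv_def by blast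
 next
  case False
  then show ?thesis using nth[OF j] j by (simp add: nth_append)
 qed
 have 3: "snd ?s' (Slot kp (p @ [j])) v = snd s (Slot kp (p @ [j])) v" if "v ~= w" for j v
 proof (cases "j < J")
  case True
  then have "Slot kp (p @ [j]) : set ?sl" by (auto simp: set_slots)
  then show ?thesis using pl(1) that unfolding F_def by blast
 next
  case False
  then have "Slot kp (p @ [j]) ~: set ?sl" by (auto simp: set_slots)
  then have "Slot kp (p @ [j]) ~: warrs (fill_pass q K J kp p)" using pass_simps(4)[of q K J kp p] by auto
  from sem_arr[OF this] show ?thesis by simp
 qed
 have 4: "snd ?s' Cnt v <= cntv q tv Y v" for v using pl(1) by (simp add: F_def)
 have "norep ?ini" "csz ?ini = J"
 proof -
  have "csz (seqs (map (%a. Prm (Wr a 1 1)) as)) = length as" for as :: "aname list" by (induction as) auto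
  then show "csz ?ini = J" by (simp add: set_slots(3))
 qed auto
 then have "tim cap ?ini s <= J" using cost_norep by metis
 then have "tim cap (fill_pass q K J kp p) s <= J + (4 + length ?ys * (csz ?c + 4))"
  using conjunct2[OF T] unfolding fill_pass_def cost.simps s0_def[symmetric] by (rule add_mono)
 then show ?thesis unfolding Let_def using 1 2 3 4 by (auto simp: hv_def)
qed

lemma clear_pass_sem:
 fixes s :: ast
 assumes c: "cstate n q tv w s" and ts: "fst kp < q"
  and nz: "!!v. snd s Cnt v ~= 0 ==> EX y<n. tv (fst kp) y = w & (EX t<q. tv t y = v)"
 shows "(ALL v. snd (exa cap (clear_pass q kp) s) Cnt v = 0) &
  tim cap (clear_pass q kp) s <= 4 + length (members n tv (fst kp) w) * (csz (seqs (map clr_item [0..<q])) + 4)"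
proof -
 let ?ys = "members n tv (fst kp) w" and ?c = "seqs (map clr_item [0..<q])"
 have e: "env n q tv s" and l: "lists_ok n q tv s" and w: "fst s 1 = w" using c by (auto simp: cstate_def)
 have ys: "?ys = lst (snd s (Nx (fst kp))) (snd s (Hd (fst kp)) (fst s 1)) (snd s (Len (fst kp)) (fst s 1))" using l ts w by (simp add: lists_ok_def)
 let ?I = "%m s'. ALL v. snd s' Cnt v = (if EX y:set (take m ?ys). EX t<q. tv t y = v then 0 else snd s Cnt v)"
 have nr: "norep ?c" by (simp add: item_simps)
 have "?I (length ?ys) (exa cap (Trav (fst kp) ?c) s) &
   tim cap (Trav (fst kp) ?c) s <= 4 + length ?ys * (csz ?c + 4)"
 proof (rule Trav_rule[OF ys, where I = ?I])
  show "3 ~: wregs ?c" "Nx (fst kp) ~: warrs ?c" by (auto simp: item_simps)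
  show "?I 0 s" by simp
  fix m and s' :: ast assume m: "m < length ?ys" and I: "?I m s'" and x3: "fst s' 3 = ?ys ! m"
   and sm: "same ({3, 4} Un wregs ?c) (warrs ?c) s s'"
  let ?y = "?ys ! m"
  have "?y : set ?ys" using m by simp
  then have yn: "?y < n" by (simp add: set_members)
  have tau: "snd s' (Tau t) (fst s' 3) = tv t ?y" if "t : set [0..<q]" for t
  proof -
   have "snd s' (Tau t) = snd s (Tau t)" by (rule same_arr[OF sm]) (auto simp: item_simps)
   then show ?thesis using e yn that x3 by (simp add: env_def)
  qed
  have "?I (Suc m) (exa cap ?c s')"
  proof -
   have "snd (exa cap ?c s') Cnt v = (if v : (%t. tv t ?y) ` set [0..<q] then 0 else snd s' Cnt v)" for v by (rule clr_seq_sem[OF tau])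
   then show ?thesis using I m by (auto simp: take_Suc_conv_app_nth image_iff)
  qed
  then show "?I (Suc m) (exa cap ?c s') & tim cap ?c s' <= csz ?c" using cost_norep[OF nr] by blast
 qed simp
 moreover have "snd s Cnt v = 0" if "~ (EX y:set ?ys. EX t<q. tv t y = v)" for v using that nz[of v] by (auto simp: set_members)
 ultimately show ?thesis unfolding clear_pass_def by (metis take_all order_refl)
qed

definition pcode :: "(tm => nat) => fm => nat => nat => nat => ctx => nat list => prog" where
 "pcode ix ph q K J kp p = count_pass ix ph q kp p ;; fill_pass q K J kp p ;; clear_pass q kp"

definition pcost :: "(tm => nat) => fm => nat => nat => nat => ctx => nat list => nat" where
 "pcost ix ph q K J kp p = csz (cbody ix ph q kp p) + csz (seqs (map (fill_item K (slots kp p J)) [0..<q])) +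
   csz (seqs (map clr_item [0..<q])) + 12"

text \<open>Besides completeness of the slots, their soundness matters: an entry other than
  \<open>w\<close> is a value of some vertex still counted. Such a vertex avoids the earlier slots,
  so values do not repeat along a path.\<close>

definition good :: "(tm => nat) => fm => nat => nat => (nat => nat => nat) => nat => nat => (aname => nat => nat) =>
  ctx => nat list => nat => bool" where
 "good ix ph n q tv K J A kp p w = ((let Y = Yset ix ph n q tv A kp p w in A (Num kp p) w = card Y &
   (ALL v. 0 < cntv q tv Y v & card Y <= K * cntv q tv Y v --> (EX j<J. A (Slot kp (p @ [j])) w = v)) &
   (ALL j<J. A (Slot kp (p @ [j])) w = w \<or> (EX y:Y. EX t<q. tv t y = A (Slot kp (p @ [j])) w))))"

lemma Yset_cong:
 assumes "!!i. A' (Tau i) = A (Tau i)" "!!p. A' (Pr p) = A (Pr p)" "!!l. A' (Hn l) w = A (Hn l) w"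
  "!!j. 1 <= j ==> j <= length p ==> A' (Slot kp (take j p)) w = A (Slot kp (take j p)) w"
 shows "Yset ix ph n q tv A' kp p w = Yset ix ph n q tv A kp p w"
proof -
 have "ytest ix ph q A' kp p w y = ytest ix ph q A kp p w y" for y by (rule ytest_cong) (use assms in auto)
 then show ?thesis unfolding Yset_def by simp
qed

lemma good_cong:
 assumes "!!i. A' (Tau i) = A (Tau i)" "!!p. A' (Pr p) = A (Pr p)" "!!l. A' (Hn l) w = A (Hn l) w"
  "!!j. 1 <= j ==> j <= length p ==> A' (Slot kp (take j p)) w = A (Slot kp (take j p)) w"
  "A' (Num kp p) w = A (Num kp p) w" "!!j. A' (Slot kp (p @ [j])) w = A (Slot kp (p @ [j])) w"
 shows "good ix ph n q tv K J A' kp p w = good ix ph n q tv K J A kp p w"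
proof -
 have Y: "Yset ix ph n q tv A' kp p w = Yset ix ph n q tv A kp p w" by (rule Yset_cong) (use assms(1-4) in auto)
 show ?thesis unfolding good_def Let_def Y assms(5,6) ..
qed

lemma pcode_simps:
 "wregs (pcode ix ph q K J kp p) <= {3, 4, 5, 6, 7, 8, 10, 11, 12, 14, 15, 19}"
 "warrs (pcode ix ph q K J kp p) <= {Cnt, Num kp p} Un set (slots kp p J)"
proof -
 have "wregs (pcode ix ph q K J kp p) <= {3, 4, 5, 6, 7, 10, 11, 12, 19} Un ({3, 4, 5, 6, 7, 8, 14, 15} Un {3, 4, 5, 6})"
  unfolding pcode_def wregs.simps by (intro Un_mono pass_simps)
 then show "wregs (pcode ix ph q K J kp p) <= {3, 4, 5, 6, 7, 8, 10, 11, 12, 14, 15, 19}" by (rule order.trans) simp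
 have "warrs (pcode ix ph q K J kp p) <= {Cnt, Num kp p} Un (insert Cnt (set (slots kp p J)) Un {Cnt})"
  unfolding pcode_def warrs.simps by (intro Un_mono pass_simps)
 then show "warrs (pcode ix ph q K J kp p) <= {Cnt, Num kp p} Un set (slots kp p J)" by (rule order.trans) auto
qed

lemma same_subset: "wregs c <= X ==> warrs c <= A ==> same X A s (exa cap c s)" by (rule same_mono[OF same_sem])

lemma pcode_sem:
 fixes s :: ast and p :: "nat list" and ix :: "tm => nat" and ph :: fm
 assumes c: "cstate n q tv w s" and ts: "fst kp < q" and z: "ALL v. snd s Cnt v = 0" and J: "J = q * K"
 shows "let s' = exa cap (pcode ix ph q K J kp p) s in
  cstate n q tv w s' & good ix ph n q tv K J (snd s') kp p w & (ALL v. snd s' Cnt v = 0) &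
  (ALL a. a ~= Cnt --> (ALL v. v ~= w --> snd s' a v = snd s a v)) &
  (ALL a. a ~= Cnt --> a ~= Num kp p --> (ALL j. a ~= Slot kp (p @ [j])) --> snd s' a = snd s a) &
  tim cap (pcode ix ph q K J kp p) s <= 14 + J + length (members n tv (fst kp) w) * pcost ix ph q K J kp p"
proof -
 define Y where "Y = Yset ix ph n q tv (snd s) kp p w"
 define s1 where "s1 = exa cap (count_pass ix ph q kp p) s"
 define s2 where "s2 = exa cap (fill_pass q K J kp p) s1"
 define s3 where "s3 = exa cap (clear_pass q kp) s2"
 have e: "exa cap (pcode ix ph q K J kp p) s = s3" by (simp add: pcode_def s3_def s2_def s1_def)
 have m1: "same {3, 4, 5, 6, 7, 10, 11, 12, 19} {Cnt, Num kp p} s s1" unfolding s1_def by (rule same_subset) (rule pass_simps)+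
 have m2: "same {3, 4, 5, 6, 7, 8, 14, 15} (insert Cnt (set (slots kp p J))) s1 s2" unfolding s2_def by (rule same_subset) (rule pass_simps)+
 have m3: "same {3, 4, 5, 6} {Cnt} s2 s3" unfolding s3_def by (rule same_subset) (rule pass_simps)+
 have c1: "cstate n q tv w s1" by (rule cstate_same[OF c m1]) auto
 have c2: "cstate n q tv w s2" by (rule cstate_same[OF c1 m2]) (auto simp: set_slots)
 have c3: "cstate n q tv w s3" by (rule cstate_same[OF c2 m3]) auto
 have 1: "snd s1 (Num kp p) = (snd s (Num kp p))(w := card Y)" "fst s1 12 = card Y" "ALL v. snd s1 Cnt v = cntv q tv Y v"
  "tim cap (count_pass ix ph q kp p) s <= 6 + length (members n tv (fst kp) w) * (csz (cbody ix ph q kp p) + 4)"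
  using count_pass_sem[OF c ts z, of cap ix ph p] unfolding Y_def s1_def Let_def by blast+
 have Ysub: "Y <= {y. y < n & tv (fst kp) y = w}" by (auto simp: Y_def Yset_def)
 note F = fill_pass_sem[OF c1 ts J Ysub 1(3,2), of cap p, unfolded Let_def, folded s2_def]
 have "EX y<n. tv (fst kp) y = w & (EX t<q. tv t y = v)" if v: "snd s2 Cnt v ~= 0" for v
 proof -
  have "snd s2 Cnt v <= cntv q tv Y v" using F by blast
  then have "0 < cntv q tv Y v" using v by simp
  from cntv_pos[OF this] show ?thesis using Ysub by blast
 qed
 note C = clear_pass_sem[OF c2 ts this, of cap, folded s3_def]
 have a3: "snd s3 a = snd s2 a" if "a ~= Cnt" for a by (rule same_arr[OF m3]) (use that in simp)
 have a2: "snd s2 a = snd s1 a" if "a ~= Cnt" "!!j. a ~= Slot kp (p @ [j])" for a by (rule same_arr[OF m2]) (use that in "auto simp: set_slots")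
 have a1: "snd s1 a = snd s a" if "a ~= Cnt" "a ~= Num kp p" for a by (rule same_arr[OF m1]) (use that in simp)
 have arr: "snd s3 a = snd s a" if "a ~= Cnt" "a ~= Num kp p" "!!j. a ~= Slot kp (p @ [j])" for a using a1 a2 a3 that by metis
 have idx: "snd s3 a v = snd s a v" if a: "a ~= Cnt" "v ~= w" for a v
 proof (cases "EX j. a = Slot kp (p @ [j])")
  case True
  then obtain j where j: "a = Slot kp (p @ [j])" by blast
  have "snd s2 a v = snd s1 a v" using F a(2) unfolding j by blast
  then show ?thesis using a3[OF a(1)] a1[of a] by (simp add: j)
 next
  case False
  then have "snd s3 a = snd s1 a" using a2[of a] a3[of a] a(1) by auto
  then show ?thesis using a1[OF a(1)] 1(1) a(2) by (cases "a = Num kp p") auto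
 qed
 have Y3: "Yset ix ph n q tv (snd s3) kp p w = Y" unfolding Y_def
 proof (rule Yset_cong)
  fix j assume "j <= length p"
  then have "take j p ~= p @ [i]" for i by (metis length_append_singleton length_take min.absorb2 not_less_eq_eq order_refl)
  then show "snd s3 (Slot kp (take j p)) w = snd s (Slot kp (take j p)) w" using arr[of "Slot kp (take j p)"] by simp
 qed (simp_all add: arr)
 have "snd s3 (Num kp p) w = card Y" using a3[of "Num kp p"] a2[of "Num kp p"] 1(1) by simp
 moreover have sl: "snd s3 (Slot kp (p @ [j])) = snd s2 (Slot kp (p @ [j]))" for j by (rule a3) simp
 ultimately have "good ix ph n q tv K J (snd s3) kp p w" unfolding good_def Let_def Y3 sl using F by blast
 moreover have "tim cap (pcode ix ph q K J kp p) s <= 14 + J + length (members n tv (fst kp) w) * pcost ix ph q K J kp p"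
 proof -
  have "tim cap (pcode ix ph q K J kp p) s = tim cap (count_pass ix ph q kp p) s +
   (tim cap (fill_pass q K J kp p) s1 + tim cap (clear_pass q kp) s2)"
   by (simp add: pcode_def s2_def s1_def)
  moreover have "tim cap (fill_pass q K J kp p) s1 <= J + 4 + length (members n tv (fst kp) w) *
   (csz (seqs (map (fill_item K (slots kp p J)) [0..<q])) + 4)" using F by blast
  ultimately show ?thesis using 1(4) conjunct2[OF C] by (simp add: pcost_def algebra_simps)
 qed
 ultimately show ?thesis unfolding e Let_def using c3 C arr idx by blast
qed

section \<open>All contexts and all paths\<close>

definition ctx_code :: "(tm => nat) => fm => nat => nat => nat => nat list list => ctx => prog" where
 "ctx_code ix ph q K J ps kp = For 1 (seqs (map (pcode ix ph q K J kp) ps))"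

text \<open>For a path \<open>p\<close>, slots of paths up to the length of \<open>p\<close> are
  read and slots of paths one longer are written. In order of nondecreasing length nothing is
  overwritten on which an earlier result depends.\<close>

definition paths_ok :: "nat list list => bool" where
 "paths_ok ps = (sorted_wrt (%p p'. length p <= length p' & p ~= p') ps)"

definition kcost :: "(tm => nat) => fm => nat => nat => nat => nat list list => ctx => nat" where
 "kcost ix ph q K J ps kp = 7 + length ps * (14 + J) + (\<Sum>i<length ps. pcost ix ph q K J kp (ps ! i))"

lemma ctx_code_simps:
 "wregs (ctx_code ix ph q K J ps kp) <= {1, 3, 4, 5, 6, 7, 8, 10, 11, 12, 14, 15, 19}"
 "warrs (ctx_code ix ph q K J ps kp) <= {Cnt} Un range (Num kp) Un range (Slot kp)"
proof -
 show "wregs (ctx_code ix ph q K J ps kp) <= {1, 3, 4, 5, 6, 7, 8, 10, 11, 12, 14, 15, 19}"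
 proof
  fix x assume "x : wregs (ctx_code ix ph q K J ps kp)"
  then have "x = 1 \<or> (EX p. x : wregs (pcode ix ph q K J kp p))" by (auto simp: ctx_code_def)
  then show "x : {1, 3, 4, 5, 6, 7, 8, 10, 11, 12, 14, 15, 19}" using pcode_simps(1) by blast
 qed
 show "warrs (ctx_code ix ph q K J ps kp) <= {Cnt} Un range (Num kp) Un range (Slot kp)"
 proof
  fix x assume "x : warrs (ctx_code ix ph q K J ps kp)"
  then have "EX p. x : warrs (pcode ix ph q K J kp p)" by (auto simp: ctx_code_def)
  then obtain p where "x : {Cnt, Num kp p} Un set (slots kp p J)" using pcode_simps(2) by blast
  then show "x : {Cnt} Un range (Num kp) Un range (Slot kp)" by (auto simp: set_slots)
 qed
qed

lemma ctx_code_sem: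
 fixes s :: ast
 assumes e: "env n q tv s" and l: "lists_ok n q tv s" and pr: "ALL p v. snd s (Pr p) v <= 1"
  and ts: "fst kp < q" and z: "ALL v. snd s Cnt v = 0" and J: "J = q * K" and ps: "paths_ok ps"
  and tv: "!!i y. i < q ==> y < n ==> tv i y < n"
 shows "let s' = exa cap (ctx_code ix ph q K J ps kp) s in
  (ALL w<n. ALL p:set ps. good ix ph n q tv K J (snd s') kp p w) & (ALL v. snd s' Cnt v = 0) &
  tim cap (ctx_code ix ph q K J ps kp) s <= kcost ix ph q K J ps kp * (n + 1)"
proof -
 let ?cs = "map (pcode ix ph q K J kp) ps"
 let ?c = "seqs ?cs"
 have n: "fst s 0 = n" using e by (simp add: env_def)
 let ?len = "%w. length (members n tv (fst kp) w)"
 let ?PC = "%i. pcost ix ph q K J kp (ps ! i)"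
 have cw: "wregs ?c <= {1, 3, 4, 5, 6, 7, 8, 10, 11, 12, 14, 15, 19}"
  "warrs ?c <= {Cnt} Un range (Num kp) Un range (Slot kp)" using ctx_code_simps[of ix ph q K J ps kp] by (auto simp: ctx_code_def)
 have nw1: "1 ~: wregs ?c"
 proof
  assume "1 : wregs ?c"
  then obtain p where "1 : wregs (pcode ix ph q K J kp p)" by auto
  from subsetD[OF pcode_simps(1) this] show False by simp
 qed
 have row: "cstate n q tv w (exa cap ?c s1) & (ALL v. snd (exa cap ?c s1) Cnt v = 0) &
   (ALL p:set ps. good ix ph n q tv K J (snd (exa cap ?c s1)) kp p w) &
   (ALL a. a ~= Cnt --> (ALL v. v ~= w --> snd (exa cap ?c s1) a v = snd s1 a v)) &
   tim cap ?c s1 <= (\<Sum>i<length ps. 14 + J + ?len w * ?PC i)"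
  if c: "cstate n q tv w s1" and z1: "ALL v. snd s1 Cnt v = 0" for s1 :: ast and w
 proof -
  let ?I = "%m s'. cstate n q tv w s' & (ALL v. snd s' Cnt v = 0) & (ALL i<m. good ix ph n q tv K J (snd s') kp (ps ! i) w) &
   (ALL a. a ~= Cnt --> (ALL v. v ~= w --> snd s' a v = snd s1 a v))"
  have "?I (length ?cs) (exa cap ?c s1) & tim cap ?c s1 <= (\<Sum>i<length ?cs. 14 + J + ?len w * ?PC i)"
  proof (rule seqs_rule[where I = ?I])
   show "?I 0 s1" using c z1 by simp
   fix m and s' :: ast assume m: "m < length ?cs" and I: "?I m s'"
   let ?p = "ps ! m"
   let ?s = "exa cap (pcode ix ph q K J kp ?p) s'"
   have c': "cstate n q tv w s'" and z': "ALL v. snd s' Cnt v = 0" using I by blast+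
   note P = pcode_sem[OF c' ts z' J, of cap ix ph ?p, unfolded Let_def]
   have ar: "snd ?s a = snd s' a" if "a ~= Cnt" "a ~= Num kp ?p" "!!j. a ~= Slot kp (?p @ [j])" for a using P that by blast
   have "good ix ph n q tv K J (snd ?s) kp (ps ! i) w" if i: "i < Suc m" for i
   proof (cases "i = m")
    case True
    then show ?thesis using P by simp
   next
    case False
    then have im: "i < m" using i by simp
    then have lt: "length (ps ! i) <= length ?p" "ps ! i ~= ?p" using ps m unfolding paths_ok_def by (auto simp: sorted_wrt_iff_nth_less)
    have "good ix ph n q tv K J (snd ?s) kp (ps ! i) w = good ix ph n q tv K J (snd s') kp (ps ! i) w"
    proof (rule good_cong)
    fix j
    have "take j (ps ! i) ~= ?p @ [j']" for j'
    proof
    assume "take j (ps ! i) = ?p @ [j']"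
    then have "length (take j (ps ! i)) = Suc (length ?p)" by simp
    then show False using lt(1) by simp
    qed
    then show "snd ?s (Slot kp (take j (ps ! i))) w = snd s' (Slot kp (take j (ps ! i))) w" using ar[of "Slot kp (take j (ps ! i))"] by simp
    show "snd ?s (Slot kp (ps ! i @ [j])) w = snd s' (Slot kp (ps ! i @ [j])) w" using ar[of "Slot kp (ps ! i @ [j])"] lt(2) by simp
    qed (use lt(2) in "simp_all add: ar")
    then show ?thesis using I im by blast
   qed
   then have "?I (Suc m) ?s" using P I by simp
   then show "?I (Suc m) (exa cap (?cs ! m) s') & tim cap (?cs ! m) s' <= 14 + J + ?len w * ?PC m" using m P by simp
  qed
  then show ?thesis by (auto simp: in_set_conv_nth)
 qed
 let ?I = "%m s'. (ALL v. snd s' Cnt v = 0) & (ALL w<m. ALL p:set ps. good ix ph n q tv K J (snd s') kp p w)"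
 have F: "?I n (exa cap (For 1 ?c) s) & tim cap (For 1 ?c) s <= 3 + (\<Sum>w<n. (\<Sum>i<length ps. 14 + J + ?len w * ?PC i) + 4)"
 proof (rule For_rule[OF n _ nw1, where I = ?I])
  show "?I 0 s" using z by simp
  fix w and s' :: ast assume w: "w < n" and I: "?I w s'" and x: "fst s' 1 = w"
   and sm: "same (insert 1 (wregs ?c)) (warrs ?c) s s'"
  have sm': "same {1, 3, 4, 5, 6, 7, 8, 10, 11, 12, 14, 15, 19} ({Cnt} Un range (Num kp) Un range (Slot kp)) s s'"
   by (rule same_mono[OF sm _ cw(2)]) (use cw(1) in simp)
  have ar: "snd s' a = snd s a" if "a : garrs Un range Pr" for a by (rule same_arr[OF sm']) (use that in auto)
  have c': "cstate n q tv w s'" using e l pr x ar same_reg[OF sm', of 0] by (simp add: cstate_def env_def lists_ok_def)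
  let ?s = "exa cap ?c s'"
  note P = row[OF c' conjunct1[OF I]]
  have "good ix ph n q tv K J (snd ?s) kp p w'" if "w' < w" "p : set ps" for w' p
  proof -
   have ne: "snd ?s a w' = snd s' a w'" if "a ~= Cnt" for a using P \<open>w' < w\<close> that by auto
   have sy: "snd ?s a = snd s' a" if "a : range Tau Un range Pr" for a
   proof (rule sem_arr, rule notI)
    assume "a : warrs ?c"
    from subsetD[OF cw(2) this] show False using that by auto
   qed
   have "good ix ph n q tv K J (snd ?s) kp p w' = good ix ph n q tv K J (snd s') kp p w'" by (rule good_cong) (simp_all add: sy ne)
   then show ?thesis using I that by blast
  qed
  then show "?I (Suc w) ?s & tim cap ?c s' <= (\<Sum>i<length ps. 14 + J + ?len w * ?PC i)" using P by (auto simp: less_Suc_eq)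
 qed auto
 have "(\<Sum>w<n. (\<Sum>i<length ps. 14 + J + ?len w * ?PC i) + 4) = n * (length ps * (14 + J)) + (\<Sum>w<n. ?len w) * (\<Sum>i<length ps. ?PC i) + 4 * n"
  unfolding sum.distrib sum_product by (simp add: algebra_simps)
 also have "(\<Sum>w<n. ?len w) = n" by (rule sum_length_members) (use tv ts in auto)
 finally have "tim cap (ctx_code ix ph q K J ps kp) s <= kcost ix ph q K J ps kp * (n + 1)"
  using F by (simp add: ctx_code_def kcost_def algebra_simps)
 then show ?thesis using F by (simp add: ctx_code_def Let_def)
qed

definition ctxs_prog :: "(tm => nat) => fm => nat => nat => nat => nat list list => ctx list => prog" where
 "ctxs_prog ix ph q K J ps kps = seqs (map (ctx_code ix ph q K J ps) kps)"

lemma ctxs_prog_simps: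
 "wregs (ctxs_prog ix ph q K J ps kps) <= {1, 3, 4, 5, 6, 7, 8, 10, 11, 12, 14, 15, 19}"
 "warrs (ctxs_prog ix ph q K J ps kps) <= {Cnt} Un range (case_prod Num) Un range (case_prod Slot)"
proof -
 show "wregs (ctxs_prog ix ph q K J ps kps) <= {1, 3, 4, 5, 6, 7, 8, 10, 11, 12, 14, 15, 19}"
  unfolding ctxs_prog_def wregs_seqs set_map using ctx_code_simps(1) by blast
 show "warrs (ctxs_prog ix ph q K J ps kps) <= {Cnt} Un range (case_prod Num) Un range (case_prod Slot)"
 proof
  fix x assume "x : warrs (ctxs_prog ix ph q K J ps kps)"
  then obtain kp where "x : warrs (ctx_code ix ph q K J ps kp)" by (auto simp: ctxs_prog_def)
  from subsetD[OF ctx_code_simps(2) this] show "x : {Cnt} Un range (case_prod Num) Un range (case_prod Slot)" by auto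
 qed
qed

lemma ctxs_prog_sem:
 fixes s :: ast
 assumes e: "env n q tv s" and l: "lists_ok n q tv s" and pr: "ALL p v. snd s (Pr p) v <= 1"
  and ts: "ALL kp:set kps. fst kp < q" and z: "ALL v. snd s Cnt v = 0" and J: "J = q * K" and ps: "paths_ok ps"
  and tv: "!!i y. i < q ==> y < n ==> tv i y < n" and dist: "distinct kps"
 shows "let s' = exa cap (ctxs_prog ix ph q K J ps kps) s in
  (ALL kp:set kps. ALL w<n. ALL p:set ps. good ix ph n q tv K J (snd s') kp p w) &
  tim cap (ctxs_prog ix ph q K J ps kps) s <= (\<Sum>i<length kps. kcost ix ph q K J ps (kps ! i)) * (n + 1)"
proof -
 let ?cs = "map (ctx_code ix ph q K J ps) kps"
 let ?I = "%m s'. (ALL v. snd s' Cnt v = 0) & (ALL i<m. ALL w<n. ALL p:set ps. good ix ph n q tv K J (snd s') (kps ! i) p w)"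
 have "?I (length ?cs) (exa cap (seqs ?cs) s) & tim cap (seqs ?cs) s <=
   (\<Sum>i<length ?cs. kcost ix ph q K J ps (kps ! i) * (n + 1))"
 proof (rule seqs_rule[where I = ?I])
  show "?I 0 s" using z by simp
  fix m and s' :: ast assume m: "m < length ?cs" and I: "?I m s'" and sm0: "same (wregs (seqs ?cs)) (warrs (seqs ?cs)) s s'"
  let ?kp = "kps ! m"
  have sm: "same {1, 3, 4, 5, 6, 7, 8, 10, 11, 12, 14, 15, 19} ({Cnt} Un range (case_prod Num) Un range (case_prod Slot)) s s'"
   by (rule same_mono[OF sm0]) (rule ctxs_prog_simps[unfolded ctxs_prog_def])+
  have ar: "snd s' a = snd s a" if "a : garrs Un range Pr" for a by (rule same_arr[OF sm]) (use that in auto)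
  have e': "env n q tv s'" using e ar same_reg[OF sm, of 0] by (simp add: env_def)
  have l': "lists_ok n q tv s'" using l ar by (simp add: lists_ok_def)
  have pr': "ALL p v. snd s' (Pr p) v <= 1" using pr ar by simp
  have tk: "fst ?kp < q" using ts m by simp
  let ?s = "exa cap (ctx_code ix ph q K J ps ?kp) s'"
  note P = ctx_code_sem[OF e' l' pr' tk conjunct1[OF I] J ps tv, of cap ix ph, unfolded Let_def]
  have "good ix ph n q tv K J (snd ?s) (kps ! i) p w" if i: "i < m" "w < n" "p : set ps" for i w p
  proof -
   have ne: "kps ! i ~= ?kp" using dist i(1) m by (simp add: nth_eq_iff_index_eq)
   have sy: "snd ?s a = snd s' a" if "a ~= Cnt" "a ~: range (Num ?kp)" "a ~: range (Slot ?kp)" for a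
   proof (rule sem_arr, rule notI)
    assume "a : warrs (ctx_code ix ph q K J ps ?kp)"
    from subsetD[OF ctx_code_simps(2) this] show False using that by auto
   qed
   have "Num (kps ! i) r ~: range (Num ?kp)" "Slot (kps ! i) r ~: range (Slot ?kp)"
    "Num (kps ! i) r ~: range (Slot ?kp)" "Slot (kps ! i) r ~: range (Num ?kp)" for r using ne by auto
   then have "good ix ph n q tv K J (snd ?s) (kps ! i) p w = good ix ph n q tv K J (snd s') (kps ! i) p w"
    by (intro good_cong) (simp_all add: sy image_iff)
   then show ?thesis using I i by blast
  qed
  then show "?I (Suc m) (exa cap (?cs ! m) s') & tim cap (?cs ! m) s' <= kcost ix ph q K J ps ?kp * (n + 1)" using P m by (auto simp: less_Suc_eq)
 qed
 note F = this
 have "ALL kp:set kps. ALL w<n. ALL p:set ps. good ix ph n q tv K J (snd (exa cap (seqs ?cs) s)) kp p w"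
  using F unfolding set_conv_nth[of kps] by auto
 moreover have "tim cap (seqs ?cs) s <= (\<Sum>i<length kps. kcost ix ph q K J ps (kps ! i)) * (n + 1)"
  using conjunct2[OF F] unfolding sum_distrib_right length_map .
 ultimately show ?thesis unfolding Let_def ctxs_prog_def by (rule conjI)
qed

section \<open>The weights and the complete program\<close>

type_synonym terms = "(nat \<times> ctx \<times> nat list) list"

text \<open>Which counts contribute to a weight is decided when the program is built, as
  \<open>T\<close> depends on the clause and not on the structure. At run time only table entries
  are added.\<close>

definition wt_code :: "(fm => nat => terms) => fm \<times> nat => prog" where
 "wt_code T = (%(om, i). For 1 (Prm (SetC 12 0) ;; seqs (map (%(t, kp, p).
   Prm (Rd 5 (Tau t) 1) ;; Prm (Rd 6 (Num kp p) 5) ;; Prm (AddC 12 12 6)) (T om i)) ;; Prm (Wr (Wt om i) 1 12)))"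

definition wt_sum :: "(aname => nat => nat) => terms => nat => nat" where
 "wt_sum A ts v = (\<Sum>(t, kp, p)\<leftarrow>ts. A (Num kp p) (A (Tau t) v))"

lemma sem_sum_chain:
 fixes s :: ast
 assumes "fst s 12 + wt_sum (snd s) ts (fst s 1) <= cap"
 shows "fst (exa cap (seqs (map (%(t, kp, p).
   Prm (Rd 5 (Tau t) 1) ;; Prm (Rd 6 (Num kp p) 5) ;; Prm (AddC 12 12 6)) ts)) s) 12 = fst s 12 + wt_sum (snd s) ts (fst s 1)"
 using assms
proof (induction ts arbitrary: s)
 case (Cons x ts)
 obtain t kp p where x: "x = (t, kp, p)" by (cases x)
 define u where "u = exa cap (Prm (Rd 5 (Tau t) 1) ;; Prm (Rd 6 (Num kp p) 5) ;; Prm (AddC 12 12 6)) s"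
 have u: "fst u 12 = fst s 12 + snd s (Num kp p) (snd s (Tau t) (fst s 1))" "fst u 1 = fst s 1" "snd u = snd s"
  using Cons.prems by (simp_all add: u_def x wt_sum_def)
 have "fst u 12 + wt_sum (snd u) ts (fst u 1) <= cap" using Cons.prems u by (simp add: x wt_sum_def)
 note IH = Cons.IH[OF this]
 have e: "exa cap (seqs (map (%(t, kp, p).
   Prm (Rd 5 (Tau t) 1) ;; Prm (Rd 6 (Num kp p) 5) ;; Prm (AddC 12 12 6)) (x # ts))) s =
  exa cap (seqs (map (%(t, kp, p).
   Prm (Rd 5 (Tau t) 1) ;; Prm (Rd 6 (Num kp p) 5) ;; Prm (AddC 12 12 6)) ts)) u"
  by (simp add: x u_def)
 show ?case unfolding e IH using u by (simp add: x wt_sum_def)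
qed (simp add: wt_sum_def)

lemma wt_code_simps: "wregs (wt_code T x) <= {1, 5, 6, 12}" "warrs (wt_code T x) = {Wt (fst x) (snd x)}"
 by (auto simp: wt_code_def split: prod.splits)

lemma wt_code_sem:
 fixes s :: ast
 assumes n: "fst s 0 = n" and cap: "ALL v<n. wt_sum (snd s) (T om i) v <= cap"
 shows "(ALL v<n. snd (exa cap (wt_code T (om, i)) s) (Wt om i) v = wt_sum (snd s) (T om i) v) &
  tim cap (wt_code T (om, i)) s <= (9 + 3 * length (T om i)) * (n + 1)"
proof -
 let ?ch = "seqs (map (%(t, kp, p). Prm (Rd 5 (Tau t) 1) ;; Prm (Rd 6 (Num kp p) 5) ;; Prm (AddC 12 12 6)) (T om i)) :: prog"
 let ?c = "Prm (SetC 12 0) ;; ?ch ;; Prm (Wr (Wt om i) 1 12)"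
 have "csz (seqs (map (%(t, kp, p). Prm (Rd 5 (Tau t) 1) ;; Prm (Rd 6 (Num kp p) 5) ;; Prm (AddC 12 12 6)) ts) :: prog) = 3 * length ts" for ts
  by (induction ts) auto
 then have nr: "norep ?c" "csz ?c = 2 + 3 * length (T om i)" by auto
 have chw: "wregs ?ch <= {5, 6, 12}" "warrs ?ch = {}" by auto
 let ?I = "%m s'. ALL v<m. snd s' (Wt om i) v = wt_sum (snd s) (T om i) v"
 have "?I n (exa cap (For 1 ?c) s) & tim cap (For 1 ?c) s <= 3 + (\<Sum>v<n. (2 + 3 * length (T om i)) + 4)"
 proof (rule For_rule[OF n, where I = ?I])
  show "1 ~: wregs ?c" by auto
  fix m and s' :: ast assume m: "m < n" and I: "?I m s'" and x: "fst s' 1 = m"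
   and sm: "same (insert 1 (wregs ?c)) (warrs ?c) s s'"
  have ar: "snd s' a = snd s a" if "a ~= Wt om i" for a by (rule same_arr[OF sm]) (use that chw(2) in simp)
  let ?s0 = "((fst s')(12 := 0), snd s')"
  have ws: "wt_sum (snd s') ts m = wt_sum (snd s) ts m" for ts unfolding wt_sum_def by (simp add: ar)
  have "fst (exa cap ?ch ?s0) 12 = wt_sum (snd s) (T om i) m" using sem_sum_chain[of ?s0 "T om i" cap] cap m x ws by simp
  moreover have "fst (exa cap ?ch ?s0) 1 = m"
  proof -
   have "1 ~: wregs ?ch" using chw(1) by auto
   from sem_reg[OF this] show ?thesis using x by simp
  qed
  moreover have "snd (exa cap ?ch ?s0) = snd s'" by (intro ext, subst sem_arr) (use chw(2) in auto)
  ultimately show "?I (Suc m) (exa cap ?c s') & tim cap ?c s' <= 2 + 3 * length (T om i)"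
   using I cost_norep[OF nr(1), of "aram cap" s'] nr(2) by (auto simp: less_Suc_eq)
 qed auto
 then show ?thesis unfolding wt_code_def by (simp add: algebra_simps)
qed

definition wts_prog :: "(fm => nat => terms) => (fm \<times> nat) list => prog" where
 "wts_prog T xs = seqs (map (wt_code T) xs)"

lemma wts_prog_simps: "wregs (wts_prog T xs) <= {1, 5, 6, 12}" "warrs (wts_prog T xs) <= range (case_prod Wt)"
proof -
 show "wregs (wts_prog T xs) <= {1, 5, 6, 12}" unfolding wts_prog_def wregs_seqs set_map using wt_code_simps(1) by blast
 show "warrs (wts_prog T xs) <= range (case_prod Wt)" unfolding wts_prog_def warrs_seqs set_map by (auto simp: wt_code_simps)
qed

lemma wts_prog_sem:
 fixes s :: ast
 assumes n: "fst s 0 = n" and cap: "ALL (om, i):set xs. ALL v<n. wt_sum (snd s) (T om i) v <= cap"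
 shows "(ALL (om, i):set xs. ALL v<n. snd (exa cap (wts_prog T xs) s) (Wt om i) v = wt_sum (snd s) (T om i) v) &
  tim cap (wts_prog T xs) s <= (\<Sum>m<length xs. 9 + 3 * length (case_prod T (xs ! m))) * (n + 1)"
proof -
 let ?cs = "map (wt_code T) xs"
 let ?I = "%m s'. ALL j<m. ALL v<n. snd s' (case_prod Wt (xs ! j)) v = wt_sum (snd s) (case_prod T (xs ! j)) v"
 have "?I (length ?cs) (exa cap (seqs ?cs) s) & tim cap (seqs ?cs) s <=
   (\<Sum>m<length ?cs. (9 + 3 * length (case_prod T (xs ! m))) * (n + 1))"
 proof (rule seqs_rule[where I = ?I])
  fix m and s' :: ast assume m: "m < length ?cs" and I: "?I m s'" and sm0: "same (wregs (seqs ?cs)) (warrs (seqs ?cs)) s s'"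
  have sm: "same {1, 5, 6, 12} (range (case_prod Wt)) s s'" by (rule same_mono[OF sm0]) (rule wts_prog_simps[unfolded wts_prog_def])+
  have n': "fst s' 0 = n" using same_reg[OF sm, of 0] n by simp
  have ar: "snd s' a = snd s a" if "a ~: range (case_prod Wt)" for a by (rule same_arr[OF sm that])
  have nw: "Num kp p ~: range (case_prod Wt)" "Tau t ~: range (case_prod Wt)" for kp p t by auto
  have ws: "wt_sum (snd s') ts v = wt_sum (snd s) ts v" for ts v unfolding wt_sum_def by (simp add: ar nw)
  obtain om i where x: "xs ! m = (om, i)" by (cases "xs ! m")
  have "(om, i) : set xs" using m x by (metis length_map nth_mem)
  then have cap': "ALL v<n. wt_sum (snd s') (T om i) v <= cap" using cap unfolding ws by auto
  note P = wt_code_sem[where T = T and om = om and i = i, OF n' cap']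
  have "snd (exa cap (wt_code T (om, i)) s') (case_prod Wt (xs ! j)) v = wt_sum (snd s) (case_prod T (xs ! j)) v"
   if j: "j < Suc m" "v < n" for j v
  proof (cases "xs ! j = (om, i)")
   case True
   then show ?thesis using P j(2) ws by simp
  next
   case False
   obtain om' i' where x': "xs ! j = (om', i')" by (cases "xs ! j")
   have "snd (exa cap (wt_code T (om, i)) s') (Wt om' i') = snd s' (Wt om' i')" by (rule sem_arr) (use False x' in "simp add: wt_code_simps")
   moreover have "j < m" using j(1) False x by (cases "j = m") auto
   moreover have "snd s' (case_prod Wt (xs ! j)) v = wt_sum (snd s) (case_prod T (xs ! j)) v" using I j(2) calculation(2) by blast
   ultimately show ?thesis using x' by simp
  qed
  then show "?I (Suc m) (exa cap (?cs ! m) s') & tim cap (?cs ! m) s' <= (9 + 3 * length (case_prod T (xs ! m))) * (n + 1)" using P m x by simp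
 qed simp
 note F = this
 have "ALL x:set xs. ALL v<n. snd (exa cap (seqs ?cs) s) (case_prod Wt x) v = wt_sum (snd s) (case_prod T x) v"
  using conjunct1[OF F] unfolding all_set_conv_all_nth length_map .
 then have "ALL (om, i):set xs. ALL v<n. snd (exa cap (seqs ?cs) s) (Wt om i) v = wt_sum (snd s) (T om i) v" by auto
 moreover have "tim cap (seqs ?cs) s <= (\<Sum>m<length xs. 9 + 3 * length (case_prod T (xs ! m))) * (n + 1)"
  using conjunct2[OF F] unfolding sum_distrib_right length_map .
 ultimately show ?thesis unfolding wts_prog_def by (rule conjI)
qed

lemma com_ok_mono:
 assumes "!!p. pok p ==> pok' p" "R <= R'" "com_ok pok R c"
 shows "com_ok pok' R' c" using assms(3) by (induction c) (use assms(1,2) in auto)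

lemma prim_ok_mono:
 assumes "prim_ok R cm N p" "R <= R'" "cm <= cm'" "N <= N'"
 shows "prim_ok R' cm' N' p" using assms by (cases p) auto

text \<open>A program is a finite text. As only the existence of a machine is claimed for a fixed
  formula, no explicit bounds on its registers, constants and arrays are needed.\<close>

lemma com_ok_exists: "EX R cm N. finite N & com_ok (prim_ok R cm N) R c"
proof -
 have pr: "EX R cm N. finite N & prim_ok R cm N p" for p :: "'a prim"
 proof (cases p)
  case (SetC x c)
  show ?thesis unfolding SetC by (intro exI[of _ "Suc x"] exI[of _ c] exI[of _ "{}"]) simp
 next
  case (Inc x)
  show ?thesis unfolding Inc by (intro exI[of _ "Suc x"] exI[of _ 0] exI[of _ "{}"]) simp
 next
  case (Mov x y)
  show ?thesis unfolding Mov by (intro exI[of _ "Suc (x + y)"] exI[of _ 0] exI[of _ "{}"]) simp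
 next
  case (Sb x y z)
  show ?thesis unfolding Sb by (intro exI[of _ "Suc (x + y + z)"] exI[of _ 0] exI[of _ "{}"]) simp
 next
  case (AddC x y z)
  show ?thesis unfolding AddC by (intro exI[of _ "Suc (x + y + z)"] exI[of _ 0] exI[of _ "{}"]) simp
 next
  case (Rd x a y)
  show ?thesis unfolding Rd by (intro exI[of _ "Suc (x + y)"] exI[of _ 0] exI[of _ "{a}"]) simp
 next
  case (Wr a x y)
  show ?thesis unfolding Wr by (intro exI[of _ "Suc (x + y)"] exI[of _ 0] exI[of _ "{a}"]) simp
 qed
 show ?thesis
 proof (induction c)
  case Skip
  show ?case by (intro exI[of _ 0] exI[of _ "{}"]) simp
 next
  case (Prm p)
  then show ?case using pr[of p] by simp
 next
  case (Seq c d)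
  then obtain R1 c1 N1 R2 c2 N2 where A: "finite N1" "com_ok (prim_ok R1 c1 N1) R1 c" "finite N2" "com_ok (prim_ok R2 c2 N2) R2 d" by blast
  have "com_ok (prim_ok (max R1 R2) (max c1 c2) (N1 Un N2)) (max R1 R2) c" by (rule com_ok_mono[OF _ _ A(2)]) (auto elim: prim_ok_mono)
  moreover have "com_ok (prim_ok (max R1 R2) (max c1 c2) (N1 Un N2)) (max R1 R2) d" by (rule com_ok_mono[OF _ _ A(4)]) (auto elim: prim_ok_mono)
  ultimately show ?case using A(1,3) by (intro exI[of _ "max R1 R2"] exI[of _ "max c1 c2"] exI[of _ "N1 Un N2"]) simp
 next
  case (IfNZ x c)
  then obtain R1 c1 N1 where A: "finite N1" "com_ok (prim_ok R1 c1 N1) R1 c" by blast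
  have "com_ok (prim_ok (max R1 (Suc x)) c1 N1) (max R1 (Suc x)) c" by (rule com_ok_mono[OF _ _ A(2)]) (auto elim: prim_ok_mono)
  then show ?case using A(1) by (intro exI[of _ "max R1 (Suc x)"] exI[of _ c1] exI[of _ N1]) simp
 next
  case (Rep x c)
  then obtain R1 c1 N1 where A: "finite N1" "com_ok (prim_ok R1 c1 N1) R1 c" by blast
  have "com_ok (prim_ok (max R1 (Suc x)) c1 N1) (max R1 (Suc x)) c" by (rule com_ok_mono[OF _ _ A(2)]) (auto elim: prim_ok_mono)
  then show ?case using A(1) by (intro exI[of _ "max R1 (Suc x)"] exI[of _ c1] exI[of _ N1]) simp
 qed
qed

definition full_prog :: "nat list list => nat => (tm => nat) => fm => nat => nat list list => ctx list =>
  (fm => nat => terms) => (fm \<times> nat) list => prog" where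
 "full_prog Tw d ix ph K ps kps T xs = tau_prog Tw ;; list_prog (length Tw) ;; deg_prog (length Tw) ;; init_prog d ;;
   greedy (length Tw) d ;; ctxs_prog ix ph (length Tw) K (length Tw * K) ps kps ;; wts_prog T xs"

lemma wt_sum_le:
 assumes "ALL (t, kp, p):set ts. A (Num kp p) (A (Tau t) v) <= n"
 shows "wt_sum A ts v <= length ts * n" using assms unfolding wt_sum_def by (induction ts) auto

definition full_cost :: "nat list list => nat => nat => (tm => nat) => fm => nat => nat list list => ctx list =>
  (fm => nat => terms) => (fm \<times> nat) list => nat" where
 "full_cost Tw D d ix ph K ps kps T xs = (let q = length Tw in q * (D + 9) + q * 14 + (7 + q * (8 + q * 24)) + (d + 22) +
   (10 + q * (8 + q * (44 + 3 * d))) + (\<Sum>i<length kps. kcost ix ph q K (q * K) ps (kps ! i)) +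
   (\<Sum>m<length xs. 9 + 3 * length (case_prod T (xs ! m))))"

text \<open>What one phase has established survives the later ones by the frame conditions
  \<open>m1\<close> to \<open>m7\<close>.\<close>

lemma full_prog_sem:
 fixes A0 :: "aname => nat => nat"
 defines "tv \<equiv> %Tw i v. apply_tab A0 (Tw ! i) v"
 assumes A0: "ALL a v. v < n --> A0 (In a) v < n" "ALL p v. A0 (Pr p) v <= 1"
   "ALL a v. a ~: range In --> a ~: range Pr --> A0 a v = 0"
  and D: "ALL ws:set Tw. length ws <= D" and q: "q = length Tw"
  and deg: "!!S. S <= {..<n} ==> S ~= {} ==> EX v:S. card (Nb n q (tv Tw) v Int S) <= d"
  and kps: "ALL kp:set kps. fst kp < q" "distinct kps" and ps: "paths_ok ps"
  and T: "ALL (om, i):set xs. length (T om i) <= cc & (ALL (t, kp, p):set (T om i). t < q & kp : set kps & p : set ps)"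
 shows "EX A. (%s. fst s 0 = n & snd s = A) (sem (aram (cc * n)) (full_prog Tw d ix ph K ps kps T xs) ((%x. 0)(0 := n), A0)) &
  cost (aram (cc * n)) (full_prog Tw d ix ph K ps kps T xs) ((%x. 0)(0 := n), A0) <=
   full_cost Tw D d ix ph K ps kps T xs * (n + 1) &
  (ALL a. A (In a) = A0 (In a)) & (ALL p. A (Pr p) = A0 (Pr p)) & (ALL i<q. ALL v<n. A (Tau i) v = tv Tw i v) &
  (ALL v<n. A (Hn 0) v = v) &
  (EX L. distinct L & set L = {..<n} & (ALL i<n. insert (L ! i) (set (map (%h. A h (L ! i)) (hs_of d))) =
    insert (L ! i) (Nb n q (tv Tw) (L ! i) - set (take i L)))) &
  (ALL kp:set kps. ALL w<n. ALL p:set ps. good ix ph n q (tv Tw) K (q * K) A kp p w) &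
  (ALL (om, i):set xs. ALL v<n. A (Wt om i) v = wt_sum A (T om i) v)"
proof -
 let ?cap = "cc * n"
 let ?tv = "tv Tw"
 define s0 :: ast where "s0 = ((%x. 0)(0 := n), A0)"
 define s1 where "s1 = sem (aram ?cap) (tau_prog Tw) s0"
 define s2 where "s2 = sem (aram ?cap) (list_prog q) s1"
 define s3 where "s3 = sem (aram ?cap) (deg_prog q) s2"
 define s4 where "s4 = sem (aram ?cap) (init_prog d) s3"
 define s5 where "s5 = sem (aram ?cap) (greedy q d) s4"
 define s6 where "s6 = sem (aram ?cap) (ctxs_prog ix ph q K (q * K) ps kps) s5"
 define s7 where "s7 = sem (aram ?cap) (wts_prog T xs) s6"
 have z: "snd s0 a v = 0" if "a ~: range In" "a ~: range Pr" for a v using A0(3) that by (simp add: s0_def)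
 have m1: "same {1, 2} (range Tau) s0 s1" unfolding s1_def by (rule same_mono[OF same_sem tau_prog_simps])
 have m2: "same {1, 2, 3} (range Nx Un range Hd Un range Len) s1 s2" unfolding s2_def by (rule same_mono[OF same_sem list_prog_simps])
 have m3: "same {1, 3, 4, 5, 6, 7, 8, 9, 19} {Mk, Deg} s2 s3" unfolding s3_def by (rule same_mono[OF same_sem deg_prog_simps])
 have m4: "same {1, 6, 7, 8, 13} (Hn ` {..d} Un {Que, Inq}) s3 s4" unfolding s4_def by (rule same_mono[OF same_sem]) (simp_all add: init_prog_simps)
 have m5: "same {1, 2, 3, 4, 5, 6, 7, 8, 9, 10, 13, 14, 15, 19} (Hn ` {1..d} Un {Deg, Que, Inq, Rm, Mk2}) s4 s5"
  unfolding s5_def by (rule same_mono[OF same_sem greedy_simps])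
 have m6: "same {1, 3, 4, 5, 6, 7, 8, 10, 11, 12, 14, 15, 19} ({Cnt} Un range (case_prod Num) Un range (case_prod Slot)) s5 s6"
  unfolding s6_def by (rule same_mono[OF same_sem ctxs_prog_simps])
 have m7: "same {1, 5, 6, 12} (range (case_prod Wt)) s6 s7" unfolding s7_def by (rule same_mono[OF same_sem wts_prog_simps])
 have r0: "fst s0 0 = n" "fst s1 0 = n" "fst s2 0 = n" "fst s3 0 = n" "fst s4 0 = n" "fst s5 0 = n" "fst s6 0 = n" "fst s7 0 = n"
  using same_reg[OF m1, of 0] same_reg[OF m2, of 0] same_reg[OF m3, of 0] same_reg[OF m4, of 0]
   same_reg[OF m5, of 0] same_reg[OF m6, of 0] same_reg[OF m7, of 0] by (simp_all add: s0_def)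
 have a2: "snd s2 a = snd s1 a" if "a ~: range Nx Un range Hd Un range Len" for a by (rule same_arr[OF m2 that])
 have a3: "snd s3 a = snd s2 a" if "a ~: {Mk, Deg}" for a by (rule same_arr[OF m3 that])
 have a4: "snd s4 a = snd s3 a" if "a ~: range Hn Un {Que, Inq}" for a by (rule same_arr[OF m4]) (use that in auto)
 have a5: "snd s5 a = snd s4 a" if "a ~: Hn ` {1..d} Un {Deg, Que, Inq, Rm, Mk2}" for a by (rule same_arr[OF m5 that])
 have a6: "snd s6 a = snd s5 a" if "a ~: {Cnt} Un range (case_prod Num) Un range (case_prod Slot)" for a by (rule same_arr[OF m6 that])
 have a7: "snd s7 a = snd s6 a" if "a ~: range (case_prod Wt)" for a by (rule same_arr[OF m7 that])
 have a1: "snd s1 a = snd s0 a" if "a ~: range Tau" for a by (rule same_arr[OF m1 that])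
 note P1 = tau_prog_sem[OF r0(1) D, of ?cap, folded s1_def]
 have apn: "foldr (%a. A0 (In a)) ws v < n" if "v < n" for ws v using that A0(1) by (induction ws) auto
 have tvn: "?tv i v < n" if "v < n" for i v using apn[OF that] by (simp add: tv_def apply_tab_def)
 have e1: "env n q ?tv s1" using P1 r0(2) by (simp add: env_def q tv_def s0_def)
 have P2: "env n q ?tv s2 & lists_ok n q ?tv s2 & cost (aram ?cap) (list_prog q) s1 <= q * 14 * (n + 1)"
  unfolding s2_def by (rule list_prog_sem[OF e1]) (use z a1 in "simp add: image_iff")
 have e2: "env n q ?tv s2" and l2: "lists_ok n q ?tv s2" using P2 by blast+
 have z2: "ALL v. snd s2 a v = 0" if "a : {Deg, Mk, Mk2, Inq, Rm, Cnt}" for a using that z[of a] a1[of a] a2[of a] by (auto simp: image_iff)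
 have P3: "(ALL v<n. snd s3 Deg v = card (Nb n q ?tv v)) & cost (aram ?cap) (deg_prog q) s2 <= (7 + q * (8 + q * 24)) * (n + 1)"
  unfolding s3_def by (rule deg_prog_sem[OF e2 l2]) (use z2 tvn in auto)
 have P4: "qinv n s4 & (ALL v<n. v : set (qlist s4) \<longleftrightarrow> snd s3 Deg v <= d) & (ALL l<=d. ALL v<n. snd s4 (Hn l) v = v) &
   cost (aram ?cap) (init_prog d) s3 <= (d + 22) * (n + 1)"
  unfolding s4_def by (rule init_prog_sem[where d = d and cap = "cc * n", OF r0(4), unfolded Let_def]) (use z2[of Inq] a3[of Inq] in simp)
 have g: "snd s4 a = snd s2 a" if "a : garrs" for a using that a3[of a] a4[of a] by (auto simp: image_iff)
 have e4: "env n q ?tv s4" using e2 g r0(5) by (simp add: env_def)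
 have l4: "lists_ok n q ?tv s4" using l2 g by (simp add: lists_ok_def)
 have dg: "snd s4 Deg = snd s3 Deg" using a4[of Deg] by (simp add: image_iff)
 have P5: "(EX L. distinct L & set L = {..<n} & (ALL i<n. insert (L ! i) (set (map (%h. snd s5 h (L ! i)) (hs_of d))) =
    insert (L ! i) (Nb n q ?tv (L ! i) - set (take i L)))) &
  cost (aram ?cap) (greedy q d) s4 <= (10 + q * (8 + q * (44 + 3 * d))) * (n + 1)"
  unfolding s5_def
 proof (rule greedy_sem[OF e4 l4])
  show "!!i y. i < q ==> y < n ==> ?tv i y < n" using tvn by blast
  show "EX v:S. card (Nb n q ?tv v Int S) <= d" if "S <= {..<n}" "S ~= {}" for S by (rule deg[OF that])
  show "qinv n s4" "ALL l<=d. ALL v<n. snd s4 (Hn l) v = v" "ALL v<n. v : set (qlist s4) \<longleftrightarrow> snd s4 Deg v <= d"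
   using P4 dg by simp_all
  show "ALL v<n. snd s4 Deg v = card (Nb n q ?tv v)" using P3 dg by simp
  show "ALL v. snd s4 Rm v = 0" "ALL v. snd s4 Mk2 v = 0"
   using z2[of Rm] z2[of Mk2] a3[of Rm] a3[of Mk2] a4[of Rm] a4[of Mk2] by (simp_all add: image_iff)
 qed
 have g5: "snd s5 a = snd s4 a" if "a : garrs Un range Pr" for a by (rule a5) (use that in auto)
 have e5: "env n q ?tv s5" using e4 g5 r0(6) by (simp add: env_def)
 have l5: "lists_ok n q ?tv s5" using l4 g5 by (simp add: lists_ok_def)
 have pr: "snd s5 (Pr p) = A0 (Pr p)" "snd s5 (In p) = A0 (In p)" for p using a1[of "Pr p"] a2[of "Pr p"] a3[of "Pr p"] a4[of "Pr p"] a5[of "Pr p"]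
   a1[of "In p"] a2[of "In p"] a3[of "In p"] a4[of "In p"] a5[of "In p"] by (simp_all add: s0_def image_iff)
 have P6: "(ALL kp:set kps. ALL w<n. ALL p:set ps. good ix ph n q ?tv K (q * K) (snd s6) kp p w) &
  cost (aram ?cap) (ctxs_prog ix ph q K (q * K) ps kps) s5 <= (\<Sum>i<length kps. kcost ix ph q K (q * K) ps (kps ! i)) * (n + 1)"
  unfolding s6_def
 proof (rule ctxs_prog_sem[OF e5 l5 _ kps(1) _ refl ps _ kps(2), unfolded Let_def])
  show "ALL p v. snd s5 (Pr p) v <= 1" using pr(1) A0(2) by simp
  show "ALL v. snd s5 Cnt v = 0" using z2[of Cnt] a3[of Cnt] a4[of Cnt] a5[of Cnt] by (simp add: image_iff)
  show "!!i y. i < q ==> y < n ==> ?tv i y < n" using tvn by blast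
 qed
 have t6: "snd s6 (Tau i) v = ?tv i v" if "i < q" "v < n" for i v
 proof -
  have "snd s6 (Tau i) = snd s5 (Tau i)" by (rule a6) auto
  then show ?thesis using e5 that by (simp add: env_def)
 qed
 have num: "snd s6 (Num kp p) w <= n" if "kp : set kps" "p : set ps" "w < n" for kp p w
 proof -
  have "snd s6 (Num kp p) w = card (Yset ix ph n q ?tv (snd s6) kp p w)" using P6 that unfolding good_def Let_def by blast
  also have "... <= card {..<n}" by (rule card_mono) (auto simp: Yset_def)
  finally show ?thesis by simp
 qed
 \<comment> \<open>A count is at most \<open>n\<close> and a weight has at most \<open>cc\<close>
   summands, so the saturated sums are exact.\<close>
 have cap: "ALL (om, i):set xs. ALL v<n. wt_sum (snd s6) (T om i) v <= ?cap"
 proof clarify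
  fix om i v assume x: "(om, i) : set xs" and v: "v < n"
  have "wt_sum (snd s6) (T om i) v <= length (T om i) * n" by (rule wt_sum_le) (use bspec[OF T x] num t6 tvn v in auto)
  also have "... <= ?cap" using bspec[OF T x] by simp
  finally show "wt_sum (snd s6) (T om i) v <= ?cap" .
 qed
 note P7 = wts_prog_sem[OF r0(7) cap, folded s7_def]
 have ws: "wt_sum (snd s7) ts v = wt_sum (snd s6) ts v" for ts v
 proof -
  have "snd s7 (Num kp p) = snd s6 (Num kp p)" "snd s7 (Tau t) = snd s6 (Tau t)" for kp p t by (rule a7; auto)+
  then show ?thesis by (simp add: wt_sum_def)
 qed
 have sem: "sem (aram ?cap) (full_prog Tw d ix ph K ps kps T xs) s0 = s7"
  by (simp add: full_prog_def q[symmetric] s1_def s2_def s3_def s4_def s5_def s6_def s7_def)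
 have cst: "cost (aram ?cap) (full_prog Tw d ix ph K ps kps T xs) s0 <= full_cost Tw D d ix ph K ps kps T xs * (n + 1)"
 proof -
  have "cost (aram ?cap) (full_prog Tw d ix ph K ps kps T xs) s0 = cost (aram ?cap) (tau_prog Tw) s0 +
   (cost (aram ?cap) (list_prog q) s1 + (cost (aram ?cap) (deg_prog q) s2 + (cost (aram ?cap) (init_prog d) s3 +
   (cost (aram ?cap) (greedy q d) s4 + (cost (aram ?cap) (ctxs_prog ix ph q K (q * K) ps kps) s5 +
    cost (aram ?cap) (wts_prog T xs) s6)))))"
   by (simp add: full_prog_def q[symmetric] s1_def s2_def s3_def s4_def s5_def s6_def)
  also have "... <= q * (D + 9) * (n + 1) + (q * 14 * (n + 1) + ((7 + q * (8 + q * 24)) * (n + 1) + ((d + 22) * (n + 1) +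
   ((10 + q * (8 + q * (44 + 3 * d))) * (n + 1) + ((\<Sum>i<length kps. kcost ix ph q K (q * K) ps (kps ! i)) * (n + 1) +
    (\<Sum>m<length xs. 9 + 3 * length (case_prod T (xs ! m))) * (n + 1))))))"
   using conjunct2[OF P1, folded q] conjunct2[OF conjunct2[OF P2]] conjunct2[OF P3] conjunct2[OF conjunct2[OF conjunct2[OF P4]]]
    conjunct2[OF P5] conjunct2[OF P6] conjunct2[OF P7] by (intro add_mono)
  also have "... = full_cost Tw D d ix ph K ps kps T xs * (n + 1)"
   unfolding full_cost_def Let_def q[symmetric] by (simp only: add_mult_distrib add.assoc)
  finally show ?thesis .
 qed
 have 1: "snd s7 (In a) = A0 (In a)" "snd s7 (Pr a) = A0 (Pr a)" for a
  using a7[of "In a"] a6[of "In a"] a7[of "Pr a"] a6[of "Pr a"] pr by (simp_all add: image_iff)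
 have 2: "snd s7 (Tau i) v = ?tv i v" if "i < q" "v < n" for i v
 proof -
  have "snd s7 (Tau i) = snd s6 (Tau i)" by (rule a7) auto
  then show ?thesis using t6 that by simp
 qed
 have hn: "snd s7 (Hn l) = snd s5 (Hn l)" for l using a7[of "Hn l"] a6[of "Hn l"] by (simp add: image_iff)
 have 3: "snd s7 (Hn 0) v = v" if "v < n" for v using P4 that a5[of "Hn 0"] hn[of 0] by (simp add: image_iff)
 have 4: "map (%h. snd s7 h x) (hs_of d) = map (%h. snd s5 h x) (hs_of d)" for x using hn by (simp add: hs_of_def)
 have 5: "good ix ph n q ?tv K (q * K) (snd s7) kp p w = good ix ph n q ?tv K (q * K) (snd s6) kp p w" for kp p w
  by (rule good_cong) (subst a7; auto)+
 have 6: "ALL (om, i):set xs. ALL v<n. snd s7 (Wt om i) v = wt_sum (snd s7) (T om i) v" using conjunct1[OF P7] unfolding ws .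
 have 7: "ALL kp:set kps. ALL w<n. ALL p:set ps. good ix ph n q ?tv K (q * K) (snd s7) kp p w" using conjunct1[OF P6] unfolding 5 .
 have 8: "EX L. distinct L & set L = {..<n} & (ALL i<n. insert (L ! i) (set (map (%h. snd s7 h (L ! i)) (hs_of d))) =
    insert (L ! i) (Nb n q ?tv (L ! i) - set (take i L)))"
  using conjunct1[OF P5] unfolding 4 .
 have 9: "fst s7 0 = n & snd s7 = snd s7" using r0(8) by blast
 show ?thesis unfolding s0_def[symmetric] sem
  by (intro exI[of _ "snd s7"] conjI[OF 9] conjI[OF cst] conjI[OF _ conjI[OF _ conjI[OF _ conjI[OF _ conjI[OF 8 conjI[OF 7 6]]]]]])
   (use 1 2 3 in blast)+
qed

subsection \<open>The approximation argument\<close>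

lemma Yset_avoid:
 "Yset ix ph n q tv A kp p w =
  {y : Yset ix ph n q tv A kp [] w. ALL j:{1..length p}. ALL t<q. A (Tau t) y ~= A (Slot kp (take j p)) w}"
 by (auto simp: Yset_def ytest_def)

definition visits :: "(aname => nat => nat) => ctx => nat => nat set => nat list => bool" where
 "visits A kp w U p = ((ALL j:{1..length p}. A (Slot kp (take j p)) w : U))"

definition stuck :: "nat => (aname => nat => nat) => ctx => nat => nat set => nat list => bool" where
 "stuck J A kp w U p = ((ALL j<J. A (Slot kp (p @ [j])) w ~: U))"

text \<open>Extend the path by a slot with a value in \<open>U\<close> as long as there is one. Such
  a value differs from \<open>w\<close>, so it is a value of a vertex still counted, and that vertex
  avoids all earlier values of the path. Hence the values are different elements of
  \<open>U\<close>, and the walk stops within \<open>card U\<close> steps.\<close>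

lemma slot_path_exists:
 assumes good: "!!p. p : set ps ==> good ix ph n q tv K J A kp p w"
  and ps: "set ps = {p. length p <= N & set p <= {..<J}}"
  and U: "finite U" "card U <= N" "w ~: U" and tau: "!!t y. t < q ==> y < n ==> A (Tau t) y = tv t y"
 shows "EX p:set ps. visits A kp w U p & stuck J A kp w U p"
proof (rule ccontr)
 assume none: "~ ?thesis"
 let ?sl = "%p j. A (Slot kp (take j p)) w"
 have len: "length p <= card U" if "visits A kp w U p" "inj_on (?sl p) {1..length p}" for p
 proof -
  have "length p = card (?sl p ` {1..length p})" using card_image[OF that(2)] by simp
  also have "... <= card U" by (rule card_mono) (use U that(1) in "auto simp: visits_def")
  finally show ?thesis .
 qed
 \<comment> \<open>If no path were stuck, there would be paths of every length with distinct values
   in \<open>U\<close>; length \<open>Suc (card U)\<close> is impossible.\<close>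
 have "EX p. length p = m & set p <= {..<J} & visits A kp w U p & inj_on (?sl p) {1..length p}" for m
 proof (induction m)
  case 0
  show ?case by (simp add: visits_def)
 next
  case (Suc m)
  then obtain p where p: "length p = m" "set p <= {..<J}" "visits A kp w U p" "inj_on (?sl p) {1..length p}" by blast
  have inps: "p : set ps" using len[OF p(3,4)] U(2) p(2) by (simp add: ps)
  then obtain j where j: "j < J" "A (Slot kp (p @ [j])) w : U" using none p(3) by (auto simp: stuck_def)
  have "A (Slot kp (p @ [j])) w ~= w" using j(2) U(3) by metis
  then obtain y t where y: "y : Yset ix ph n q tv A kp p w" "t < q" "tv t y = A (Slot kp (p @ [j])) w"
   using good[OF inps] j(1) unfolding good_def Let_def by metis
  have new: "?sl p i ~= A (Slot kp (p @ [j])) w" if "i : {1..m}" for i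
  proof -
   have "A (Tau t) y ~= ?sl p i" using y(1,2) that p(1) unfolding Yset_def ytest_def by blast
   moreover have "A (Tau t) y = tv t y" by (rule tau[OF y(2)]) (use y(1) in "simp add: Yset_def")
   ultimately show ?thesis using y(3) by simp
  qed
  have sl: "?sl (p @ [j]) i = (if i = Suc m then A (Slot kp (p @ [j])) w else ?sl p i)" if "i : {1..Suc m}" for i using that p(1) by auto
  have "visits A kp w U (p @ [j])" unfolding visits_def
  proof
   fix i assume i: "i : {1..length (p @ [j])}"
   then show "?sl (p @ [j]) i : U" using sl[of i] p(1,3) j(2) by (auto simp: visits_def)
  qed
  moreover have "inj_on (?sl (p @ [j])) {1..length (p @ [j])}"
  proof (rule inj_onI)
   fix a b assume ab: "a : {1..length (p @ [j])}" "b : {1..length (p @ [j])}" "?sl (p @ [j]) a = ?sl (p @ [j]) b"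
   show "a = b"
   proof (cases "a = Suc m \<or> b = Suc m")
    case True
    then show ?thesis using ab sl[of a] sl[of b] new[of a] new[of b] p(1) by (cases "a = Suc m"; cases "b = Suc m") auto
   next
    case False
    then show ?thesis using ab sl[of a] sl[of b] p(1) inj_onD[OF p(4), of a b] by auto
   qed
  qed
  ultimately show ?case using p(1,2) j(1) by (intro exI[of _ "p @ [j]"]) auto
 qed
 from this[of "Suc (card U)"] len show False by fastforce
qed

text \<open>The path excludes only values in \<open>U\<close>, so it loses no element of
  \<open>X\<close>. Being stuck, it leaves no frequent value in \<open>U\<close>: each excludes at
  most the fraction \<open>1 / K\<close> of what is counted, all of them together at most
  \<open>card U / K\<close>.\<close>

lemma slot_path_approx:
 assumes good: "good ix ph n q tv K J A kp p w" and p: "visits A kp w U p" "stuck J A kp w U p" and U: "finite U"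
  and tau: "!!t y. t < q ==> y < n ==> A (Tau t) y = tv t y"
 defines "X \<equiv> {y : Yset ix ph n q tv A kp [] w. ALL t<q. tv t y ~: U}"
 shows "card X <= A (Num kp p) w" "K * A (Num kp p) w <= K * card X + card U * A (Num kp p) w"
proof -
 define Y where "Y = Yset ix ph n q tv A kp p w"
 have fin: "finite Y" by (simp add: Y_def Yset_def)
 have Yn: "y < n" if "y : Y" for y using that by (simp add: Y_def Yset_def)
 have XY: "X <= Y"
 proof
  fix y assume y: "y : X"
  then have "y < n" by (simp add: X_def Yset_def)
  then show "y : Y" using y tau p(1) unfolding Y_def Yset_avoid[of ix ph n q tv A kp p w] X_def visits_def by fastforce
 qed
 have num: "A (Num kp p) w = card Y" using good by (simp add: good_def Let_def Y_def)
 show "card X <= A (Num kp p) w" unfolding num by (rule card_mono[OF fin XY])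
 have light: "K * cntv q tv Y v <= card Y" if v: "v : U" for v
 proof (rule ccontr)
  assume "~ ?thesis"
  then have "0 < cntv q tv Y v & card Y <= K * cntv q tv Y v" by (cases "cntv q tv Y v") auto
  then obtain j where "j < J" "A (Slot kp (p @ [j])) w = v" using good unfolding good_def Let_def Y_def by blast
  then show False using p(2) v by (auto simp: stuck_def)
 qed
 have "Y - X <= snd ` (\<Union>v\<in>U. {(t, y). t < q & y : Y & tv t y = v})"
 proof
  fix y assume y: "y : Y - X"
  then have "y : Yset ix ph n q tv A kp [] w" unfolding Y_def Yset_avoid[of ix ph n q tv A kp p w] by blast
  then obtain t where "t < q" "tv t y : U" using y by (auto simp: X_def)
  then show "y : snd ` (\<Union>v\<in>U. {(t, y). t < q & y : Y & tv t y = v})" using y by (intro image_eqI[of _ _ "(t, y)"]) auto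
 qed
 then have "card (Y - X) <= card (snd ` (\<Union>v\<in>U. {(t, y). t < q & y : Y & tv t y = v}))"
  by (rule card_mono[rotated]) (use U fin finite_cntv in auto)
 also have "... <= card (\<Union>v\<in>U. {(t, y). t < q & y : Y & tv t y = v})" by (rule card_image_le) (use U fin finite_cntv in auto)
 also have "... <= (\<Sum>v\<in>U. cntv q tv Y v)" unfolding cntv_def by (rule card_UN_le[OF U])
 finally have "K * card (Y - X) <= (\<Sum>v\<in>U. K * cntv q tv Y v)" by (simp add: sum_distrib_left[symmetric])
 also have "... <= card U * card Y" using sum_bounded_above[of U "%v. K * cntv q tv Y v" "card Y"] light by simp
 finally have "K * card (Y - X) <= card U * card Y" .
 moreover have "card Y = card X + card (Y - X)" using XY fin by (metis card_Diff_subset card_mono finite_subset le_add_diff_inverse)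
 ultimately show "K * A (Num kp p) w <= K * card X + card U * A (Num kp p) w" unfolding num by (metis add_mult_distrib2 add_le_cancel_left)
qed

text \<open>Since \<open>y - x <= y / E <= y * e / (1 + e)\<close>, at least the fraction
  \<open>1 / (1 + e)\<close> of \<open>y\<close> is left in \<open>x\<close>.\<close>

lemma approx_factor:
 fixes x y e :: real
 assumes "N * E * y <= N * E * x + N * y" "0 < N" "0 < e" "(1 + e) / e <= E" "x <= y" 
 shows "y <= (1 + e) * x"
proof -
 have "N * (E * (y - x)) <= N * y" using assms(1) by (simp add: algebra_simps)
 then have "E * (y - x) <= y" using assms(2) by simp
 moreover have "(1 + e) / e * (y - x) <= E * (y - x)" by (rule mult_right_mono) (use assms in auto)
 ultimately have "(1 + e) / e * (y - x) <= y" by simp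
 then have "(1 + e) * (y - x) <= e * y" using assms(3) by (simp add: field_simps)
 then show ?thesis by (simp add: algebra_simps)
qed

definition later :: "nat => (aname => nat => nat) => nat => nat set" where
 "later d A w = (%l. A (Hn l) w) ` {..d}"

lemma later_eq:
 assumes h0: "A (Hn 0) w = w" and "insert w (set (map (%h. A h w) (hs_of d))) = B"
 shows "later d A w = B"
proof -
 have "{..d} = insert 0 {1..d}" by auto
 then show ?thesis unfolding later_def assms(2)[symmetric] hs_of_def using h0 by (auto simp: image_iff)
qed

text \<open>Every \<open>y\<close> is attributed to the earliest vertex of \<open>W\<close> that occurs among its values; by the choice
 of the order all other values in \<open>W\<close> are then later neighbours of that vertex.\<close>

lemma count_by_first_hit:
 assumes L: "distinct L" "set L = {..<n}"
  and H: "!!i. i < n ==> H (L ! i) = insert (L ! i) (Nb n q tv (L ! i) - set (take i L))"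
  and W: "W <= {..<n}" and hit: "!!y. y < n ==> EX t<q. tv t y : W"
 shows "card {y. y < n & P y} = (\<Sum>w\<in>W. \<Sum>t<q. card {y. y < n & tv t y = w & (ALL t'<t. tv t' y ~= w) &
   (ALL t'<q. tv t' y : W --> tv t' y : H w) & P y})"
proof -
 let ?S = "%(w, t). {y. y < n & tv t y = w & (ALL t'<t. tv t' y ~= w) & (ALL t'<q. tv t' y : W --> tv t' y : H w) & P y}"
 have lenL: "length L = n" using L distinct_card[OF L(1)] by simp
 define rk where "rk w = (LEAST i. i < n & L ! i = w)" for w
 have rk: "rk w < n & L ! rk w = w" if "w < n" for w
 proof -
  have "EX i. i < n & L ! i = w" using that L(2) lenL by (metis in_set_conv_nth lessThan_iff)
  then show ?thesis unfolding rk_def by (rule LeastI_ex)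
 qed
 have rkeq: "w = w'" if "w < n" "w' < n" "rk w = rk w'" for w w' using rk that by metis
 have Hrk: "rk w <= rk w'" if "w < n" "w' < n" "w' : H w" for w w'
 proof (rule ccontr)
  assume lt: "~ ?thesis"
  then have "w' : set (take (rk w) L)" using rk[OF that(1)] rk[OF that(2)] lenL lt by (auto simp: in_set_conv_nth intro!: exI[of _ "rk w'"])
  then have "w' = w" using H[of "rk w"] rk[OF that(1)] that(3) by auto
  then show False using lt by simp
 qed
 have fW: "finite W" using W finite_subset by blast
 have U: "{y. y < n & P y} = (\<Union>x\<in>W \<times> {..<q}. ?S x)"
 proof (intro subset_antisym subsetI)
  fix y assume "y : {y. y < n & P y}"
  then have y: "y < n" "P y" by auto
  let ?R = "W Int {tv t y | t. t < q}"
  have "?R ~= {}" using hit[OF y(1)] by blast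
  then obtain w where w: "w : ?R" "!!w'. w' : ?R ==> rk w <= rk w'"
   using ex_min_if_finite[of "rk ` ?R"] fW by (metis (no_types, lifting) finite_Int arg_min_if_finite(1) arg_min_least)
  then have wn: "w < n" using W by auto
  define t where "t = (LEAST t. tv t y = w)"
  obtain t0 where t0: "t0 < q" "tv t0 y = w" using w(1) by auto
  have t: "tv t y = w" "t < q" "ALL t'<t. tv t' y ~= w"
   using LeastI[of "%t. tv t y = w", OF t0(2)] Least_le[of "%t. tv t y = w", OF t0(2)] t0(1) not_less_Least unfolding t_def by auto
  have "tv t' y : H w" if "t' < q" "tv t' y : W" for t'
  proof (cases "tv t' y = w")
   case True
   then show ?thesis using H[of "rk w"] rk[OF wn] by simp
  next
   case False
   have t'n: "tv t' y < n" using that(2) W by auto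
   have "tv t' y : Nb n q tv w" using False that(1) t(1,2) y(1) by (auto simp: Nb_def)
   moreover have "rk w <= rk (tv t' y)" by (rule w(2)) (use that in auto)
   then have "tv t' y ~: set (take (rk w) L)" using rk[OF t'n] lenL nth_eq_iff_index_eq[OF L(1), of _ "rk (tv t' y)"] by (auto simp: in_set_conv_nth)
   ultimately show ?thesis using H[of "rk w"] rk[OF wn] by simp
  qed
  then show "y : (\<Union>x\<in>W \<times> {..<q}. ?S x)" using y t w(1) by (intro UN_I[of "(w, t)"]) auto
 qed auto
 have "card (\<Union>x\<in>W \<times> {..<q}. ?S x) = (\<Sum>x\<in>W \<times> {..<q}. card (?S x))"
 proof (rule card_UN_disjoint)
  show "finite (W \<times> {..<q})" using fW by simp
  show "ALL i:W \<times> {..<q}. finite (?S i)" by auto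
  show "ALL i:W \<times> {..<q}. ALL j:W \<times> {..<q}. i ~= j --> ?S i Int ?S j = {}"
  proof (intro ballI impI)
   fix x x' assume x: "x : W \<times> {..<q}" "x' : W \<times> {..<q}" "x ~= x'"
   obtain w t w' t' where e: "x = (w, t)" "x' = (w', t')" by (cases x, cases x')
   \<comment> \<open>If \<open>y\<close> were attributed to both \<open>w\<close> and
     \<open>w'\<close>, each of them would lie in \<open>H\<close> of the other, so their ranks
     would coincide.\<close>
   have F: False if y: "y : ?S (w, t)" "y : ?S (w', t')" for y
   proof -
    have wn: "w < n" "w' < n" "t < q" "t' < q" "w : W" "w' : W" using x W e by auto
    have "w' : H w" "w : H w'" using y wn by auto
    then have ww: "w = w'" using Hrk wn rkeq by (metis le_antisym)
    have "t = t'" using y ww by (cases t t' rule: linorder_cases) auto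
    then show False using ww x(3) e by simp
   qed
   show "?S x Int ?S x' = {}" unfolding e
   proof (rule equals0I)
    fix y assume "y : ?S (w, t) Int ?S (w', t')"
    then show False using F[of y] by blast
   qed
  qed
 qed
 moreover have "(\<Sum>x\<in>W \<times> {..<q}. card (?S x)) = (\<Sum>w\<in>W. \<Sum>t<q. card (?S (w, t)))" unfolding sum.cartesian_product
 proof (rule sum.cong[OF refl])
  fix x show "card (?S x) = (case x of (w, t) => card (?S (w, t)))" by (cases x) (simp only: prod.case)
 qed
 ultimately show ?thesis unfolding U by (simp only: prod.case)
qed

subsection \<open>Generating the clauses\<close>

lemma instr_ok_mono: "instr_ok z i ==> z <= z' ==> instr_ok z' i" by (cases i) auto

text \<open>The machine that writes the clauses has no time bound but must serve all formulas and
  may ask the oracle (\<open>Orc\<close>). It evaluates closed expressions for sizes and indices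
  instead of manipulating formulas.\<close>

datatype aexp = Cst nat | Rg nat | Pl aexp aexp | Mi aexp aexp | Ti aexp aexp | Dv aexp aexp | Pw aexp aexp | Orc aexp

fun aval :: "(nat => nat) => (nat => nat) => aexp => nat" where
 "aval g r (Cst n) = n"
| "aval g r (Rg x) = r x"
| "aval g r (Pl a b) = aval g r a + aval g r b"
| "aval g r (Mi a b) = aval g r a - aval g r b"
| "aval g r (Ti a b) = aval g r a * aval g r b"
| "aval g r (Dv a b) = aval g r a div aval g r b"
| "aval g r (Pw a b) = aval g r a ^ aval g r b"
| "aval g r (Orc a) = g (aval g r a)"

fun aregs :: "aexp => nat set" where
 "aregs (Cst n) = {}"
| "aregs (Rg x) = {x}"
| "aregs (Pl a b) = aregs a Un aregs b"
| "aregs (Mi a b) = aregs a Un aregs b"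
| "aregs (Ti a b) = aregs a Un aregs b"
| "aregs (Dv a b) = aregs a Un aregs b"
| "aregs (Pw a b) = aregs a Un aregs b"
| "aregs (Orc a) = aregs a"

text \<open>Stack discipline: the result goes to register \<open>t\<close>, temporaries lie above
  it, and all registers below \<open>t\<close> are preserved.\<close>

fun acode :: "aexp => nat => instr com" where
 "acode (Cst n) t = Prm (Const t n)"
| "acode (Rg x) t = Prm (Const t 0) ;; Prm (Add t t x)"
| "acode (Pl a b) t = acode a t ;; acode b (Suc t) ;; Prm (Add t t (Suc t))"
| "acode (Mi a b) t = acode a t ;; acode b (Suc t) ;; Prm (Sub t t (Suc t))"
| "acode (Ti a b) t = acode a t ;; acode b (Suc t) ;; Prm (Mult t t (Suc t))"
| "acode (Dv a b) t = acode a t ;; acode b (Suc t) ;; Prm (Div t t (Suc t))"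
| "acode (Pw a b) t = acode a t ;; acode b (Suc t) ;; Prm (Const (t + 2) 1) ;;
   Rep (Suc t) (Prm (Mult (t + 2) (t + 2) t)) ;; Prm (Const t 0) ;; Prm (Add t t (t + 2))"
| "acode (Orc a) t = acode a t ;; Prm (Oracle t t)"

lemma aval_cong: "(!!x. x : aregs e ==> r x = r' x) ==> aval g r e = aval g r' e" by (induction e) auto

lemma Rep_Mult:
 "a ~= c ==> exr g (Rep b (Prm (Mult a a c))) s = ((fst s)(a := fst s a * fst s c ^ fst s b), snd s)"
proof -
 assume ac: "a ~= c"
 have "(exr g (Prm (Mult a a c)) ^^ j) s = ((fst s)(a := fst s a * fst s c ^ j), snd s)" for j using ac by (induction j) (auto simp: fun_eq_iff)
 then show ?thesis by simp
qed

lemma acode_sem: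
 "(!!x. x : aregs e ==> x < t) ==> fst (exr g (acode e t) s) t = aval g (fst s) e &
  (ALL x<t. fst (exr g (acode e t) s) x = fst s x) & snd (exr g (acode e t) s) = snd s"
proof (induction e arbitrary: t s)
 case (Pw a b)
 define s1 where "s1 = exr g (acode a t) s"
 define s2 where "s2 = exr g (acode b (Suc t)) s1"
 have 1: "fst s1 t = aval g (fst s) a" "ALL x<t. fst s1 x = fst s x" "snd s1 = snd s" using Pw.IH(1)[of t s] Pw.prems by (simp_all add: s1_def)
 have rb: "!!x. x : aregs b ==> x < Suc t" using Pw.prems less_SucI by (metis UnCI aregs.simps(7))
 have 2: "fst s2 (Suc t) = aval g (fst s1) b" "ALL x<Suc t. fst s2 x = fst s1 x" "snd s2 = snd s1"
  using Pw.IH(2)[of "Suc t" s1, OF rb] by (simp_all add: s2_def)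
 have "aval g (fst s1) b = aval g (fst s) b" by (rule aval_cong) (use 1(2) Pw.prems in auto)
 moreover have "exr g (acode (Pw a b) t) s = exr g (Prm (Const t 0) ;; Prm (Add t t (t + 2)))
   (exr g (Rep (Suc t) (Prm (Mult (t + 2) (t + 2) t))) ((fst s2)(t + 2 := 1), snd s2))"
  by (simp add: s1_def s2_def del: sem.simps(5))
 ultimately show ?case using 1 2 by (simp add: Rep_Mult del: sem.simps(5))
next
 case (Orc e)
 then show ?case by simp
next
 case (Pl a b)
 have rb: "!!x. x : aregs b ==> x < Suc t" using Pl.prems less_SucI by (metis UnCI aregs.simps(3))
 have "aval g (fst (exr g (acode a t) s)) b = aval g (fst s) b" by (rule aval_cong) (use Pl.IH(1)[of t s] Pl.prems in auto)
 then show ?case using Pl.IH(1)[of t s] Pl.IH(2)[of "Suc t" "exr g (acode a t) s", OF rb] Pl.prems by simp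
next
 case (Mi a b)
 have rb: "!!x. x : aregs b ==> x < Suc t" using Mi.prems less_SucI by (metis UnCI aregs.simps(4))
 have "aval g (fst (exr g (acode a t) s)) b = aval g (fst s) b" by (rule aval_cong) (use Mi.IH(1)[of t s] Mi.prems in auto)
 then show ?case using Mi.IH(1)[of t s] Mi.IH(2)[of "Suc t" "exr g (acode a t) s", OF rb] Mi.prems by simp
next
 case (Ti a b)
 have rb: "!!x. x : aregs b ==> x < Suc t" using Ti.prems less_SucI by (metis UnCI aregs.simps(5))
 have "aval g (fst (exr g (acode a t) s)) b = aval g (fst s) b" by (rule aval_cong) (use Ti.IH(1)[of t s] Ti.prems in auto)
 then show ?case using Ti.IH(1)[of t s] Ti.IH(2)[of "Suc t" "exr g (acode a t) s", OF rb] Ti.prems by simp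
next
 case (Dv a b)
 have rb: "!!x. x : aregs b ==> x < Suc t" using Dv.prems less_SucI by (metis UnCI aregs.simps(6))
 have "aval g (fst (exr g (acode a t) s)) b = aval g (fst s) b" by (rule aval_cong) (use Dv.IH(1)[of t s] Dv.prems in auto)
 then show ?case using Dv.IH(1)[of t s] Dv.IH(2)[of "Suc t" "exr g (acode a t) s", OF rb] Dv.prems by simp
qed auto

datatype gen = Em aexp | Sq gen gen | Cnd aexp gen | Lp nat aexp gen

fun out :: "(nat => nat) => (nat => nat) => gen => nat list" where
 "out g r (Em e) = [aval g r e]"
| "out g r (Sq c d) = out g r c @ out g r d"
| "out g r (Cnd e c) = (if aval g r e = 0 then [] else out g r c)"
| "out g r (Lp x e c) = concat (map (%i. out g (r(x := i)) c) [0..<aval g r e])"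

text \<open>\<open>X\<close> contains the registers that may be read. Loop variables are fresh and
  lie below \<open>t\<close>, where the temporaries begin.\<close>

fun gen_ok :: "nat => nat set => gen => bool" where
 "gen_ok t X (Em e) = (aregs e <= X)"
| "gen_ok t X (Sq c d) = (gen_ok t X c & gen_ok t X d)"
| "gen_ok t X (Cnd e c) = (aregs e <= X & gen_ok t X c)"
| "gen_ok t X (Lp x e c) = (aregs e <= X & x ~: X & 1 < x & x < t & gen_ok t (insert x X) c)"

text \<open>The output is written from address 0 on, over the input, of which only the head and the
  length are kept, in registers. Register 0 is the length of the output so far, register 1 the
  constant 1.\<close>

fun gcode :: "gen => nat => instr com" where
 "gcode (Em e) t = acode e t ;; Prm (Store 0 t) ;; Prm (Add 0 0 1)"
| "gcode (Sq c d) t = gcode c t ;; gcode d t"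
| "gcode (Cnd e c) t = acode e t ;; IfNZ t (gcode c t)"
| "gcode (Lp x e c) t = acode e t ;; Prm (Const x 0) ;; Rep t (gcode c (Suc t) ;; Prm (Add x x 1))"

lemma out_cong: "gen_ok t X c ==> (!!x. x : X ==> r x = r' x) ==> out g r c = out g r' c"
proof (induction c arbitrary: X r r')
 case (Em e)
 have "aval g r e = aval g r' e" by (rule aval_cong) (use Em.prems in auto)
 then show ?case by simp
next
 case (Sq c d)
 have "out g r c = out g r' c" by (rule Sq.IH(1)[of X]) (use Sq.prems in auto)
 moreover have "out g r d = out g r' d" by (rule Sq.IH(2)[of X]) (use Sq.prems in auto)
 ultimately show ?case by simp
next
 case (Cnd e c)
 have "aval g r e = aval g r' e" by (rule aval_cong) (use Cnd.prems in auto)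
 moreover have "out g r c = out g r' c" by (rule Cnd.IH[of X]) (use Cnd.prems in auto)
 ultimately show ?case by simp
next
 case (Lp x e c)
 have "aval g r e = aval g r' e" by (rule aval_cong) (use Lp.prems in auto)
 moreover have "out g (r(x := i)) c = out g (r'(x := i)) c" for i by (rule Lp.IH[of "insert x X"]) (use Lp.prems in auto)
 ultimately show ?case by simp
qed

lemma gen_ok_Suc: "gen_ok t X c ==> gen_ok (Suc t) X c" by (induction c arbitrary: X) auto

definition word :: "(nat => nat) state => nat list" where
 "word s = map (snd s) [0..<fst s 0]"

lemma gcode_sem:
 "gen_ok t X c ==> (!!x. x : X ==> 1 < x & x < t) ==> 1 < t ==> fst s 1 = 1 ==>
  word (exr g (gcode c t) s) = word s @ out g (fst s) c & (ALL x:insert 1 X. fst (exr g (gcode c t) s) x = fst s x)"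
proof (induction c arbitrary: X s t)
 case (Em e)
 have "x < t" if "x : aregs e" for x using Em.prems(1,2) that by auto
 from acode_sem[OF this, where g = g and s = s]
 have a: "fst (exr g (acode e t) s) t = aval g (fst s) e" "ALL x<t. fst (exr g (acode e t) s) x = fst s x"
  "snd (exr g (acode e t) s) = snd s" by blast+
 define s1 where "s1 = exr g (acode e t) s"
 have z: "fst s1 0 = fst s 0" using a(2) Em.prems(3) by (simp add: s1_def)
 have o: "fst s1 1 = 1" using a(2) Em.prems(3,4) by (simp add: s1_def)
 have x: "ALL x:insert 1 X. x ~= 0 & fst s1 x = fst s x" using a(2) Em.prems(2,3) by (fastforce simp: s1_def)
 have "word ((fst s1)(0 := fst s1 0 + fst s1 1), (snd s1)(fst s1 0 := fst s1 t)) = word s @ [aval g (fst s) e]"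
  using a(1,3) by (simp add: word_def z o[simplified] s1_def[symmetric])
 moreover have e: "exr g (gcode (Em e) t) s = ((fst s1)(0 := fst s1 0 + fst s1 1), (snd s1)(fst s1 0 := fst s1 t))" by (simp add: s1_def)
 moreover have "fst (exr g (gcode (Em e) t) s) y = fst s y" if "y : insert 1 X" for y using bspec[OF x that] unfolding e by simp
 ultimately show ?case by simp
next
 case (Sq c d)
 define s1 where "s1 = exr g (gcode c t) s"
 have 1: "word s1 = word s @ out g (fst s) c" "ALL x:insert 1 X. fst s1 x = fst s x" using Sq.IH(1)[of t X s] Sq.prems by (auto simp: s1_def)
 have "out g (fst s1) d = out g (fst s) d" by (rule out_cong[of t X]) (use Sq.prems 1(2) in auto)
 moreover have "word (exr g (gcode d t) s1) = word s1 @ out g (fst s1) d & (ALL x:insert 1 X. fst (exr g (gcode d t) s1) x = fst s1 x)"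
  by (rule Sq.IH(2)) (use Sq.prems 1(2) in auto)
 ultimately show ?case using 1 by (simp add: s1_def)
next
 case (Cnd e c)
 define s1 where "s1 = exr g (acode e t) s"
 have "x < t" if "x : aregs e" for x using Cnd.prems(1,2) that by auto
 from acode_sem[OF this, where g = g and s = s]
 have 1: "fst s1 t = aval g (fst s) e" "ALL x<t. fst s1 x = fst s x" "snd s1 = snd s" by (simp_all add: s1_def)
 have w: "word s1 = word s" using 1 Cnd.prems(3) by (simp add: word_def)
 have x: "ALL x:insert 1 X. fst s1 x = fst s x" using 1(2) Cnd.prems(2,3) by auto
 have "out g (fst s1) c = out g (fst s) c" by (rule out_cong[of t X]) (use Cnd.prems x in auto)
 moreover have "word (exr g (gcode c t) s1) = word s1 @ out g (fst s1) c & (ALL x:insert 1 X. fst (exr g (gcode c t) s1) x = fst s1 x)"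
  by (rule Cnd.IH) (use Cnd.prems x in auto)
 ultimately show ?case using 1(1) w x by (simp add: s1_def)
next
 case (Lp x e c)
 define s1 where "s1 = exr g (acode e t) s"
 have "x < t" if "x : aregs e" for x using Lp.prems(1,2) that by auto
 from acode_sem[OF this, where g = g and s = s]
 have 1: "fst s1 t = aval g (fst s) e" "ALL x<t. fst s1 x = fst s x" "snd s1 = snd s" by (simp_all add: s1_def)
 define b where "b = gcode c (Suc t) ;; Prm (Add x x 1)"
 define s2 where "s2 = ((fst s1)(x := 0), snd s1)"
 have xt: "x < t" "1 < x" "x ~: X" "gen_ok (Suc t) (insert x X) c" using Lp.prems(1) gen_ok_Suc by auto
 have "word ((exr g b ^^ j) s2) = word s @ concat (map (%i. out g ((fst s)(x := i)) c) [0..<j]) &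
   fst ((exr g b ^^ j) s2) x = j & (ALL y:insert 1 X. fst ((exr g b ^^ j) s2) y = fst s y)" for j
 proof (induction j)
  case 0
  have "y ~= x" if "y : insert 1 X" for y using that xt by auto
  then show ?case using 1 Lp.prems(2,3) xt by (auto simp: s2_def word_def)
 next
  case (Suc j)
  define u where "u = (exr g b ^^ j) s2"
  have u: "word u = word s @ concat (map (%i. out g ((fst s)(x := i)) c) [0..<j])" "fst u x = j" "ALL y:insert 1 X. fst u y = fst s y"
   using Suc unfolding u_def by blast+
  define v where "v = exr g (gcode c (Suc t)) u"
  have o: "out g (fst u) c = out g ((fst s)(x := j)) c" by (rule out_cong[OF xt(4)]) (use u in auto)
  have v: "word v = word u @ out g (fst u) c & (ALL y:insert 1 (insert x X). fst v y = fst u y)" unfolding v_def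
  proof (rule Lp.IH[OF xt(4)])
   show "!!y. y : insert x X ==> 1 < y & y < Suc t" using Lp.prems(2) xt less_SucI by blast
   show "1 < Suc t" using Lp.prems(3) by simp
   show "fst u 1 = 1" using u(3) Lp.prems(4) by simp
  qed
  have e: "(exr g b ^^ Suc j) s2 = ((fst v)(x := fst v x + fst v 1), snd v)"
  proof -
   have "(exr g b ^^ Suc j) s2 = exr g b u" by (simp add: u_def)
   also have "... = ((fst v)(x := fst v x + fst v 1), snd v)" by (simp add: b_def v_def)
   finally show ?thesis .
  qed
  have v1: "fst v 1 = 1" using v u(3) Lp.prems(4) by simp
  have "word ((fst v)(x := fst v x + fst v 1), snd v) = word v" using xt(2) by (simp add: word_def)
  then have W: "word ((fst v)(x := fst v x + fst v 1), snd v) =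
    word s @ concat (map (%i. out g ((fst s)(x := i)) c) [0..<Suc j])"
   using conjunct1[OF v] u(1) o by (simp del: fun_upd_apply)
  have vx: "fst v x = j" using v u(2) by simp
  have Y: "fst ((fst v)(x := fst v x + fst v 1), snd v) y = fst s y" if "y : insert 1 X" for y
  proof -
   have "y ~= x" using that xt(2,3) by auto
   moreover have "fst v y = fst u y" using v that by blast
   ultimately show ?thesis using u(3)[rule_format, OF that] by simp
  qed
  have J: "fst ((fst v)(x := fst v x + fst v 1), snd v) x = Suc j" using vx v1 by simp
  show ?case unfolding e by (intro conjI ballI W J Y)
 qed
 moreover have "exr g (gcode (Lp x e c) t) s = (exr g b ^^ aval g (fst s) e) s2" using 1(1) xt(1) by (simp add: b_def s2_def s1_def)
 ultimately show ?case by simp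
qed

lemma com_instr_ok_exists:
 "(ALL x y. p ~= Jump_Zero x y) ==> EX z. instr_ok z p"
proof (cases p)
 case (Const i n) then show ?thesis by (intro exI[of _ "Suc i"]) simp
next
 case (Add i j l) then show ?thesis by (intro exI[of _ "Suc (i + j + l)"]) simp
next
 case (Sub i j l) then show ?thesis by (intro exI[of _ "Suc (i + j + l)"]) simp
next
 case (Mult i j l) then show ?thesis by (intro exI[of _ "Suc (i + j + l)"]) simp
next
 case (Div i j l) then show ?thesis by (intro exI[of _ "Suc (i + j + l)"]) simp
next
 case (Load i j) then show ?thesis by (intro exI[of _ "Suc (i + j)"]) simp
next
 case (Store i j) then show ?thesis by (intro exI[of _ "Suc (i + j)"]) simp
next
 case (Oracle i j) then show ?thesis by (intro exI[of _ "Suc (i + j)"]) simp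
qed simp

fun jump_free :: "instr com => bool" where
 "jump_free Skip = (True)"
| "jump_free (Prm p) = ((ALL x y. p ~= Jump_Zero x y))"
| "jump_free (c ;; d) = (jump_free c & jump_free d)"
| "jump_free (IfNZ x c) = (jump_free c)"
| "jump_free (Rep x c) = (jump_free c)"

lemma jump_free_code: "jump_free (acode e t)" "jump_free (gcode c t)"
proof -
 show "jump_free (acode e t)" for e t by (induction e arbitrary: t) auto
 then show "jump_free (gcode c t)" by (induction c arbitrary: t) auto
qed

lemma com_ok_instr_exists: "jump_free c ==> EX z. com_ok (instr_ok z) z c"
proof (induction c)
 case (Prm p)
 then show ?case using com_instr_ok_exists[of p] by simp
next
 case (Seq c d)
 then obtain z1 z2 where z: "com_ok (instr_ok z1) z1 c" "com_ok (instr_ok z2) z2 d" by auto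
 have "com_ok (instr_ok (max z1 z2)) (max z1 z2) c" by (rule com_ok_mono[OF _ _ z(1)]) (auto elim: instr_ok_mono)
 moreover have "com_ok (instr_ok (max z1 z2)) (max z1 z2) d" by (rule com_ok_mono[OF _ _ z(2)]) (auto elim: instr_ok_mono)
 ultimately show ?case by (intro exI[of _ "max z1 z2"]) simp
next
 case (IfNZ x c)
 then obtain z where z: "com_ok (instr_ok z) z c" by auto
 have "com_ok (instr_ok (max z (Suc x))) (max z (Suc x)) c" by (rule com_ok_mono[OF _ _ z]) (auto elim: instr_ok_mono)
 then show ?case by (intro exI[of _ "max z (Suc x)"]) simp
next
 case (Rep x c)
 then obtain z where z: "com_ok (instr_ok z) z c" by auto
 have "com_ok (instr_ok (max z (Suc x))) (max z (Suc x)) c" by (rule com_ok_mono[OF _ _ z]) (auto elim: instr_ok_mono)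
 then show ?case by (intro exI[of _ "max z (Suc x)"]) simp
qed auto

text \<open>Only the first number and the length of the input are read. This is enough, because the
  clauses depend on the formula only through the length of its encoding.\<close>

theorem gen_computable:
 assumes "gen_ok 8 {2, 3} c"
 shows "EX P. ALL xs. xs ~= [] --> computes g P xs (out g ((%_. 0)(1 := 1, 2 := hd xs, 3 := length xs)) c)"
proof -
 let ?p = "Prm (Load 2 1) ;; Prm (Add 3 0 1) ;; Prm (Const 0 0) ;; Prm (Const 1 1)"
 let ?c = "?p ;; gcode c 8"
 obtain z where z: "com_ok (instr_ok z) z ?c" using com_ok_instr_exists[of ?c] jump_free_code by auto
 then have z0: "0 < z" by auto
 have "computes g (machine z ?c) xs (out g ((%_. 0)(1 := 1, 2 := hd xs, 3 := length xs)) c)" if xs: "xs ~= []" for xs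
 proof -
  define s where "s = exr g ?p (snd (init_config xs))"
  have s: "fst s 0 = 0" "fst s 1 = 1" "fst s 2 = hd xs" "fst s 3 = length xs" using xs by (simp_all add: s_def init_config_def hd_conv_nth)
  have "word (exr g (gcode c 8) s) = word s @ out g (fst s) c" by (rule conjunct1[OF gcode_sem[OF assms]]) (use s(2) in auto)
  moreover have "word s = []" using s(1) by (simp add: word_def)
  moreover have "out g (fst s) c = out g ((%_. 0)(1 := 1, 2 := hd xs, 3 := length xs)) c" by (rule out_cong[OF assms]) (use s in auto)
  moreover have "exr g ?c (snd (init_config xs)) = exr g (gcode c 8) s" by (simp add: s_def)
  ultimately show ?thesis using machine_computes[OF z z0, of g xs] by (metis (no_types, lifting) append_Nil prod.collapse word_def)
 qed
 then show ?thesis by blast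
qed

text \<open>\<open>a\<close> is read as a numeral in mixed radix whose digits are three function
  symbols and two variables. These shallow equations suffice, as every word is a single function
  symbol of the expansion.\<close>

definition EqA :: "nat => nat => nat => fm" where
 "EqA F k a = Eq (App (a mod F) (App (a div F mod F) (Var (Suc (a div F ^ 3 mod k)))))
   (App (a div F ^ 2 mod F) (Var (Suc (a div (F ^ 3 * k) mod k))))"

definition PrA :: "nat => nat => nat => nat => fm" where
 "PrA F Pn k a = Pred (a mod Pn) (App (a div Pn mod F) (Var (Suc (a div (Pn * F) mod k))))"

definition lit :: "nat => fm => fm" where
 "lit b ph = (if b = 0 then Neg ph else ph)"

text \<open>A common range for both enumerations and a multiple of what either of them needs. Atoms
  are therefore repeated, but a satisfiable clause gives all copies the same sign.\<close>

definition num_atoms :: "nat => nat => nat => nat" where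
 "num_atoms F Pn k = F ^ 3 * k ^ 2 * Pn"

text \<open>The digit of \<open>e\<close> at position \<open>a\<close> in base 4 holds the signs of
  both atoms with number \<open>a\<close>, so the numbers below \<open>4 ^ N\<close> run through all
  sign patterns.\<close>

definition bit1 :: "nat => nat => nat" where "bit1 e a = e div 4 ^ a mod 2"
definition bit2 :: "nat => nat => nat" where "bit2 e a = e div 4 ^ a div 2 mod 2"

text \<open>The trivial equation ends the conjunction, since formulas have no constant for
  truth.\<close>

fun clause :: "nat => nat => nat => nat => nat list => fm" where
 "clause F Pn k e [] = Eq (Var 1) (Var 1)"
| "clause F Pn k e (a # as) = Conj (lit (bit1 e a) (EqA F k a)) (Conj (lit (bit2 e a) (PrA F Pn k a)) (clause F Pn k e as))"

definition clauses :: "nat => nat => nat => fm list" where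
 "clauses F Pn k = map (%e. clause F Pn k e [0..<num_atoms F Pn k]) [0..<4 ^ num_atoms F Pn k]"

definition sig :: "nat => nat => signature" where
 "sig F Pn = \<lparr>fsig = {..<F}, psig = {..<Pn}\<rparr>"

abbreviation "Md a b \<equiv> Mi a (Ti (Dv a b) b)"

lemma aval_Md [simp]: "aval g r a - aval g r a div aval g r b * aval g r b = aval g r a mod aval g r b" by (rule minus_div_mult_eq_mod)

text \<open>There is no generator for the empty word, so a condition that fails takes its
  place.\<close>

primrec ems :: "aexp list => gen" where
 "ems [] = Cnd (Cst 0) (Em (Cst 0))"
| "ems (e # es) = Sq (Em e) (ems es)"

lemma out_ems [simp]: "out g r (ems es) = map (aval g r) es" by (induction es) auto

lemma gen_ok_ems [simp]: "gen_ok t X (ems es) = ((ALL e:set es. aregs e <= X))" by (induction es) auto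

definition lit_gen :: "aexp => aexp list => gen" where
 "lit_gen b es = Sq (Cnd (Mi (Cst 1) b) (Em (Cst 2))) (ems es)"

definition atoms_gen :: "aexp => nat => gen" where
 "atoms_gen F Pn = (let a = Rg 5; e = Dv (Rg 4) (Pw (Cst 4) a); k = Rg 2 in
   Sq (Em (Cst 3)) (Sq (lit_gen (Md e (Cst 2))
    [Cst 0, Cst 1, Md a F, Cst 1, Md (Dv a F) F, Cst 0, Pl (Cst 1) (Md (Dv a (Pw F (Cst 3))) k),
    Cst 1, Md (Dv a (Pw F (Cst 2))) F, Cst 0, Pl (Cst 1) (Md (Dv a (Ti (Pw F (Cst 3)) k)) k)])
   (Sq (Em (Cst 3)) (lit_gen (Md (Dv e (Cst 2)) (Cst 2))
    [Cst 1, Md a (Cst Pn), Cst 1, Md (Dv a (Cst Pn)) F, Cst 0, Pl (Cst 1) (Md (Dv a (Ti (Cst Pn) F)) k)]))))"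

definition full_gen :: "aexp => nat => gen" where
 "full_gen F Pn = (let N = Ti (Ti (Pw F (Cst 3)) (Pw (Rg 2) (Cst 2))) (Cst Pn) in
   Sq (ems [F, Cst Pn]) (Sq (Lp 4 F (Em (Rg 4))) (Sq (Lp 4 (Cst Pn) (Em (Rg 4))) (Sq (Em (Pw (Cst 4) N))
    (Lp 4 (Pw (Cst 4) N) (Sq (Lp 5 N (atoms_gen F Pn)) (ems [Cst 0, Cst 0, Cst 1, Cst 0, Cst 1])))))))"

lemma enc_lit: "enc_fm (lit b ph) = (if b = 0 then [2] else []) @ enc_fm ph" by (simp add: lit_def)

lemma enc_clause: "enc_fm (clause F Pn k e as) = concat (map (%a. 3 # enc_fm (lit (bit1 e a) (EqA F k a)) @
  3 # enc_fm (lit (bit2 e a) (PrA F Pn k a))) as) @ [0, 0, 1, 0, 1]"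
 by (induction as) auto

lemma out_lit_gen: "aval g r b <= 1 ==> out g r (lit_gen b es) = (if aval g r b = 0 then [2] else []) @ map (aval g r) es" by (auto simp: lit_gen_def)

lemma out_atoms_gen:
 assumes "aregs F <= {2, 3}"
 shows "out g r (atoms_gen F Pn) = 3 # enc_fm (lit (bit1 (r 4) (r 5)) (EqA (aval g r F) (r 2) (r 5))) @
  3 # enc_fm (lit (bit2 (r 4) (r 5)) (PrA (aval g r F) Pn (r 2) (r 5)))"
 unfolding atoms_gen_def Let_def enc_lit by (simp add: out_lit_gen EqA_def PrA_def bit1_def bit2_def minus_div_mult_eq_mod)

lemma enc_sig_sig: "enc_sig (sig F Pn) = F # Pn # [0..<F] @ [0..<Pn]" by (simp add: enc_sig_def sig_def lessThan_atLeast0)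

lemma out_full_gen:
 assumes F: "aregs F <= {2, 3}"
 shows "out g r (full_gen F Pn) = enc_sig (sig (aval g r F) Pn) @ enc_fms (clauses (aval g r F) Pn (r 2))"
proof -
 let ?F = "aval g r F" and ?k = "r 2"
 have c1: "aval g (r(4 := e)) F = ?F" for e by (rule aval_cong) (use F in auto)
 have c2: "aval g (r(4 := e, 5 := a)) F = ?F" for e a by (rule aval_cong) (use F in auto)
 have cc: "concat (map (%i. [i]) xs) = xs" for xs :: "nat list" by (induction xs) auto
 show ?thesis unfolding full_gen_def Let_def enc_sig_sig
  by (simp add: cc c1 c2 out_atoms_gen[OF F] enc_fms_def clauses_def num_atoms_def enc_clause comp_def)
qed

lemma full_gen_ok:
 assumes F: "aregs F <= {2, 3}"
 shows "gen_ok 8 {2, 3} (full_gen F Pn)"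
proof -
 have "aregs F <= {4, 2, 3}" "aregs F <= {5, 4, 2, 3}" using F by auto
 then show ?thesis using F by (auto simp: full_gen_def atoms_gen_def lit_gen_def Let_def)
qed

lemma sat_lit: "sat G u (lit b ph) \<longleftrightarrow> (sat G u ph \<longleftrightarrow> b ~= 0)" by (simp add: lit_def)

lemma sat_clause:
 "sat G u (clause F Pn k e as) \<longleftrightarrow> (ALL a:set as. (sat G u (EqA F k a) \<longleftrightarrow> bit1 e a ~= 0) & (sat G u (PrA F Pn k a) \<longleftrightarrow> bit2 e a ~= 0))"
 by (induction as) (auto simp: sat_lit)

lemma digits_exist: "(!!a. f a < 4) ==> EX e<4 ^ N. ALL a<N. e div 4 ^ a mod 4 = (f a :: nat)"
proof (induction N arbitrary: f)
 case (Suc N)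
 note prems = Suc.prems
 from Suc.IH[of "f \<circ> Suc"] Suc.prems obtain e where e: "e < 4 ^ N" "ALL a<N. e div 4 ^ a mod 4 = f (Suc a)" by auto
 have "(f 0 + 4 * e) div 4 ^ a mod 4 = f a" if "a < Suc N" for a
 proof (cases a)
  case 0
  then show ?thesis using Suc.prems[of 0] by simp
 next
  case (Suc b)
  have "f 0 < 4" by (rule prems)
  then have "(f 0 + 4 * e) div 4 = e" by simp
  then have "(f 0 + 4 * e) div 4 ^ a = e div 4 ^ b" using Suc by (simp add: div_mult2_eq)
  then show ?thesis using e(2) Suc that by simp
 qed
 moreover have "f 0 + 4 * e < 4 ^ Suc N" using e(1) Suc.prems[of 0] by simp
 ultimately show ?case by blast
qed simp

lemma digits_unique: "e < 4 ^ N ==> e' < 4 ^ N ==> (ALL a<N. e div 4 ^ a mod 4 = e' div 4 ^ a mod (4 :: nat)) ==> e = e'"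
proof (induction N arbitrary: e e')
 case (Suc N)
 have D: "e div 4 = e' div 4"
 proof (rule Suc.IH)
  show "e div 4 < 4 ^ N" "e' div 4 < 4 ^ N" using Suc.prems by (simp_all add: less_mult_imp_div_less mult.commute)
  show "ALL a<N. e div 4 div 4 ^ a mod 4 = e' div 4 div 4 ^ a mod 4"
  proof (intro allI impI)
   fix a assume "a < N"
   then show "e div 4 div 4 ^ a mod 4 = e' div 4 div 4 ^ a mod 4" using Suc.prems(3)[rule_format, of "Suc a"] by (simp add: div_mult2_eq)
  qed
 qed
 have M: "e mod 4 = e' mod 4" using Suc.prems(3)[rule_format, OF zero_less_Suc] by (simp only: power_0 div_by_1)
 have "e = e div 4 * 4 + e mod 4" by (rule div_mult_mod_eq[symmetric])
 also have "... = e'" unfolding D M by (rule div_mult_mod_eq)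
 finally show ?case .
next
 case 0
 from 0(1) have "e = 0" by simp
 moreover from 0(2) have "e' = 0" by simp
 ultimately show ?case by simp
qed

lemma bits_digit: "bit1 e a = (e div 4 ^ a mod 4) mod 2" "bit2 e a = (e div 4 ^ a mod 4) div 2"
proof -
 have 1: "x mod 2 = x mod 4 mod 2" for x :: nat by (rule mod_mod_cancel[symmetric]) simp
 have 2: "x div 2 mod 2 = x mod 4 div 2" for x :: nat using mod_mult2_eq[of x 2 2] by simp
 show "bit1 e a = (e div 4 ^ a mod 4) mod 2" unfolding bit1_def by (rule 1)
 show "bit2 e a = (e div 4 ^ a mod 4) div 2" unfolding bit2_def by (rule 2)
qed

text \<open>The truth values of the atoms, collected into base 4 digits, give a satisfied clause;
  conversely, satisfaction determines every digit. Contradictory sign patterns are listed too, but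
  never satisfied.\<close>

lemma clauses_unique: "\<exists>!om. om : set (clauses F Pn k) & sat G u om"
proof -
 let ?N = "num_atoms F Pn k"
 have "EX e<(4 :: nat) ^ ?N. ALL a<?N. e div 4 ^ a mod 4 = of_bool (sat G u (EqA F k a)) + 2 * of_bool (sat G u (PrA F Pn k a))"
  by (rule digits_exist) (auto split: if_splits)
 then obtain e :: nat where e: "e < 4 ^ ?N"
  "ALL a<?N. e div 4 ^ a mod 4 = of_bool (sat G u (EqA F k a)) + 2 * of_bool (sat G u (PrA F Pn k a))" by blast
 have sat_e: "sat G u (clause F Pn k e [0..<?N])" unfolding sat_clause bits_digit using e(2) by auto
 have uniq: "e' = e" if "e' < 4 ^ ?N" "sat G u (clause F Pn k e' [0..<?N])" for e'
 proof (rule digits_unique[OF that(1) e(1)], intro allI impI)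
  fix a assume a: "a < ?N"
  have eq: "x = y" if "x < 4" "y < 4" "x mod 2 = 0 = (y mod 2 = 0)" "x div 2 = 0 = (y div 2 = 0)" for x y :: nat
   using that by presburger
  have "a : set [0..<?N]" using a by simp
  then have "bit1 e' a = 0 = (bit1 e a = 0)" "bit2 e' a = 0 = (bit2 e a = 0)"
   using that(2) sat_e unfolding sat_clause by blast+
  then show "e' div 4 ^ a mod 4 = e div 4 ^ a mod 4" unfolding bits_digit by (intro eq) (simp_all only: mod_less_divisor zero_less_numeral)
 qed
 show ?thesis
 proof (rule ex1I[of _ "clause F Pn k e [0..<?N]"])
  show "clause F Pn k e [0..<?N] : set (clauses F Pn k) & sat G u (clause F Pn k e [0..<?N])" using e(1) sat_e by (auto simp: clauses_def)
  fix om assume "om : set (clauses F Pn k) & sat G u om"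
  then show "om = clause F Pn k e [0..<?N]" using uniq by (auto simp: clauses_def)
 qed
qed

text \<open>A clause is used as the record of a type: when it is satisfied, an atom in its range is
  true iff it occurs here. So weights can be chosen by looking at the clause alone.\<close>

fun pos :: "fm => fm set" where
 "pos (Conj ph psi) = pos ph Un pos psi"
| "pos (Neg ph) = {}"
| "pos (Disj ph psi) = {}"
| "pos ph = {ph}"

lemma sat_pos: "sat G u om ==> \<alpha> : pos om ==> sat G u \<alpha>" by (induction om) auto

lemma pos_lit: "b ~= 0 ==> EqA F k a : pos (lit b (EqA F k a))" "b ~= 0 ==> PrA F Pn k a : pos (lit b (PrA F Pn k a))"
 by (auto simp: lit_def EqA_def PrA_def)

lemma pos_clause:
 "a : set as ==> bit1 e a ~= 0 ==> EqA F k a : pos (clause F Pn k e as)"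
 "a : set as ==> bit2 e a ~= 0 ==> PrA F Pn k a : pos (clause F Pn k e as)" by (induction as) (use pos_lit in auto)

text \<open>Inverts the numeral: \<open>a = f1 + F * (f2 + F * (f3 + F * (i' + k * j')))\<close>,
  where the variables are shifted to start from 0.\<close>

lemma EqA_surj:
 assumes "f1 < F" "f2 < F" "f3 < F" "1 <= i" "i <= k" "1 <= j" "j <= k" "1 <= Pn"
 shows "EX a<num_atoms F Pn k. EqA F k a = Eq (App f1 (App f2 (Var i))) (App f3 (Var j))"
proof -
 define i' j' where "i' = i - 1" "j' = j - 1"
 have ij: "i = Suc i'" "j = Suc j'" "i' < k" "j' < k" using assms by (auto simp: i'_j'_def)
 define b where "b = f3 + F * (i' + k * j')"
 define a where "a = f1 + F * (f2 + F * b)"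
 have 1: "a div F = f2 + F * b" "a mod F = f1" using assms by (simp_all add: a_def)
 have 2: "a div F ^ 2 = b" using 1 assms by (simp add: power2_eq_square div_mult2_eq)
 have 3: "a div F ^ 3 = i' + k * j'"
 proof -
  have "a div F ^ 3 = a div F ^ 2 div F" by (simp add: power3_eq_cube power2_eq_square div_mult2_eq)
  then show ?thesis using 2 assms by (simp add: b_def)
 qed
 have 4: "a div (F ^ 3 * k) = j'" using 3 ij by (simp add: div_mult2_eq)
 have lt: "i' + k * j' < k * k"
 proof -
  have "i' + k * j' < k * Suc j'" using ij by simp
  also have "... <= k * k" using ij by (intro mult_le_mono) auto
  finally show ?thesis .
 qed
 have "0 < F ^ 3" using assms(1) by simp
 from div_less_iff_less_mult[OF this, of a "k * k"] lt have "a < F ^ 3 * (k * k)" unfolding 3 by (simp only: mult.commute)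
 also have "... <= F ^ 3 * (k * k) * Pn" using assms(8) by simp
 finally have "a < num_atoms F Pn k" by (simp add: num_atoms_def power2_eq_square)
 moreover have "EqA F k a = Eq (App f1 (App f2 (Var i))) (App f3 (Var j))" unfolding EqA_def 1 2 3 4 ij using assms ij by (simp add: b_def)
 ultimately show ?thesis by blast
qed

lemma PrA_surj:
 assumes "p < Pn" "f < F" "1 <= i" "i <= k"
 shows "EX a<num_atoms F Pn k. PrA F Pn k a = Pred p (App f (Var i))"
proof -
 define i' where "i' = i - 1"
 have i: "i = Suc i'" "i' < k" using assms by (auto simp: i'_def)
 define a where "a = p + Pn * (f + F * i')"
 have 1: "a div Pn = f + F * i'" "a mod Pn = p" using assms by (simp_all add: a_def)
 have 2: "a div (Pn * F) = i'" using 1 assms by (simp add: div_mult2_eq)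
 have "f + F * i' < F * Suc i'" using assms by simp
 also have "... <= F * k" using i by (intro mult_le_mono) auto
 finally have lt: "f + F * i' < F * k" .
 have "0 < Pn" using assms(1) by simp
 from div_less_iff_less_mult[OF this, of a "F * k"] lt have "a < Pn * (F * k)" unfolding 1 by (simp only: mult.commute)
 also have "... <= num_atoms F Pn k"
 proof -
  have "F * 1 <= F * (F * F)" "k * 1 <= k * k" using assms by (intro mult_le_mono; simp)+
  then have "Pn * (F * k) <= Pn * ((F * (F * F)) * (k * k))" by (intro mult_le_mono) auto
  then show ?thesis by (simp add: num_atoms_def power2_eq_square power3_eq_cube mult_ac)
 qed
 finally have "a < num_atoms F Pn k" .
 moreover have "PrA F Pn k a = Pred p (App f (Var i))" unfolding PrA_def 1 2 i using assms i by simp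
 ultimately show ?thesis by blast
qed

lemma pos_Eq:
 assumes "om : set (clauses F Pn k)" "sat G u om"
  "f1 < F" "f2 < F" "f3 < F" "1 <= i" "i <= k" "1 <= j" "j <= k" "1 <= Pn"
 shows "Eq (App f1 (App f2 (Var i))) (App f3 (Var j)) : pos om \<longleftrightarrow> fint G f1 (fint G f2 (u i)) = fint G f3 (u j)"
proof
 assume "Eq (App f1 (App f2 (Var i))) (App f3 (Var j)) : pos om"
 from sat_pos[OF assms(2) this] show "fint G f1 (fint G f2 (u i)) = fint G f3 (u j)" by simp
next
 assume e: "fint G f1 (fint G f2 (u i)) = fint G f3 (u j)"
 obtain a where a: "a < num_atoms F Pn k" "EqA F k a = Eq (App f1 (App f2 (Var i))) (App f3 (Var j))" using EqA_surj[OF assms(3-10)] by blast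
 obtain e where om: "om = clause F Pn k e [0..<num_atoms F Pn k]" using assms(1) by (auto simp: clauses_def)
 have "bit1 e a ~= 0" using assms(2) a e unfolding om sat_clause by auto
 then show "Eq (App f1 (App f2 (Var i))) (App f3 (Var j)) : pos om" unfolding om a(2)[symmetric] by (intro pos_clause) (use a in auto)
qed

lemma pos_Pred:
 assumes "om : set (clauses F Pn k)" "sat G u om" "p < Pn" "f < F" "1 <= i" "i <= k"
 shows "Pred p (App f (Var i)) : pos om \<longleftrightarrow> pint G p (fint G f (u i))"
proof
 assume "Pred p (App f (Var i)) : pos om"
 from sat_pos[OF assms(2) this] show "pint G p (fint G f (u i))" by simp
next
 assume e: "pint G p (fint G f (u i))"
 obtain a where a: "a < num_atoms F Pn k" "PrA F Pn k a = Pred p (App f (Var i))" using PrA_surj[OF assms(3-6)] by blast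
 obtain e where om: "om = clause F Pn k e [0..<num_atoms F Pn k]" using assms(1) by (auto simp: clauses_def)
 have "bit2 e a ~= 0" using assms(2) a e unfolding om sat_clause by auto
 then show "Pred p (App f (Var i)) : pos om" unfolding om a(2)[symmetric] by (intro pos_clause) (use a in auto)
qed

lemma clauses_ok:
 assumes "om : set (clauses F Pn k)" "1 <= F" "1 <= Pn" "1 <= k"
 shows "conj_clause om" "fm_over (sig F Pn) {1..k} om"
proof -
 have m: "x mod k < k" "x mod F < F" "x mod Pn < Pn" for x using assms by simp_all
 have mem: "Suc (x mod k) : {1..k}" for x using m(1)[of x] by simp
 then have "conj_clause (clause F Pn k e as) & fm_over (sig F Pn) {1..k} (clause F Pn k e as)" for e as
 proof (induction as)
  case (Cons a as)
  have "conj_clause (lit b (EqA F k a))" "conj_clause (lit b (PrA F Pn k a))" for b by (simp_all add: lit_def EqA_def PrA_def)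
  moreover have "fm_over (sig F Pn) {1..k} (lit b (EqA F k a))" "fm_over (sig F Pn) {1..k} (lit b (PrA F Pn k a))" for b
  proof -
   have "fm_over (sig F Pn) {1..k} (EqA F k a)" "fm_over (sig F Pn) {1..k} (PrA F Pn k a)"
    unfolding EqA_def PrA_def by (simp_all only: fm_over.simps tm_over.simps sig_def signature.simps lessThan_iff m mem simp_thms)
   then show "fm_over (sig F Pn) {1..k} (lit b (EqA F k a))" "fm_over (sig F Pn) {1..k} (lit b (PrA F Pn k a))" by (simp_all add: lit_def)
  qed
  ultimately show ?case using Cons by simp
 qed (use assms in simp)
 then show "conj_clause om" "fm_over (sig F Pn) {1..k} om" using assms(1) by (auto simp: clauses_def)
qed

subsection \<open>Reading the weights off a clause\<close>

fun atoms :: "fm => fm list" where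
 "atoms (Eq s t) = [Eq s t]"
| "atoms (Pred p t) = [Pred p t]"
| "atoms (Neg ph) = atoms ph"
| "atoms (Conj ph psi) = atoms ph @ atoms psi"
| "atoms (Disj ph psi) = atoms ph @ atoms psi"

text \<open>The values of terms are a parameter, so that a formula can be evaluated on vertex
  numbers instead of vertices.\<close>

fun holds :: "(tm => nat) => (nat => nat => bool) => fm => bool" where
 "holds val pr (Eq s t) = (val s = val t)"
| "holds val pr (Pred p t) = (pr p (val t))"
| "holds val pr (Neg ph) = (~ holds val pr ph)"
| "holds val pr (Conj ph psi) = (holds val pr ph & holds val pr psi)"
| "holds val pr (Disj ph psi) = (holds val pr ph \<or> holds val pr psi)"

fun atom_ok :: "(tm => nat) => nat set => nat => nat => fm => bool" where
 "atom_ok ix Ps q k (Eq s t) = (ix s < q & ix t < q & tvar s <= k & tvar t <= k)"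
| "atom_ok ix Ps q k (Pred p t) = (p : Ps & ix t < q & tvar t <= k)"
| "atom_ok ix Ps q k _ = (False)"

text \<open>For \<open>a = Hn 0\<close>, which denotes the identity, this compares two words of the
  tuple.\<close>

definition eqv :: "(aname => nat) => fm => aname => nat => nat => nat => nat => bool" where
 "eqv sy om a s i t j = (Eq (App (sy a) (App (sy (Tau s)) (Var i))) (App (sy (Tau t)) (Var j)) : pos om)"

fun atom_dec :: "(tm => nat) => (aname => nat) => fm => fm => bool" where
 "atom_dec ix sy om (Eq s t) = (eqv sy om (Hn 0) (ix s) (tvar s) (ix t) (tvar t))"
| "atom_dec ix sy om (Pred p t) = (Pred p (App (sy (Tau (ix t))) (Var (tvar t))) : pos om)"
| "atom_dec ix sy om _ = (False)"

text \<open>The same vertex may arise from several pairs of a variable and a word; only the first one counts.\<close>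

definition frep :: "(aname => nat) => fm => nat => nat => nat => nat => bool" where
 "frep sy om q k i s = ((ALL i':{1..k}. ALL s'<q. (i' < i \<or> i' = i & s' < s) --> ~ eqv sy om (Hn 0) s' i' s i))"

text \<open>What the clause knows about membership in \<open>U\<close>: with \<open>w\<close> for
  word \<open>s\<close> of \<open>u i\<close>, the entry of \<open>a\<close> at \<open>w\<close> is
  a value of the tuple, but no later neighbour of \<open>w\<close>.\<close>

definition upair :: "(aname => nat) => fm => nat => nat => nat => nat => nat => aname => bool" where
 "upair sy om q k d i s a = ((EX t<q. EX j:{1..k}. eqv sy om a s i t j & (ALL l<=d. ~ eqv sy om (Hn l) s i t j)))"

text \<open>\<open>SOME\<close> is admissible, as the path is chosen when the machine for the
  formula is built, and only the existence of this machine is claimed. The default \<open>[]\<close>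
  keeps the result among the available paths.\<close>

definition path_dec :: "nat list list => nat => ctx => (aname => bool) => nat list" where
 "path_dec ps J kp inU = (let W = %p. p : set ps & (ALL m:{1..length p}. inU (Slot kp (take m p))) & (ALL j<J. ~ inU (Slot kp (p @ [j])))
   in if EX p. W p then SOME p. W p else [])"

definition ctx_dec :: "(tm => nat) => (aname => nat) => links => fm list => fm => nat => nat => nat => ctx" where
 "ctx_dec ix sy AL AT om i s t = (t, filter (%(l, t, j). eqv sy om (Hn l) s i t j) AL, filter (atom_dec ix sy om) AT)"

text \<open>One summand for each value \<open>w\<close> of the tuple, at its first occurrence, and
  each word \<open>t\<close> that takes the counted vertex to \<open>w\<close>; hence at most
  \<open>q * q\<close> summands per variable.\<close>

definition terms_of :: "(tm => nat) => (aname => nat) => links => fm list => nat list list => nat => nat => nat => nat => fm => nat => terms" where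
 "terms_of ix sy AL AT ps J q k d om i = concat (map (%s. if frep sy om q k i s
   then map (%t. let kp = ctx_dec ix sy AL AT om i s t in (s, kp, path_dec ps J kp (upair sy om q k d i s))) [0..<q] else []) [0..<q])"

lemma filter_in_subseqs: "filter P xs : set (subseqs xs)" by (induction xs) (auto simp: Let_def)

lemma path_dec_mem: "[] : set ps ==> path_dec ps J kp inU : set ps" unfolding path_dec_def Let_def by (auto intro: someI2_ex split: if_splits)

lemma length_terms_of: "length (terms_of ix sy AL AT ps J q k d om i) <= q * q"
proof -
 have "length (concat (map (%s. if P s then map (f s) [0..<q] else []) ss)) <= length ss * q" for P f and ss :: "nat list" by (induction ss) auto
 from this[of _ _ "[0..<q]"] show ?thesis unfolding terms_of_def by simp
qed

lemma terms_of_mem: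
 assumes "(s, kp, p) : set (terms_of ix sy AL AT ps J q k d om i)" "[] : set ps"
 shows "s < q & fst kp < q & fst (snd kp) : set (subseqs AL) & snd (snd kp) : set (subseqs AT) & p : set ps"
proof -
 obtain t where "s < q" "t < q" "kp = ctx_dec ix sy AL AT om i s t" "p = path_dec ps J kp (upair sy om q k d i s)"
  using assms(1) by (auto simp: terms_of_def Let_def split: if_splits)
 then show ?thesis using path_dec_mem[OF assms(2)] by (simp add: ctx_dec_def filter_in_subseqs)
qed

lemma wt_sum_concat: "wt_sum A (concat xss) v = (\<Sum>xs\<leftarrow>xss. wt_sum A xs v)" by (induction xss) (auto simp: wt_sum_def)

lemma wt_sum_terms:
 "wt_sum A (terms_of ix sy AL AT ps J q k d om i) v = (\<Sum>s\<in>{s. s < q & frep sy om q k i s}. \<Sum>t<q.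
   A (Num (ctx_dec ix sy AL AT om i s t) (path_dec ps J (ctx_dec ix sy AL AT om i s t) (upair sy om q k d i s))) (A (Tau s) v))"
proof -
 let ?g = "%s t. A (Num (ctx_dec ix sy AL AT om i s t) (path_dec ps J (ctx_dec ix sy AL AT om i s t) (upair sy om q k d i s))) (A (Tau s) v)"
 have "wt_sum A (if frep sy om q k i s then map (%t. let kp = ctx_dec ix sy AL AT om i s t in
   (s, kp, path_dec ps J kp (upair sy om q k d i s))) [0..<q] else []) v = (if frep sy om q k i s then \<Sum>t<q. ?g s t else 0)" for s
  by (simp add: wt_sum_def Let_def comp_def interv_sum_list_conv_sum_set_nat atLeast0LessThan)
 then have "wt_sum A (terms_of ix sy AL AT ps J q k d om i) v = (\<Sum>s<q. if frep sy om q k i s then \<Sum>t<q. ?g s t else 0)"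
  by (simp add: terms_of_def wt_sum_concat comp_def interv_sum_list_conv_sum_set_nat atLeast0LessThan)
 also have "... = (\<Sum>s\<in>{s:{..<q}. frep sy om q k i s}. \<Sum>t<q. ?g s t)" by (rule sum.inter_filter[symmetric]) simp
 also have "{s:{..<q}. frep sy om q k i s} = {s. s < q & frep sy om q k i s}" by auto
 finally show ?thesis .
qed

text \<open>Mixed equations are the crux. By \<open>av\<close> a value that \<open>y\<close> shares
  with the tuple is some \<open>Hn l\<close> of \<open>w\<close>, and \<open>nu\<close> lists for
  each \<open>l\<close> all words of the tuple with that value.\<close>

lemma ptest_holds:
 assumes nu: "!!l t j. (l, t, j) : set nu \<longleftrightarrow> l <= d & t < q & j : {1..k} & A (Hn l) w = tv t (u j)"
  and xi: "!!s t. Eq s t : set (atoms ph) ==> tvar s ~= 0 ==> tvar t ~= 0 ==>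
    Eq s t : set xi \<longleftrightarrow> tv (ix s) (u (tvar s)) = tv (ix t) (u (tvar t))"
   "!!p t. Pred p t : set (atoms ph) ==> tvar t ~= 0 ==> Pred p t : set xi \<longleftrightarrow> A (Pr p) (tv (ix t) (u (tvar t))) ~= 0"
  and ok: "ALL \<alpha>:set (atoms ph). atom_ok ix Ps q k \<alpha>"
  and tau: "!!t. t < q ==> A (Tau t) y = tv t y"
  and av: "!!t s j. t < q ==> s < q ==> j : {1..k} ==> tv t y = tv s (u j) ==> tv t y : later d A w"
 shows "ptest ix A nu xi w y ph = (holds (%t. tv (ix t) (if tvar t = 0 then y else u (tvar t))) (%p v. A (Pr p) v ~= 0) ph)"
 using xi ok
proof (induction ph)
 case (Eq s t)
 have o: "ix s < q" "ix t < q" "tvar s <= k" "tvar t <= k" using Eq.prems(3) by auto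
 have link: "(EX l. (l, b, j) : set nu & tv a y = A (Hn l) w) = (tv a y = tv b (u j))"
  if ab: "a < q" "b < q" "j ~= 0" "j <= k" for a b j
 proof
  assume "EX l. (l, b, j) : set nu & tv a y = A (Hn l) w"
  then show "tv a y = tv b (u j)" using nu by auto
 next
  assume e: "tv a y = tv b (u j)"
  have jk: "j : {1..k}" using ab by auto
  from av[OF ab(1,2) jk e] obtain l where l: "l <= d" "tv a y = A (Hn l) w" by (auto simp: later_def)
  then have "(l, b, j) : set nu" using nu ab(2) jk e by simp
  then show "EX l. (l, b, j) : set nu & tv a y = A (Hn l) w" using l(2) by blast
 qed
 show ?case
 proof (cases "tvar s = 0")
  case True
  then show ?thesis using link[OF o(1,2) _ o(4)] tau[OF o(1)] tau[OF o(2)] by simp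
 next
  case s: False
  show ?thesis
  proof (cases "tvar t = 0")
   case True
   then show ?thesis using s link[OF o(2,1) s o(3)] tau[OF o(2)] by auto
  next
   case False
   then show ?thesis using s Eq.prems(1)[of s t] by simp
  qed
 qed
next
 case (Pred p t)
 then show ?case using tau[of "ix t"] by auto
next
 case (Neg ph)
 then show ?case by auto
next
 case (Conj ph psi)
 have "ptest ix A nu xi w y ph = holds (%t. tv (ix t) (if tvar t = 0 then y else u (tvar t))) (%p v. A (Pr p) v ~= 0) ph"
  by (rule Conj.IH(1)) (use Conj.prems in auto)
 moreover have "ptest ix A nu xi w y psi = holds (%t. tv (ix t) (if tvar t = 0 then y else u (tvar t))) (%p v. A (Pr p) v ~= 0) psi"
  by (rule Conj.IH(2)) (use Conj.prems in auto)
 ultimately show ?case by simp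
next
 case (Disj ph psi)
 have "ptest ix A nu xi w y ph = holds (%t. tv (ix t) (if tvar t = 0 then y else u (tvar t))) (%p v. A (Pr p) v ~= 0) ph"
  by (rule Disj.IH(1)) (use Disj.prems in auto)
 moreover have "ptest ix A nu xi w y psi = holds (%t. tv (ix t) (if tvar t = 0 then y else u (tvar t))) (%p v. A (Pr p) v ~= 0) psi"
  by (rule Disj.IH(2)) (use Disj.prems in auto)
 ultimately show ?case by simp
qed

text \<open>The vertices attributed to a value \<open>w\<close> of the tuple by a first word
  \<open>t\<close> are those counted in the context without path that avoid \<open>U\<close>, the
  values of the tuple that are not later neighbours of \<open>w\<close>. Each such number is
  approximated by the count on the path that the clause determines, and relative errors survive a
  sum of nonnegative terms.\<close>

lemma weights_approximate:
 fixes eps :: real and u :: "nat => nat"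
 assumes tau: "!!t y. t < q ==> y < n ==> A (Tau t) y = tv t y" and tv: "!!t y. t < q ==> y < n ==> tv t y < n"
  and h0: "!!v. v < n ==> A (Hn 0) v = v"
  and L: "distinct L" "set L = {..<n}"
  and Lh: "!!i. i < n ==> insert (L ! i) (set (map (%h. A h (L ! i)) (hs_of d))) = insert (L ! i) (Nb n q tv (L ! i) - set (take i L))"
  and good: "!!kp w p. kp : set kps ==> w < n ==> p : set ps ==> good ix ph n q tv K J A kp p w"
  and kps: "!!t nu xi. t < q ==> nu : set (subseqs AL) ==> xi : set (subseqs AT) ==> (t, nu, xi) : set kps"
  and AL: "set AL = {(l, t, j). l <= d & t < q & j : {1..k}}" and AT: "set AT = set (atoms ph)"
  and ok: "ALL \<alpha>:set (atoms ph). atom_ok ix Ps q k \<alpha>"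
  and ps: "set ps = {p. length p <= k * q & set p <= {..<J}}"
  and K: "K = k * q * E" and E: "0 < eps" "(1 + eps) / eps <= real E" and kq: "1 <= k" "1 <= q"
  and t0: "t0 < q" "!!y y'. y < n ==> y' < n ==> tv t0 y = tv t0 y'"
  and u: "!!i. i : {1..k} ==> u i < n"
  and hn: "!!l s t i j. l <= d ==> s < q ==> t < q ==> i : {1..k} ==> j : {1..k} ==>
   eqv sy om (Hn l) s i t j = (A (Hn l) (tv s (u i)) = tv t (u j))"
  and sl: "!!kp p s t i j. kp : set kps ==> p ~= [] ==> length p <= Suc (k * q) ==> set p <= {..<J} ==> s < q ==> t < q ==> i : {1..k} ==> j : {1..k} ==>
   eqv sy om (Slot kp p) s i t j = (A (Slot kp p) (tv s (u i)) = tv t (u j))"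
  and pr: "!!p t i. p : Ps ==> t < q ==> i : {1..k} ==> Pred p (App (sy (Tau t)) (Var i)) : pos om \<longleftrightarrow> A (Pr p) (tv t (u i)) ~= 0"
 defines "c \<equiv> card {y. y < n & holds (%t. tv (ix t) (if tvar t = 0 then y else u (tvar t))) (%p v. A (Pr p) v ~= 0) ph}"
  and "S \<equiv> \<Sum>i=1..k. wt_sum A (terms_of ix sy AL AT ps J q k d om i) (u i)"
 shows "real c <= real S" "real S <= (1 + eps) * real c"
proof -
 let ?P = "%y. holds (%t. tv (ix t) (if tvar t = 0 then y else u (tvar t))) (%p v. A (Pr p) v ~= 0) ph"
 define W where "W = (%(i, s). tv s (u i)) ` ({1..k} \<times> {..<q})"
 have Wmem: "x : W \<longleftrightarrow> (EX t<q. EX j:{1..k}. x = tv t (u j))" for x by (auto simp: W_def)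
 have finW: "finite W" and cW: "card W <= k * q" using card_image_le[of "{1..k} \<times> {..<q}" "%(i, s). tv s (u i)"] by (auto simp: W_def)
 have Wn: "W <= {..<n}" using tv u by (auto simp: W_def)
 define H where "H = later d A"
 have H: "H (L ! i) = insert (L ! i) (Nb n q tv (L ! i) - set (take i L))" if "i < n" for i
 proof -
  have "length L = n" using L distinct_card[OF L(1)] by simp
  then have "L ! i < n" using L(2) that nth_mem by blast
  then show ?thesis unfolding H_def by (intro later_eq[where A = A and w = "L ! i"] h0 Lh[OF that])
 qed
 \<comment> \<open>The constant word \<open>t0\<close> gives \<open>y\<close> and the tuple a common
   value.\<close>
 have hit: "EX t<q. tv t y : W" if "y < n" for y
 proof -
  have "tv t0 y = tv t0 (u 1)" by (rule t0(2)) (use that u kq in auto)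
  moreover have "tv t0 (u 1) : W" unfolding Wmem by (intro exI[of _ t0] conjI bexI[of _ 1]) (use t0(1) kq in auto)
  ultimately show ?thesis using t0(1) by (intro exI[of _ t0]) simp
 qed
 define X where "X w t = {y. y < n & tv t y = w & (ALL t'<t. tv t' y ~= w) & (ALL t'<q. tv t' y : W --> tv t' y : H w) & ?P y}" for w t
 have c: "c = (\<Sum>w\<in>W. \<Sum>t<q. card (X w t))" unfolding c_def X_def by (rule count_by_first_hit[OF L H Wn hit])
 define N where "N i s t = A (Num (ctx_dec ix sy AL AT om i s t)
   (path_dec ps J (ctx_dec ix sy AL AT om i s t) (upair sy om q k d i s))) (tv s (u i))" for i s t
 have N: "card (X (tv s (u i)) t) <= N i s t & real (N i s t) <= (1 + eps) * real (card (X (tv s (u i)) t))"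
  if i: "i : {1..k}" and s: "s < q" and t: "t < q" for i s t
 proof -
  define w where "w = tv s (u i)"
  define kp where "kp = ctx_dec ix sy AL AT om i s t"
  define U where "U = W - H w"
  have wn: "w < n" unfolding w_def by (rule tv[OF s u[OF i]])
  have kpm: "kp : set kps" unfolding kp_def ctx_dec_def by (rule kps[OF t]) (rule filter_in_subseqs)+
  have wU: "w ~: U" using h0[OF wn] by (force simp: U_def H_def later_def)
  have finU: "finite U" and cU: "card U <= k * q" using finW cW card_mono[OF finW, of U] by (auto simp: U_def)
  \<comment> \<open>Membership in \<open>U\<close> becomes a condition on the clause. The length
    bound is \<open>Suc (k * q)\<close> because the slots \<open>p @ [j]\<close> behind the longest
    paths are tested as well.\<close>
  have inU: "upair sy om q k d i s (Slot kp p) = (A (Slot kp p) w : U)" if "p ~= []" "length p <= Suc (k * q)" "set p <= {..<J}" for p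
  proof -
   have "A (Slot kp p) w : U \<longleftrightarrow> (EX t<q. EX j:{1..k}. A (Slot kp p) w = tv t (u j) & A (Slot kp p) w ~: H w)"
    unfolding U_def using Wmem by blast
   also have "... = ((EX t<q. EX j:{1..k}. eqv sy om (Slot kp p) s i t j & (ALL l<=d. ~ eqv sy om (Hn l) s i t j)))"
   proof (intro ex_cong bex_cong refl conj_cong)
    fix t j assume tj: "t < q" "j : {1..k}"
    show "(A (Slot kp p) w = tv t (u j)) = eqv sy om (Slot kp p) s i t j" using sl[OF kpm that s tj(1) i tj(2)] by (simp add: w_def)
    assume e: "eqv sy om (Slot kp p) s i t j"
    then have "A (Slot kp p) w = tv t (u j)" using sl[OF kpm that s tj(1) i tj(2)] by (simp add: w_def)
    then show "(A (Slot kp p) w ~: H w) = (ALL l<=d. ~ eqv sy om (Hn l) s i t j)"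
    proof -
    have h: "eqv sy om (Hn l) s i t j = (A (Hn l) w = tv t (u j))" if "l <= d" for l
    using hn[OF that s tj(1) i tj(2)] by (simp add: w_def)
    have "x ~: H w \<longleftrightarrow> (ALL l<=d. A (Hn l) w ~= x)" for x by (auto simp: H_def later_def)
    then show ?thesis using h \<open>A (Slot kp p) w = tv t (u j)\<close> by simp
    qed
   qed
   finally show ?thesis unfolding upair_def by blast
  qed
  have WS: "(p : set ps & (ALL m:{1..length p}. upair sy om q k d i s (Slot kp (take m p))) &
    (ALL j<J. ~ upair sy om q k d i s (Slot kp (p @ [j])))) = (p : set ps & visits A kp w U p & stuck J A kp w U p)" for p
  proof (cases "p : set ps")
   case True
   then have p: "length p <= k * q" "set p <= {..<J}" using ps by auto
   have "upair sy om q k d i s (Slot kp (take m p)) = (A (Slot kp (take m p)) w : U)" if "m : {1..length p}" for m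
    by (rule inU) (use p that set_take_subset[of m p] in auto)
   moreover have "upair sy om q k d i s (Slot kp (p @ [j])) = (A (Slot kp (p @ [j])) w : U)" if "j < J" for j
    by (rule inU) (use p that in auto)
   ultimately show ?thesis by (simp add: visits_def stuck_def)
  qed simp
  have ex: "EX p:set ps. visits A kp w U p & stuck J A kp w U p" by (rule slot_path_exists[OF good[OF kpm wn] ps finU cU wU tau])
  define p where "p = path_dec ps J kp (upair sy om q k d i s)"
  have p: "p : set ps & visits A kp w U p & stuck J A kp w U p"
  proof -
   have "p = (SOME p. p : set ps & visits A kp w U p & stuck J A kp w U p)" unfolding p_def path_dec_def Let_def WS using ex by auto
   then show ?thesis using someI_ex[of "%p. p : set ps & visits A kp w U p & stuck J A kp w U p"] ex by auto
  qed
  \<comment> \<open>The machine counts by \<open>ptest\<close>, which agrees with the formula for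
    every \<open>y\<close> attributed to \<open>w\<close> that avoids \<open>U\<close>.\<close>
  have X: "{y : Yset ix ph n q tv A kp [] w. ALL t<q. tv t y ~: U} = X w t"
  proof (intro set_eqI)
   fix y
   show "y : {y : Yset ix ph n q tv A kp [] w. ALL t<q. tv t y ~: U} \<longleftrightarrow> y : X w t"
   proof (cases "y < n & tv t y = w & (ALL t'<t. tv t' y ~= w) & (ALL t'<q. tv t' y ~: U)")
    case True
    have "ptest ix A (fst (snd kp)) (snd (snd kp)) w y ph = (?P y)"
    proof (rule ptest_holds[OF _ _ _ ok])
    fix l t' j
    show "(l, t', j) : set (fst (snd kp)) \<longleftrightarrow> l <= d & t' < q & j : {1..k} & A (Hn l) w = tv t' (u j)"
    using hn[of l s t' i j] s i by (auto simp: kp_def ctx_dec_def AL w_def)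
    next
    fix a b assume ab: "Eq a b : set (atoms ph)" "tvar a ~= 0" "tvar b ~= 0"
    have o: "ix a < q" "ix b < q" "tvar a : {1..k}" "tvar b : {1..k}" using bspec[OF ok ab(1)] ab(2,3) by auto
    show "Eq a b : set (snd (snd kp)) \<longleftrightarrow> tv (ix a) (u (tvar a)) = tv (ix b) (u (tvar b))"
    using hn[OF _ o, of 0] h0[OF tv[OF o(1) u[OF o(3)]]] ab(1) by (simp add: kp_def ctx_dec_def AT)
    next
    fix p b assume ab: "Pred p b : set (atoms ph)" "tvar b ~= 0"
    have o: "p : Ps" "ix b < q" "tvar b : {1..k}" using bspec[OF ok ab(1)] ab(2) by auto
    show "Pred p b : set (snd (snd kp)) \<longleftrightarrow> A (Pr p) (tv (ix b) (u (tvar b))) ~= 0"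
    using pr[OF o] ab(1) by (simp add: kp_def ctx_dec_def AT)
    next
    fix t' assume "t' < q"
    then show "A (Tau t') y = tv t' y" using tau True by blast
    next
    fix t' s' j assume "t' < q" "s' < q" "j : {1..k}" "tv t' y = tv s' (u j)"
    then have "tv t' y : W" unfolding Wmem by blast
    then show "tv t' y : later d A w" using True \<open>t' < q\<close> by (auto simp: U_def H_def)
    qed
    then show ?thesis using True tau t by (auto simp: X_def Yset_def ytest_def U_def kp_def ctx_dec_def)
   next
    case False
    then show ?thesis using tau t by (auto simp: X_def Yset_def ytest_def U_def kp_def ctx_dec_def)
   qed
  qed
  have g: "good ix ph n q tv K J A kp p w" by (rule good[OF kpm wn]) (use p in blast)
  note A1 = slot_path_approx(1)[OF g conjunct1[OF conjunct2[OF p]] conjunct2[OF conjunct2[OF p]] finU tau, unfolded X]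
  note A2 = slot_path_approx(2)[OF g conjunct1[OF conjunct2[OF p]] conjunct2[OF conjunct2[OF p]] finU tau, unfolded X]
  have Ni: "N i s t = A (Num kp p) w" by (simp add: N_def kp_def p_def w_def)
  have "K * N i s t <= K * card (X w t) + k * q * N i s t" using order.trans[OF A2 add_left_mono[OF mult_right_mono[OF cU]]] unfolding Ni by simp
  then have "real (K * N i s t) <= real (K * card (X w t) + k * q * N i s t)" by (rule of_nat_mono)
  then have "real (k * q) * real E * real (N i s t) <= real (k * q) * real E * real (card (X w t)) + real (k * q) * real (N i s t)" by (simp add: K)
  moreover have "0 < real (k * q)" using kq by simp
  ultimately have "real (N i s t) <= (1 + eps) * real (card (X w t))" by (rule approx_factor[OF _ _ E]) (use A1 in "simp add: Ni")
  note R = this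
  show ?thesis using A1 R unfolding w_def[symmetric] Ni by blast
 qed
 define Rp where "Rp = {(i, s). i : {1..k} & s < q & frep sy om q k i s}"
 have finR: "finite Rp" by (rule finite_subset[of _ "{1..k} \<times> {..<q}"]) (auto simp: Rp_def)
 have eq0: "eqv sy om (Hn 0) s' i' s i = (tv s' (u i') = tv s (u i))" if "i : {1..k}" "i' : {1..k}" "s < q" "s' < q" for i i' s s'
  using hn[of 0 s' s i' i] that h0[OF tv[OF that(4) u[OF that(2)]]] by simp
 \<comment> \<open>First occurrences enumerate the values of the tuple without repetition, so sums
   over \<open>W\<close> become sums over pairs of a variable and a word.\<close>
 have bij: "bij_betw (%(i, s). tv s (u i)) Rp W" unfolding bij_betw_def
 proof
  show "inj_on (%(i, s). tv s (u i)) Rp"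
  proof (rule inj_onI)
   fix x y assume xy: "x : Rp" "y : Rp" "(case x of (i, s) => tv s (u i)) = (case y of (i, s) => tv s (u i))"
   obtain i s i' s' where e: "x = (i, s)" "y = (i', s')" by (cases x, cases y)
   have h: "i : {1..k}" "s < q" "frep sy om q k i s" "i' : {1..k}" "s' < q" "frep sy om q k i' s'" "tv s (u i) = tv s' (u i')"
    using xy by (auto simp: e Rp_def)
   have "~ (i' < i \<or> i' = i & s' < s)" using h(3) h(4,5) eq0[OF h(1,4,2,5)] h(7) unfolding frep_def by auto
   moreover have "~ (i < i' \<or> i = i' & s < s')" using h(6) h(1,2) eq0[OF h(4,1,5,2)] h(7) unfolding frep_def by auto
   ultimately show "x = y" unfolding e by auto
  qed
  show "(%(i, s). tv s (u i)) ` Rp = W"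
  proof (intro subset_antisym subsetI)
   fix x assume "x : (%(i, s). tv s (u i)) ` Rp"
   then show "x : W" by (auto simp: Rp_def W_def)
  next
   fix x assume "x : W"
   then have ex: "EX i. i : {1..k} & (EX s<q. x = tv s (u i))" by (auto simp: Wmem)
   define i where "i = (LEAST i. i : {1..k} & (EX s<q. x = tv s (u i)))"
   have i: "i : {1..k} & (EX s<q. x = tv s (u i))" unfolding i_def by (rule LeastI_ex[OF ex])
   have imin: "~ (i' : {1..k} & (EX s<q. x = tv s (u i')))" if "i' < i" for i' using not_less_Least that unfolding i_def by blast
   define s where "s = (LEAST s. s < q & x = tv s (u i))"
   have s: "s < q & x = tv s (u i)" unfolding s_def by (rule LeastI_ex) (use i in blast)
   have smin: "~ (s' < q & x = tv s' (u i))" if "s' < s" for s' using not_less_Least that unfolding s_def by blast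
   have "frep sy om q k i s" unfolding frep_def
   proof (intro ballI allI impI)
    fix i' s' assume a: "i' : {1..k}" "s' < q" "i' < i \<or> i' = i & s' < s"
    have "x ~= tv s' (u i')" using a imin[of i'] smin[of s'] by auto
    then show "~ eqv sy om (Hn 0) s' i' s i" using eq0[OF _ a(1) _ a(2)] i s by auto
   qed
   then show "x : (%(i, s). tv s (u i)) ` Rp" using i s by (intro image_eqI[of _ _ "(i, s)"]) (auto simp: Rp_def)
  qed
 qed
 have "S = (\<Sum>i=1..k. \<Sum>s\<in>{s. s < q & frep sy om q k i s}. \<Sum>t<q. N i s t)" unfolding S_def wt_sum_terms N_def
 proof (intro sum.cong refl)
  fix i s t assume "i : {1..k}" "s : {s. s < q & frep sy om q k i s}"
  then have "A (Tau s) (u i) = tv s (u i)" using tau u by auto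
  then show "A (Num (ctx_dec ix sy AL AT om i s t) (path_dec ps J (ctx_dec ix sy AL AT om i s t) (upair sy om q k d i s))) (A (Tau s) (u i)) =
   A (Num (ctx_dec ix sy AL AT om i s t) (path_dec ps J (ctx_dec ix sy AL AT om i s t) (upair sy om q k d i s))) (tv s (u i))" by simp
 qed
 also have "... = (\<Sum>(i, s)\<in>(SIGMA i:{1..k}. {s. s < q & frep sy om q k i s}). \<Sum>t<q. N i s t)" by (rule sum.Sigma) auto
 also have "(SIGMA i:{1..k}. {s. s < q & frep sy om q k i s}) = Rp" by (auto simp: Rp_def)
 finally have S: "S = (\<Sum>x\<in>Rp. \<Sum>t<q. N (fst x) (snd x) t)" by (simp add: split_def)
 have c': "c = (\<Sum>x\<in>Rp. \<Sum>t<q. card (X (tv (snd x) (u (fst x))) t))"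
  unfolding c using sum.reindex_bij_betw[OF bij, of "%w. \<Sum>t<q. card (X w t)"] by (simp add: split_def)
 have "c <= S" unfolding c' S by (intro sum_mono) (use N in "auto simp: Rp_def")
 then show "real c <= real S" by simp
 have "real S = (\<Sum>x\<in>Rp. \<Sum>t<q. real (N (fst x) (snd x) t))" unfolding S by simp
 also have "... <= (\<Sum>x\<in>Rp. \<Sum>t<q. (1 + eps) * real (card (X (tv (snd x) (u (fst x))) t)))"
  by (intro sum_mono) (use N in "auto simp: Rp_def")
 also have "... = (1 + eps) * real c" unfolding c' by (simp add: sum_distrib_left)
 finally show "real S <= (1 + eps) * real c" .
qed

subsection \<open>The expansion\<close>

definition sfuns :: "signature => nat list" where
 "sfuns sg = sorted_list_of_set (fsig sg)"

abbreviation "nf sg \<equiv> card (fsig sg)"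

text \<open>Besides the symbols of the signature there is one further function, with constant value \<open>v0\<close>.
 It makes every vertex share a value with every tuple.\<close>

definition ext_fun :: "signature => 'v fstruct => 'v => nat => 'v => 'v" where
 "ext_fun sg G v0 i = (if i < nf sg then fint G (sfuns sg ! i) else (%_. v0))"

lemma sfuns_props:
 assumes "functional_signature sg"
 shows "set (sfuns sg) = fsig sg" "length (sfuns sg) = nf sg" "distinct (sfuns sg)" "0 < nf sg" "sfuns sg ! 0 = 0"
proof -
 have fin: "finite (fsig sg)" "0 : fsig sg" using assms by (auto simp: functional_signature_def)
 show s: "set (sfuns sg) = fsig sg" "length (sfuns sg) = nf sg" "distinct (sfuns sg)" "0 < nf sg" using fin by (auto simp: sfuns_def card_gt_0_iff)
 obtain i where i: "i < length (sfuns sg)" "sfuns sg ! i = 0" using s(1) fin(2) by (metis in_set_conv_nth)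
 have "sorted (sfuns sg)" by (simp add: sfuns_def)
 then have "sfuns sg ! 0 <= sfuns sg ! i" using i(1) by (auto intro: sorted_nth_mono)
 then show "sfuns sg ! 0 = 0" using i(2) by simp
qed

lemma index_of:
 assumes "a : set xs"
 shows "index_of xs a < length xs" "xs ! index_of xs a = a"
proof -
 have "EX i. i < length xs & xs ! i = a" using assms by (metis in_set_conv_nth)
 from LeastI_ex[OF this] show "index_of xs a < length xs" "xs ! index_of xs a = a" by (auto simp: index_of_def)
qed

lemma index_of_nth: "distinct xs ==> i < length xs ==> index_of xs (xs ! i) = i" using index_of[of "xs ! i" xs] nth_eq_iff_index_eq by fastforce

text \<open>Composed of the number \<open>q\<close> of words, the depth \<open>s\<close> from
  \<open>trace_graph_minor\<close>, the bound \<open>g s + 1\<close> for the graph with an apex, and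
  the estimate for lexicographic products. The class enters only through \<open>g\<close>, so an
  oracle for \<open>g\<close> suffices to compute it.\<close>

definition dens :: "signature => (nat => nat) => nat => nat => nat" where
 "dens sg g D r = (let q = Suc (nf sg) ^ D; s = (2 * D + 1) * r + D in q + q ^ (2 * s + 2) * (g s + 1))"

lemma trace_graph_dens:
 fixes G :: "'v fstruct"
 assumes sg: "functional_signature sg" and G: "G : Fun sg" and g: "!!r. grad r (underlying sg G) <= real (g r)"
  and v0: "v0 : univ G" and H: "shallow_minor r (trace_graph (univ G) (ext_fun sg G v0) {..nf sg} D) H"
 shows "card (snd H) <= dens sg g D r * card (fst H)"
proof -
 let ?V = "univ G" and ?fn = "ext_fun sg G v0" and ?L = "{..nf sg}"
 \<comment> \<open>The constant function makes \<open>v0\<close> adjacent to all other vertices;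
   \<open>v0\<close> is the apex.\<close>
 define E where "E = snd (underlying sg G) Un {{v0, v} | v. v : ?V & v ~= v0}"
 define Gb where "Gb = (?V, E)"
 let ?s = "(2 * D + 1) * r + D"
 have fin: "finite ?V" and cl: "!!f v. f : fsig sg ==> v : ?V ==> fint G f v : ?V" and id: "!!v. v : ?V ==> fint G 0 v = v"
  using G by (auto simp: Fun_def)
 have nth: "sfuns sg ! f : fsig sg" if "f < nf sg" for f using that sfuns_props(1,2)[OF sg] by (metis nth_mem)
 have "EX H'. shallow_minor ?s (lexprod Gb (words ?L D)) H' & card (fst H') = card (fst H) & card (snd H') = card (snd H)"
 proof (rule trace_graph_minor[OF _ _ _ _ _ H])
  show "?fn f v : ?V" if "f : ?L" "v : ?V" for f v using that v0 cl nth by (auto simp: ext_fun_def)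
  show "?fn 0 v = v" if "v : ?V" for v using that id sfuns_props(4,5)[OF sg] by (simp add: ext_fun_def)
  show "0 : ?L" by simp
  show "fst Gb = ?V" by (simp add: Gb_def)
  show "{?fn f v, v} : snd Gb" if "f : ?L" "v : ?V" "?fn f v ~= v" for f v
  proof (cases "f < nf sg")
   case True
   then have "(fint G (sfuns sg ! f) v, v) : arcs sg G" using that(2) nth cl by (auto simp: arcs_def)
   then have "{fint G (sfuns sg ! f) v, v} : snd (underlying sg G)" using that(3) True unfolding underlying_def snd_conv ext_fun_def
    by (intro CollectI exI[of _ "fint G (sfuns sg ! f) v"] exI[of _ v]) simp
   then show ?thesis using True by (simp add: Gb_def E_def ext_fun_def)
  next
   case False
   then show ?thesis using that by (auto simp: Gb_def E_def ext_fun_def)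
  qed
 qed
 then obtain H' where H': "shallow_minor ?s (lexprod Gb (words ?L D)) H'" "card (fst H') = card (fst H)" "card (snd H') = card (snd H)" by blast
 have ud: "fst (underlying sg G) = ?V" by (simp add: underlying_def)
 have base: "card (snd M) <= (g ?s + 1) * card (fst M)" if M: "shallow_minor ?s Gb M" for M
 proof (rule apex_shallow_minor_edges[where G = "underlying sg G" and a = v0, OF _ _ _ _ M])
  show "finite (fst (underlying sg G))" "fst Gb = fst (underlying sg G)" using fin ud by (simp_all add: Gb_def)
  show "v0 : e \<or> e : snd (underlying sg G)" if "e : snd Gb" for e using that by (auto simp: Gb_def E_def)
  show "card (snd H) <= g ?s * card (fst H)" if "shallow_minor ?s (underlying sg G) H" for H
   by (rule shallow_minor_card_edges[OF _ g that]) (use fin ud in simp)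
 qed
 have w: "words ?L D = {ws. set ws <= {..nf sg} & length ws = D}" by (simp add: words_def)
 have "card (words ?L D) = Suc (nf sg) ^ D" "finite (words ?L D)" unfolding w by (simp_all add: card_lists_length_eq finite_lists_length_eq)
 then show ?thesis using lexprod_shallow_minor_edges[OF _ _ base H'(1)] fin unfolding H'(2,3) by (simp add: dens_def Let_def Gb_def)
qed

text \<open>Entries outside the structure are 0, like fresh memory. Index \<open>nf sg\<close> is
  outside as well, so its table is constantly 0 and represents the constant function with value
  \<open>vs ! 0\<close>.\<close>

definition table :: "signature => 'v list => 'v fstruct => aname => nat => nat" where
 "table sg vs G a v = (case a of
   In i => if i < nf sg & v < length vs then index_of vs (fint G (sfuns sg ! i) (vs ! v)) else 0
  | Pr p => if p : psig sg & v < length vs then of_bool (pint G p (vs ! v)) else 0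
  | _ => 0)"

lemma table_simps [simp]:
 "table sg vs G (In i) v = (if i < nf sg & v < length vs then index_of vs (fint G (sfuns sg ! i) (vs ! v)) else 0)"
 "table sg vs G (Pr p) v = (if p : psig sg & v < length vs then of_bool (pint G p (vs ! v)) else 0)"
 "a ~: range In ==> a ~: range Pr ==> table sg vs G a v = 0" by (auto simp: table_def split: aname.splits)

definition awords :: "signature => nat => nat list list" where
 "awords sg D = List.n_lists D [0..<Suc (nf sg)]"

lemma awords_props: "set (awords sg D) = words {..nf sg} D" "length (awords sg D) = Suc (nf sg) ^ D"
 unfolding awords_def by (auto simp: set_n_lists words_def length_n_lists simp del: upt_Suc)

definition val :: "signature => 'v list => 'v fstruct => nat => nat => nat => nat" where
 "val sg vs G D i v = apply_tab (table sg vs G) (awords sg D ! i) v"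

locale listing =
 fixes sg :: signature and G :: "'v fstruct" and vs :: "'v list" and D :: nat
 assumes sg: "functional_signature sg" and G: "G : Fun sg" and vs: "distinct vs" "set vs = univ G" and D: "1 <= D"
begin

abbreviation "n \<equiv> length vs"
abbreviation "q \<equiv> Suc (nf sg) ^ D"
abbreviation "A0 \<equiv> table sg vs G"
abbreviation "tv \<equiv> val sg vs G D"
abbreviation "Tg \<equiv> trace_graph (univ G) (ext_fun sg G (vs ! 0)) {..nf sg} D"

lemma nth_fsig: "i < nf sg ==> sfuns sg ! i : fsig sg" using sfuns_props(1,2)[OF sg] by (metis nth_mem)

lemma fint_univ: "f : fsig sg ==> v : univ G ==> fint G f v : univ G" using G by (auto simp: Fun_def)

lemma nth_univ: "i < n ==> vs ! i : univ G" using vs(2) nth_mem by blast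

lemma A0_less: "v < n ==> A0 (In i) v < n" using index_of(1)[of "fint G (sfuns sg ! i) (vs ! v)" vs] fint_univ[OF nth_fsig nth_univ] vs(2) by auto

lemma A0_ext: "i <= nf sg ==> v < n ==> vs ! A0 (In i) v = ext_fun sg G (vs ! 0) i (vs ! v)"
 using index_of(2)[of "fint G (sfuns sg ! i) (vs ! v)" vs] fint_univ[OF nth_fsig nth_univ] vs(2) by (auto simp: ext_fun_def)

lemma A0_0: "v < n ==> A0 (In 0) v = v"
proof -
 assume v: "v < n"
 have "fint G 0 (vs ! v) = vs ! v" using G nth_univ[OF v] by (auto simp: Fun_def)
 then show ?thesis using v sfuns_props(4,5)[OF sg] index_of_nth[OF vs(1) v] by simp
qed

lemma apply_tab_word:
 assumes "set ws <= {..nf sg}" "v < n"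
 shows "apply_tab A0 ws v < n & vs ! apply_tab A0 ws v = apply_word (ext_fun sg G (vs ! 0)) ws (vs ! v)" using assms(1)
proof (induction ws)
 case Nil
 then show ?case using assms(2) by (simp add: apply_tab_def apply_word_def)
next
 case (Cons a ws)
 then have IH: "apply_tab A0 ws v < n" "vs ! apply_tab A0 ws v = apply_word (ext_fun sg G (vs ! 0)) ws (vs ! v)" by auto
 have e: "apply_tab A0 (a # ws) v = A0 (In a) (apply_tab A0 ws v)" by (simp add: apply_tab_def)
 show ?case unfolding e using A0_less[OF IH(1)] A0_ext[OF _ IH(1), of a] IH(2) Cons.prems by (simp add: apply_word_def del: table_simps)
qed

lemma nth_words: "t < q ==> awords sg D ! t : words {..nf sg} D" using awords_props[of sg D] by (metis nth_mem)

lemma tv_word: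
 assumes "t < q" "v < n"
 shows "tv t v < n" "vs ! tv t v = apply_word (ext_fun sg G (vs ! 0)) (awords sg D ! t) (vs ! v)"
 using apply_tab_word[OF _ assms(2), of "awords sg D ! t"] nth_words[OF assms(1)] by (auto simp: val_def words_def)

lemma tv_index: "ws : words {..nf sg} D ==> index_of (awords sg D) ws < q & tv (index_of (awords sg D) ws) v = apply_tab A0 ws v"
 using index_of[of ws "awords sg D"] awords_props[of sg D] by (simp add: val_def)

lemma apply_tab_pad: "v < n ==> apply_tab A0 (ws @ replicate m 0) v = apply_tab A0 ws v"
proof -
 assume v: "v < n"
 have "foldr (%a. A0 (In a)) (replicate m 0) v = v" using A0_0[OF v] by (induction m) (simp_all del: table_simps)
 then show ?thesis by (simp add: apply_tab_def del: table_simps)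
qed

lemma tv_id: "EX t<q. ALL v<n. tv t v = v"
proof -
 have "replicate D 0 : words {..nf sg} D" by (auto simp: words_def)
 from tv_index[OF this] show ?thesis
  using apply_tab_pad[of _ "[]" D] by (intro exI[of _ "index_of (awords sg D) (replicate D 0)"]) (simp add: apply_tab_def del: table_simps)
qed

lemma tv_fun: "i <= nf sg ==> EX t<q. ALL v<n. tv t v = A0 (In i) v"
proof -
 assume i: "i <= nf sg"
 have "[i] @ replicate (D - 1) 0 : words {..nf sg} D" using i D by (auto simp: words_def)
 from tv_index[OF this] show ?thesis using apply_tab_pad[of _ "[i]" "D - 1"]
  by (intro exI[of _ "index_of (awords sg D) ([i] @ replicate (D - 1) 0)"]) (simp add: apply_tab_def del: table_simps append.simps)
qed

lemma tv_const: "EX t<q. ALL v<n. tv t v = 0"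
proof -
 obtain t where t: "t < q" "ALL v<n. tv t v = A0 (In (nf sg)) v" using tv_fun by blast
 then show ?thesis by auto
qed

lemma Nb_edge:
 assumes "a < n" "b : Nb n q tv a"
 shows "b < n" "vs ! a ~= vs ! b" "{vs ! a, vs ! b} : snd Tg"
proof -
 obtain i j y where y: "b ~= a" "i < q" "j < q" "y < n" "tv i y = a" "tv j y = b" using assms(2) by (auto simp: Nb_def)
 show bn: "b < n" using tv_word(1)[OF y(3,4)] y(6) by simp
 show ne: "vs ! a ~= vs ! b" using y(1) bn assms(1) vs(1) by (simp add: nth_eq_iff_index_eq)
 show "{vs ! a, vs ! b} : snd Tg" unfolding trace_graph_def snd_conv
  using ne tv_word(2)[OF y(2,4)] tv_word(2)[OF y(3,4)] nth_words[OF y(2)] nth_words[OF y(3)] nth_univ[OF y(4)] unfolding y(5,6)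
  by (intro CollectI exI[of _ "vs ! a"] exI[of _ "vs ! b"] conjI refl bexI[of _ "vs ! y"]
    bexI[of _ "awords sg D ! i"] bexI[of _ "awords sg D ! j"]) assumption+
qed

text \<open>Depth 0 minors of the trace graph, seen through vertex numbers. The number
  \<open>d\<close> of arrays for later neighbours comes from here.\<close>

lemma degenerate:
 assumes g: "!!r. grad r (underlying sg G) <= real (g r)" and S: "S <= {..<n}" "S ~= {}"
 shows "EX v:S. card (Nb n q tv v Int S) <= 2 * dens sg g D 0"
proof -
 have ne: "0 < n" using S by auto
 have Sv: "(!) vs ` S <= fst Tg" "(!) vs ` S ~= {}" using S nth_univ by (auto simp: trace_graph_def)
 have fin: "finite (fst Tg)" using G by (simp add: trace_graph_def Fun_def)
 obtain v where v: "v : S" "card {w : (!) vs ` S. w ~= vs ! v & {vs ! v, w} : snd Tg} <= 2 * dens sg g D 0"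
  using degenerate_of_shallow_minor_edges[OF fin trace_graph_dens[OF sg G g nth_univ[OF ne]] Sv] by auto
 have vn: "v < n" using v(1) S(1) by auto
 have inj: "inj_on ((!) vs) (Nb n q tv v Int S)" by (rule inj_onI) (use S(1) vs(1) nth_eq_iff_index_eq in blast)
 have "card (Nb n q tv v Int S) = card ((!) vs ` (Nb n q tv v Int S))" using card_image[OF inj] by simp
 also have "... <= card {w : (!) vs ` S. w ~= vs ! v & {vs ! v, w} : snd Tg}"
 proof (rule card_mono)
  show "finite {w : (!) vs ` S. w ~= vs ! v & {vs ! v, w} : snd Tg}" using finite_subset[OF S(1)] by simp
  show "(!) vs ` (Nb n q tv v Int S) <= {w : (!) vs ` S. w ~= vs ! v & {vs ! v, w} : snd Tg}"
  proof
   fix w assume "w : (!) vs ` (Nb n q tv v Int S)"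
   then obtain b where b: "w = vs ! b" "b : Nb n q tv v" "b : S" by blast
   show "w : {w : (!) vs ` S. w ~= vs ! v & {vs ! v, w} : snd Tg}"
    using Nb_edge(2,3)[OF vn b(2)] b(1,3) by (intro CollectI conjI) (auto simp del: insert_iff)
  qed
 qed
 finally show ?thesis using v by (intro bexI[of _ v]) simp_all
qed

end

section \<open>Terms as words, and formulas on vertex numbers\<close>

fun term_word :: "signature => tm => nat list" where
 "term_word sg (Var i) = []"
| "term_word sg (App f t) = index_of (sfuns sg) f # term_word sg t"

text \<open>The length of the encoded formula bounds the length of all its terms, so padding them to
  \<open>D\<close> is possible.\<close>

definition tidx :: "signature => nat => tm => nat" where
 "tidx sg D t = index_of (awords sg D) (term_word sg t @ replicate (D - length (term_word sg t)) 0)"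

lemma length_term_word: "length (term_word sg t) <= length (enc_tm t)" by (induction t) auto

lemma length_atoms: "length (atoms ph) <= length (enc_fm ph)" by (induction ph) auto

context listing begin

lemma term_word_set: "tm_over sg X t ==> set (term_word sg t) <= {..<nf sg} & tvar t : X"
proof (induction t)
 case (App f t)
 have "f : set (sfuns sg)" using App.prems sfuns_props(1)[OF sg] by simp
 from index_of(1)[OF this] show ?case using App sfuns_props(2)[OF sg] by simp
qed simp

lemma tidx_less: "tm_over sg X t ==> length (enc_tm t) <= D ==> tidx sg D t < q"
 unfolding tidx_def using term_word_set[of X t] length_term_word[of sg t] by (intro conjunct1[OF tv_index]) (auto simp: words_def)

lemma term_value:
 assumes t: "tm_over sg X t" "length (enc_tm t) <= D" and a: "!!x. x : X ==> a x : univ G"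
 shows "tm_val G a t : univ G" "index_of vs (tm_val G a t) = tv (tidx sg D t) (index_of vs (a (tvar t)))"
proof -
 let ?i = "index_of vs (a (tvar t))"
 have "a (tvar t) : univ G" using a term_word_set[OF t(1)] by blast
 then have i: "?i < n" "vs ! ?i = a (tvar t)" using index_of vs(2) by metis+
 have "term_word sg t @ replicate (D - length (term_word sg t)) 0 : words {..nf sg} D"
  using term_word_set[OF t(1)] length_term_word[of sg t] t(2) by (auto simp: words_def)
 then have e: "tv (tidx sg D t) ?i = apply_tab A0 (term_word sg t) ?i" using tv_index apply_tab_pad[OF i(1)] unfolding tidx_def by metis
 have "tm_val G a t = apply_word (ext_fun sg G (vs ! 0)) (term_word sg t) (a (tvar t))" using t(1)
 proof (induction t)
  case (App f t)
  then have "f : set (sfuns sg)" using sfuns_props(1)[OF sg] by simp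
  from index_of[OF this] show ?case using App sfuns_props(2)[OF sg] by (simp add: apply_word_def ext_fun_def)
 qed (simp add: apply_word_def)
 moreover have sub: "set (term_word sg t) <= {..nf sg}" using term_word_set[OF t(1)] by auto
 ultimately have v: "tm_val G a t = vs ! apply_tab A0 (term_word sg t) ?i" and l: "apply_tab A0 (term_word sg t) ?i < n"
  using apply_tab_word[OF sub i(1)] i(2) by simp_all
 show "tm_val G a t : univ G" unfolding v by (rule nth_univ[OF l])
 show "index_of vs (tm_val G a t) = tv (tidx sg D t) ?i" unfolding v e by (rule index_of_nth[OF vs(1) l])
qed

lemma atoms_ok:
 assumes "fm_over sg {0..k} ph" "length (enc_fm ph) <= D"
 shows "ALL \<alpha>:set (atoms ph). atom_ok (tidx sg D) (psig sg) q k \<alpha>" using assms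
proof (induction ph)
 case (Eq s t)
 then show ?case using tidx_less[of "{0..k}"] term_word_set[of "{0..k}" s] term_word_set[of "{0..k}" t] by auto
next
 case (Pred p t)
 then show ?case using tidx_less[of "{0..k}"] term_word_set[of "{0..k}" t] by auto
qed auto

lemma sat_holds:
 assumes "fm_over sg {0..k} ph" "length (enc_fm ph) <= D" and a: "!!x. x : {0..k} ==> a x : univ G"
  and pr: "!!p v. p : psig sg ==> v : univ G ==> pr p (index_of vs v) = pint G p v"
 shows "sat G a ph = holds (%t. tv (tidx sg D t) (index_of vs (a (tvar t)))) pr ph" using assms(1,2)
proof (induction ph)
 case (Eq s t)
 have s: "tm_val G a s : univ G" "index_of vs (tm_val G a s) = tv (tidx sg D s) (index_of vs (a (tvar s)))"
  using term_value[of "{0..k}" s a] Eq a by auto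
 have t: "tm_val G a t : univ G" "index_of vs (tm_val G a t) = tv (tidx sg D t) (index_of vs (a (tvar t)))"
  using term_value[of "{0..k}" t a] Eq a by auto
 have "tm_val G a s = tm_val G a t = (index_of vs (tm_val G a s) = index_of vs (tm_val G a t))"
  using s(1) t(1) index_of(2) vs(2) by metis
 then show ?case using s(2) t(2) by simp
next
 case (Pred p t)
 have t: "tm_val G a t : univ G" "index_of vs (tm_val G a t) = tv (tidx sg D t) (index_of vs (a (tvar t)))"
  using term_value[of "{0..k}" t a] Pred a by auto
 show ?case using pr[OF _ t(1), of p, unfolded t(2)] Pred.prems(1) by simp
qed auto

end

section \<open>Enumeration of paths, contexts and new symbols\<close>

definition lists_upto :: "nat => nat => nat list list" where
 "lists_upto J N = concat (map (%m. List.n_lists m [0..<J]) [0..<Suc N])"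

lemma set_lists_upto: "set (lists_upto J N) = {p. length p <= N & set p <= {..<J}}"
 by (auto simp: lists_upto_def set_n_lists less_Suc_eq_le atLeast0LessThan simp del: upt_Suc)

lemma length_lists_upto:
 assumes "1 <= J" shows "length (lists_upto J N) <= (N + 1) * J ^ N"
proof -
 have "length (lists_upto J N) = (\<Sum>m<Suc N. J ^ m)"
  by (simp add: lists_upto_def length_concat comp_def length_n_lists interv_sum_list_conv_sum_set_nat atLeast0LessThan del: upt_Suc)
 also have "... <= (\<Sum>m<Suc N. J ^ N)" by (intro sum_mono power_increasing) (use assms in auto)
 finally show ?thesis by simp
qed

lemma paths_ok_lists_upto: "paths_ok (lists_upto J N)"
proof -
 have d: "sorted_wrt (%p p'. length p <= length p' & p ~= p') (List.n_lists m [0..<J])" for m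
 proof -
  have "distinct (List.n_lists m [0..<J])" by (rule distinct_n_lists) simp
  moreover have "ALL p:set (List.n_lists m [0..<J]). length p = m" by (simp add: set_n_lists)
  ultimately show ?thesis
  proof (induction "List.n_lists m [0..<J]")
   case Nil
   then show ?case by simp
  next
   case (Cons p ps)
   have "sorted_wrt (%p p'. length p <= length p' & p ~= p') xs" if "distinct xs" "ALL p:set xs. length p = m" for xs :: "nat list list"
    using that by (induction xs) auto
   then show ?case using Cons.prems by blast
  qed
 qed
 have "sorted_wrt (%p p'. length p <= length p' & p ~= p') (concat (map (%m. List.n_lists m [0..<J]) [0..<N]))" for N
  by (induction N) (auto simp: sorted_wrt_append d set_n_lists)
 then show ?thesis unfolding paths_ok_def lists_upto_def by blast
qed

definition all_links :: "nat => nat => nat => links" where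
 "all_links d q k = List.product [0..<Suc d] (List.product [0..<q] [1..<Suc k])"

text \<open>A context is a choice of subsets. \<open>subseqs\<close> lists them as sublists in a
  fixed order, which is what \<open>filter\<close> yields when a context is read off a
  clause.\<close>

definition all_ctxs :: "nat => nat => nat => fm => ctx list" where
 "all_ctxs d q k ph = List.product [0..<q] (List.product (subseqs (all_links d q k)) (subseqs (remdups (atoms ph))))"

text \<open>The arrays that a clause has to mention: words, later neighbours and slots. Counts and
  weights are numbers and not vertices, so they stay outside the structure.\<close>

definition syms :: "nat => nat => ctx list => nat list list => nat => aname list" where
 "syms q d kps ps J = map Tau [0..<q] @ map Hn [0..<Suc d] @
   concat (map (%kp. concat (map (%p. map (%j. Slot kp (p @ [j])) [0..<J]) ps)) kps)"

lemma set_all_links: "set (all_links d q k) = {(l, t, j). l <= d & t < q & j : {1..k}}" by (auto simp: all_links_def less_Suc_eq_le simp del: upt_Suc)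

lemma distinct_all_ctxs: "distinct (all_ctxs d q k ph)"
proof -
 have "distinct (all_links d q k)" by (simp add: all_links_def distinct_product del: upt_Suc)
 then have "distinct (subseqs (all_links d q k))" "distinct (subseqs (remdups (atoms ph)))"
  using distinct_set_subseqs distinct_map distinct_remdups by metis+
 then show ?thesis by (simp add: all_ctxs_def distinct_product)
qed

lemma length_all_ctxs: "length (all_ctxs d q k ph) <= q * (2 ^ ((d + 1) * q * k) * 2 ^ length (enc_fm ph))"
proof -
 have "length (remdups (atoms ph)) <= length (enc_fm ph)" using length_remdups_leq length_atoms order.trans by metis
 then have "2 ^ length (remdups (atoms ph)) <= (2 :: nat) ^ length (enc_fm ph)" by (intro power_increasing) auto
 moreover have "length (all_links d q k) = (d + 1) * q * k" by (simp add: all_links_def length_product algebra_simps del: upt_Suc)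
 ultimately show ?thesis by (simp add: all_ctxs_def length_product length_subseqs del: upt_Suc)
qed

lemma set_syms: "set (syms q d kps ps J) = Tau ` {..<q} Un Hn ` {..d} Un {Slot kp (p @ [j]) | kp p j. kp : set kps & p : set ps & j < J}"
 unfolding syms_def set_append set_map set_concat set_upt atLeast0LessThan lessThan_Suc_atMost image_image by blast

lemma length_syms: "length (syms q d kps ps J) = q + (d + 1) + length kps * (length ps * J)"
proof -
 have "length (concat (map (%p. map (%j. Slot kp (p @ [j])) [0..<J]) ps)) = length ps * J" for kp by (induction ps) auto
 then have "length (concat (map (%kp. concat (map (%p. map (%j. Slot kp (p @ [j])) [0..<J]) ps)) kps)) = length kps * (length ps * J)"
  by (induction kps) auto
 then show ?thesis by (simp add: syms_def)
qed

text \<open>New symbols are numbered from \<open>s0\<close> on. Symbols without an array of their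
  own become the identity \<open>Hn 0\<close> and add no edges.\<close>

definition farr :: "signature => nat => aname list => nat => aname" where
 "farr sg s0 sy f = (if f : fsig sg then In (index_of (sfuns sg) f)
   else if s0 <= f & f - s0 < length sy then sy ! (f - s0) else Hn 0)"

text \<open>The array at position \<open>nf \<sigma>\<close> is that of the constant function, so it is zero throughout.\<close>

definition parr :: "signature => nat => aname" where
 "parr sg p = (if p : psig sg then Pr p else In (nf sg))"

definition expand :: "signature => nat => aname list => 'v list => 'v fstruct => (aname => nat => nat) => 'v fstruct" where
 "expand sg s0 sy vs G A = \<lparr>univ = univ G, fint = %f v. vs ! A (farr sg s0 sy f) (index_of vs v),
   pint = %p v. A (parr sg p) (index_of vs v) ~= 0\<rparr>"

locale arrays = listing sg G vs D for sg :: signature and G :: "'v fstruct" and vs D +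
 fixes ph :: fm and k d K J s0 F Pn :: nat and A :: "aname => nat => nat" and L :: "nat list"
  and sy :: "aname list" and kps :: "ctx list" and ps :: "nat list list" and rh :: signature
 assumes A_In: "!!i. A (In i) = table sg vs G (In i)" and A_Pr: "!!p. A (Pr p) = table sg vs G (Pr p)"
  and A_Tau: "!!t v. t < Suc (nf sg) ^ D ==> v < length vs ==> A (Tau t) v = val sg vs G D t v"
  and A_Hn0: "!!v. v < length vs ==> A (Hn 0) v = v"
  and L: "distinct L" "set L = {..<length vs}"
  and A_Hn: "!!i. i < length vs ==> insert (L ! i) (set (map (%h. A h (L ! i)) (hs_of d))) =
    insert (L ! i) (Nb (length vs) (Suc (nf sg) ^ D) (val sg vs G D) (L ! i) - set (take i L))"
  and A_good: "!!kp w p. kp : set kps ==> w < length vs ==> p : set ps ==>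
    good (tidx sg D) ph (length vs) (Suc (nf sg) ^ D) (val sg vs G D) K J A kp p w"
  and kps_lt: "!!kp. kp : set kps ==> fst kp < Suc (nf sg) ^ D"
  and sy: "sy = syms (Suc (nf sg) ^ D) d kps ps J"
  and s0: "!!f. f : fsig sg ==> f < s0" and F: "s0 + length sy <= F" and Pn: "!!p. p : psig sg ==> p < Pn" "1 <= Pn"
  and rh: "rh = sig F Pn"
begin

abbreviation "G' \<equiv> expand sg s0 sy vs G A"
abbreviation "symb \<equiv> %a. s0 + index_of sy a"

lemma val_Nb: "t < q ==> v < n ==> tv t v = v \<or> tv t v : Nb n q tv v"
proof -
 assume t: "t < q" and v: "v < n"
 obtain t' where "t' < q" "tv t' v = v" using tv_id v by auto
 then show ?thesis using t v unfolding Nb_def by blast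
qed

text \<open>Every function of the expansion leads from \<open>v\<close> to \<open>v\<close> or to a
  neighbour in the trace graph: words because the identity is a word too, \<open>Hn\<close> by
  construction, and slots because a frequent value is shared with a vertex that also has the value
  \<open>v\<close>. So the expansion has no edges beyond the trace graph.\<close>

lemma A_value:
 assumes v: "v < n" and a: "a : In ` {..nf sg} Un set sy"
 shows "A a v < n & (A a v = v \<or> A a v : Nb n q tv v)"
proof -
 have "A a v = v \<or> A a v : Nb n q tv v"
 proof -
  consider i where "a = In i" "i <= nf sg" | t where "a = Tau t" "t < q" | l where "a = Hn l" "l <= d"
   | kp p j where "a = Slot kp (p @ [j])" "kp : set kps" "p : set ps" "j < J" using a unfolding sy set_syms by auto
  then show ?thesis
  proof cases
   case 1
   then obtain t where "t < q" "tv t v = A (In i) v" using tv_fun[OF 1(2)] v A_In by metis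
   then show ?thesis using val_Nb v 1(1) by metis
  next
   case 2
   then show ?thesis using val_Nb[OF 2(2) v] A_Tau[OF 2(2) v] by simp
  next
   case 3
   obtain i where i: "i < n" "L ! i = v"
   proof -
    have "v : set L" "length L = n" using L v distinct_card[OF L(1)] by auto
    then show thesis using that by (metis in_set_conv_nth)
   qed
   have "later d A v = insert v (Nb n q tv v - set (take i L))"
    by (rule later_eq[where A = A and w = v]) (use A_Hn0[OF v] A_Hn[OF i(1)] i(2) in simp_all)
   moreover have "A (Hn l) v : later d A v" using 3(2) by (auto simp: later_def)
   ultimately show ?thesis using 3(1) by auto
  next
   case 4
   have "A a v = v \<or> (EX y:Yset (tidx sg D) ph n q tv A kp p v. EX t<q. tv t y = A a v)"
    using A_good[OF 4(2) v 4(3)] 4(4) unfolding good_def Let_def 4(1) by blast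
   then show ?thesis using kps_lt[OF 4(2)] unfolding Nb_def Yset_def by blast
  qed
 qed
 then show ?thesis using Nb_edge(1)[OF v] v by auto
qed

lemma farr_mem: "farr sg s0 sy f : In ` {..nf sg} Un set sy"
proof -
 have "Hn 0 : set sy" by (auto simp: sy set_syms)
 moreover have "index_of (sfuns sg) f <= nf sg" if "f : fsig sg" using index_of(1)[of f "sfuns sg"] sfuns_props(1,2)[OF sg] that by simp
 ultimately show ?thesis by (auto simp: farr_def)
qed

lemma farr_sym:
 assumes "a : set sy"
 shows "farr sg s0 sy (symb a) = a" "symb a < F" using index_of[OF assms] s0[of "symb a"] F by (auto simp: farr_def)

lemma univ_index: "v : univ G ==> index_of vs v < n & vs ! index_of vs v = v" using index_of vs(2) by metis

lemma expand_simps: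
 "univ G' = univ G" "fint G' f v = vs ! A (farr sg s0 sy f) (index_of vs v)" "pint G' p v = (A (parr sg p) (index_of vs v) ~= 0)"
 by (simp_all add: expand_def)

lemma expand_fint: "f : fsig sg ==> v : univ G ==> fint G' f v = fint G f v"
proof -
 assume f: "f : fsig sg" and v: "v : univ G"
 have i: "index_of (sfuns sg) f < nf sg" "sfuns sg ! index_of (sfuns sg) f = f" using index_of[of f "sfuns sg"] sfuns_props(1,2)[OF sg] f by auto
 have "A (farr sg s0 sy f) (index_of vs v) = index_of vs (fint G f v)" using i univ_index[OF v] f by (simp add: farr_def A_In)
 then show ?thesis using univ_index[OF fint_univ[OF f v]] by (simp add: expand_simps)
qed

lemma expand_Fun: "G' : Fun rh"
proof -
 have "fint G' f v : univ G" if "v : univ G" for f v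
  unfolding expand_simps using A_value[OF conjunct1[OF univ_index[OF that]] farr_mem] nth_univ by blast
 moreover have "fint G' 0 v = v" if "v : univ G" for v using expand_fint[of 0 v] that sg G by (auto simp: functional_signature_def Fun_def)
 ultimately show ?thesis using G by (auto simp: Fun_def expand_simps(1))
qed

lemma expand_is_expansion: "is_expansion sg G G'" using expand_fint univ_index by (auto simp: is_expansion_def expand_simps(1,3) parr_def A_Pr)

lemma expand_edges: "snd (underlying rh G') <= snd Tg"
proof
 fix e assume "e : snd (underlying rh G')"
 then obtain x v where e: "e = {x, v}" "(x, v) : arcs rh G'" "x ~= v" unfolding underlying_def snd_conv by blast
 then obtain f where f: "fint G' f v = x" "v : univ G" unfolding arcs_def by (auto simp: expand_simps(1))
 define a where "a = index_of vs v"
 define b where "b = A (farr sg s0 sy f) a"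
 have a: "a < n" "vs ! a = v" using univ_index[OF f(2)] by (simp_all add: a_def)
 have x: "x = vs ! b" using f(1) by (simp add: expand_simps b_def a_def)
 have "b ~= a" using x a e(3) by auto
 then have "b : Nb n q tv a" using A_value[OF a(1) farr_mem[of f]] by (simp add: b_def)
 from Nb_edge(3)[OF a(1) this] show "e : snd Tg" unfolding e(1) x a(2) by (simp add: insert_commute)
qed

lemma enc_expand:
 "enc_struct rh vs G' = n # concat (map (%a. map (A a) [0..<n]) (map (farr sg s0 sy) [0..<F] @ map (parr sg) [0..<Pn]))"
proof -
 have vsm: "map h vs = map (%i. h (vs ! i)) [0..<n]" for h :: "'v => nat" by (rule nth_equalityI) simp_all
 have f: "map (%v. index_of vs (fint G' f v)) vs = map (A (farr sg s0 sy f)) [0..<n]" for f unfolding vsm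
 proof (rule map_cong[OF refl])
  fix i assume "i : set [0..<n]"
  then have i: "i < n" by simp
  then have "A (farr sg s0 sy f) i < n" using A_value farr_mem by blast
  then show "index_of vs (fint G' f (vs ! i)) = A (farr sg s0 sy f) i" by (simp add: expand_simps index_of_nth[OF vs(1)] i)
 qed
 have p: "map (%v. of_bool (pint G' p v)) vs = map (A (parr sg p)) [0..<n]" for p unfolding vsm
 proof (rule map_cong[OF refl])
  fix i assume "i : set [0..<n]"
  then show "of_bool (pint G' p (vs ! i)) = A (parr sg p) i" by (auto simp: expand_simps index_of_nth[OF vs(1)] parr_def A_Pr A_In)
 qed
 have "sorted_list_of_set {..<m} = [0..<m]" for m :: nat by (simp add: lessThan_atLeast0)
 then show ?thesis unfolding enc_struct_def rh sig_def signature.simps f p by (simp add: comp_def)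
qed

text \<open>A satisfied clause decides all equations in its range, and different vertices have
  different numbers; so what it records can be tested in the arrays.\<close>

lemma eqv_iff:
 assumes om: "om : set (clauses F Pn k)" "sat G' u om" and a: "a : set sy"
  and s: "s < q" "t < q" and ij: "i : {1..k}" "j : {1..k}" and u: "!!i. i : {1..k} ==> u i : univ G"
 shows "eqv symb om a s i t j = (A a (tv s (index_of vs (u i))) = tv t (index_of vs (u j)))"
proof -
 have T: "Tau s : set sy" "Tau t : set sy" using s by (auto simp: sy set_syms)
 have ui: "index_of vs (u i) < n" "index_of vs (u j) < n" using univ_index u ij by blast+
 have v: "tv s (index_of vs (u i)) < n" "tv t (index_of vs (u j)) < n" using tv_word(1) s ui by blast+
 have av: "A a (tv s (index_of vs (u i))) < n" using A_value[OF v(1)] a by blast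
 have "eqv symb om a s i t j = (fint G' (symb a) (fint G' (symb (Tau s)) (u i)) = fint G' (symb (Tau t)) (u j))"
  unfolding eqv_def by (rule pos_Eq[OF om]) (use farr_sym(2)[OF a] farr_sym(2)[OF T(1)] farr_sym(2)[OF T(2)] ij Pn(2) in auto)
 also have "... = (vs ! A a (tv s (index_of vs (u i))) = vs ! tv t (index_of vs (u j)))"
  unfolding expand_simps farr_sym(1)[OF a] farr_sym(1)[OF T(1)] farr_sym(1)[OF T(2)] A_Tau[OF s(1) ui(1)] A_Tau[OF s(2) ui(2)]
   index_of_nth[OF vs(1) v(1)] ..
 also have "... = (A a (tv s (index_of vs (u i))) = tv t (index_of vs (u j)))"
  using av v(2) vs(1) by (simp add: nth_eq_iff_index_eq)
 finally show ?thesis .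
qed

lemma pred_iff:
 assumes om: "om : set (clauses F Pn k)" "sat G' u om" and p: "p : psig sg"
  and t: "t < q" and i: "i : {1..k}" and u: "u i : univ G"
 shows "Pred p (App (symb (Tau t)) (Var i)) : pos om \<longleftrightarrow> A (Pr p) (tv t (index_of vs (u i))) ~= 0"
proof -
 have T: "Tau t : set sy" using t by (auto simp: sy set_syms)
 have ui: "index_of vs (u i) < n" using univ_index u by blast
 have v: "tv t (index_of vs (u i)) < n" using tv_word(1) t ui by blast
 have "Pred p (App (symb (Tau t)) (Var i)) : pos om \<longleftrightarrow> pint G' p (fint G' (symb (Tau t)) (u i))"
  by (rule pos_Pred[OF om]) (use farr_sym(2)[OF T] Pn(1)[OF p] i in auto)
 also have "... = (A (Pr p) (tv t (index_of vs (u i))) ~= 0)"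
  unfolding expand_simps farr_sym(1)[OF T] A_Tau[OF t ui] index_of_nth[OF vs(1) v] using p by (simp add: parr_def)
 finally show ?thesis .
qed

lemma count_index:
 assumes "fm_over sg {0..k} ph" "length (enc_fm ph) <= D" and u: "!!i. i : {1..k} ==> u i : univ G"
 shows "count_sat G ph u = card {y. y < n & holds (%t. tv (tidx sg D t) (if tvar t = 0 then y else index_of vs (u (tvar t))))
  (%p v. A (Pr p) v ~= 0) ph}" (is "_ = card ?Y")
proof -
 have "sat G (u(0 := vs ! y)) ph = (holds (%t. tv (tidx sg D t) (if tvar t = 0 then y else index_of vs (u (tvar t))))
  (%p v. A (Pr p) v ~= 0) ph)" if y: "y < n" for y
 proof -
  have e: "index_of vs ((u(0 := vs ! y)) (tvar t)) = (if tvar t = 0 then y else index_of vs (u (tvar t)))" for t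
   using index_of_nth[OF vs(1) y] by simp
  show ?thesis unfolding e[symmetric]
  proof (rule sat_holds[OF assms(1,2)])
   fix x assume "x : {0..k}"
   then show "(u(0 := vs ! y)) x : univ G" using nth_univ[OF y] u[of x] by (cases "x = 0") auto
  next
   fix p v assume "p : psig sg" "v : univ G"
   then show "(A (Pr p) (index_of vs v) ~= 0) = pint G p v" using univ_index by (simp add: A_Pr)
  qed
 qed
 then have "{v : univ G. sat G (u(0 := v)) ph} = (!) vs ` ?Y" using univ_index nth_univ by (force simp: image_iff)
 moreover have "inj_on ((!) vs) ?Y" by (rule inj_onI) (use vs(1) in "auto simp: nth_eq_iff_index_eq")
 ultimately show ?thesis by (simp add: count_sat_def card_image)
qed

end

section \<open>Assembling the result\<close>

lemma computes_within_mono: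
 assumes "computes_within T W P xs ys" "T <= T'" "W <= W'"
 shows "computes_within T' W' P xs ys"
proof -
 have wb: "word_bounded W c ==> word_bounded W' c" for c using assms(3) order.trans by (cases c) fastforce
 obtain t where t: "t <= T" "halted P ((step (%_. 0) P ^^ t) (init_config xs))"
  "result ((step (%_. 0) P ^^ t) (init_config xs)) = ys"
  "ALL s<=t. word_bounded W ((step (%_. 0) P ^^ s) (init_config xs))" using assms(1) unfolding computes_within_def by blast
 show ?thesis unfolding computes_within_def by (intro exI[of _ t] conjI) (use t assms(2) wb in auto)
qed

text \<open>The class may depend on the formula but not on the given structure. It admits every
  interpretation whose edges lie in a trace graph, because bounded expansion concerns the edges
  only. Empty universes come separately, since they offer no \<open>v0\<close>.\<close>

definition wide_graphs :: "signature => 'v fstruct set => nat => signature => 'v fstruct set" where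
 "wide_graphs sg C D rh = {G' : Fun rh. univ G' = {} \<or> (EX G:C. EX v0:univ G. univ G' = univ G &
   snd (underlying rh G') <= snd (trace_graph (univ G) (ext_fun sg G v0) {..nf sg} D))}"

text \<open>Each member with a nonempty universe lies in a trace graph on the same vertices, and
  \<open>dens\<close> does not depend on which one.\<close>

lemma bounded_expansion_wide_graphs:
 assumes sg: "functional_signature sg" and C: "C <= Fun sg" and g: "expansion_bound sg C g"
 shows "bounded_expansion rh (wide_graphs sg C D rh)" unfolding bounded_expansion_def
proof (rule exI[of _ "dens sg g D"], unfold expansion_bound_def, intro allI ballI)
 fix r G' assume G': "G' : wide_graphs sg C D rh"
 have fin: "finite (fst (underlying rh G'))" using G' by (simp add: wide_graphs_def Fun_def underlying_def)
 show "grad r (underlying rh G') <= real (dens sg g D r)"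
 proof (rule grad_leI[OF fin])
  fix H assume H: "shallow_minor r (underlying rh G') H"
  show "card (snd H) <= dens sg g D r * card (fst H)"
  proof (cases "univ G' = {}")
   case True
   have "~ B : fst H" for B
   proof
    assume "B : fst H"
    then have "branch_set r (underlying rh G') B" using H by (simp add: shallow_minor_def)
    then show False using True by (auto simp: branch_set_def underlying_def)
   qed
   then have "snd H = {}" using H by (auto simp: shallow_minor_def)
   then show ?thesis by simp
  next
   case False
   then obtain G v0 where G: "G : C" "v0 : univ G" "univ G' = univ G"
    "snd (underlying rh G') <= snd (trace_graph (univ G) (ext_fun sg G v0) {..nf sg} D)" using G' unfolding wide_graphs_def by blast
   have gG: "grad r (underlying sg G) <= real (g r)" for r using g G(1) by (simp add: expansion_bound_def)
   have "shallow_minor r (trace_graph (univ G) (ext_fun sg G v0) {..nf sg} D) H"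
    by (rule shallow_minor_mono[OF H _ G(4)]) (simp add: underlying_def trace_graph_def G(3))
   then show ?thesis by (rule trace_graph_dens[OF sg subsetD[OF C G(1)] gG G(2)])
  qed
 qed
qed

lemma table_input:
 assumes "functional_signature sg"
 shows "enc_struct sg vs G = length vs # concat (map (%a. map (table sg vs G a) [0..<length vs])
   (map In [0..<nf sg] @ map Pr (sorted_list_of_set (psig sg))))"
proof -
 have vsm: "map h vs = map (%i. h (vs ! i)) [0..<length vs]" for h :: "'a => nat" by (rule nth_equalityI) simp_all
 have sf: "map h (sfuns sg) = map (%i. h (sfuns sg ! i)) [0..<nf sg]" for h :: "nat => nat list"
  by (rule nth_equalityI) (simp_all add: sfuns_props(2)[OF assms])
 have f: "map (%f. map (%v. index_of vs (fint G f v)) vs) (sfuns sg) = map (%i. map (table sg vs G (In i)) [0..<length vs]) [0..<nf sg]"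
  unfolding sf vsm by simp
 have "set (sorted_list_of_set (psig sg)) = psig sg" using assms by (simp add: functional_signature_def)
 then have p: "map (%p. map (%v. of_bool (pint G p v)) vs) (sorted_list_of_set (psig sg)) =
   map (%p. map (table sg vs G (Pr p)) [0..<length vs]) (sorted_list_of_set (psig sg))"
  unfolding vsm by simp
 show ?thesis unfolding enc_struct_def sfuns_def[symmetric] f p by (simp add: comp_def)
qed

lemma concat_tables:
 fixes h :: "aname => nat => nat"
 shows "length (n # concat (map (%a. map (h a) [0..<n]) ins)) = Suc (length ins * n)"
  and "j < length ins ==> v < n ==> (n # concat (map (%a. map (h a) [0..<n]) ins)) ! Suc (j * n + v) = h (ins ! j) v"
proof -
 have "map (%a. map (h a) [0..<n]) ins = map (%j. map (h (ins ! j)) [0..<n]) [0..<length ins]" by (rule nth_equalityI) auto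
 then have e: "concat (map (%a. map (h a) [0..<n]) ins) = map (%i. h (ins ! (i div n)) (i mod n)) [0..<length ins * n]" by (simp add: concat_map_upt)
 show "length (n # concat (map (%a. map (h a) [0..<n]) ins)) = Suc (length ins * n)" unfolding e by simp
 assume j: "j < length ins" "v < n"
 have "j * n + v < Suc j * n" using j(2) by simp
 also have "... <= length ins * n" using j(1) by (intro mult_le_mono1) simp
 finally have "j * n + v < length ins * n" .
 then show "(n # concat (map (%a. map (h a) [0..<n]) ins)) ! Suc (j * n + v) = h (ins ! j) v" unfolding e using j by simp
qed

lemma enc_weights_product:
 "enc_weights oms k vs c = concat (map (%(om, i). map (c om i) vs) (List.product oms [1..<Suc k]))"
 unfolding enc_weights_def by (induction oms) (auto simp: comp_def simp del: upt_Suc)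

text \<open>\<open>F\<close> and \<open>Pn\<close> are only required to be large enough. So the
  signature can be sized by an expression that is easy to evaluate instead of by the exact number of
  symbols.\<close>

lemma fixed_formula:
 fixes C :: "'v fstruct set" and eps :: real
 assumes sg: "functional_signature sg" and C: "C <= Fun sg" and g: "expansion_bound sg C g"
  and E: "0 < eps" "(1 + eps) / eps <= real E" and k: "1 <= k" and ph: "fm_over sg {0..k} ph"
  and Dl: "D = Suc (length (enc_fm ph))" and q: "q = Suc (nf sg) ^ D" and d: "d = 2 * dens sg g D 0"
  and K: "K = k * q * E" and J: "J = q * K"
  and F: "s0 + length (syms q d (all_ctxs d q k ph) (lists_upto J (k * q)) J) <= F" and s0: "!!f. f : fsig sg ==> f < s0"
  and Pn: "!!p. p : psig sg ==> p < Pn" "1 <= Pn"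
 defines "rh \<equiv> sig F Pn" and "Om \<equiv> clauses F Pn k"
 shows "EX (Q :: instr list) (b :: nat). ALL G:C. ALL vs. distinct vs & set vs = univ G -->
    (EX G':wide_graphs sg C D rh. EX c :: fm => nat => 'v => nat.
    is_expansion sg G G' &
    computes_within (b * (struct_size sg G + 1)) (b * (struct_size sg G + 1) ^ b) Q
    (enc_struct sg vs G) (enc_struct rh vs G' @ enc_weights Om k vs c) &
    (ALL u. (ALL i:{1..k}. u i : univ G) -->
    (\<exists>!om. om : set Om & sat G' u om) &
    (ALL om:set Om. sat G' u om -->
    real (count_sat G ph u) <= real (\<Sum>i=1..k. c om i (u i)) &
    real (\<Sum>i=1..k. c om i (u i)) <= (1 + eps) * real (count_sat G ph u))))"
proof -
 define ps where "ps = lists_upto J (k * q)"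
 define kps where "kps = all_ctxs d q k ph"
 define sy where "sy = syms q d kps ps J"
 define symb where "symb a = s0 + index_of sy a" for a
 define AL where "AL = all_links d q k"
 define AT where "AT = remdups (atoms ph)"
 define T where "T = terms_of (tidx sg D) symb AL AT ps J q k d"
 define xs where "xs = List.product Om [1..<Suc k]"
 define ins where "ins = map In [0..<nf sg] @ map Pr (sorted_list_of_set (psig sg))"
 define outs where "outs = map (farr sg s0 sy) [0..<F] @ map (parr sg) [0..<Pn] @ map (case_prod Wt) xs"
 define prog where "prog = full_prog (awords sg D) d (tidx sg D) ph K ps kps T xs"
 define c1 where "c1 = full_cost (awords sg D) D d (tidx sg D) ph K ps kps T xs"
 have qw: "q = length (awords sg D)" by (simp add: q awords_props(2))
 have setins: "set ins = In ` {..<nf sg} Un Pr ` psig sg" using sg by (auto simp: ins_def functional_signature_def)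
 obtain Rr cm N where N: "finite N" "com_ok (prim_ok Rr cm N) Rr prog" using com_ok_exists by blast
 define N' where "N' = N Un set ins Un set outs"
 have cok: "com_ok (prim_ok (Suc Rr) cm N') (Suc Rr) prog" by (rule com_ok_mono[OF _ _ N(2)]) (auto simp: N'_def elim: prim_ok_mono)
 have "finite N'" "set ins <= N'" "set outs <= N'" using N(1) by (auto simp: N'_def)
 \<comment> \<open>The cap factor \<open>q * q\<close> is the largest number of summands in a
   weight.\<close>
 from array_program_computable[OF this(1) zero_less_Suc cok this(2,3), of "q * q" c1] obtain Q b
  where b: "0 < b" and Q0: "ALL n A0 xs. length xs = Suc (length ins * n) --> xs ! 0 = n -->
  (ALL j<length ins. ALL v<n. xs ! Suc (j * n + v) = A0 (ins ! j) v) -->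
  (ALL a v. a ~: set ins \<or> n <= v --> A0 a v = 0) --> (ALL a v. A0 a v <= n) -->
  fst (sem (aram (q * q * n)) prog ((%x. 0)(0 := n), A0)) 0 = n -->
  cost (aram (q * q * n)) prog ((%x. 0)(0 := n), A0) <= c1 * (n + 1) -->
  computes_within (b * (n + 1)) (b * (n + 1)) Q xs
   (n # concat (map (%a. map (snd (sem (aram (q * q * n)) prog ((%x. 0)(0 := n), A0)) a) [0..<n]) outs))"
  by (elim exE conjE) (rule that, assumption+)
 note Q = Q0[THEN spec, THEN spec, THEN spec, THEN mp, THEN mp, THEN mp, THEN mp, THEN mp, THEN mp, THEN mp]
 show ?thesis
 proof (intro exI[of _ Q] exI[of _ b] ballI allI impI, elim conjE, goal_cases)
  case (1 G vs)
  note GC = 1(1) and vs = 1(2,3)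
  interpret listing sg G vs D by unfold_locales (use sg C GC vs Dl in auto)
  let ?n = "length vs"
  have gG: "grad r (underlying sg G) <= real (g r)" for r using g GC by (simp add: expansion_bound_def)
  have nil: "[] : set ps" by (simp add: ps_def set_lists_upto)
  have vt: "val sg vs G D = (%i v. apply_tab (table sg vs G) (awords sg D ! i) v)" by (intro ext) (simp add: val_def)
  have setkp: "set kps = {..<q} \<times> set (subseqs AL) \<times> set (subseqs AT)"
   by (simp add: kps_def all_ctxs_def AL_def AT_def atLeast0LessThan)
  have "EX A. (%s. fst s 0 = ?n & snd s = A) (sem (aram (q * q * ?n)) prog ((%x. 0)(0 := ?n), table sg vs G)) &
   cost (aram (q * q * ?n)) prog ((%x. 0)(0 := ?n), table sg vs G) <= c1 * (?n + 1) &
   (ALL a. A (In a) = table sg vs G (In a)) & (ALL p. A (Pr p) = table sg vs G (Pr p)) &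
   (ALL i<q. ALL v<?n. A (Tau i) v = val sg vs G D i v) & (ALL v<?n. A (Hn 0) v = v) &
   (EX L. distinct L & set L = {..<?n} & (ALL i<?n. insert (L ! i) (set (map (%h. A h (L ! i)) (hs_of d))) =
    insert (L ! i) (Nb ?n q (val sg vs G D) (L ! i) - set (take i L)))) &
   (ALL kp:set kps. ALL w<?n. ALL p:set ps. good (tidx sg D) ph ?n q (val sg vs G D) K (q * K) A kp p w) &
   (ALL (om, i):set xs. ALL v<?n. A (Wt om i) v = wt_sum A (T om i) v)"
   unfolding prog_def c1_def vt
  proof (rule full_prog_sem)
   show "ALL a v. v < ?n --> table sg vs G (In a) v < ?n" using A0_less by blast
   show "ALL p v. table sg vs G (Pr p) v <= 1" by simp
   show "ALL a v. a ~: range In --> a ~: range Pr --> table sg vs G a v = 0" by simp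
   show "ALL ws:set (awords sg D). length ws <= D" by (simp add: awords_props(1) words_def)
   show "q = length (awords sg D)" by (rule qw)
   show "EX v:S. card (Nb ?n q (%i v. apply_tab (table sg vs G) (awords sg D ! i) v) v Int S) <= d" if "S <= {..<?n}" "S ~= {}" for S
    using degenerate[OF gG that] unfolding d q vt .
   show "ALL kp:set kps. fst kp < q" using setkp by auto
   show "distinct kps" unfolding kps_def by (rule distinct_all_ctxs)
   show "paths_ok ps" unfolding ps_def by (rule paths_ok_lists_upto)
   have "length (T om i) <= q * q & (ALL (t, kp, p):set (T om i). t < q & kp : set kps & p : set ps)" for om i
    using length_terms_of terms_of_mem[OF _ nil] unfolding T_def setkp by fastforce
   then show "ALL (om, i):set xs. length (T om i) <= q * q & (ALL (t, kp, p):set (T om i). t < q & kp : set kps & p : set ps)" by blast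
  qed
  then obtain A L where A: "fst (sem (aram (q * q * ?n)) prog ((%x. 0)(0 := ?n), table sg vs G)) 0 = ?n"
   "snd (sem (aram (q * q * ?n)) prog ((%x. 0)(0 := ?n), table sg vs G)) = A"
   "cost (aram (q * q * ?n)) prog ((%x. 0)(0 := ?n), table sg vs G) <= c1 * (?n + 1)"
   and AI: "ALL a. A (In a) = table sg vs G (In a)" "ALL p. A (Pr p) = table sg vs G (Pr p)"
   "ALL i<q. ALL v<?n. A (Tau i) v = val sg vs G D i v" "ALL v<?n. A (Hn 0) v = v"
   and AL': "distinct L" "set L = {..<?n}" "ALL i<?n. insert (L ! i) (set (map (%h. A h (L ! i)) (hs_of d))) =
    insert (L ! i) (Nb ?n q (val sg vs G D) (L ! i) - set (take i L))"
   and AG: "ALL kp:set kps. ALL w<?n. ALL p:set ps. good (tidx sg D) ph ?n q (val sg vs G D) K (q * K) A kp p w"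
   and AW: "ALL (om, i):set xs. ALL v<?n. A (Wt om i) v = wt_sum A (T om i) v" by blast
  have arrays: "arrays sg G vs D ph d K J s0 F Pn A L sy kps ps rh"
  proof (unfold_locales, goal_cases)
   case (1 i) then show ?case using AI(1) by blast
  next
   case (2 p) then show ?case using AI(2) by blast
  next
   case (3 t v) then show ?case using AI(3) unfolding q by blast
  next
   case (4 v) then show ?case using AI(4) by blast
  next
   case 5 show ?case by (rule AL'(1))
  next
   case 6 show ?case by (rule AL'(2))
  next
   case (7 i) then show ?case using AL'(3) unfolding q by blast
  next
   case (8 kp w p) then show ?case using AG unfolding J q by blast
  next
   case (9 kp)
   then have "fst kp < q" unfolding setkp by (simp only: mem_Times_iff lessThan_iff)
   then show ?case unfolding q .
  next
   case 10 show ?case unfolding sy_def q ..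
  next
   case (11 f) then show ?case by (rule s0)
  next
   case 12 show ?case using F unfolding sy_def kps_def ps_def .
  next
   case (13 p) then show ?case by (rule Pn(1))
  next
   case 14 show ?case by (rule Pn(2))
  next
   case 15 show ?case by (simp add: rh_def)
  qed
  interpret arr: arrays sg G vs D ph k d K J s0 F Pn A L sy kps ps rh by (rule arrays)
  let ?G' = "expand sg s0 sy vs G A"
  define c :: "fm => nat => 'v => nat" where "c om i v = A (Wt om i) (index_of vs v)" for om i v
  show ?case
  proof (intro bexI[of _ ?G'] exI[of _ c] conjI allI impI ballI)
   show "?G' : wide_graphs sg C D rh"
   proof (cases "univ G = {}")
    case True
    then show ?thesis using arr.expand_Fun by (simp add: wide_graphs_def arr.expand_simps(1))
   next
    case False
    then have "vs ! 0 : univ G" using vs(2) by (intro nth_univ) auto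
    then show ?thesis using arr.expand_Fun arr.expand_edges GC unfolding wide_graphs_def
    by (intro CollectI conjI disjI2 bexI[of _ G] bexI[of _ "vs ! 0"] arr.expand_simps(1)) auto
   qed
   show "is_expansion sg G ?G'" by (rule arr.expand_is_expansion)
   have "computes_within (b * (?n + 1)) (b * (?n + 1)) Q (enc_struct sg vs G)
    (?n # concat (map (%a. map (A a) [0..<?n]) outs))"
    unfolding table_input[OF sg] ins_def[symmetric] A(2)[symmetric]
   proof (rule Q)
    show "ALL a v. a ~: set ins \<or> ?n <= v --> table sg vs G a v = 0" unfolding setins by (auto simp: table_def split: aname.splits)
    show "ALL a v. table sg vs G a v <= ?n"
    proof (intro allI)
    fix a v show "table sg vs G a v <= ?n"
    proof (cases a)
    case (In i)
    then show ?thesis using A0_less[of v i] by (cases "v < ?n") auto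
    qed (auto simp: table_def)
    qed
    show "fst (sem (aram (q * q * ?n)) prog ((%x. 0)(0 := ?n), table sg vs G)) 0 = ?n" by (rule A(1))
    show "cost (aram (q * q * ?n)) prog ((%x. 0)(0 := ?n), table sg vs G) <= c1 * (?n + 1)" by (rule A(3))
   qed (use concat_tables in auto)
   moreover have "?n # concat (map (%a. map (A a) [0..<?n]) outs) = enc_struct rh vs ?G' @ enc_weights Om k vs c"
   proof -
    have "map (c om i) vs = map (A (Wt om i)) [0..<?n]" for om i by (rule nth_equalityI) (simp_all add: c_def index_of_nth[OF vs(1)])
    then have "enc_weights Om k vs c = concat (map (%a. map (A a) [0..<?n]) (map (case_prod Wt) xs))"
    unfolding enc_weights_product xs_def by (simp add: comp_def split_def)
    then show ?thesis unfolding arr.enc_expand outs_def by simp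
   qed
   \<comment> \<open>The identity symbol makes \<open>sig_size\<close> positive, so the universe is
     no larger than the structure. As \<open>b\<close> is positive, the polynomial word bound
     follows from the linear one.\<close>
   moreover have "b * (?n + 1) <= b * (struct_size sg G + 1)" "b * (?n + 1) <= b * (struct_size sg G + 1) ^ b"
   proof -
    have "?n = card (univ G)" using distinct_card[OF vs(1)] vs(2) by simp
    moreover have "1 <= sig_size sg" using sfuns_props(4)[OF sg] by (simp add: sig_size_def)
    ultimately have n: "?n <= struct_size sg G" by (simp add: struct_size_def)
    have "struct_size sg G + 1 <= (struct_size sg G + 1) ^ b" using b by (intro self_le_power) auto
    then show "b * (?n + 1) <= b * (struct_size sg G + 1)" "b * (?n + 1) <= b * (struct_size sg G + 1) ^ b"
    using n by (intro mult_le_mono2; linarith)+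
   qed
   ultimately show "computes_within (b * (struct_size sg G + 1)) (b * (struct_size sg G + 1) ^ b) Q
    (enc_struct sg vs G) (enc_struct rh vs ?G' @ enc_weights Om k vs c)"
    using computes_within_mono by metis
  next
   fix u :: "nat => 'v" assume "ALL i:{1..k}. u i : univ G"
   show "\<exists>!om. om : set Om & sat ?G' u om" unfolding Om_def by (rule clauses_unique)
  next
   fix u :: "nat => 'v" and om assume u0: "ALL i:{1..k}. u i : univ G" and om: "om : set Om" "sat ?G' u om"
   have u: "i : {1..k} ==> u i : univ G" for i using u0 by blast
   have ui: "index_of vs (u i) < ?n" if "i : {1..k}" for i using arr.univ_index u[OF that] by blast
   have om': "om : set (clauses F Pn k)" using om(1) by (simp add: Om_def)
   have len: "length (enc_fm ph) <= D" using Dl by simp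
   obtain t0 where t0: "t0 < q" "ALL v<?n. val sg vs G D t0 v = 0" using tv_const unfolding q by blast
   have S: "(\<Sum>i=1..k. c om i (u i)) = (\<Sum>i=1..k. wt_sum A (T om i) (index_of vs (u i)))"
   proof (rule sum.cong[OF refl])
    fix i assume i: "i : {1..k}"
    then have "(om, i) : set xs" using om(1) by (simp add: xs_def atLeastLessThanSuc_atLeastAtMost del: upt_Suc)
    then show "c om i (u i) = wt_sum A (T om i) (index_of vs (u i))" using AW ui[OF i] by (auto simp: c_def)
   qed
   have kq: "1 <= q" by (simp add: q)
   have P1: "!!t y. t < q ==> y < ?n ==> A (Tau t) y = val sg vs G D t y" using AI(3) by blast
   have P2: "!!t y. t < q ==> y < ?n ==> val sg vs G D t y < ?n" using tv_word(1) unfolding q by blast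
   have P3: "!!v. v < ?n ==> A (Hn 0) v = v" using AI(4) by blast
   have P6: "!!i. i < ?n ==> insert (L ! i) (set (map (%h. A h (L ! i)) (hs_of d))) =
    insert (L ! i) (Nb ?n q (val sg vs G D) (L ! i) - set (take i L))" using AL'(3) by blast
   have P7: "!!kp w p. kp : set kps ==> w < ?n ==> p : set ps ==> good (tidx sg D) ph ?n q (val sg vs G D) K J A kp p w"
    using AG unfolding J by blast
   have P8: "!!t nu xi. t < q ==> nu : set (subseqs AL) ==> xi : set (subseqs AT) ==> (t, nu, xi) : set kps" unfolding setkp by blast
   have P9: "set AL = {(l, t, j). l <= d & t < q & j : {1..k}}" unfolding AL_def by (rule set_all_links)
   have P10: "set AT = set (atoms ph)" by (simp add: AT_def)
   have P11: "ALL \<alpha>:set (atoms ph). atom_ok (tidx sg D) (psig sg) q k \<alpha>" unfolding q by (rule atoms_ok[OF ph len])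
   have P12: "set ps = {p. length p <= k * q & set p <= {..<J}}" unfolding ps_def by (rule set_lists_upto)
   have P19: "!!y y'. y < ?n ==> y' < ?n ==> val sg vs G D t0 y = val sg vs G D t0 y'" using t0(2) by simp
   have hsy: "Hn l : set sy" if "l <= d" for l using that by (auto simp: sy_def set_syms)
   have ssy: "Slot kp p : set sy" if h: "kp : set kps" "p ~= []" "length p <= Suc (k * q)" "set p <= {..<J}" for kp p
   proof -
    obtain p' j where p: "p = p' @ [j]" using h(2) by (cases p rule: rev_exhaust) auto
    have "p' : set ps" "j < J" using h(3,4) by (auto simp: p P12)
    then show ?thesis using h(1) unfolding sy_def set_syms p by blast
   qed
   have sf: "(%a. s0 + index_of sy a) = symb" by (intro ext) (simp add: symb_def)
   have P21: "!!l s t i j. l <= d ==> s < q ==> t < q ==> i : {1..k} ==> j : {1..k} ==>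
    eqv symb om (Hn l) s i t j = (A (Hn l) (val sg vs G D s (index_of vs (u i))) = val sg vs G D t (index_of vs (u j)))"
    by (rule arr.eqv_iff[OF om' om(2), unfolded sf, folded q]) (use hsy u in simp_all)
   have P22: "!!kp p s t i j. kp : set kps ==> p ~= [] ==> length p <= Suc (k * q) ==> set p <= {..<J} ==> s < q ==> t < q ==>
    i : {1..k} ==> j : {1..k} ==>
    eqv symb om (Slot kp p) s i t j = (A (Slot kp p) (val sg vs G D s (index_of vs (u i))) = val sg vs G D t (index_of vs (u j)))"
    by (rule arr.eqv_iff[OF om' om(2), unfolded sf, folded q]) (use ssy u in simp_all)
   have P23: "!!p t i. p : psig sg ==> t < q ==> i : {1..k} ==>
    Pred p (App (symb (Tau t)) (Var i)) : pos om \<longleftrightarrow> A (Pr p) (val sg vs G D t (index_of vs (u i))) ~= 0"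
    unfolding symb_def by (rule arr.pred_iff[OF om' om(2), folded q]) (use u in simp_all)
   note W = weights_approximate[where A = A and tv = "val sg vs G D" and n = ?n and q = q and u = "%i. index_of vs (u i)",
    OF P1 P2 P3 AL'(1,2) P6 P7 P8 P9 P10 P11 P12 K E k kq t0(1) P19 ui P21 P22 P23]
   have ci: "count_sat G ph u = card {y. y < ?n & holds (%t. val sg vs G D (tidx sg D t)
    (if tvar t = 0 then y else index_of vs (u (tvar t)))) (%p v. A (Pr p) v ~= 0) ph}"
    by (rule arr.count_index[OF ph len]) (rule u)
   have "real (count_sat G ph u) <= real (\<Sum>i=1..k. c om i (u i)) &
    real (\<Sum>i=1..k. c om i (u i)) <= (1 + eps) * real (count_sat G ph u)"
    unfolding S T_def ci by (rule conjI[OF W])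
   then show "real (count_sat G ph u) <= real (\<Sum>i=1..k. c om i (u i))"
    "real (\<Sum>i=1..k. c om i (u i)) <= (1 + eps) * real (count_sat G ph u)" by blast+
  qed
 qed
qed

text \<open>Mirrors the length of \<open>syms\<close>, with \<open>Rg 2\<close> for \<open>k\<close>
  and \<open>Rg 3\<close> for \<open>D\<close>, which is the length of the whole input. The oracle
  is asked at \<open>D\<close>, the depth that occurs in \<open>dens\<close> at rank 0. Quantities
  that would need parsing are over-estimated: \<open>2 ^ D\<close> bounds the number of sets of
  atoms.\<close>

definition size_expr :: "signature => nat => nat => aexp" where
 "size_expr sg s0 E = (let
   q = Pw (Cst (Suc (nf sg))) (Rg 3);
   d = Ti (Cst 2) (Pl q (Ti (Pw q (Pl (Ti (Cst 2) (Rg 3)) (Cst 2))) (Pl (Orc (Rg 3)) (Cst 1))));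
   w = Ti (Rg 2) q;
   J = Ti q (Ti w (Cst E))
  in Pl (Cst s0) (Pl q (Pl (Pl d (Cst 1)) (Ti (Ti q (Ti (Pw (Cst 2) (Ti (Ti (Pl d (Cst 1)) q) (Rg 2))) (Pw (Cst 2) (Rg 3))))
   (Ti (Ti (Pl w (Cst 1)) (Pw J w)) J)))))"

lemma size_expr_regs: "aregs (size_expr sg s0 E) <= {2, 3}" by (simp add: size_expr_def Let_def)

lemma size_expr_ge:
 assumes "r 2 = k" "r 3 = D" "D = Suc (length (enc_fm ph))" "1 <= k" "1 <= E"
  and q: "q = Suc (nf sg) ^ D" and d: "d = 2 * dens sg g D 0" and J: "J = q * (k * q * E)"
 shows "s0 + length (syms q d (all_ctxs d q k ph) (lists_upto J (k * q)) J) <= aval g r (size_expr sg s0 E)"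
proof -
 have e: "aval g r (size_expr sg s0 E) = s0 + (q + (d + 1 + q * (2 ^ ((d + 1) * q * k) * 2 ^ D) * ((k * q + 1) * J ^ (k * q) * J)))"
  using assms(1,2) by (simp add: size_expr_def Let_def dens_def q d J)
 have "2 ^ length (enc_fm ph) <= (2 :: nat) ^ D" by (rule power_increasing) (use assms(3) in auto)
 then have "q * (2 ^ ((d + 1) * q * k) * 2 ^ length (enc_fm ph)) <= q * (2 ^ ((d + 1) * q * k) * 2 ^ D)" by (intro mult_le_mono le_refl)
 with length_all_ctxs have 1: "length (all_ctxs d q k ph) <= q * (2 ^ ((d + 1) * q * k) * 2 ^ D)" by (rule order.trans)
 have "1 <= J" using assms(4,5) by (simp add: J q)
 then have 2: "length (lists_upto J (k * q)) * J <= (k * q + 1) * J ^ (k * q) * J" using length_lists_upto by (intro mult_le_mono1)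
 from mult_le_mono[OF 1 2] show ?thesis unfolding length_syms e by simp
qed

theorem theorem23:
  fixes \<sigma> :: signature and C :: "'v fstruct set" and g :: "nat \<Rightarrow> nat" and \<epsilon> :: real
  assumes "functional_signature \<sigma>"
    and "C \<subseteq> Fun \<sigma>"
    and "bounded_expansion \<sigma> C"
    and "expansion_bound \<sigma> C g"
    and "\<epsilon> > 0"
  shows "\<exists>(\<rho> :: nat \<Rightarrow> fm \<Rightarrow> signature) (\<Omega> :: nat \<Rightarrow> fm \<Rightarrow> fm list) (P :: instr list).
    \<forall>k\<ge>1. \<forall>\<phi>. fm_over \<sigma> {0..k} \<phi> \<longrightarrow>
      computes g P (k # enc_fm \<phi>) (enc_sig (\<rho> k \<phi>) @ enc_fms (\<Omega> k \<phi>)) \<and>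
      functional_signature (\<rho> k \<phi>) \<and> sig_le \<sigma> (\<rho> k \<phi>) \<and>
      (\<forall>\<omega>\<in>set (\<Omega> k \<phi>). conj_clause \<omega> \<and> fm_over (\<rho> k \<phi>) {1..k} \<omega>) \<and>
      (\<exists>C' \<subseteq> (Fun (\<rho> k \<phi>) :: 'v fstruct set). bounded_expansion (\<rho> k \<phi>) C' \<and>
        (\<exists>(Q :: instr list) (b :: nat). \<forall>G\<in>C. \<forall>vs. distinct vs \<and> set vs = univ G \<longrightarrow>
          (\<exists>G'\<in>C'. \<exists>c :: fm \<Rightarrow> nat \<Rightarrow> 'v \<Rightarrow> nat.
            is_expansion \<sigma> G G' \<and>
            computes_within (b * (struct_size \<sigma> G + 1)) (b * (struct_size \<sigma> G + 1) ^ b) Q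
              (enc_struct \<sigma> vs G)
              (enc_struct (\<rho> k \<phi>) vs G' @ enc_weights (\<Omega> k \<phi>) k vs c) \<and>
            (\<forall>u. (\<forall>i\<in>{1..k}. u i \<in> univ G) \<longrightarrow>
              (\<exists>!\<omega>. \<omega> \<in> set (\<Omega> k \<phi>) \<and> sat G' u \<omega>) \<and>
              (\<forall>\<omega>\<in>set (\<Omega> k \<phi>). sat G' u \<omega> \<longrightarrow>
                real (count_sat G \<phi> u) \<le> real (\<Sum>i=1..k. c \<omega> i (u i)) \<and>
                real (\<Sum>i=1..k. c \<omega> i (u i)) \<le> (1 + \<epsilon>) * real (count_sat G \<phi> u))))))"
proof -
 obtain E where E: "(1 + \<epsilon>) / \<epsilon> <= real E" using real_arch_simple by blast
 have "0 < (1 + \<epsilon>) / \<epsilon>" using assms(5) by simp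
 then have E1: "1 <= E" using E by (cases E) auto
 define s0 where "s0 = Suc (Max (fsig \<sigma>))"
 \<comment> \<open>Inserting 0 covers an empty set of predicate symbols, for which
   \<open>Max\<close> is unspecified.\<close>
 define Pn where "Pn = Suc (Max (insert 0 (psig \<sigma>)))"
 define FE where "FE = size_expr \<sigma> s0 E"
 \<comment> \<open>The registers of the generator for the input \<open>k # enc_fm \<phi>\<close>.
   The leading \<open>k\<close> accounts for the \<open>Suc\<close>, so register 3 holds exactly
   \<open>D\<close>.\<close>
 define inp :: "nat => fm => nat => nat" where "inp k \<phi> = (%_. 0)(1 := 1, 2 := k, 3 := Suc (length (enc_fm \<phi>)))" for k \<phi>
 define F where "F k \<phi> = aval g (inp k \<phi>) FE" for k \<phi>
 define \<rho> where "\<rho> k \<phi> = sig (F k \<phi>) Pn" for k \<phi>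
 define \<Omega> where "\<Omega> k \<phi> = clauses (F k \<phi>) Pn k" for k \<phi>
 have FEr: "aregs FE <= {2, 3}" unfolding FE_def by (rule size_expr_regs)
 have fin: "finite (fsig \<sigma>)" "finite (psig \<sigma>)" using assms(1) by (auto simp: functional_signature_def)
 have s0: "f < s0" if "f : fsig \<sigma>" for f using Max_ge[OF fin(1) that] by (simp add: s0_def)
 have Pn: "p < Pn" if "p : psig \<sigma>" for p
 proof -
  have "p <= Max (insert 0 (psig \<sigma>))" by (rule Max_ge) (use fin(2) that in auto)
  then show ?thesis unfolding Pn_def by (rule le_imp_less_Suc)
 qed
 have Pn1: "1 <= Pn" by (simp add: Pn_def)
 obtain P where P: "!!xs. xs ~= [] ==> computes g P xs (out g ((%_. 0)(1 := 1, 2 := hd xs, 3 := length xs)) (full_gen FE Pn))"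
  using gen_computable[OF full_gen_ok[OF FEr]] by blast
 show ?thesis
 proof (intro exI[of _ \<rho>] exI[of _ \<Omega>] exI[of _ P] allI impI, goal_cases)
  case (1 k \<phi>)
  note k = 1(1) and \<phi> = 1(2)
  define D where "D = Suc (length (enc_fm \<phi>))"
  define q where "q = Suc (nf \<sigma>) ^ D"
  define d where "d = 2 * dens \<sigma> g D 0"
  define J where "J = q * (k * q * E)"
  have F: "s0 + length (syms q d (all_ctxs d q k \<phi>) (lists_upto J (k * q)) J) <= F k \<phi>"
   unfolding F_def FE_def by (rule size_expr_ge[OF _ _ D_def k E1 q_def d_def J_def]) (simp_all add: inp_def D_def)
  have F1: "1 <= F k \<phi>" using F s0 by (simp add: s0_def)
  have "computes g P (k # enc_fm \<phi>) (enc_sig (\<rho> k \<phi>) @ enc_fms (\<Omega> k \<phi>))"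
   using P[of "k # enc_fm \<phi>"] unfolding out_full_gen[OF FEr] by (simp add: \<rho>_def \<Omega>_def F_def inp_def)
  moreover have "functional_signature (\<rho> k \<phi>)" using F1 by (simp add: \<rho>_def sig_def functional_signature_def)
  moreover have "sig_le \<sigma> (\<rho> k \<phi>)"
  proof -
   have "f < F k \<phi>" if "f : fsig \<sigma>" for f using s0[OF that] F by simp
   then show ?thesis using Pn by (auto simp: sig_le_def \<rho>_def sig_def)
  qed
  moreover have "ALL \<omega>:set (\<Omega> k \<phi>). conj_clause \<omega> & fm_over (\<rho> k \<phi>) {1..k} \<omega>"
   using clauses_ok[OF _ F1 Pn1 k] unfolding \<Omega>_def \<rho>_def by blast
  moreover have "wide_graphs \<sigma> C D (\<rho> k \<phi>) <= Fun (\<rho> k \<phi>)" by (auto simp: wide_graphs_def)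
  moreover have "bounded_expansion (\<rho> k \<phi>) (wide_graphs \<sigma> C D (\<rho> k \<phi>))"
   by (rule bounded_expansion_wide_graphs[OF assms(1,2,4)])
  moreover note fixed_formula[OF assms(1,2,4,5) E k \<phi> D_def q_def d_def refl J_def F s0 Pn Pn1, folded \<rho>_def \<Omega>_def]
  ultimately show ?case by (intro conjI exI[of _ "wide_graphs \<sigma> C D (\<rho> k \<phi>)"])
 qed
qed

end
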